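(* Let $n\ge 2$ and $z>0$, and let $(Z(1),\ldots,Z(n))$ be continuous processes whose joint law is the size-biased sampled BESQ$^0$ law $P$ (defined in the context). Let $\zeta_t=Z_t(1)+\cdots+Z_t(n)$ be the total sum process. Then the processes $$N_t=\frac{\zeta_t^2}{Z_t(1)},\qquad U_t=\frac{Z_t(2)\,\zeta_t}{Z_t(1)},\qquad V_t=\frac{\zeta_t}{Z_t(1)}\prod_{i=2}^nZ_t(i),\qquad t\ge 0,$$ are all strict local martingales. However, the process $$M_t=\zeta_t\prod_{i=2}^nZ_t(i),\qquad t\ge 0,$$ is a true martingale.
   Context: A strict local martingale is a local martingale which is not a martingale. BESQ$^0$ (Bessel square process of dimension zero) started at $z>0$ is the nonnegative strong solution of $Z_t=z+2\int_0^t\sqrt{Z_s}\,d\beta_s$, with $\beta$ a one-dimensional Brownian motion; it is absorbed at $0$. On the path space $C^n[0,\infty)$ with coordinate process $\omega_t=(\omega_t(1),\ldots,\omega_t(n))$ and the usual right-continuous complete filtration $\{\mathcal F_t\}$ generated by the coordinates, let $Q$ be the joint law of $n$ independent BESQ$^0$ processes all started from the same point $z>0$. For $i=1,\ldots,n$ let $T_i:C^n[0,\infty)\to C^n[0,\infty)$ be the coordinate permutation with $T_i\omega(1)=\omega(i)$, $T_i\omega(j+1)=\omega(j)$ if $j<i$, and $T_i\omega(j)=\omega(j)$ if $j>i$. Let $\omega[0,t]$ denote the path on $[0,t]$. The size-biased sampled law $P$ is defined by $$P(A)=E^Q\left[\sum_{i=1}^n\frac{\omega_t(i)}{\omega_t(1)+\cdots+\omega_t(n)}\,1_{\{T_i\omega[0,t]\in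 A\}}\right],\qquad A\in\mathcal F_t,\ t\ge0;$$ this is consistent in $t$. By exchangeability, equivalently $P(A)=E^Q[h_t1_A]$ for $A\in\mathcal F_t$, with $h_t=n\,\omega_t(1)/(\omega_t(1)+\cdots+\omega_t(n))$. Convention: once the total sum has reached zero, each ratio $\omega_t(i)/(\omega_t(1)+\cdots+\omega_t(n))$ is frozen at its limiting value at that time, and the factor $\zeta_t/Z_t(1)$ appearing in $N,U,V$ is understood as the reciprocal of the ratio $Z_t(1)/\zeta_t$ so extended. *)

theory Defs
  imports "HOL-Probability.Probability"
begin

section \<open>Processes, filtrations and martingales\<close>

text \<open>
  Real-valued processes are functions \<open>X :: real \<Rightarrow> 'a \<Rightarrow> real\<close> of which only the values at times
  \<open>t \<ge> 0\<close> matter. Filtrations are indexed by all reals so that the library notions of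
  filtration and stopping time apply; the filtrations below contain only events of
  probability 0 or 1 at negative times.
\<close>

definition random_process :: "'a measure \<Rightarrow> (real \<Rightarrow> 'a \<Rightarrow> real) \<Rightarrow> bool" where
  "random_process M X \<longleftrightarrow> (\<forall>t\<ge>0. X t \<in> borel_measurable M)"

definition continuous_paths :: "'a measure \<Rightarrow> (real \<Rightarrow> 'a \<Rightarrow> real) \<Rightarrow> bool" where
  "continuous_paths M X \<longleftrightarrow> (\<forall>x\<in>space M. continuous_on {0..} (\<lambda>t. X t x))"

definition adapted :: "(real \<Rightarrow> 'a measure) \<Rightarrow> (real \<Rightarrow> 'a \<Rightarrow> real) \<Rightarrow> bool" where
  "adapted F X \<longleftrightarrow> (\<forall>t\<ge>0. X t \<in> borel_measurable (F t))"

definition natural_filtration ::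
    "'a set \<Rightarrow> 'i set \<Rightarrow> ('i \<Rightarrow> real \<Rightarrow> 'a \<Rightarrow> real) \<Rightarrow> real \<Rightarrow> 'a measure" where
  "natural_filtration \<Omega> I Y t =
     sigma \<Omega> {Y i s -` B \<inter> \<Omega> | i s B. i \<in> I \<and> 0 \<le> s \<and> s \<le> t \<and> B \<in> sets borel}"

text \<open>Right limits of \<open>F\<close>, augmented by all subsets of null sets of \<open>M\<close>: a filtration of the completion.\<close>

definition usual_augmentation :: "'a measure \<Rightarrow> (real \<Rightarrow> 'a measure) \<Rightarrow> real \<Rightarrow> 'a measure" where
  "usual_augmentation M F t =
     sigma (space M) ((\<Inter>s\<in>{t<..}. sets (F s)) \<union> null_sets (completion M))"

definition filtered :: "'a measure \<Rightarrow> (real \<Rightarrow> 'a measure) \<Rightarrow> bool" where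
  "filtered M F \<longleftrightarrow> filtration (space M) F \<and> (\<forall>t. subalgebra M (F t))"

definition martingale :: "'a measure \<Rightarrow> (real \<Rightarrow> 'a measure) \<Rightarrow> (real \<Rightarrow> 'a \<Rightarrow> real) \<Rightarrow> bool" where
  "martingale M F X \<longleftrightarrow>
     filtered M F \<and> adapted F X \<and> (\<forall>t\<ge>0. integrable M (X t)) \<and>
     (\<forall>s t. 0 \<le> s \<and> s \<le> t \<longrightarrow> (AE x in M. real_cond_exp M (F s) (X t) x = X s x))"

definition cadlag :: "(real \<Rightarrow> real) \<Rightarrow> bool" where
  "cadlag f \<longleftrightarrow> (\<forall>t\<ge>0. (f \<longlongrightarrow> f t) (at_right t)) \<and> (\<forall>t>0. \<exists>l. (f \<longlongrightarrow> l) (at_left t))"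

text \<open>
  Localizing sequences consist of finite stopping times. This is no restriction: the sequence
  \<open>\<tau> k\<close> may be replaced by \<open>min (\<tau> k) k\<close>.
\<close>

definition local_martingale ::
    "'a measure \<Rightarrow> (real \<Rightarrow> 'a measure) \<Rightarrow> (real \<Rightarrow> 'a \<Rightarrow> real) \<Rightarrow> bool" where
  "local_martingale M F X \<longleftrightarrow>
     filtered M F \<and> adapted F X \<and> (AE x in M. cadlag (\<lambda>t. X t x)) \<and>
     (\<exists>\<tau> :: nat \<Rightarrow> 'a \<Rightarrow> real.
        (\<forall>k. stopping_time F (\<tau> k) \<and> (\<forall>x\<in>space M. 0 \<le> \<tau> k x)) \<and>
        (AE x in M. incseq (\<lambda>k. \<tau> k x) \<and> filterlim (\<lambda>k. \<tau> k x) at_top sequentially) \<and>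
        (\<forall>k. martingale M F (\<lambda>t x. X (min t (\<tau> k x)) x)))"

definition strict_local_martingale ::
    "'a measure \<Rightarrow> (real \<Rightarrow> 'a measure) \<Rightarrow> (real \<Rightarrow> 'a \<Rightarrow> real) \<Rightarrow> bool" where
  "strict_local_martingale M F X \<longleftrightarrow> local_martingale M F X \<and> \<not> martingale M F X"

section \<open>Brownian motion, the Ito integral and BESQ(0)\<close>

definition brownian_motion :: "'a measure \<Rightarrow> (real \<Rightarrow> 'a \<Rightarrow> real) \<Rightarrow> bool" where
  "brownian_motion M \<beta> \<longleftrightarrow>
     prob_space M \<and> random_process M \<beta> \<and> continuous_paths M \<beta> \<and> (AE x in M. \<beta> 0 x = 0) \<and>
     (\<forall>s t. 0 \<le> s \<and> s < t \<longrightarrow>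
        distributed M lborel (\<lambda>x. \<beta> t x - \<beta> s x) (normal_density 0 (sqrt (t - s))) \<and>
        prob_space.indep_set M
          (sets (natural_filtration (space M) (UNIV :: unit set) (\<lambda>_. \<beta>) s))
          {(\<lambda>x. \<beta> t x - \<beta> s x) -` B \<inter> space M | B. B \<in> sets borel})"

definition tendsto_in_prob :: "'a measure \<Rightarrow> (nat \<Rightarrow> 'a \<Rightarrow> real) \<Rightarrow> ('a \<Rightarrow> real) \<Rightarrow> bool" where
  "tendsto_in_prob M Y L \<longleftrightarrow>
     (\<forall>\<epsilon>>0. (\<lambda>k. measure M {x\<in>space M. \<epsilon> < \<bar>Y k x - L x\<bar>}) \<longlonglongrightarrow> 0)"

text \<open>
  The data \<open>m\<close>, \<open>p\<close>, \<open>\<xi>\<close> encode the simple process that takes the value \<open>\<xi> k\<close> on the time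
  interval \<open>(p k, p (k + 1)]\<close> for \<open>k < m\<close>.
\<close>

definition simple_integrand ::
    "'a measure \<Rightarrow> (real \<Rightarrow> 'a measure) \<Rightarrow> nat \<Rightarrow> (nat \<Rightarrow> real) \<Rightarrow> (nat \<Rightarrow> 'a \<Rightarrow> real) \<Rightarrow> bool" where
  "simple_integrand M F m p \<xi> \<longleftrightarrow>
     0 \<le> p 0 \<and> (\<forall>k<m. p k \<le> p (Suc k)) \<and>
     (\<forall>k<m. \<xi> k \<in> borel_measurable (F (p k)) \<and> (\<exists>c. \<forall>x\<in>space M. \<bar>\<xi> k x\<bar> \<le> c))"

definition simple_value ::
    "nat \<Rightarrow> (nat \<Rightarrow> real) \<Rightarrow> (nat \<Rightarrow> 'a \<Rightarrow> real) \<Rightarrow> real \<Rightarrow> 'a \<Rightarrow> real" where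
  "simple_value m p \<xi> s x = (\<Sum>k<m. \<xi> k x * indicator {p k<..p (Suc k)} s)"

definition simple_integral ::
    "(real \<Rightarrow> 'a \<Rightarrow> real) \<Rightarrow> nat \<Rightarrow> (nat \<Rightarrow> real) \<Rightarrow> (nat \<Rightarrow> 'a \<Rightarrow> real) \<Rightarrow> real \<Rightarrow> 'a \<Rightarrow> real" where
  "simple_integral \<beta> m p \<xi> t x =
     (\<Sum>k<m. \<xi> k x * (\<beta> (min t (p (Suc k))) x - \<beta> (min t (p k)) x))"

text \<open>
  \<open>J\<close> is a continuous version of the Ito integral of the continuous adapted process \<open>H\<close> with
  respect to \<open>\<beta>\<close>: the limit in probability of integrals of simple processes that approximate \<open>H\<close>
  in \<open>L\<^sup>2[0,t]\<close>, in probability, for every \<open>t\<close>. The limit does not depend on the approximation.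
\<close>

definition ito_integral ::
    "'a measure \<Rightarrow> (real \<Rightarrow> 'a measure) \<Rightarrow> (real \<Rightarrow> 'a \<Rightarrow> real) \<Rightarrow>
     (real \<Rightarrow> 'a \<Rightarrow> real) \<Rightarrow> (real \<Rightarrow> 'a \<Rightarrow> real) \<Rightarrow> bool" where
  "ito_integral M F \<beta> H J \<longleftrightarrow>
     adapted F H \<and> continuous_paths M H \<and> adapted F J \<and> continuous_paths M J \<and>
     (\<exists>m p \<xi>. (\<forall>j :: nat. simple_integrand M F (m j) (p j) (\<xi> j)) \<and>
        (\<forall>t\<ge>0.
           tendsto_in_prob M
             (\<lambda>j x. LBINT s:{0..t}. (simple_value (m j) (p j) (\<xi> j) s x - H s x)\<^sup>2) (\<lambda>x. 0) \<and>
           tendsto_in_prob M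
             (\<lambda>j x. simple_integral \<beta> (m j) (p j) (\<xi> j) t x) (J t)))"

text \<open>
  The solution is strong: it is adapted to the usual augmentation of the filtration
  generated by the driving Brownian motion alone.
\<close>

definition besq0 :: "'a measure \<Rightarrow> real \<Rightarrow> (real \<Rightarrow> 'a \<Rightarrow> real) \<Rightarrow> bool" where
  "besq0 M z X \<longleftrightarrow>
     random_process M X \<and> continuous_paths M X \<and> (\<forall>t\<ge>0. \<forall>x\<in>space M. 0 \<le> X t x) \<and>
     (\<exists>\<beta> F J.
        brownian_motion M \<beta> \<and>
        F = usual_augmentation M (natural_filtration (space M) (UNIV :: unit set) (\<lambda>_. \<beta>)) \<and>
        adapted F X \<and>
        ito_integral (completion M) F \<beta> (\<lambda>t x. sqrt (X t x)) J \<and>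
        (AE x in M. \<forall>t\<ge>0. X t x = z + 2 * J t x))"

section \<open>Path space and the size-biased law\<close>

text \<open>A path \<open>\<omega>\<close> has coordinates \<open>\<omega> i t\<close> for \<open>i \<in> {1..n}\<close> and \<open>t \<ge> 0\<close>.\<close>

definition cont_paths :: "nat \<Rightarrow> (nat \<Rightarrow> real \<Rightarrow> real) set" where
  "cont_paths n = {\<omega> \<in> {1..n} \<rightarrow>\<^sub>E ({0..} \<rightarrow>\<^sub>E UNIV). \<forall>i\<in>{1..n}. continuous_on {0..} (\<omega> i)}"

definition path_space :: "nat \<Rightarrow> (nat \<Rightarrow> real \<Rightarrow> real) measure" where
  "path_space n =
     restrict_space (\<Pi>\<^sub>M i\<in>{1..n}. \<Pi>\<^sub>M t\<in>{0 :: real..}. (borel :: real measure)) (cont_paths n)"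

definition joint_path ::
    "nat \<Rightarrow> (nat \<Rightarrow> real \<Rightarrow> 'a \<Rightarrow> real) \<Rightarrow> 'a \<Rightarrow> nat \<Rightarrow> real \<Rightarrow> real" where
  "joint_path n Z x = (\<lambda>i\<in>{1..n}. \<lambda>t\<in>{0..}. Z i t x)"

definition total_mass :: "nat \<Rightarrow> (nat \<Rightarrow> real \<Rightarrow> real) \<Rightarrow> real \<Rightarrow> real" where
  "total_mass n \<omega> t = (\<Sum>i=1..n. \<omega> i t)"

text \<open>From the first zero of the total sum on, the ratio keeps its left limit at that time.
  The reciprocal of the ratio of coordinate 1 is the factor \<open>\<zeta>\<^sub>t / Z\<^sub>t(1)\<close>, so that
  \<open>\<zeta>\<^sub>t\<^sup>2 / Z\<^sub>t(1)\<close> reads \<open>\<zeta>\<^sub>t * (1 / ratio)\<close>; it is only used under laws for which this ratio is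
  almost surely positive at all times.\<close>

definition ratio :: "nat \<Rightarrow> (nat \<Rightarrow> real \<Rightarrow> real) \<Rightarrow> nat \<Rightarrow> real \<Rightarrow> real" where
  "ratio n \<omega> i t =
     (if \<forall>s\<in>{0..t}. total_mass n \<omega> s \<noteq> 0 then \<omega> i t / total_mass n \<omega> t
      else Lim (at_left (Inf {s. 0 \<le> s \<and> total_mass n \<omega> s = 0})) (\<lambda>s. \<omega> i s / total_mass n \<omega> s))"

text \<open>Move coordinate \<open>i\<close> to the first place and shift the coordinates \<open>1, \<dots>, i - 1\<close> up by one.\<close>

definition move_to_front :: "nat \<Rightarrow> nat \<Rightarrow> (nat \<Rightarrow> real \<Rightarrow> real) \<Rightarrow> nat \<Rightarrow> real \<Rightarrow> real" where
  "move_to_front n i \<omega> =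
     (\<lambda>j\<in>{1..n}. if j = 1 then \<omega> i else if j \<le> i then \<omega> (j - 1) else \<omega> j)"

text \<open>The usual augmentation, under \<open>Q\<close>, of the filtration generated by the coordinates.\<close>

definition path_filtration ::
    "nat \<Rightarrow> (nat \<Rightarrow> real \<Rightarrow> real) measure \<Rightarrow> real \<Rightarrow> (nat \<Rightarrow> real \<Rightarrow> real) measure" where
  "path_filtration n Q =
     usual_augmentation Q (natural_filtration (cont_paths n) {1..n} (\<lambda>i t \<omega>. \<omega> i t))"

text \<open>
  \<open>Q\<close> and \<open>P\<close> are measures on \<open>path_space n\<close>; since the filtration contains all subsets of
  \<open>Q\<close>-null sets, its events are measured by the completions. The identity determines \<open>P\<close>.
\<close>

definition size_biased_law ::
    "nat \<Rightarrow> (nat \<Rightarrow> real \<Rightarrow> real) measure \<Rightarrow> (nat \<Rightarrow> real \<Rightarrow> real) measure \<Rightarrow> bool" where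
  "size_biased_law n Q P \<longleftrightarrow>
     prob_space P \<and> sets P = sets (path_space n) \<and>
     (\<forall>t\<ge>0. \<forall>A\<in>sets (path_filtration n Q t).
        measure (completion P) A =
          (\<integral>\<omega>. (\<Sum>i=1..n. ratio n \<omega> i t * indicator A (move_to_front n i \<omega>)) \<partial>completion Q))"

end

theory Submission
  imports Defs "HOL-Real_Asymp.Real_Asymp"
begin

text \<open>
  On events on which the total mass \<open>\<zeta>\<close> is still alive, \<open>P\<close> is the sum over \<open>i\<close> of the measures with
  density \<open>\<omega>\<^sub>t(1) / \<zeta>\<^sub>t\<close> with respect to the law \<open>Q\<^sub>i\<close> of the permuted coordinates. This density
  cancels the factor \<open>\<zeta>\<^sub>t / Z\<^sub>t(1)\<close>: if \<open>Y\<close> is one of \<open>\<zeta>\<close>, \<open>\<omega>(2)\<close>, \<open>\<omega>(2) \<cdots> \<omega>(n)\<close>, a nonnegative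
  martingale under every \<open>Q\<^sub>i\<close> that vanishes with \<open>\<zeta>\<close>, then the \<open>P\<close>-mean of \<open>Y\<^sub>t \<zeta>\<^sub>t / Z\<^sub>t(1)\<close> on \<open>A\<close> is
  the sum of the \<open>Q\<^sub>i\<close>-means of \<open>Y\<^sub>t\<close> on \<open>A \<inter> {\<omega>\<^sub>t(1) > 0}\<close>. The mass of \<open>Y\<close> on the event that the first
  coordinate has died is lost, so the mean decreases strictly and the process is not a martingale.
  Nothing is lost before the first time at which \<open>\<zeta> / Z(1)\<close> or \<open>\<zeta>\<close> exceeds a level \<open>\<kappa>\<close>, and optional
  stopping under \<open>Q\<^sub>i\<close> makes the stopped process a martingale. These times are unbounded because
  \<open>\<zeta> / Z(1)\<close> ever exceeds \<open>\<kappa>\<close> with \<open>P\<close>-probability at most \<open>n / \<kappa>\<close>. The last process is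
  \<open>\<zeta>\<^sub>t / Z\<^sub>t(1)\<close> times the product of all coordinates, which already vanishes with \<open>Z\<^sub>t(1)\<close>.

  The facts on BESQ(0) come from one exponential supermartingale inequality for the Ito integral,
  obtained from simple integrands by Fatou's lemma. It yields exponential moments, then the
  martingale property by letting the exponent tend to zero, and, with the integrand
  \<open>\<theta> / \<surd>X\<close>, that \<open>X\<close> must hit zero when the driving Brownian motion falls far enough.
\<close>

section \<open>Augmented filtrations\<close>

text \<open>The Ito integral is known only as a limit in probability, so Fatou's lemma yields
  one-sided bounds. Equalities come back by symmetry: exponents of both signs give the martingale
  property of BESQ(0), an event together with its complement gives it for the augmented filtration.
  Each coordinate is a martingale for the filtration of its own driver, and nothing is assumed about
  the joint law of the drivers; only the coordinates are independent. Martingale identities for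
  products are therefore checked on cylinder events, where means factor over the coordinates. The
  density between \<open>P\<close> and the permuted laws is available at deterministic times only. A
  stopping time is therefore rounded up to a finite grid, the values are truncated so that dominated
  convergence applies, and the grid is refined. On path space all of this happens in the raw
  filtration, which knows \<open>{\<tau> < r}\<close> rather than \<open>{\<tau> \<le> r}\<close>;
  right limits and null sets enter when a process on path space is turned into one on the given
  space. The levels bound \<open>\<zeta>\<close> in addition to \<open>\<zeta> / Z(1)\<close> so
  that \<open>Y\<close> is bounded up to the stopping time.\<close>

lemma filtered_natural_filtration:
  assumes "\<And>i s. i \<in> I \<Longrightarrow> 0 \<le> s \<Longrightarrow> Y i s \<in> borel_measurable M"
  shows "filtered M (natural_filtration (space M) I Y)"
proof -
  let ?G = "\<lambda>t. {Y i s -` B \<inter> space M | i s B. i \<in> I \<and> 0 \<le> s \<and> s \<le> t \<and> B \<in> sets borel}"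
  have Gsub: "?G t \<subseteq> sets M" for t
    using assms by (auto intro: measurable_sets)
  have Gpow: "?G t \<subseteq> Pow (space M)" for t
    by auto
  have sets_eq: "sets (natural_filtration (space M) I Y t) = sigma_sets (space M) (?G t)" for t
    unfolding natural_filtration_def by (rule sets_measure_of[OF Gpow])
  have sp: "space (natural_filtration (space M) I Y t) = space M" for t
    unfolding natural_filtration_def by (rule space_measure_of[OF Gpow])
  have mono: "?G s \<subseteq> ?G t" if "s \<le> t" for s t
    using that by force
  have "sets (natural_filtration (space M) I Y t) \<subseteq> sets M" for t
    unfolding sets_eq by (rule sets.sigma_sets_subset[OF Gsub])
  moreover have "sets (natural_filtration (space M) I Y s) \<subseteq> sets (natural_filtration (space M) I Y t)"
    if "s \<le> t" for s t
    unfolding sets_eq by (rule sigma_sets_mono'[OF mono[OF that]])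
  ultimately show ?thesis
    unfolding filtered_def subalgebra_def filtration_def sp by simp
qed

lemma natural_filtration_measurable:
  fixes Y :: "'i \<Rightarrow> real \<Rightarrow> 'a \<Rightarrow> real"
  assumes "i \<in> I" "0 \<le> s" "s \<le> t"
  shows "Y i s \<in> borel_measurable (natural_filtration \<Omega> I Y t)"
proof (rule measurableI)
  let ?G = "{Y i s -` B \<inter> \<Omega> | i s B. i \<in> I \<and> 0 \<le> s \<and> s \<le> t \<and> B \<in> sets borel}"
  have Gpow: "?G \<subseteq> Pow \<Omega>" by auto
  fix A :: "real set" assume "A \<in> sets borel"
  then show "Y i s -` A \<inter> space (natural_filtration \<Omega> I Y t) \<in> sets (natural_filtration \<Omega> I Y t)"
    unfolding natural_filtration_def space_measure_of[OF Gpow] sets_measure_of[OF Gpow]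
    using assms by (intro sigma_sets.Basic) blast
qed auto

text \<open>\<open>N\<close> is a raw filtration inside \<open>M\<close>; its augmentation
  \<open>F\<close> contains subsets of null sets and therefore lives on \<open>completion M\<close>.
  Events of \<open>F\<close> are compared with events of \<open>N\<close> through almost sure
  equality.\<close>

locale augmented =
  fixes M :: "'a measure" and N :: "real \<Rightarrow> 'a measure"
  assumes filtered_N: "filtered M N"
begin

abbreviation F where "F \<equiv> usual_augmentation M N"

lemma space_N [simp]: "space (N t) = space M"
  using filtered_N by (simp add: filtered_def subalgebra_def)

lemma sets_N: "sets (N t) \<subseteq> sets M"
  using filtered_N by (simp add: filtered_def subalgebra_def)

lemma sets_N_mono: "s \<le> t \<Longrightarrow> sets (N s) \<subseteq> sets (N t)"
  using filtered_N by (simp add: filtered_def filtration_def)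

lemma null_into_space: "A \<in> null_sets (completion M) \<Longrightarrow> A \<subseteq> space M"
  using sets.sets_into_space[of A "completion M"] by (auto simp: null_sets_def)

lemma generator_Pow: "(\<Inter>s\<in>{t<..}. sets (N s)) \<union> null_sets (completion M) \<subseteq> Pow (space M)"
proof -
  have "A \<subseteq> space M" if "A \<in> (\<Inter>s\<in>{t<..}. sets (N s))" for A
  proof -
    have "A \<in> sets (N (t + 1))" using that by auto
    then show ?thesis using sets.sets_into_space by force
  qed
  then show ?thesis using null_into_space by blast
qed

lemma space_F [simp]: "space (F t) = space M"
  unfolding usual_augmentation_def by (rule space_measure_of[OF generator_Pow])

lemma sets_F: "sets (F t) = sigma_sets (space M) ((\<Inter>s\<in>{t<..}. sets (N s)) \<union> null_sets (completion M))"
  unfolding usual_augmentation_def by (rule sets_measure_of[OF generator_Pow])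

lemma sets_F_completion: "sets (F t) \<subseteq> sets (completion M)"
proof -
  have "(\<Inter>s\<in>{t<..}. sets (N s)) \<subseteq> sets (N (t + 1))"
    by auto
  also have "\<dots> \<subseteq> sets (completion M)"
    using sets_N by (auto simp del: sets_completion)
  finally have "(\<Inter>s\<in>{t<..}. sets (N s)) \<union> null_sets (completion M) \<subseteq> sets (completion M)"
    by (auto simp: null_sets_def simp del: sets_completion)
  then have "sigma_sets (space (completion M)) ((\<Inter>s\<in>{t<..}. sets (N s)) \<union> null_sets (completion M))
        \<subseteq> sets (completion M)"
    by (rule sets.sigma_sets_subset)
  then show ?thesis by (simp add: sets_F)
qed

lemma sets_F_mono: "s \<le> t \<Longrightarrow> sets (F s) \<subseteq> sets (F t)"
  unfolding sets_F by (rule sigma_sets_mono') force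

lemma subalgebra_F: "subalgebra (completion M) (F t)"
  using sets_F_completion by (simp add: subalgebra_def)

lemma filtered_F: "filtered (completion M) F"
  unfolding filtered_def filtration_def using subalgebra_F sets_F_mono by simp

lemma sets_N_F: "sets (N t) \<subseteq> sets (F t)"
proof
  fix A assume "A \<in> sets (N t)"
  then have "A \<in> sets (N s)" if "t < s" for s
    using sets_N_mono[of t s] that by auto
  then have "A \<in> (\<Inter>s\<in>{t<..}. sets (N s))"
    by simp
  then show "A \<in> sets (F t)"
    unfolding sets_F by (intro sigma_sets.Basic) blast
qed

lemma sets_F_right: "(\<And>s. t < s \<Longrightarrow> A \<in> sets (N s)) \<Longrightarrow> A \<in> sets (F t)"
  unfolding sets_F by (intro sigma_sets.Basic) blast

lemma null_sets_F: "A \<in> null_sets (completion M) \<Longrightarrow> A \<in> sets (F t)"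
  unfolding sets_F by (intro sigma_sets.Basic) blast

lemma measurable_N_F: "f \<in> measurable (N t) L \<Longrightarrow> f \<in> measurable (F t) L"
  using sets_N_F by (auto simp: measurable_def)

lemma measurable_N_M: "f \<in> measurable (N t) L \<Longrightarrow> f \<in> measurable M L"
  using sets_N by (auto simp: measurable_def)

lemma measurable_N_mono: "s \<le> t \<Longrightarrow> f \<in> measurable (N s) L \<Longrightarrow> f \<in> measurable (N t) L"
  using sets_N_mono[of s t] by (auto simp: measurable_def)

lemma measurable_F_completion: "f \<in> measurable (F t) L \<Longrightarrow> f \<in> measurable (completion M) L"
  using sets_F_completion[of t] by (auto simp: measurable_def)

lemma measurable_F_mono: "s \<le> t \<Longrightarrow> f \<in> measurable (F s) L \<Longrightarrow> f \<in> measurable (F t) L"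
  using sets_F_mono[of s t] by (auto simp: measurable_def)

text \<open>The two differences of \<open>A\<close> and \<open>B\<close> are null for the
  completion, and every \<open>F t\<close> contains all such sets, so \<open>B\<close> arises from
  \<open>A\<close> by adding one difference and removing the other.\<close>

lemma sets_F_cong_AE:
  assumes A: "A \<in> sets (F t)" and B: "B \<subseteq> space M" and AE: "AE x in M. x \<in> A \<longleftrightarrow> x \<in> B"
  shows "B \<in> sets (F t)"
proof -
  have AE': "AE x in completion M. x \<in> A \<longleftrightarrow> x \<in> B"
    using AE by (rule AE_completion)
  have A': "A \<in> sets (completion M)"
    using A sets_F_completion by blast
  have A'': "A \<subseteq> space M"
    using A sets.sets_into_space by force
  have B': "B \<in> sets (completion M)"
    using completion.in_sets_AE[OF AE' A'] B by simp
  have n1: "A - B \<in> null_sets (completion M)" "B - A \<in> null_sets (completion M)"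
    using AE' A'' B by (auto simp: completion.null_sets_iff_AE elim!: eventually_mono)
  have "A \<union> (B - A) - (A - B) \<in> sets (F t)"
    by (intro sets.Diff sets.Un A null_sets_F[OF n1(1)] null_sets_F[OF n1(2)])
  also have "A \<union> (B - A) - (A - B) = B"
    by auto
  finally show ?thesis .
qed

lemma measurable_F_cong_AE:
  assumes f: "f \<in> measurable (F t) L" and g: "g \<in> space M \<rightarrow> space L" and AE: "AE x in M. f x = g x"
  shows "g \<in> measurable (F t) L"
proof (rule measurableI)
  fix A assume A: "A \<in> sets L"
  show "g -` A \<inter> space (F t) \<in> sets (F t)"
    by (rule sets_F_cong_AE[OF measurable_sets[OF f A]]) (use AE in \<open>auto elim!: AE_mp\<close>)
qed (use g in auto)

text \<open>The events that agree almost surely with an event of \<open>N t\<close> form a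
  \<sigma>-algebra that contains both kinds of generators of \<open>F s\<close>. The strict gap
  \<open>s < t\<close> places the right limit of \<open>N\<close> at \<open>s\<close> inside
  \<open>N t\<close>.\<close>

lemma sets_F_approx:
  assumes "A \<in> sets (F s)" "s < t"
  shows "\<exists>A'\<in>sets (N t). AE x in M. x \<in> A \<longleftrightarrow> x \<in> A'"
  using assms(1) unfolding sets_F
proof (induction rule: sigma_sets.induct)
  case (Basic A)
  then consider "A \<in> sets (N t)" | "A \<in> null_sets (completion M)"
    using \<open>s < t\<close> by auto
  then show ?case
  proof cases
    case 2
    then have "AE x in M. x \<in> A \<longleftrightarrow> x \<in> {}"
      using AE_not_in[OF 2] by (simp add: AE_completion_iff)
    then show ?thesis by (intro bexI[of _ "{}"]) auto
  qed auto
next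
  case Empty
  then show ?case by (intro bexI[of _ "{}"]) auto
next
  case (Compl A)
  then obtain A' where "A' \<in> sets (N t)" "AE x in M. x \<in> A \<longleftrightarrow> x \<in> A'" by blast
  then show ?case
    by (intro bexI[of _ "space M - A'"]) (auto intro: sets.compl_sets[where M="N t", simplified])
next
  case (Union A)
  then have "\<forall>i. \<exists>A'\<in>sets (N t). AE x in M. x \<in> A i \<longleftrightarrow> x \<in> A'" by blast
  then obtain A' where A': "\<And>i. A' i \<in> sets (N t)" "\<And>i. AE x in M. x \<in> A i \<longleftrightarrow> x \<in> A' i"
    by metis
  have "AE x in M. \<forall>i. x \<in> A i \<longleftrightarrow> x \<in> A' i"
    using A' by (simp add: AE_all_countable)
  then have "AE x in M. x \<in> (\<Union>i. A i) \<longleftrightarrow> x \<in> (\<Union>i. A' i)"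
    by eventually_elim auto
  then show ?case
    by (intro bexI[of _ "\<Union>i. A' i"]) (use A'(1) in auto)
qed

text \<open>Passing from \<open>N\<close> to its right limits: Fatou's lemma along times decreasing to \<open>s\<close> gives one
  inequality on \<open>A\<close> and one on its complement, and both add up to an equality.\<close>

lemma martingale_augmentedI:
  assumes "prob_space M"
    and meas: "\<And>t. 0 \<le> t \<Longrightarrow> V t \<in> borel_measurable (F t)"
    and nonneg: "\<And>t. 0 \<le> t \<Longrightarrow> AE x in M. 0 \<le> V t x"
    and cont: "\<And>s. 0 \<le> s \<Longrightarrow> AE x in M. ((\<lambda>t. V t x) \<longlongrightarrow> V s x) (at_right s)"
    and fin: "(\<integral>\<^sup>+ x. ennreal (V 0 x) \<partial>M) < \<infinity>"
    and eq: "\<And>s t A. 0 \<le> s \<Longrightarrow> s < t \<Longrightarrow> A \<in> sets (N s) \<Longrightarrow>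
        (\<integral>\<^sup>+ x. ennreal (V t x) * indicator A x \<partial>M) = (\<integral>\<^sup>+ x. ennreal (V s x) * indicator A x \<partial>M)"
  shows "martingale (completion M) F V"
proof -
  interpret prob_space M by fact
  have measC: "V t \<in> borel_measurable (completion M)" if "0 \<le> t" for t
    using meas[OF that] by (rule measurable_F_completion)
  have total: "(\<integral>\<^sup>+ x. ennreal (V t x) \<partial>M) = (\<integral>\<^sup>+ x. ennreal (V s x) \<partial>M)" if "0 \<le> s" "s < t" for s t
  proof -
    have "(\<integral>\<^sup>+ x. ennreal (V t x) \<partial>M) = (\<integral>\<^sup>+ x. ennreal (V t x) * indicator (space M) x \<partial>M)" for t
      by (intro nn_integral_cong) auto
    moreover have "space M \<in> sets (N s)" using sets.top[of "N s"] by simp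
    ultimately show ?thesis using eq[OF that, of "space M"] by simp
  qed
  have finite: "(\<integral>\<^sup>+ x. ennreal (V t x) \<partial>M) < \<infinity>" if "0 \<le> t" for t
    using total[of 0 t] that fin by (cases "t = 0") auto
  have int: "integrable (completion M) (V t)" if "0 \<le> t" for t
    using measC[OF that] finite[OF that] nonneg[OF that]
    by (intro integrableI_nonneg) (auto simp: nn_integral_completion AE_completion)
  have le: "(\<integral>\<^sup>+ x. ennreal (V s x) * indicator A x \<partial>M) \<le> (\<integral>\<^sup>+ x. ennreal (V t x) * indicator A x \<partial>M)"
    if st: "0 \<le> s" "s < t" and A: "A \<in> sets (F s)" for s t A
  proof -
    \<comment> \<open>The offset 2 keeps \<open>u k\<close> strictly below \<open>t\<close>, as
      \<open>eq\<close> requires, while \<open>s < u k\<close> makes every event of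
      \<open>F s\<close> almost surely equal to one of \<open>N (u k)\<close>.\<close>
    define u where "u k = s + (t - s) / (real k + 2)" for k :: nat
    have u: "s < u k" "u k < t" for k
    proof -
      have "(t - s) / (real k + 2) < (t - s) / 1"
        using st by (intro divide_strict_left_mono) auto
      then show "u k < t" by (simp add: u_def)
      show "s < u k" using st by (simp add: u_def)
    qed
    have ulim: "u \<longlonglongrightarrow> s"
    proof -
      show ?thesis unfolding u_def by real_asymp
    qed
    have "u k \<in> {s<..} \<and> u k \<noteq> s" for k
      using u(1)[of k] by auto
    with ulim have ulim': "filterlim u (at_right s) sequentially"
      by (simp add: filterlim_at)
    have conv: "AE x in completion M. (\<lambda>k. V (u k) x) \<longlonglongrightarrow> V s x"
      using AE_completion[OF cont[OF st(1)]] by eventually_elim (rule filterlim_compose[OF _ ulim'])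
    have "(\<integral>\<^sup>+ x. ennreal (V s x) * indicator A x \<partial>M) = (\<integral>\<^sup>+ x. ennreal (V s x) * indicator A x \<partial>completion M)"
      by (simp add: nn_integral_completion)
    also have "\<dots> = (\<integral>\<^sup>+ x. liminf (\<lambda>k. ennreal (V (u k) x) * indicator A x) \<partial>completion M)"
    proof (rule nn_integral_cong_AE)
      show "AE x in completion M. ennreal (V s x) * indicator A x = liminf (\<lambda>k. ennreal (V (u k) x) * indicator A x)"
        using conv
      proof eventually_elim
        case (elim x)
        have "(\<lambda>k. ennreal (V (u k) x) * indicator A x) \<longlonglongrightarrow> ennreal (V s x) * indicator A x"
          using elim by (cases "x \<in> A") (auto intro: tendsto_ennrealI)
        from lim_imp_Liminf[OF _ this] show ?case by simp
      qed
    qed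
    also have "\<dots> \<le> liminf (\<lambda>k. \<integral>\<^sup>+ x. ennreal (V (u k) x) * indicator A x \<partial>completion M)"
    proof (rule nn_integral_liminf)
      fix k
      have [measurable]: "V (u k) \<in> borel_measurable (completion M)" "A \<in> sets (completion M)"
        using measC[of "u k"] u[of k] st A sets_F_completion by auto
      show "(\<lambda>x. ennreal (V (u k) x) * indicator A x) \<in> borel_measurable (completion M)"
        by measurable
    qed
    also have "\<dots> = liminf (\<lambda>k. \<integral>\<^sup>+ x. ennreal (V t x) * indicator A x \<partial>M)"
    proof -
      have "(\<integral>\<^sup>+ x. ennreal (V (u k) x) * indicator A x \<partial>completion M)
          = (\<integral>\<^sup>+ x. ennreal (V t x) * indicator A x \<partial>M)" for k
      proof -
        obtain A' where A': "A' \<in> sets (N (u k))" "AE x in M. x \<in> A \<longleftrightarrow> x \<in> A'"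
          using sets_F_approx[OF A u(1)] by blast
        have sw: "(\<integral>\<^sup>+ x. ennreal (V v x) * indicator A x \<partial>M) = (\<integral>\<^sup>+ x. ennreal (V v x) * indicator A' x \<partial>M)" for v
          using A'(2) by (intro nn_integral_cong_AE) (auto split: split_indicator)
        show ?thesis
          using eq[OF _ u(2) A'(1)] u(1)[of k] st(1) unfolding nn_integral_completion sw by simp
      qed
      then show ?thesis by simp
    qed
    finally show ?thesis by (simp add: Liminf_const)
  qed
  have setint: "(\<integral>x\<in>A. V t x \<partial>completion M) = (\<integral>x\<in>A. V s x \<partial>completion M)"
    if st: "0 \<le> s" "s \<le> t" and A: "A \<in> sets (F s)" for s t A
  proof (cases "s = t")
    case False
    with st have "s < t" by simp
    have Ac: "A \<in> sets (completion M)" using A sets_F_completion by blast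
    have iA: "set_integrable (completion M) B (V v)" if "0 \<le> v" "B \<in> sets (completion M)" for v B
      unfolding set_integrable_def using integrable_mult_indicator[OF that(2) int[OF that(1)]] .
    have conv: "(\<integral>\<^sup>+ x. ennreal (V v x) * indicator B x \<partial>M) = ennreal (\<integral>x\<in>B. V v x \<partial>completion M)"
      if "0 \<le> v" "B \<in> sets (completion M)" for v B
    proof -
      have "(\<integral>\<^sup>+ x. ennreal (V v x) * indicator B x \<partial>completion M)
          = (\<integral>\<^sup>+ x. ennreal (indicator B x *\<^sub>R V v x) \<partial>completion M)"
        by (intro nn_integral_cong) (auto split: split_indicator)
      also have "\<dots> = ennreal (\<integral>x\<in>B. V v x \<partial>completion M)"
        unfolding set_lebesgue_integral_def using iA[OF that] AE_completion[OF nonneg[OF that(1)]]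
        by (intro nn_integral_eq_integral) (auto simp: set_integrable_def split: split_indicator)
      finally show ?thesis by (simp add: nn_integral_completion)
    qed
    have nn: "0 \<le> (\<integral>x\<in>B. V v x \<partial>completion M)" if "0 \<le> v" for v B
      unfolding set_lebesgue_integral_def using AE_completion[OF nonneg[OF that(1)]]
      by (intro integral_nonneg_AE) (auto split: split_indicator)
    have le': "(\<integral>x\<in>B. V s x \<partial>completion M) \<le> (\<integral>x\<in>B. V t x \<partial>completion M)" if "B \<in> sets (F s)" for B
    proof -
      have "B \<in> sets (completion M)" using that sets_F_completion by blast
      with le[OF st(1) \<open>s < t\<close> that] st show ?thesis by (simp add: conv nn)
    qed
    have compl: "space M - A \<in> sets (F s)" using A sets.compl_sets[of A "F s"] by simp
    have split: "(\<integral>x. V v x \<partial>completion M) =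
      (\<integral>x\<in>A. V v x \<partial>completion M) + (\<integral>x\<in>space M - A. V v x \<partial>completion M)" if "0 \<le> v" for v
    proof -
      have "(\<integral>x\<in>A \<union> (space M - A). V v x \<partial>completion M) =
        (\<integral>x\<in>A. V v x \<partial>completion M) + (\<integral>x\<in>space M - A. V v x \<partial>completion M)"
        using Ac that by (intro set_integral_Un iA) auto
      moreover have "A \<union> (space M - A) = space M" using sets.sets_into_space[OF Ac] by auto
      ultimately show ?thesis
        using set_integral_space[OF int[OF that]] by simp
    qed
    have tot: "(\<integral>x. V t x \<partial>completion M) = (\<integral>x. V s x \<partial>completion M)"
    proof -
      have "ennreal (\<integral>x. V t x \<partial>completion M) = ennreal (\<integral>x. V s x \<partial>completion M)"
        using total[OF st(1) \<open>s < t\<close>] nn_integral_eq_integral[OF int[of t]] nn_integral_eq_integral[OF int[of s]]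
          AE_completion[OF nonneg[of t]] AE_completion[OF nonneg[of s]] st
        by (simp add: nn_integral_completion)
      then show ?thesis
        using AE_completion[OF nonneg[of t]] AE_completion[OF nonneg[of s]] st
        by (simp add: integral_nonneg_AE)
    qed
    show ?thesis
      using le'[OF A] le'[OF compl] split[of s] split[of t] tot st by simp
  qed simp
  show ?thesis
    unfolding martingale_def
  proof (intro conjI allI impI)
    show "filtered (completion M) F" by (rule filtered_F)
    show "adapted F V" using meas by (simp add: adapted_def)
    show "integrable (completion M) (V t)" if "0 \<le> t" for t by (rule int[OF that])
    fix s t :: real assume st: "0 \<le> s \<and> s \<le> t"
    interpret CM: prob_space "completion M"
      by (rule prob_spaceI) (simp add: emeasure_space_1)
    interpret C: finite_measure_subalgebra "completion M" "F s"
      by unfold_locales (rule subalgebra_F)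
    show "AE x in completion M. real_cond_exp (completion M) (F s) (V t) x = V s x"
      by (rule C.real_cond_exp_charact) (use st setint int meas in auto)
  qed
qed

end

section \<open>Exponential inequalities for Ito integrals\<close>

text \<open>Completing the square: the exponential tilt moves the centred Gaussian density to mean
  \<open>w * v\<close>, and the shifted density still integrates to 1. For negative \<open>g\<close>
  both sides are 0, because \<open>ennreal\<close> truncates.\<close>

lemma nn_integral_exp_normal_density:
  fixes g w v :: real
  assumes "0 < v"
  shows "(\<integral>\<^sup>+ d. ennreal (g * exp (w * d - w\<^sup>2 * v / 2)) * ennreal (normal_density 0 (sqrt v) d) \<partial>lborel) = ennreal g"
proof (cases "0 \<le> g")
  case True
  have "exp (w * d - w\<^sup>2 * v / 2) * normal_density 0 (sqrt v) d = normal_density (w * v) (sqrt v) d" for d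
  proof -
    have "w * d - w\<^sup>2 * v / 2 + - (d - 0)\<^sup>2 / (2 * (sqrt v)\<^sup>2) = - (d - w * v)\<^sup>2 / (2 * (sqrt v)\<^sup>2)"
      using assms by (simp add: field_simps power2_eq_square)
    then show ?thesis
      unfolding normal_density_def by (simp add: exp_add[symmetric] mult.left_commute)
  qed
  then have "(\<integral>\<^sup>+ d. ennreal (g * exp (w * d - w\<^sup>2 * v / 2)) * ennreal (normal_density 0 (sqrt v) d) \<partial>lborel)
      = (\<integral>\<^sup>+ d. ennreal g * ennreal (normal_density (w * v) (sqrt v) d) \<partial>lborel)"
    using True by (intro nn_integral_cong) (simp add: ennreal_mult[symmetric] mult.assoc)
  also have "\<dots> = ennreal g * emeasure (density lborel (normal_density (w * v) (sqrt v))) UNIV"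
    by (subst nn_integral_cmult) (auto simp: emeasure_density)
  also have "emeasure (density lborel (normal_density (w * v) (sqrt v))) UNIV = 1"
    using prob_space.emeasure_space_1[OF prob_space_normal_density[of "sqrt v" "w * v"]] assms by simp
  finally show ?thesis by simp
next
  case False
  have "ennreal (g * exp (w * d - w\<^sup>2 * v / 2)) = 0" for d
    using False by (simp add: ennreal_neg mult_nonpos_nonneg)
  moreover have "ennreal g = 0" using False by (simp add: ennreal_neg)
  ultimately show ?thesis by simp
qed

locale brownian =
  fixes M :: "'a measure" and \<beta> :: "real \<Rightarrow> 'a \<Rightarrow> real"
  assumes bm: "brownian_motion M \<beta>"
begin

definition N where "N = natural_filtration (space M) (UNIV :: unit set) (\<lambda>_. \<beta>)"

sublocale prob_space M
  using bm by (simp add: brownian_motion_def)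

lemma measurable_bm [measurable]: "0 \<le> t \<Longrightarrow> \<beta> t \<in> borel_measurable M"
  using bm by (simp add: brownian_motion_def random_process_def)

sublocale augmented M N
  unfolding N_def by unfold_locales (rule filtered_natural_filtration, simp)

sublocale C: prob_space "completion M"
  by (rule prob_spaceI) (simp add: emeasure_space_1)

lemma measurable_bm_F: "0 \<le> s \<Longrightarrow> s \<le> t \<Longrightarrow> \<beta> s \<in> borel_measurable (F t)"
  by (rule measurable_N_F) (simp add: N_def natural_filtration_measurable[where Y="\<lambda>_::unit. \<beta>", simplified])

text \<open>Independence of increments is given for the raw filtration. An event of
  \<open>F a\<close> agrees almost surely with one of \<open>N a'\<close>, thanks to
  \<open>a < a'\<close>, and is therefore independent of the increment after \<open>a'\<close>;
  rectangles then determine the joint law.\<close>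

lemma distr_increment:
  assumes f: "f \<in> measurable (F a) L" and ab: "0 \<le> a" "a < a'" "a' < b"
  shows "distr (completion M) (L \<Otimes>\<^sub>M borel) (\<lambda>x. (f x, \<beta> b x - \<beta> a' x))
    = distr (completion M) L f \<Otimes>\<^sub>M distr (completion M) borel (\<lambda>x. \<beta> b x - \<beta> a' x)"
proof -
  let ?D = "\<lambda>x. \<beta> b x - \<beta> a' x"
  have D: "?D \<in> borel_measurable M" using ab by simp
  have DC: "?D \<in> borel_measurable (completion M)" using D by (rule measurable_completion)
  have fC: "f \<in> measurable (completion M) L" using f by (rule measurable_F_completion)
  have ind: "indep_set (sets (N a')) {?D -` B \<inter> space M | B. B \<in> sets borel}"
    using bm ab unfolding brownian_motion_def N_def by auto
  interpret D: prob_space "distr (completion M) borel ?D"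
    using DC by (rule C.prob_space_distr)
  interpret f: prob_space "distr (completion M) L f"
    using fC by (rule C.prob_space_distr)
  show ?thesis
  proof (rule pair_measure_eqI[symmetric])
    fix A B assume "A \<in> sets (distr (completion M) L f)" "B \<in> sets (distr (completion M) borel ?D)"
    then have A: "A \<in> sets L" and B: "B \<in> sets borel" by auto
    let ?A = "f -` A \<inter> space M" and ?B = "?D -` B \<inter> space M"
    have AF: "?A \<in> sets (F a)" using measurable_sets[OF f A] by simp
    then have AC: "?A \<in> sets (completion M)" using sets_F_completion by blast
    obtain A' where A': "A' \<in> sets (N a')" "AE x in M. x \<in> ?A \<longleftrightarrow> x \<in> A'"
      using sets_F_approx[OF AF ab(2)] by blast
    have A'M: "A' \<in> sets M" using A' sets_N by blast
    have BM: "?B \<in> sets M" using measurable_sets[OF D B] by simp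
    have "C.prob (?A \<inter> ?B) = C.prob (A' \<inter> ?B)"
      using AE_completion[OF A'(2)] AC A'M BM by (intro C.finite_measure_eq_AE) (auto simp del: sets_completion)
    also have "\<dots> = prob (A' \<inter> ?B)" using A'M BM by simp
    also have "\<dots> = prob A' * prob ?B"
      using ind A'(1) B unfolding indep_sets2_eq by blast
    also have "\<dots> = C.prob A' * C.prob ?B" using A'M BM by simp
    also have "C.prob A' = C.prob ?A"
      using AE_completion[OF A'(2)] AC A'M by (intro C.finite_measure_eq_AE) (auto simp del: sets_completion)
    finally have eq: "C.prob (?A \<inter> ?B) = C.prob ?A * C.prob ?B" .
    have "(\<lambda>x. (f x, ?D x)) -` (A \<times> B) \<inter> space (completion M) = ?A \<inter> ?B" by auto
    with eq show "emeasure (distr (completion M) L f) A * emeasure (distr (completion M) borel ?D) B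
      = emeasure (distr (completion M) (L \<Otimes>\<^sub>M borel) (\<lambda>x. (f x, ?D x))) (A \<times> B)"
      using A B fC DC by (simp add: emeasure_distr C.emeasure_eq_measure ennreal_mult[symmetric])
  qed (auto intro: sets_pair_measure_cong D.sigma_finite_measure_axioms f.sigma_finite_measure_axioms)
qed

text \<open>The product form of the joint law allows the increment to be integrated first, with
  \<open>G\<close> and \<open>w\<close> frozen; the inner Gaussian integral is \<open>G\<close>
  again.\<close>

lemma nn_integral_exp_increment:
  assumes [measurable]: "G \<in> borel_measurable (F a)" "w \<in> borel_measurable (F a)"
    and ab: "0 \<le> a" "a < a'" "a' < b"
  shows "(\<integral>\<^sup>+ x. ennreal (G x * exp (w x * (\<beta> b x - \<beta> a' x) - (w x)\<^sup>2 * (b - a') / 2)) \<partial>M)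
    = (\<integral>\<^sup>+ x. ennreal (G x) \<partial>M)"
proof -
  let ?D = "\<lambda>x. \<beta> b x - \<beta> a' x" and ?p = "\<lambda>x. (G x, w x)" and ?S = "borel \<Otimes>\<^sub>M borel :: (real \<times> real) measure"
  let ?f = "\<lambda>q :: (real \<times> real) \<times> real. ennreal (fst (fst q) * exp (snd (fst q) * snd q - (snd (fst q))\<^sup>2 * (b - a') / 2))"
  have D: "?D \<in> borel_measurable M" using ab by simp
  have p: "?p \<in> measurable (completion M) ?S"
    by (intro measurable_F_completion[of _ a]) measurable
  have ind: "distr (completion M) (?S \<Otimes>\<^sub>M borel) (\<lambda>x. (?p x, ?D x))
      = distr (completion M) ?S ?p \<Otimes>\<^sub>M distr (completion M) borel ?D"
    by (intro distr_increment[OF _ ab]) measurable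
  have dD: "distr (completion M) borel ?D = density lborel (normal_density 0 (sqrt (b - a')))"
  proof -
    have "distributed M lborel ?D (normal_density 0 (sqrt (b - a')))"
      using bm ab unfolding brownian_motion_def by auto
    then have "distr M lborel ?D = density lborel (normal_density 0 (sqrt (b - a')))"
      by (rule distributed_distr_eq_density)
    moreover have "distr (completion M) borel ?D = distr M borel ?D"
      by (rule distr_completion[OF D])
    moreover have "distr M borel ?D = distr M lborel ?D"
      by (rule distr_cong) simp_all
    ultimately show ?thesis by metis
  qed
  have f: "?f \<in> borel_measurable (?S \<Otimes>\<^sub>M borel)" by measurable
  interpret PD: prob_space "distr (completion M) borel ?D"
    using D by (intro C.prob_space_distr) (simp add: measurable_completion)
  have "(\<integral>\<^sup>+ x. ennreal (G x * exp (w x * (\<beta> b x - \<beta> a' x) - (w x)\<^sup>2 * (b - a') / 2)) \<partial>M)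
     = (\<integral>\<^sup>+ x. ?f (?p x, ?D x) \<partial>completion M)"
    by (simp add: nn_integral_completion)
  also have "\<dots> = (\<integral>\<^sup>+ q. ?f q \<partial>distr (completion M) (?S \<Otimes>\<^sub>M borel) (\<lambda>x. (?p x, ?D x)))"
    using p D f by (subst nn_integral_distr) (auto simp: measurable_completion intro!: measurable_Pair)
  also have "\<dots> = (\<integral>\<^sup>+ q. ?f q \<partial>(distr (completion M) ?S ?p \<Otimes>\<^sub>M distr (completion M) borel ?D))"
    unfolding ind ..
  also have "\<dots> = (\<integral>\<^sup>+ p. \<integral>\<^sup>+ d. ?f (p, d) \<partial>distr (completion M) borel ?D \<partial>distr (completion M) ?S ?p)"
    using f by (subst PD.nn_integral_fst) (auto simp: cong: measurable_cong_sets)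
  also have "\<dots> = (\<integral>\<^sup>+ p. ennreal (fst p) \<partial>distr (completion M) ?S ?p)"
    unfolding dD using ab
    by (intro nn_integral_cong) (simp add: nn_integral_density mult.commute[of _ "ennreal (exp _)"]
      nn_integral_exp_normal_density[of "b - a'", simplified] mult.commute[of "ennreal (normal_density _ _ _)"])
  also have "\<dots> = (\<integral>\<^sup>+ x. ennreal (G x) \<partial>M)"
    using p by (subst nn_integral_distr) (auto simp: nn_integral_completion)
  finally show ?thesis .
qed

text \<open>Letting \<open>a'\<close> decrease to \<open>a\<close> in the exact formula closes the
  gap. Path continuity gives pointwise convergence and Fatou's lemma the inequality, in the
  direction that is propagated to the Ito integral.\<close>

lemma nn_integral_exp_increment_le:
  assumes G: "G \<in> borel_measurable (F a)" and w: "w \<in> borel_measurable (F a)"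
    and ab: "0 \<le> a" "a \<le> b"
  shows "(\<integral>\<^sup>+ x. ennreal (G x * exp (w x * (\<beta> b x - \<beta> a x) - (w x)\<^sup>2 * (b - a) / 2)) \<partial>M)
    \<le> (\<integral>\<^sup>+ x. ennreal (G x) \<partial>M)"
proof (cases "a = b")
  case False
  with ab have "a < b" by simp
  define u where "u k = a + (b - a) / (real k + 2)" for k :: nat
  have u: "a < u k" "u k < b" for k
  proof -
    have "(b - a) / (real k + 2) < (b - a) / 1"
      using \<open>a < b\<close> by (intro divide_strict_left_mono) auto
    then show "u k < b" by (simp add: u_def)
    show "a < u k" using \<open>a < b\<close> by (simp add: u_def)
  qed
  have ulim: "u \<longlonglongrightarrow> a" unfolding u_def by real_asymp
  have m: "G \<in> borel_measurable (completion M)" "w \<in> borel_measurable (completion M)"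
    using G w by (auto intro: measurable_F_completion)
  have "(\<integral>\<^sup>+ x. ennreal (G x * exp (w x * (\<beta> b x - \<beta> a x) - (w x)\<^sup>2 * (b - a) / 2)) \<partial>M)
    = (\<integral>\<^sup>+ x. liminf (\<lambda>k. ennreal (G x * exp (w x * (\<beta> b x - \<beta> (u k) x) - (w x)\<^sup>2 * (b - u k) / 2))) \<partial>completion M)"
    unfolding nn_integral_completion
  proof (rule nn_integral_cong)
    fix x assume x: "x \<in> space M"
    have "continuous_on {0..} (\<lambda>t. \<beta> t x)"
      using bm x by (simp add: brownian_motion_def continuous_paths_def)
    moreover have "u k \<in> {0..}" for k
      using u(1)[of k] ab(1) by simp
    ultimately have "(\<lambda>k. \<beta> (u k) x) \<longlonglongrightarrow> \<beta> a x"
      using ulim ab by (intro continuous_on_tendsto_compose[where f="\<lambda>t. \<beta> t x" and s="{0..}"]) auto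
    then have "(\<lambda>k. ennreal (G x * exp (w x * (\<beta> b x - \<beta> (u k) x) - (w x)\<^sup>2 * (b - u k) / 2)))
      \<longlonglongrightarrow> ennreal (G x * exp (w x * (\<beta> b x - \<beta> a x) - (w x)\<^sup>2 * (b - a) / 2))"
      by (intro tendsto_ennrealI tendsto_intros ulim) auto
    from lim_imp_Liminf[OF _ this]
    show "ennreal (G x * exp (w x * (\<beta> b x - \<beta> a x) - (w x)\<^sup>2 * (b - a) / 2)) =
      liminf (\<lambda>k. ennreal (G x * exp (w x * (\<beta> b x - \<beta> (u k) x) - (w x)\<^sup>2 * (b - u k) / 2)))" by simp
  qed
  also have "\<dots> \<le> liminf (\<lambda>k. \<integral>\<^sup>+ x. ennreal (G x * exp (w x * (\<beta> b x - \<beta> (u k) x) - (w x)\<^sup>2 * (b - u k) / 2)) \<partial>completion M)"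
  proof (rule nn_integral_liminf)
    fix k
    have [measurable]: "\<beta> b \<in> borel_measurable (completion M)" "\<beta> (u k) \<in> borel_measurable (completion M)"
      using u[of k] ab by (auto intro: measurable_completion)
    note m [measurable]
    show "(\<lambda>x. ennreal (G x * exp (w x * (\<beta> b x - \<beta> (u k) x) - (w x)\<^sup>2 * (b - u k) / 2))) \<in> borel_measurable (completion M)"
      by measurable
  qed
  also have "\<dots> = (\<integral>\<^sup>+ x. ennreal (G x) \<partial>M)"
    unfolding nn_integral_completion nn_integral_exp_increment[OF G w ab(1) u] by (simp add: Liminf_const)
  finally show ?thesis .
qed simp

end

section \<open>Exponential inequality for simple integrands\<close>

lemma partition_mono:
  fixes p :: "nat \<Rightarrow> real"
  assumes p: "\<And>k. k < m \<Longrightarrow> p k \<le> p (Suc k)" and "i \<le> k" "k \<le> m"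
  shows "p i \<le> p k"
  using assms(2,3) by (induction k rule: dec_induct) (auto intro: order_trans[OF _ p])

text \<open>\<open>v\<close> is the constant value of the integrand on the interval from
  \<open>t\<close> (excluded) to \<open>t'\<close>. The second alternative covers the times before
  the first and after the last partition point, where that value is 0, so that any interval can be
  cut into such steps.\<close>

definition simple_step :: "nat \<Rightarrow> (nat \<Rightarrow> real) \<Rightarrow> (nat \<Rightarrow> 'a \<Rightarrow> real) \<Rightarrow> real \<Rightarrow> real \<Rightarrow> ('a \<Rightarrow> real) \<Rightarrow> bool" where
  "simple_step m p \<xi> t t' v \<longleftrightarrow> (\<exists>j<m. p j \<le> t \<and> t' \<le> p (Suc j) \<and> v = \<xi> j) \<or>
    (v = (\<lambda>_. 0) \<and> (t' \<le> p 0 \<or> p m \<le> t))"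

lemma simple_value_step:
  assumes p: "\<And>k. k < m \<Longrightarrow> p k \<le> p (Suc k)" and st: "simple_step m p \<xi> t t' v" and s: "t < s" "s \<le> t'"
  shows "simple_value m p \<xi> s x = v x"
proof -
  note mono = partition_mono[of m p, OF p]
  from st consider j where "j < m" "p j \<le> t" "t' \<le> p (Suc j)" "v = \<xi> j"
    | "v = (\<lambda>_. 0)" "t' \<le> p 0" | "v = (\<lambda>_. 0)" "p m \<le> t"
    unfolding simple_step_def by blast
  then show ?thesis
  proof cases
    case 1
    have "\<xi> i x * indicator {p i<..p (Suc i)} s = (if i = j then \<xi> j x else 0)" if "i < m" for i
      using 1 s that mono[of "Suc i" j] mono[of "Suc j" i] by (cases i j rule: linorder_cases) auto
    then have "simple_value m p \<xi> s x = (\<Sum>i<m. if i = j then \<xi> j x else 0)"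
      unfolding simple_value_def by (intro sum.cong) auto
    then show ?thesis using 1 by simp
  next
    case 2
    have "\<xi> i x * indicator {p i<..p (Suc i)} s = 0" if "i < m" for i
      using 2 s that mono[of 0 i] by auto
    then have "simple_value m p \<xi> s x = 0"
      unfolding simple_value_def by (intro sum.neutral ballI) auto
    then show ?thesis using 2 by simp
  next
    case 3
    have "\<xi> i x * indicator {p i<..p (Suc i)} s = 0" if "i < m" for i
      using 3 s that mono[of "Suc i" m] by auto
    then have "simple_value m p \<xi> s x = 0"
      unfolding simple_value_def by (intro sum.neutral ballI) auto
    then show ?thesis using 3 by simp
  qed
qed

text \<open>Truncating both endpoints at the running time makes the summands of all other cells
  equal at \<open>t\<close> and \<open>t'\<close>; only the cell that contains the step contributes
  the increment.\<close>

lemma simple_integral_step: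
  assumes p: "\<And>k. k < m \<Longrightarrow> p k \<le> p (Suc k)" and st: "simple_step m p \<xi> t t' v" and t: "t \<le> t'"
  shows "simple_integral \<beta> m p \<xi> t' x = simple_integral \<beta> m p \<xi> t x + v x * (\<beta> t' x - \<beta> t x)"
proof -
  note mono = partition_mono[of m p, OF p]
  let ?d = "\<lambda>i. \<xi> i x * (\<beta> (min t' (p (Suc i))) x - \<beta> (min t' (p i)) x)
    - \<xi> i x * (\<beta> (min t (p (Suc i))) x - \<beta> (min t (p i)) x)"
  have diff: "simple_integral \<beta> m p \<xi> t' x - simple_integral \<beta> m p \<xi> t x = (\<Sum>i<m. ?d i)"
    by (simp add: simple_integral_def sum_subtractf)
  from st consider j where "j < m" "p j \<le> t" "t' \<le> p (Suc j)" "v = \<xi> j"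
    | "v = (\<lambda>_. 0)" "t' \<le> p 0" | "v = (\<lambda>_. 0)" "p m \<le> t"
    unfolding simple_step_def by blast
  then have "(\<Sum>i<m. ?d i) = v x * (\<beta> t' x - \<beta> t x)"
  proof cases
    case 1
    have "?d i = (if i = j then v x * (\<beta> t' x - \<beta> t x) else 0)" if "i < m" for i
    proof (cases i j rule: linorder_cases)
      case less
      then have "p i \<le> t" "p (Suc i) \<le> t" using 1 mono[of i j] mono[of "Suc i" j] that by auto
      then show ?thesis using less t by (simp add: min_absorb2)
    next
      case equal
      then show ?thesis using 1 t by (simp add: min_absorb1 min_absorb2 algebra_simps)
    next
      case greater
      then have "t' \<le> p i" "t' \<le> p (Suc i)" using 1 mono[of "Suc j" i] mono[of "Suc j" "Suc i"] that by auto
      then show ?thesis using greater t by (simp add: min_absorb1)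
    qed
    then show ?thesis using 1 by simp
  next
    case 2
    have "?d i = 0" if "i < m" for i
    proof -
      have "t' \<le> p i" "t' \<le> p (Suc i)" using 2 mono[of 0 i] mono[of 0 "Suc i"] that by auto
      then show ?thesis using t by (simp add: min_absorb1)
    qed
    then have "(\<Sum>i<m. ?d i) = 0" by (intro sum.neutral ballI) auto
    then show ?thesis using 2 by simp
  next
    case 3
    have "?d i = 0" if "i < m" for i
    proof -
      have "p i \<le> t" "p (Suc i) \<le> t" using 3 mono[of i m] mono[of "Suc i" m] that by auto
      then show ?thesis using t by (simp add: min_absorb2)
    qed
    then have "(\<Sum>i<m. ?d i) = 0" by (intro sum.neutral ballI) auto
    then show ?thesis using 3 by simp
  qed
  then show ?thesis using diff by simp
qed

lemma measurable_simple_value [measurable]: "(\<lambda>s. simple_value m p \<xi> s x) \<in> borel_measurable borel"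
  unfolding simple_value_def by measurable

lemma simple_value_bounded: "\<bar>simple_value m p \<xi> s x\<bar> \<le> (\<Sum>k<m. \<bar>\<xi> k x\<bar>)"
  unfolding simple_value_def
  by (rule order_trans[OF sum_abs]) (auto intro!: sum_mono split: split_indicator)

lemma set_integrable_bounded_Icc:
  fixes f :: "real \<Rightarrow> real"
  assumes "set_borel_measurable borel {a..b} f" "\<And>s. s \<in> {a..b} \<Longrightarrow> \<bar>f s\<bar> \<le> B"
  shows "set_integrable lborel {a..b} f"
  unfolding set_integrable_def
proof (rule integrableI_bounded_set)
  show "(\<lambda>x. indicator {a..b} x *\<^sub>R f x) \<in> borel_measurable lborel"
    using assms(1) by (simp add: set_borel_measurable_def)
  show "AE x in lborel. x \<in> {a..b} \<longrightarrow> norm (indicator {a..b} x *\<^sub>R f x) \<le> B"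
    using assms(2) by (intro AE_I2) auto
qed (auto simp: emeasure_lborel_Icc_eq)

lemma set_integrable_simple_value:
  "set_integrable lborel {a..b} (\<lambda>s. (y * simple_value m p \<xi> s x + c)\<^sup>2)"
proof (rule set_integrable_bounded_Icc)
  show "set_borel_measurable borel {a..b} (\<lambda>s. (y * simple_value m p \<xi> s x + c)\<^sup>2)"
    unfolding set_borel_measurable_def by measurable
  fix s
  have "\<bar>y * simple_value m p \<xi> s x + c\<bar> \<le> \<bar>y\<bar> * (\<Sum>k<m. \<bar>\<xi> k x\<bar>) + \<bar>c\<bar>"
    using mult_left_mono[OF simple_value_bounded[of m p \<xi> s x], of "\<bar>y\<bar>"] by (simp add: abs_mult[symmetric])
  then have "\<bar>y * simple_value m p \<xi> s x + c\<bar>\<^sup>2 \<le> (\<bar>y\<bar> * (\<Sum>k<m. \<bar>\<xi> k x\<bar>) + \<bar>c\<bar>)\<^sup>2"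
    by (rule power_mono) simp
  then show "\<bar>(y * simple_value m p \<xi> s x + c)\<^sup>2\<bar> \<le> (\<bar>y\<bar> * (\<Sum>k<m. \<bar>\<xi> k x\<bar>) + \<bar>c\<bar>)\<^sup>2"
    by simp
qed

lemma set_integral_simple_step:
  assumes p: "\<And>k. k < m \<Longrightarrow> p k \<le> p (Suc k)" and st: "simple_step m p \<xi> t t' v" and t: "a \<le> t" "t \<le> t'"
  shows "(LBINT s:{a..t'}. (y * simple_value m p \<xi> s x + c)\<^sup>2)
    = (LBINT s:{a..t}. (y * simple_value m p \<xi> s x + c)\<^sup>2) + (y * v x + c)\<^sup>2 * (t' - t)"
proof -
  let ?f = "\<lambda>s. (y * simple_value m p \<xi> s x + c)\<^sup>2"
  have i: "set_integrable lborel {a..t'} ?f" by (rule set_integrable_simple_value)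
  have "(LBINT s:{a..t'}. ?f s) = (LBINT s:{a..t}\<union>{t<..t'}. ?f s)"
    using t by (simp add: ivl_disj_un)
  also have "\<dots> = (LBINT s:{a..t}. ?f s) + (LBINT s:{t<..t'}. ?f s)"
    using t by (intro set_integral_Un set_integrable_subset[OF i]) auto
  also have "(LBINT s:{t<..t'}. ?f s) = (LBINT s:{t<..t'}. (y * v x + c)\<^sup>2)"
    by (intro set_lebesgue_integral_cong) (auto simp: simple_value_step[OF p st])
  also have "\<dots> = (y * v x + c)\<^sup>2 * (t' - t)"
    using t by (subst set_integral_const) auto
  finally show ?thesis .
qed

context brownian
begin

text \<open>During one step the combined integrand \<open>y * v + c\<close> is known at
  \<open>t\<close>, and \<open>\<Phi>\<close> gains exactly the factor treated in
  \<open>nn_integral_exp_increment_le\<close>. The separate weights, \<open>y\<close> on the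
  integral and \<open>c\<close> on the Brownian motion, later allow the two to be played against
  each other.\<close>

lemma simple_exponential_step:
  fixes G y c :: "'a \<Rightarrow> real"
  assumes p: "\<And>k. k < m \<Longrightarrow> p k \<le> p (Suc k)" and st: "simple_step m p \<xi> t t' v"
    and t: "0 \<le> a" "a \<le> t" "t \<le> t'" and v: "v \<in> borel_measurable (F t)"
    and y: "y \<in> borel_measurable (F t)" and c: "c \<in> borel_measurable (F t)"
  defines "\<Phi> \<equiv> \<lambda>t x. G x * exp (y x * (simple_integral \<beta> m p \<xi> t x - simple_integral \<beta> m p \<xi> a x)
      + c x * (\<beta> t x - \<beta> a x) - (LBINT s:{a..t}. (y x * simple_value m p \<xi> s x + c x)\<^sup>2) / 2)"
  assumes \<Phi>: "\<Phi> t \<in> borel_measurable (F t)"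
  shows "\<Phi> t' \<in> borel_measurable (F t')" "(\<integral>\<^sup>+ x. ennreal (\<Phi> t' x) \<partial>M) \<le> (\<integral>\<^sup>+ x. ennreal (\<Phi> t x) \<partial>M)"
proof -
  have eq: "\<Phi> t' x = \<Phi> t x * exp ((y x * v x + c x) * (\<beta> t' x - \<beta> t x) - (y x * v x + c x)\<^sup>2 * (t' - t) / 2)" for x
  proof -
    have e1: "simple_integral \<beta> m p \<xi> t' x = simple_integral \<beta> m p \<xi> t x + v x * (\<beta> t' x - \<beta> t x)"
      by (rule simple_integral_step[OF p st t(3)])
    have e2: "(LBINT s:{a..t'}. (y x * simple_value m p \<xi> s x + c x)\<^sup>2)
        = (LBINT s:{a..t}. (y x * simple_value m p \<xi> s x + c x)\<^sup>2) + (y x * v x + c x)\<^sup>2 * (t' - t)"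
      by (rule set_integral_simple_step[OF p st t(2,3)])
    show ?thesis
      unfolding \<Phi>_def e1 e2 mult.assoc[of "G x"] exp_add[symmetric]
      by (rule arg_cong[where f="\<lambda>u. G x * exp u"]) (simp add: field_simps)
  qed
  have w: "(\<lambda>x. y x * v x + c x) \<in> borel_measurable (F t)"
    using v y c by measurable
  note [measurable] = measurable_F_mono[OF t(3) \<Phi>] measurable_F_mono[OF t(3) w]
  have [measurable]: "\<beta> t' \<in> borel_measurable (F t')" "\<beta> t \<in> borel_measurable (F t')"
    using t by (auto intro: measurable_bm_F)
  show "\<Phi> t' \<in> borel_measurable (F t')"
    unfolding eq[abs_def] by measurable
  show "(\<integral>\<^sup>+ x. ennreal (\<Phi> t' x) \<partial>M) \<le> (\<integral>\<^sup>+ x. ennreal (\<Phi> t x) \<partial>M)"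
    unfolding eq using t by (intro nn_integral_exp_increment_le[OF \<Phi> w]) auto
qed

lemma simple_exponential:
  assumes si: "simple_integrand (completion M) F m p \<xi>" and ab: "0 \<le> a" "a \<le> b"
    and [measurable]: "G \<in> borel_measurable (F a)" "y \<in> borel_measurable (F a)" "c \<in> borel_measurable (F a)"
  shows "(\<integral>\<^sup>+ x. ennreal (G x * exp (y x * (simple_integral \<beta> m p \<xi> b x - simple_integral \<beta> m p \<xi> a x)
      + c x * (\<beta> b x - \<beta> a x) - (LBINT s:{a..b}. (y x * simple_value m p \<xi> s x + c x)\<^sup>2) / 2)) \<partial>M)
    \<le> (\<integral>\<^sup>+ x. ennreal (G x) \<partial>M)"
proof -
  have p: "\<And>k. k < m \<Longrightarrow> p k \<le> p (Suc k)" and \<xi>: "\<And>k. k < m \<Longrightarrow> \<xi> k \<in> borel_measurable (F (p k))"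
    using si by (auto simp: simple_integrand_def)
  note mono = partition_mono[of m p, OF p]
  define \<Phi> where "\<Phi> t x = G x * exp (y x * (simple_integral \<beta> m p \<xi> t x - simple_integral \<beta> m p \<xi> a x)
      + c x * (\<beta> t x - \<beta> a x) - (LBINT s:{a..t}. (y x * simple_value m p \<xi> s x + c x)\<^sup>2) / 2)" for t x
  \<comment> \<open>The partition is clamped to the interval and framed by its endpoints:
    \<open>r 0\<close> is \<open>a\<close>, \<open>r (Suc k)\<close> the clamped point
    \<open>p k\<close> for \<open>k \<le> m\<close>, and \<open>r (Suc (Suc m))\<close> is
    \<open>b\<close>. Clamping can create empty cells, which the induction below skips.\<close>
  define r where "r k = (case k of 0 \<Rightarrow> a | Suc k \<Rightarrow> if k \<le> m then max a (min b (p k)) else b)" for k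
  have ra: "a \<le> r k" "r k \<le> b" for k using ab by (auto simp: r_def split: nat.split)
  have ex: "\<exists>v. simple_step m p \<xi> (r k) (r (Suc k)) v \<and> v \<in> borel_measurable (F (r k))"
    if lt: "r k < r (Suc k)" and k: "k \<le> Suc m" for k
  proof (cases k)
    case 0
    then have "r (Suc k) \<le> p 0" using lt by (auto simp: r_def split: if_splits)
    then show ?thesis by (intro exI[of _ "\<lambda>_. 0"]) (auto simp: simple_step_def)
  next
    case (Suc j)
    show ?thesis
    proof (cases "j = m")
      case True
      then have "p m \<le> r k" using lt Suc by (auto simp: r_def)
      then show ?thesis by (intro exI[of _ "\<lambda>_. 0"]) (auto simp: simple_step_def)
    next
      case False
      with k Suc have j: "j < m" by simp
      then have "p j \<le> r k" "r (Suc k) \<le> p (Suc j)" using lt Suc by (auto simp: r_def)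
      then show ?thesis using j by (intro exI[of _ "\<xi> j"]) (auto simp: simple_step_def intro: measurable_F_mono[OF _ \<xi>])
    qed
  qed
  have r_mono: "r k \<le> r (Suc k)" if "k \<le> Suc m" for k
  proof (cases k)
    case 0
    then show ?thesis using ra(1)[of "Suc k"] by (simp add: r_def)
  next
    case (Suc j)
    then show ?thesis using that p[of j] ab by (auto simp: r_def)
  qed
  have "\<Phi> (r k) \<in> borel_measurable (F (r k)) \<and> (\<integral>\<^sup>+ x. ennreal (\<Phi> (r k) x) \<partial>M) \<le> (\<integral>\<^sup>+ x. ennreal (G x) \<partial>M)"
    if "k \<le> Suc (Suc m)" for k
    using that
  proof (induction k)
    case 0
    have "(LBINT s:{a..a}. (y x * simple_value m p \<xi> s x + c x)\<^sup>2) = 0" for x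
    proof -
      have "AE s in lborel. indicator {a..a} s *\<^sub>R (y x * simple_value m p \<xi> s x + c x)\<^sup>2 = 0"
        using AE_lborel_singleton[of a] by eventually_elim auto
      then show ?thesis
        unfolding set_lebesgue_integral_def by (rule integral_eq_zero_AE)
    qed
    then have "\<Phi> a x = G x" for x by (simp add: \<Phi>_def)
    then have "\<Phi> a = G" by (intro ext)
    then show ?case by (simp add: r_def)
  next
    case (Suc k)
    show ?case
    proof (cases "r k = r (Suc k)")
      case False
      with r_mono[of k] Suc.prems have "r k < r (Suc k)" by simp
      from ex[OF this] Suc.prems obtain v where v: "simple_step m p \<xi> (r k) (r (Suc k)) v" "v \<in> borel_measurable (F (r k))"
        by auto
      have ym: "y \<in> borel_measurable (F (r k))" "c \<in> borel_measurable (F (r k))"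
        by (rule measurable_F_mono[OF ra(1)], measurable)+
      note st = simple_exponential_step[where G=G, OF p v(1) ab(1) ra(1) r_mono v(2) ym, folded \<Phi>_def]
      from Suc.IH Suc.prems have IH: "\<Phi> (r k) \<in> borel_measurable (F (r k))"
        "(\<integral>\<^sup>+ x. ennreal (\<Phi> (r k) x) \<partial>M) \<le> (\<integral>\<^sup>+ x. ennreal (G x) \<partial>M)" by auto
      show ?thesis using st[OF _ _ IH(1)] Suc.prems order_trans[OF _ IH(2)] by simp
    qed (use Suc in simp)
  qed
  from this[of "Suc (Suc m)"] show ?thesis by (simp add: r_def \<Phi>_def)
qed

end

section \<open>Passage from simple integrals to the Ito integral\<close>

lemma (in prob_space) tendsto_in_prob_L1:
  assumes lim: "tendsto_in_prob M Y L"
    and [measurable]: "\<And>k. Y k \<in> borel_measurable M" "L \<in> borel_measurable M"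
  shows "(\<lambda>k. \<integral>x. min 1 \<bar>Y k x - L x\<bar> \<partial>M) \<longlonglongrightarrow> 0"
proof (rule LIMSEQ_I)
  fix e :: real assume "0 < e"
  then have "(\<lambda>k. measure M {x\<in>space M. e / 2 < \<bar>Y k x - L x\<bar>}) \<longlonglongrightarrow> 0"
    by (intro lim[unfolded tendsto_in_prob_def, rule_format]) simp
  from LIMSEQ_D[OF this, of "e / 2"] \<open>0 < e\<close> obtain k0 where
    k0: "\<And>k. k \<ge> k0 \<Longrightarrow> measure M {x\<in>space M. e / 2 < \<bar>Y k x - L x\<bar>} < e / 2" by auto
  have "norm ((\<integral>x. min 1 \<bar>Y k x - L x\<bar> \<partial>M) - 0) < e" if "k \<ge> k0" for k
  proof -
    let ?B = "{x\<in>space M. e / 2 < \<bar>Y k x - L x\<bar>}"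
    have int: "integrable M (\<lambda>x. min 1 \<bar>Y k x - L x\<bar>)"
      by (rule integrable_const_bound[of _ 1]) auto
    have Bm: "?B \<in> sets M" by measurable
    have iB: "integrable M (indicator ?B :: 'a \<Rightarrow> real)"
      using Bm by (simp add: emeasure_eq_measure)
    then have int': "integrable M (\<lambda>x. e / 2 + indicator ?B x :: real)" by simp
    have "(\<integral>x. min 1 \<bar>Y k x - L x\<bar> \<partial>M) \<le> (\<integral>x. e / 2 + indicator ?B x \<partial>M)"
    proof (rule integral_mono[OF int int'])
      fix x assume "x \<in> space M"
      then show "min 1 \<bar>Y k x - L x\<bar> \<le> e / 2 + indicator ?B x"
        using \<open>0 < e\<close> by (cases "x \<in> ?B") (auto simp: min_def)
    qed
    also have "\<dots> = e / 2 + measure M ?B"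
      using iB by (simp add: prob_space)
    also have "\<dots> < e" using k0[OF that] by simp
    finally show ?thesis by simp
  qed
  then show "\<exists>k0. \<forall>k\<ge>k0. norm ((\<integral>x. min 1 \<bar>Y k x - L x\<bar> \<partial>M) - 0) < e" by blast
qed

lemma tendsto_min_one_abs_iff:
  fixes f :: "nat \<Rightarrow> real"
  assumes "(\<lambda>k. min 1 \<bar>f k - l\<bar>) \<longlonglongrightarrow> 0"
  shows "f \<longlonglongrightarrow> l"
proof (rule LIMSEQ_I)
  fix e :: real assume "0 < e"
  then obtain k0 where k0: "\<And>k. k \<ge> k0 \<Longrightarrow> norm (min 1 \<bar>f k - l\<bar> - 0) < min 1 e"
    using LIMSEQ_D[OF assms, of "min 1 e"] by auto
  have "norm (f k - l) < e" if "k \<ge> k0" for k using k0[OF that] by (auto split: if_splits simp: min_def)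
  then show "\<exists>k0. \<forall>k\<ge>k0. norm (f k - l) < e" by blast
qed

text \<open>Truncated differences turn convergence in probability into convergence in mean.
  Extracting an almost surely convergent subsequence from the sum of the three differences makes one
  subsequence serve all three limits.\<close>

lemma (in prob_space) tendsto_in_prob3_subseq:
  assumes "tendsto_in_prob M Y1 L1" "tendsto_in_prob M Y2 L2" "tendsto_in_prob M Y3 L3"
    and [measurable]: "\<And>k. Y1 k \<in> borel_measurable M" "L1 \<in> borel_measurable M"
      "\<And>k. Y2 k \<in> borel_measurable M" "L2 \<in> borel_measurable M"
      "\<And>k. Y3 k \<in> borel_measurable M" "L3 \<in> borel_measurable M"
  shows "\<exists>r :: nat \<Rightarrow> nat. strict_mono r \<and> (AE x in M. (\<lambda>k. Y1 (r k) x) \<longlonglongrightarrow> L1 x \<and>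
    (\<lambda>k. Y2 (r k) x) \<longlonglongrightarrow> L2 x \<and> (\<lambda>k. Y3 (r k) x) \<longlonglongrightarrow> L3 x)"
proof -
  define u where "u k x = min 1 \<bar>Y1 k x - L1 x\<bar> + min 1 \<bar>Y2 k x - L2 x\<bar> + min 1 \<bar>Y3 k x - L3 x\<bar>" for k x
  have int: "integrable M (\<lambda>x. min 1 \<bar>Y1 k x - L1 x\<bar>)" "integrable M (\<lambda>x. min 1 \<bar>Y2 k x - L2 x\<bar>)"
    "integrable M (\<lambda>x. min 1 \<bar>Y3 k x - L3 x\<bar>)" for k
    by (rule integrable_const_bound[of _ 1]; simp)+
  have "(\<lambda>k. (\<integral>x. min 1 \<bar>Y1 k x - L1 x\<bar> \<partial>M) + (\<integral>x. min 1 \<bar>Y2 k x - L2 x\<bar> \<partial>M) + (\<integral>x. min 1 \<bar>Y3 k x - L3 x\<bar> \<partial>M)) \<longlonglongrightarrow> 0 + 0 + 0"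
    by (intro tendsto_add tendsto_in_prob_L1 assms)
  moreover have "(\<integral>x. norm (u k x) \<partial>M) = (\<integral>x. min 1 \<bar>Y1 k x - L1 x\<bar> \<partial>M) + (\<integral>x. min 1 \<bar>Y2 k x - L2 x\<bar> \<partial>M) + (\<integral>x. min 1 \<bar>Y3 k x - L3 x\<bar> \<partial>M)" for k
  proof -
    have "norm (u k x) = u k x" for x by (simp add: u_def)
    then show ?thesis using int by (simp add: u_def)
  qed
  ultimately have "(\<lambda>k. \<integral>x. norm (u k x) \<partial>M) \<longlonglongrightarrow> 0" by simp
  moreover have "integrable M (u k)" for k unfolding u_def using int by simp
  ultimately obtain r :: "nat \<Rightarrow> nat" where r: "strict_mono r" "AE x in M. (\<lambda>k. u (r k) x) \<longlonglongrightarrow> 0"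
    using tendsto_L1_AE_subseq[of M u] by auto
  from r(2) have "AE x in M. (\<lambda>k. Y1 (r k) x) \<longlonglongrightarrow> L1 x \<and>
    (\<lambda>k. Y2 (r k) x) \<longlonglongrightarrow> L2 x \<and> (\<lambda>k. Y3 (r k) x) \<longlonglongrightarrow> L3 x"
  proof eventually_elim
    case (elim x)
    have "(\<lambda>k. min 1 \<bar>Y1 (r k) x - L1 x\<bar>) \<longlonglongrightarrow> 0" "(\<lambda>k. min 1 \<bar>Y2 (r k) x - L2 x\<bar>) \<longlonglongrightarrow> 0"
      "(\<lambda>k. min 1 \<bar>Y3 (r k) x - L3 x\<bar>) \<longlonglongrightarrow> 0"
      by (rule tendsto_sandwich[OF _ _ tendsto_const elim]; simp add: u_def)+
    then show ?case by (blast intro: tendsto_min_one_abs_iff)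
  qed
  with r(1) show ?thesis by blast
qed

text \<open>Turns \<open>L\<^sup>2\<close> approximation into a one-sided comparison of the quadratic terms, which is all that Fatou's lemma needs.\<close>

lemma square_sum_le:
  fixes u d e :: real
  assumes "0 < e"
  shows "(u + d)\<^sup>2 \<le> (1 + e) * u\<^sup>2 + (1 + 1 / e) * d\<^sup>2"
proof -
  have "0 \<le> (e * u - d)\<^sup>2 / e" using assms by simp
  also have "(e * u - d)\<^sup>2 / e = e * u\<^sup>2 - 2 * u * d + d\<^sup>2 / e"
    using assms by (simp add: power2_eq_square field_simps)
  finally show ?thesis by (simp add: power2_eq_square algebra_simps)
qed

lemma grid_time_tendsto:
  fixes s :: real
  assumes "0 \<le> s"
  shows "(\<lambda>k. real (nat \<lfloor>s * real (Suc k)\<rfloor>) / real (Suc k)) \<longlonglongrightarrow> s"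
proof (rule tendsto_sandwich[OF _ _ _ tendsto_const])
  show "\<forall>\<^sub>F k in sequentially. real (nat \<lfloor>s * real (Suc k)\<rfloor>) / real (Suc k) \<le> s"
    using assms by (intro always_eventually allI) (simp add: divide_le_eq)
  show "\<forall>\<^sub>F k in sequentially. s - 1 / real (Suc k) \<le> real (nat \<lfloor>s * real (Suc k)\<rfloor>) / real (Suc k)"
  proof (intro always_eventually allI)
    fix k
    have "s * real (Suc k) - 1 \<le> real (nat \<lfloor>s * real (Suc k)\<rfloor>)"
      using assms by linarith
    then have "(s * real (Suc k) - 1) / real (Suc k) \<le> real (nat \<lfloor>s * real (Suc k)\<rfloor>) / real (Suc k)"
      by (rule divide_right_mono) simp
    then show "s - 1 / real (Suc k) \<le> real (nat \<lfloor>s * real (Suc k)\<rfloor>) / real (Suc k)"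
      by (simp add: diff_divide_distrib)
  qed
  show "(\<lambda>k. s - 1 / real (Suc k)) \<longlonglongrightarrow> s" by real_asymp
qed

text \<open>By continuity in time the process is a limit of step functions on grids
  \<open>j / Suc k\<close>, each measurable by a countable case distinction. The
  \<open>max 0 s\<close> extends it to negative times, where nothing is known about
  \<open>H\<close>.\<close>

lemma jointly_measurable_continuous:
  assumes H: "\<And>t. 0 \<le> t \<Longrightarrow> H t \<in> borel_measurable M" and cont: "continuous_paths M H"
  shows "(\<lambda>(x, s). H (max 0 s) x :: real) \<in> borel_measurable (M \<Otimes>\<^sub>M borel)"
proof (rule borel_measurable_LIMSEQ_real)
  fix k
  have "(\<lambda>(x, s). H (real (nat \<lfloor>max 0 s * real (Suc k)\<rfloor>) / real (Suc k)) x)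
    \<in> borel_measurable (M \<Otimes>\<^sub>M borel)"
  proof -
    let ?j = "\<lambda>q :: 'a \<times> real. nat \<lfloor>max 0 (snd q) * real (Suc k)\<rfloor>"
    have 1: "?j \<in> measurable (M \<Otimes>\<^sub>M borel) (count_space UNIV)"
      by measurable
    have 2: "(\<lambda>q. H (real j / real (Suc k)) (fst q)) \<in> borel_measurable (M \<Otimes>\<^sub>M (borel :: real measure))" for j :: nat
      using H[of "real j / real (Suc k)"] by measurable
    show ?thesis
      using measurable_compose_countable[OF 2 1] by (simp only: split_beta')
  qed
  then show "(\<lambda>q. (\<lambda>(x, s). H (real (nat \<lfloor>max 0 s * real (Suc k)\<rfloor>) / real (Suc k)) x) q)
    \<in> borel_measurable (M \<Otimes>\<^sub>M borel)" .
next
  fix q assume "q \<in> space (M \<Otimes>\<^sub>M (borel :: real measure))"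
  then obtain x s where q: "q = (x, s)" "x \<in> space M" by (auto simp: space_pair_measure)
  have "continuous_on {0..} (\<lambda>t. H t x)" using cont q by (simp add: continuous_paths_def)
  then have "(\<lambda>k. H (real (nat \<lfloor>max 0 s * real (Suc k)\<rfloor>) / real (Suc k)) x) \<longlonglongrightarrow> H (max 0 s) x"
    by (rule continuous_on_tendsto_compose[OF _ grid_time_tendsto]) auto
  then show "(\<lambda>k. (\<lambda>(x, s). H (real (nat \<lfloor>max 0 s * real (Suc k)\<rfloor>) / real (Suc k)) x) q)
    \<longlonglongrightarrow> (\<lambda>(x, s). H (max 0 s) x) q" by (simp add: q)
qed


context brownian
begin

context
  fixes H J :: "real \<Rightarrow> 'a \<Rightarrow> real"
  assumes ito: "ito_integral (completion M) F \<beta> H J"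
begin

text \<open>Fatou's lemma along a subsequence on which the simple integrals converge almost surely.
  Their quadratic terms \<open>U k\<close> need not be shown to converge: an upper bound
  \<open>Q k\<close> that tends to the quadratic term \<open>V\<close> of \<open>H\<close> makes the
  exponentials large enough.\<close>

lemma ito_exponential_le:
  assumes ab: "0 \<le> a" "a \<le> b"
    and G: "G \<in> borel_measurable (F a)" and y: "y \<in> borel_measurable (F a)" and c: "c \<in> borel_measurable (F a)"
  shows "(\<integral>\<^sup>+ x. ennreal (G x * exp (y x * (J b x - J a x) + c x * (\<beta> b x - \<beta> a x)
      - (LBINT s:{a..b}. (y x * H s x + c x)\<^sup>2) / 2)) \<partial>M) \<le> (\<integral>\<^sup>+ x. ennreal (G x) \<partial>M)"
proof -
  have H: "H t \<in> borel_measurable (F t)" and J: "J t \<in> borel_measurable (F t)" if "0 \<le> t" for t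
    using ito that by (auto simp: ito_integral_def adapted_def)
  have HC: "H t \<in> borel_measurable (completion M)" and JC [measurable]: "J t \<in> borel_measurable (completion M)" if "0 \<le> t" for t
    using H[OF that] J[OF that] by (auto intro: measurable_F_completion)
  have contH: "continuous_paths (completion M) H"
    using ito by (simp add: ito_integral_def)
  obtain m p \<xi> where si: "\<And>j :: nat. simple_integrand (completion M) F (m j) (p j) (\<xi> j)"
    and limD: "\<And>t. 0 \<le> t \<Longrightarrow> tendsto_in_prob (completion M)
             (\<lambda>j x. LBINT s:{0..t}. (simple_value (m j) (p j) (\<xi> j) s x - H s x)\<^sup>2) (\<lambda>x. 0)"
    and limS: "\<And>t. 0 \<le> t \<Longrightarrow> tendsto_in_prob (completion M)
             (\<lambda>j x. simple_integral \<beta> (m j) (p j) (\<xi> j) t x) (J t)"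
    using ito unfolding ito_integral_def by blast
  have p0: "0 \<le> p j 0" and p: "k < m j \<Longrightarrow> p j k \<le> p j (Suc k)" for j k
    using si[of j] by (auto simp: simple_integrand_def)
  have p_nonneg: "0 \<le> p j k" if "k \<le> m j" for j k
    using partition_mono[of "m j" "p j" 0 k, OF p] p0[of j] that by simp
  have \<xi>C [measurable]: "\<xi> j k \<in> borel_measurable (completion M)" if "k < m j" for j k
    using si[of j] that by (auto simp: simple_integrand_def intro: measurable_F_completion)
  define D where "D j x = (LBINT s:{0..b}. (simple_value (m j) (p j) (\<xi> j) s x - H s x)\<^sup>2)" for j x
  have Dmeas: "D j \<in> borel_measurable (completion M)" for j
  proof -
    have [measurable]: "(\<lambda>(x, s). H (max 0 s) x) \<in> borel_measurable (completion M \<Otimes>\<^sub>M borel)"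
      by (rule jointly_measurable_continuous[OF HC contH])
    have sv: "(\<lambda>(x, s). simple_value (m j) (p j) (\<xi> j) s x) \<in> borel_measurable (completion M \<Otimes>\<^sub>M borel)"
      unfolding simple_value_def split_beta'
    proof (rule borel_measurable_sum)
      fix k assume "k \<in> {..<m j}"
      then have [measurable]: "\<xi> j k \<in> borel_measurable (completion M)" using \<xi>C by simp
      show "(\<lambda>q. \<xi> j k (fst q) * indicator {p j k<..p j (Suc k)} (snd q)) \<in> borel_measurable (completion M \<Otimes>\<^sub>M borel)"
        by measurable
    qed
    note sv [measurable]
    have "(\<lambda>x. \<integral>s. indicator {0..b} s *\<^sub>R (simple_value (m j) (p j) (\<xi> j) s x - H (max 0 s) x)\<^sup>2 \<partial>lborel) \<in> borel_measurable (completion M)"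
      by measurable
    also have "(\<lambda>x. \<integral>s. indicator {0..b} s *\<^sub>R (simple_value (m j) (p j) (\<xi> j) s x - H (max 0 s) x)\<^sup>2 \<partial>lborel) = D j"
      unfolding D_def set_lebesgue_integral_def
      by (intro ext Bochner_Integration.integral_cong) (auto split: split_indicator)
    finally show ?thesis .
  qed
  have Smeas: "simple_integral \<beta> (m j) (p j) (\<xi> j) t \<in> borel_measurable (completion M)" if t: "0 \<le> t" for j t
    unfolding simple_integral_def[abs_def]
  proof (rule borel_measurable_sum)
    fix k assume k: "k \<in> {..<m j}"
    then have [measurable]: "\<xi> j k \<in> borel_measurable (completion M)" using \<xi>C by simp
    have [measurable]: "\<beta> (min t (p j (Suc k))) \<in> borel_measurable (completion M)" "\<beta> (min t (p j k)) \<in> borel_measurable (completion M)"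
      using k t p_nonneg[of k j] p_nonneg[of "Suc k" j] by (auto intro!: measurable_completion)
    show "(\<lambda>x. \<xi> j k x * (\<beta> (min t (p j (Suc k))) x - \<beta> (min t (p j k)) x)) \<in> borel_measurable (completion M)"
      by measurable
  qed
  have b: "0 \<le> b" using ab by simp
  obtain r :: "nat \<Rightarrow> nat" where r: "AE x in completion M. (\<lambda>k. D (r k) x) \<longlonglongrightarrow> 0 \<and>
    (\<lambda>k. simple_integral \<beta> (m (r k)) (p (r k)) (\<xi> (r k)) a x) \<longlonglongrightarrow> J a x \<and>
    (\<lambda>k. simple_integral \<beta> (m (r k)) (p (r k)) (\<xi> (r k)) b x) \<longlonglongrightarrow> J b x"
    using C.tendsto_in_prob3_subseq[OF limD[OF b, folded D_def] limS[OF ab(1)] limS[OF b] Dmeas _ Smeas[OF ab(1)] JC[OF ab(1)] Smeas[OF b] JC[OF b]]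
    by auto
  define V where "V x = (LBINT s:{a..b}. (y x * H s x + c x)\<^sup>2)" for x
  \<comment> \<open>The summand \<open>1 / (real k + 1)\<close> keeps \<open>E\<close> positive, so
    that \<open>sqrt (E k x)\<close> can serve as the parameter of \<open>square_sum_le\<close>.
    With this choice the factor of \<open>V\<close> tends to 1, and the error, of order
    \<open>E + sqrt E\<close>, tends to 0.\<close>
  define E where "E k x = D (r k) x + 1 / (real k + 1)" for k x
  define Q where "Q k x = (1 + sqrt (E k x)) * V x + (y x)\<^sup>2 * (E k x + sqrt (E k x))" for k x
  define U where "U k x = (LBINT s:{a..b}. (y x * simple_value (m (r k)) (p (r k)) (\<xi> (r k)) s x + c x)\<^sup>2)" for k x
  have UQ: "U k x \<le> Q k x" if x: "x \<in> space M" for k x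
  proof -
    let ?f = "\<lambda>s. simple_value (m (r k)) (p (r k)) (\<xi> (r k)) s x"
    have cH: "continuous_on {0..b} (\<lambda>s. H s x)"
      using contH x by (auto simp: continuous_paths_def intro: continuous_on_subset)
    have iH: "set_integrable lborel {a..b} (\<lambda>s. (y x * H s x + c x)\<^sup>2)"
      by (rule borel_integrable_atLeastAtMost') (intro continuous_intros continuous_on_subset[OF cH], use ab in auto)
    have iD: "set_integrable lborel {0..b} (\<lambda>s. (?f s - H s x)\<^sup>2)"
    proof -
      obtain B where B: "\<And>s. s \<in> {0..b} \<Longrightarrow> \<bar>H s x\<bar> \<le> B"
        using compact_imp_bounded[OF compact_continuous_image[OF cH]] unfolding bounded_iff by force
      have hm: "(\<lambda>s. indicator {0..b} s *\<^sub>R H s x) \<in> borel_measurable borel"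
        by (rule borel_measurable_continuous_on_indicator[OF _ cH]) simp
      show ?thesis
      proof (rule set_integrable_bounded_Icc)
        have "(\<lambda>s. indicator {0..b} s *\<^sub>R (?f s - indicator {0..b} s *\<^sub>R H s x)\<^sup>2) \<in> borel_measurable borel"
          using hm by measurable
        also have "(\<lambda>s. indicator {0..b} s *\<^sub>R (?f s - indicator {0..b} s *\<^sub>R H s x)\<^sup>2) = (\<lambda>s. indicator {0..b} s *\<^sub>R (?f s - H s x)\<^sup>2)"
          by (auto split: split_indicator)
        finally show "set_borel_measurable borel {0..b} (\<lambda>s. (?f s - H s x)\<^sup>2)"
          by (simp add: set_borel_measurable_def)
        fix s assume "s \<in> {0..b}"
        then have "\<bar>?f s - H s x\<bar> \<le> (\<Sum>i<m (r k). \<bar>\<xi> (r k) i x\<bar>) + B"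
          using simple_value_bounded[of "m (r k)" "p (r k)" "\<xi> (r k)" s x] B[of s] by linarith
        then have "\<bar>?f s - H s x\<bar>\<^sup>2 \<le> ((\<Sum>i<m (r k). \<bar>\<xi> (r k) i x\<bar>) + B)\<^sup>2"
          by (rule power_mono) simp
        then show "\<bar>(?f s - H s x)\<^sup>2\<bar> \<le> ((\<Sum>i<m (r k). \<bar>\<xi> (r k) i x\<bar>) + B)\<^sup>2" by simp
      qed
    qed
    have iD': "set_integrable lborel {a..b} (\<lambda>s. (?f s - H s x)\<^sup>2)"
      by (rule set_integrable_subset[OF iD]) (use ab in auto)
    have D0: "0 \<le> D (r k) x" unfolding D_def set_lebesgue_integral_def by (intro integral_nonneg_AE) auto
    have E0: "0 < E k x" using D0 by (simp add: E_def add_nonneg_pos)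
    let ?e = "sqrt (E k x)"
    have e0: "0 < ?e" using E0 by simp
    have DE: "D (r k) x \<le> E k x" by (simp add: E_def)
    have "U k x \<le> (LBINT s:{a..b}. (1 + ?e) * (y x * H s x + c x)\<^sup>2 + (1 + 1 / ?e) * ((y x)\<^sup>2 * (?f s - H s x)\<^sup>2))"
      unfolding U_def
    proof (rule set_integral_mono)
      show "set_integrable lborel {a..b} (\<lambda>s. (y x * ?f s + c x)\<^sup>2)" by (rule set_integrable_simple_value)
      show "set_integrable lborel {a..b} (\<lambda>s. (1 + ?e) * (y x * H s x + c x)\<^sup>2 + (1 + 1 / ?e) * ((y x)\<^sup>2 * (?f s - H s x)\<^sup>2))"
        using iH iD' by (intro set_integral_add set_integrable_mult_right) auto
      fix s
      have eq: "y x * ?f s + c x = (y x * H s x + c x) + y x * (?f s - H s x)" by (simp add: algebra_simps)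
      show "(y x * ?f s + c x)\<^sup>2 \<le> (1 + ?e) * (y x * H s x + c x)\<^sup>2 + (1 + 1 / ?e) * ((y x)\<^sup>2 * (?f s - H s x)\<^sup>2)"
        unfolding eq using square_sum_le[OF e0, of "y x * H s x + c x" "y x * (?f s - H s x)"] by (simp add: power_mult_distrib)
    qed
    also have "\<dots> = (1 + ?e) * V x + (1 + 1 / ?e) * ((y x)\<^sup>2 * (LBINT s:{a..b}. (?f s - H s x)\<^sup>2))"
      using iH iD' by (subst set_integral_add) (auto simp: V_def intro!: set_integrable_mult_right)
    also have "\<dots> \<le> (1 + ?e) * V x + (1 + 1 / ?e) * ((y x)\<^sup>2 * E k x)"
    proof -
      have "(LBINT s:{a..b}. (?f s - H s x)\<^sup>2) \<le> D (r k) x"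
        unfolding D_def set_lebesgue_integral_def
        by (rule integral_mono) (use ab iD iD' in \<open>auto simp: set_integrable_def split: split_indicator\<close>)
      then have "(LBINT s:{a..b}. (?f s - H s x)\<^sup>2) \<le> E k x" using DE by simp
      then show ?thesis using e0 by (intro add_left_mono mult_left_mono) auto
    qed
    also have "(1 + 1 / ?e) * ((y x)\<^sup>2 * E k x) = (y x)\<^sup>2 * (E k x + ?e)"
    proof -
      have "E k x = ?e * ?e" using E0 by simp
      moreover have "(1 + 1 / e) * (q * (e * e)) = q * (e * e + e)" if "0 < e" for e q :: real
        using that by (simp add: field_simps)
      ultimately show ?thesis using e0 by metis
    qed
    finally show ?thesis by (simp add: Q_def)
  qed
  define S where "S k x = y x * (simple_integral \<beta> (m (r k)) (p (r k)) (\<xi> (r k)) b x - simple_integral \<beta> (m (r k)) (p (r k)) (\<xi> (r k)) a x) + c x * (\<beta> b x - \<beta> a x)" for k x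
  define T where "T x = y x * (J b x - J a x) + c x * (\<beta> b x - \<beta> a x)" for x
  have "(\<integral>\<^sup>+ x. ennreal (G x * exp (T x - V x / 2)) \<partial>M)
    \<le> (\<integral>\<^sup>+ x. liminf (\<lambda>k. ennreal (G x * exp (S k x - U k x / 2))) \<partial>completion M)"
    unfolding nn_integral_completion[symmetric, of M "\<lambda>x. ennreal (G x * exp (T x - V x / 2))"]
  proof (rule nn_integral_mono_AE)
    show "AE x in completion M. ennreal (G x * exp (T x - V x / 2)) \<le> liminf (\<lambda>k. ennreal (G x * exp (S k x - U k x / 2)))"
      using r AE_space
    proof eventually_elim
      case (elim x)
      have "(\<lambda>k. E k x) \<longlonglongrightarrow> 0 + 0"
        unfolding E_def using elim by (intro tendsto_add) (auto, real_asymp)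
      then have E: "(\<lambda>k. E k x) \<longlonglongrightarrow> 0" by simp
      have "(\<lambda>k. Q k x) \<longlonglongrightarrow> (1 + sqrt 0) * V x + (y x)\<^sup>2 * (0 + sqrt 0)"
        unfolding Q_def by (intro tendsto_intros E)
      then have Q: "(\<lambda>k. Q k x) \<longlonglongrightarrow> V x" by simp
      have S: "(\<lambda>k. S k x) \<longlonglongrightarrow> T x"
        unfolding S_def T_def using elim by (intro tendsto_intros) auto
      have "(\<lambda>k. ennreal (G x) * ennreal (exp (S k x - Q k x / 2))) \<longlonglongrightarrow> ennreal (G x) * ennreal (exp (T x - V x / 2))"
        by (intro ennreal_tendsto_cmult tendsto_ennrealI tendsto_intros S Q) auto
      from lim_imp_Liminf[OF _ this]
      have "ennreal (G x) * ennreal (exp (T x - V x / 2)) = liminf (\<lambda>k. ennreal (G x) * ennreal (exp (S k x - Q k x / 2)))"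
        by simp
      also have "\<dots> \<le> liminf (\<lambda>k. ennreal (G x) * ennreal (exp (S k x - U k x / 2)))"
        using UQ[of x] elim by (intro Liminf_mono always_eventually allI mult_left_mono ennreal_leI) auto
      finally show ?case by (simp add: ennreal_mult'')
    qed
  qed
  also have "\<dots> \<le> liminf (\<lambda>k. \<integral>\<^sup>+ x. ennreal (G x * exp (S k x - U k x / 2)) \<partial>completion M)"
  proof (rule nn_integral_liminf)
    fix k
    have [measurable]: "G \<in> borel_measurable (completion M)" "y \<in> borel_measurable (completion M)" "c \<in> borel_measurable (completion M)"
      "\<beta> b \<in> borel_measurable (completion M)" "\<beta> a \<in> borel_measurable (completion M)"
      using G y c ab b by (auto intro: measurable_F_completion measurable_completion)
    have sv [measurable]: "(\<lambda>(x, s). simple_value (m (r k)) (p (r k)) (\<xi> (r k)) s x) \<in> borel_measurable (completion M \<Otimes>\<^sub>M borel)"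
      unfolding simple_value_def split_beta'
    proof (rule borel_measurable_sum)
      fix i assume "i \<in> {..<m (r k)}"
      then have [measurable]: "\<xi> (r k) i \<in> borel_measurable (completion M)" using \<xi>C by simp
      show "(\<lambda>q. \<xi> (r k) i (fst q) * indicator {p (r k) i<..p (r k) (Suc i)} (snd q)) \<in> borel_measurable (completion M \<Otimes>\<^sub>M borel)"
        by measurable
    qed
    have [measurable]: "U k \<in> borel_measurable (completion M)"
      unfolding U_def[abs_def] set_lebesgue_integral_def by measurable
    have [measurable]: "S k \<in> borel_measurable (completion M)"
      unfolding S_def[abs_def] using Smeas[OF ab(1), of "r k"] Smeas[OF b, of "r k"] by measurable
    show "(\<lambda>x. ennreal (G x * exp (S k x - U k x / 2))) \<in> borel_measurable (completion M)"
      by measurable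
  qed
  also have "\<dots> \<le> liminf (\<lambda>k. \<integral>\<^sup>+ x. ennreal (G x) \<partial>M)"
    unfolding nn_integral_completion S_def U_def
    by (intro Liminf_mono always_eventually allI simple_exponential[OF si ab G y c])
  also have "\<dots> = (\<integral>\<^sup>+ x. ennreal (G x) \<partial>M)"
    by (simp add: Liminf_const)
  finally show ?thesis by (simp add: T_def V_def)
qed

end

end

section \<open>Moments and zeros of BESQ(0)\<close>

lemma set_integral_cells:
  fixes f :: "real \<Rightarrow> real" and g :: "nat \<Rightarrow> real"
  assumes g: "\<And>l. g l \<le> g (Suc l)" and f: "continuous_on {g 0..g L} f"
  shows "(LBINT s:{g 0..g L}. f s) = (\<Sum>l<L. LBINT s:{g l..g (Suc l)}. f s)"
  using f
proof (induction L)
  case 0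
  have "AE s in lborel. indicator {g 0..g 0} s *\<^sub>R f s = 0"
    using AE_lborel_singleton[of "g 0"] by eventually_elim auto
  then have "(LBINT s:{g 0..g 0}. f s) = 0"
    unfolding set_lebesgue_integral_def by (rule integral_eq_zero_AE)
  then show ?case by simp
next
  case (Suc L)
  have m: "g 0 \<le> g L" using g by (rule lift_Suc_mono_le) simp
  have i: "set_integrable lborel {g 0..g (Suc L)} f"
    by (rule borel_integrable_atLeastAtMost') (rule Suc.prems)
  have "(LBINT s:{g 0..g (Suc L)}. f s) = (LBINT s:{g 0..g L} \<union> {g L..g (Suc L)}. f s)"
    using m g[of L] by (simp add: ivl_disj_un_two_touch)
  also have "\<dots> = (LBINT s:{g 0..g L}. f s) + (LBINT s:{g L..g (Suc L)}. f s)"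
  proof (rule set_integral_Un_AE)
    show "AE x in lborel. \<not> (x \<in> {g 0..g L} \<and> x \<in> {g L..g (Suc L)})"
      using AE_lborel_singleton[of "g L"] by eventually_elim auto
  qed (use m g[of L] in \<open>auto intro: set_integrable_subset[OF i]\<close>)
  also have "(LBINT s:{g 0..g L}. f s) = (\<Sum>l<L. LBINT s:{g l..g (Suc l)}. f s)"
    using Suc.prems g[of L] by (intro Suc.IH) (auto elim: continuous_on_subset)
  finally show ?case by simp
qed

lemma uniform_cells:
  fixes f :: "real \<Rightarrow> real"
  assumes t: "0 < t" and f: "continuous_on {0..t} f" and e: "0 < e"
  shows "\<forall>\<^sub>F L in sequentially. \<forall>l<L. \<forall>u\<in>{t * real l / real L..t * real (Suc l) / real L}.
    \<forall>v\<in>{t * real l / real L..t * real (Suc l) / real L}. \<bar>f u - f v\<bar> < e"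
proof -
  have "uniformly_continuous_on {0..t} f"
    using f by (rule compact_uniformly_continuous) simp
  then obtain d where d: "0 < d" "\<And>u v. u \<in> {0..t} \<Longrightarrow> v \<in> {0..t} \<Longrightarrow> dist v u < d \<Longrightarrow> dist (f v) (f u) < e"
    using e unfolding uniformly_continuous_on_def by blast
  have "\<forall>\<^sub>F L in sequentially. t / d < real L"
    by real_asymp
  then show ?thesis
  proof eventually_elim
    case (elim L)
    show ?case
    proof (intro allI impI ballI)
      fix l u v assume l: "l < L" and uv: "u \<in> {t * real l / real L..t * real (Suc l) / real L}" "v \<in> {t * real l / real L..t * real (Suc l) / real L}"
      have L: "0 < real L" using l by simp
      have "0 \<le> t * real l / real L" using t by simp
      moreover have "t * real (Suc l) / real L \<le> t"
        using t l L by (simp add: divide_le_eq)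
      ultimately have r: "u \<in> {0..t}" "v \<in> {0..t}" using uv by auto
      have "t * real (Suc l) / real L - t * real l / real L = t / real L"
        by (simp add: diff_divide_distrib[symmetric] algebra_simps)
      also have "t / real L < d" using elim d L by (simp add: field_simps)
      finally have "dist u v < d" using uv by (auto simp: dist_real_def)
      from d(2)[OF r(2) r(1) this] show "\<bar>f u - f v\<bar> < e" by (simp add: dist_real_def)
    qed
  qed
qed

text \<open>Right endpoints, because the summation by parts in \<open>exponential_moment\<close>
  leaves the values of \<open>X\<close> at the right ends of the cells.\<close>

lemma right_riemann_sum_tendsto:
  fixes f :: "real \<Rightarrow> real"
  assumes t: "0 < t" and f: "continuous_on {0..t} f"
  shows "(\<lambda>L. t / real L * (\<Sum>l<L. f (t * real (Suc l) / real L))) \<longlonglongrightarrow> (LBINT s:{0..t}. f s)"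
proof (rule LIMSEQ_I)
  fix e :: real assume e: "0 < e"
  let ?S = "\<lambda>L. t / real L * (\<Sum>l<L. f (t * real (Suc l) / real L))"
  from uniform_cells[OF t f, of "e / (2 * t)"] e t have
    "\<forall>\<^sub>F L in sequentially. \<forall>l<L. \<forall>u\<in>{t * real l / real L..t * real (Suc l) / real L}.
    \<forall>v\<in>{t * real l / real L..t * real (Suc l) / real L}. \<bar>f u - f v\<bar> < e / (2 * t)" by simp
  then have "\<forall>\<^sub>F L in sequentially. norm (?S L - (LBINT s:{0..t}. f s)) < e"
    using eventually_gt_at_top[of 0]
  proof eventually_elim
    case (elim L)
    define g where "g l = t * real l / real L" for l :: nat
    have gm: "g l \<le> g (Suc l)" for l using t by (simp add: g_def divide_right_mono)
    have g0: "g 0 = 0" "g L = t" using elim by (simp_all add: g_def)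
    have sub: "{g l..g (Suc l)} \<subseteq> {0..t}" if "l < L" for l
      using lift_Suc_mono_le[of g, OF gm, of 0 l] lift_Suc_mono_le[of g, OF gm, of "Suc l" L] that g0 by auto
    have i: "set_integrable lborel {g l..g (Suc l)} f" if "l < L" for l
      by (rule borel_integrable_atLeastAtMost') (rule continuous_on_subset[OF f sub[OF that]])
    have c: "(LBINT s:{g l..g (Suc l)}. a) = t / real L * a" for l and a :: real
      using gm[of l] by (subst set_integral_const) (auto simp: g_def diff_divide_distrib[symmetric] algebra_simps)
    have ic: "set_integrable lborel {g l..g (Suc l)} (\<lambda>_. a)" for l and a :: real
      by (rule borel_integrable_atLeastAtMost') simp
    have cell: "\<bar>t / real L * f (g (Suc l)) - (LBINT s:{g l..g (Suc l)}. f s)\<bar> \<le> t / real L * (e / (2 * t))" if l: "l < L" for l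
    proof -
      have "f (g (Suc l)) - e / (2 * t) \<le> f s \<and> f s \<le> f (g (Suc l)) + e / (2 * t)" if "s \<in> {g l..g (Suc l)}" for s
      proof -
        have "g (Suc l) \<in> {g l..g (Suc l)}" using gm[of l] by simp
        with elim(1) l that have "\<bar>f (g (Suc l)) - f s\<bar> < e / (2 * t)" unfolding g_def by blast
        then show ?thesis by linarith
      qed
      then have "(LBINT s:{g l..g (Suc l)}. f (g (Suc l)) - e / (2 * t)) \<le> (LBINT s:{g l..g (Suc l)}. f s)"
        "(LBINT s:{g l..g (Suc l)}. f s) \<le> (LBINT s:{g l..g (Suc l)}. f (g (Suc l)) + e / (2 * t))"
        by (auto intro!: set_integral_mono i ic l)
      then show ?thesis unfolding c by (simp add: algebra_simps abs_le_iff)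
    qed
    have "?S L - (LBINT s:{0..t}. f s) = (\<Sum>l<L. t / real L * f (g (Suc l)) - (LBINT s:{g l..g (Suc l)}. f s))"
      using set_integral_cells[of g L f, OF gm] f g0 by (simp add: sum_subtractf sum_distrib_left g_def)
    also have "norm \<dots> \<le> (\<Sum>l<L. t / real L * (e / (2 * t)))"
      by (rule sum_norm_le) (use cell in auto)
    also have "\<dots> < e" using elim t e by simp
    finally show ?case .
  qed
  then show "\<exists>L0. \<forall>L\<ge>L0. norm (?S L - (LBINT s:{0..t}. f s)) < e"
    by (simp add: eventually_sequentially)
qed

context brownian
begin

text \<open>Clamping the time at \<open>b\<close> leaves the integral unchanged and yields a
  continuous process all of whose values are \<open>F b\<close>-measurable, to which joint
  measurability applies.\<close>

lemma measurable_F_set_integral: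
  assumes H: "\<And>t. 0 \<le> t \<Longrightarrow> H t \<in> borel_measurable (F t)" and cont: "continuous_paths M H"
    and ab: "0 \<le> a" "a \<le> b" and y: "y \<in> borel_measurable (F b)" and c: "c \<in> borel_measurable (F b)"
  shows "(\<lambda>x. LBINT s:{a..b}. (y x * H s x + c x)\<^sup>2 :: real) \<in> borel_measurable (F b)"
proof -
  have "(\<lambda>(x, s). (\<lambda>t. H (min t b)) (max 0 s) x) \<in> borel_measurable (F b \<Otimes>\<^sub>M borel)"
  proof (rule jointly_measurable_continuous)
    show "H (min t b) \<in> borel_measurable (F b)" if "0 \<le> t" for t
      using that ab by (intro measurable_F_mono[OF _ H]) auto
    show "continuous_paths (F b) (\<lambda>t. H (min t b))"
      unfolding continuous_paths_def
    proof
      fix x assume "x \<in> space (F b)"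
      then have "continuous_on {0..} (\<lambda>t. H t x)" using cont by (simp add: continuous_paths_def)
      then show "continuous_on {0..} (\<lambda>t. H (min t b) x)"
        by (rule continuous_on_compose2) (use ab in \<open>auto intro!: continuous_intros\<close>)
    qed
  qed
  note this[measurable] y [measurable] c [measurable]
  have "(\<lambda>x. \<integral>s. indicator {a..b} s *\<^sub>R (y x * H (min (max 0 s) b) x + c x)\<^sup>2 \<partial>lborel) \<in> borel_measurable (F b)"
    by measurable
  also have "(\<lambda>x. \<integral>s. indicator {a..b} s *\<^sub>R (y x * H (min (max 0 s) b) x + c x)\<^sup>2 \<partial>lborel)
    = (\<lambda>x. LBINT s:{a..b}. (y x * H s x + c x)\<^sup>2)"
    unfolding set_lebesgue_integral_def using ab
    by (intro ext Bochner_Integration.integral_cong) (auto split: split_indicator simp: min_absorb1 max_absorb2)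
  finally show ?thesis .
qed

text \<open>Iteration of \<open>ito_exponential_le\<close> with the product accumulated so far in
  the role of \<open>G\<close>. The weights may be chosen anew at each grid point from what is known
  there; fine grids then imitate weights that vary with time or with the path.\<close>

lemma ito_exponential_grid_le:
  fixes g :: "nat \<Rightarrow> real"
  assumes ito: "ito_integral (completion M) F \<beta> H J"
    and g: "0 \<le> g 0" "\<And>l. g l \<le> g (Suc l)"
    and y: "\<And>l. y l \<in> borel_measurable (F (g l))" and c: "\<And>l. c l \<in> borel_measurable (F (g l))"
  defines "\<Phi> \<equiv> \<lambda>L x. exp (\<Sum>l<L. y l x * (J (g (Suc l)) x - J (g l) x) + c l x * (\<beta> (g (Suc l)) x - \<beta> (g l) x)
      - (LBINT s:{g l..g (Suc l)}. (y l x * H s x + c l x)\<^sup>2) / 2)"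
  shows "\<Phi> L \<in> borel_measurable (F (g L)) \<and> (\<integral>\<^sup>+ x. ennreal (\<Phi> L x) \<partial>M) \<le> 1"
proof (induction L)
  case 0
  show ?case by (simp add: \<Phi>_def emeasure_space_1)
next
  case (Suc L)
  have g0: "0 \<le> g l" for l using lift_Suc_mono_le[of g, OF g(2), of 0 l] g(1) by simp
  have H: "H t \<in> borel_measurable (F t)" and J: "J t \<in> borel_measurable (F t)" if "0 \<le> t" for t
    using ito that by (auto simp: ito_integral_def adapted_def)
  have cH: "continuous_paths M H" using ito by (simp add: ito_integral_def continuous_paths_def)
  have eq: "\<Phi> (Suc L) x = \<Phi> L x * exp (y L x * (J (g (Suc L)) x - J (g L) x) + c L x * (\<beta> (g (Suc L)) x - \<beta> (g L) x)
      - (LBINT s:{g L..g (Suc L)}. (y L x * H s x + c L x)\<^sup>2) / 2)" for x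
    by (simp add: \<Phi>_def exp_add[symmetric])
  have [measurable]: "y L \<in> borel_measurable (F (g (Suc L)))" "c L \<in> borel_measurable (F (g (Suc L)))"
    "\<Phi> L \<in> borel_measurable (F (g (Suc L)))"
    using y[of L] c[of L] Suc.IH by (auto intro: measurable_F_mono[OF g(2)])
  have [measurable]: "J (g (Suc L)) \<in> borel_measurable (F (g (Suc L)))" "J (g L) \<in> borel_measurable (F (g (Suc L)))"
    "\<beta> (g (Suc L)) \<in> borel_measurable (F (g (Suc L)))" "\<beta> (g L) \<in> borel_measurable (F (g (Suc L)))"
    using J[OF g0] measurable_F_mono[OF g(2) J[OF g0]] measurable_bm_F[OF g0] g(2) by auto
  have [measurable]: "(\<lambda>x. LBINT s:{g L..g (Suc L)}. (y L x * H s x + c L x)\<^sup>2) \<in> borel_measurable (F (g (Suc L)))"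
    by (rule measurable_F_set_integral[OF H cH g0 g(2)]) measurable
  have "\<Phi> (Suc L) \<in> borel_measurable (F (g (Suc L)))"
    unfolding eq[abs_def] by measurable
  moreover have "(\<integral>\<^sup>+ x. ennreal (\<Phi> (Suc L) x) \<partial>M) \<le> (\<integral>\<^sup>+ x. ennreal (\<Phi> L x) \<partial>M)"
    unfolding eq using Suc.IH by (intro ito_exponential_le[OF ito g0 g(2) _ y c]) auto
  ultimately show ?case using Suc.IH by auto
qed

end

section \<open>A single BESQ(0) process\<close>

locale besq0_solution = brownian M \<beta> for M :: "'a measure" and \<beta> +
  fixes X J :: "real \<Rightarrow> 'a \<Rightarrow> real" and z :: real
  assumes X_measurable [measurable]: "0 \<le> t \<Longrightarrow> X t \<in> borel_measurable M"
    and X_cont: "continuous_paths M X"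
    and X_nonneg: "0 \<le> t \<Longrightarrow> x \<in> space M \<Longrightarrow> 0 \<le> X t x"
    and X_adapted: "adapted F X"
    and ito: "ito_integral (completion M) F \<beta> (\<lambda>t x. sqrt (X t x)) J"
    and sol: "AE x in M. \<forall>t\<ge>0. X t x = z + 2 * J t x"
    and z_nonneg: "0 \<le> z"
begin

lemma X_continuous_on: "x \<in> space M \<Longrightarrow> continuous_on {0..} (\<lambda>t. X t x)"
  using X_cont by (simp add: continuous_paths_def)

lemma J_diff: "AE x in M. \<forall>s\<ge>0. \<forall>t\<ge>0. J t x - J s x = (X t x - X s x) / 2"
  using sol by eventually_elim auto

text \<open>The equation gives \<open>X 0 = z + 2 * J 0\<close>, and \<open>J 0\<close> vanishes
  almost surely: at time 0 all truncated partition points are 0, so the approximating simple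
  integrals are identically 0.\<close>

lemma X_0: "AE x in M. X 0 x = z"
proof -
  have J0: "J 0 \<in> borel_measurable (completion M)"
    using ito by (auto simp: ito_integral_def adapted_def intro: measurable_F_completion)
  obtain m p \<xi> where si: "\<And>j :: nat. simple_integrand (completion M) F (m j) (p j) (\<xi> j)"
    and lim: "tendsto_in_prob (completion M) (\<lambda>j x. simple_integral \<beta> (m j) (p j) (\<xi> j) 0 x) (J 0)"
    using ito unfolding ito_integral_def by blast
  have "simple_integral \<beta> (m j) (p j) (\<xi> j) 0 x = 0" for j x
  proof -
    have p: "0 \<le> p j k" if "k \<le> m j" for k
      using partition_mono[of "m j" "p j" 0 k] si[of j] that by (fastforce simp: simple_integrand_def)
    show ?thesis
      unfolding simple_integral_def
      by (intro sum.neutral ballI) (use p in \<open>auto simp: min_absorb1\<close>)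
  qed
  then have "tendsto_in_prob (completion M) (\<lambda>_ _. 0) (J 0)" using lim by simp
  then have "(\<lambda>k :: nat. \<integral>x. min 1 \<bar>0 - J 0 x\<bar> \<partial>completion M) \<longlonglongrightarrow> 0"
    by (rule C.tendsto_in_prob_L1) (auto simp: J0)
  then have "(\<integral>x. min 1 \<bar>0 - J 0 x\<bar> \<partial>completion M) = 0"
    using LIMSEQ_unique tendsto_const by blast
  moreover have "integrable (completion M) (\<lambda>x. min 1 \<bar>0 - J 0 x\<bar>)"
    using J0 by (intro C.integrable_const_bound[of _ 1]) auto
  ultimately have "AE x in completion M. min 1 \<bar>0 - J 0 x\<bar> = 0"
    by (subst (asm) integral_nonneg_eq_0_iff_AE) auto
  then have "AE x in M. min 1 \<bar>0 - J 0 x\<bar> = 0" by (simp add: AE_completion_iff)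
  with sol show ?thesis by eventually_elim (auto simp: min_def split: if_splits)
qed

lemma set_integral_sqrt_sq:
  assumes "x \<in> space M" "0 \<le> a"
  shows "(LBINT s:{a..b}. (y * sqrt (X s x) + 0)\<^sup>2) = y\<^sup>2 * (LBINT s:{a..b}. X s x)"
proof -
  have "(LBINT s:{a..b}. (y * sqrt (X s x) + 0)\<^sup>2) = (LBINT s:{a..b}. y\<^sup>2 * X s x)"
    using assms X_nonneg by (intro set_lebesgue_integral_cong) (auto simp: power_mult_distrib)
  then show ?thesis by simp
qed

text \<open>A constant exponent would leave the quadratic term, a multiple of the time integral of
  \<open>X\<close>, uncontrolled. The weight \<open>lam\<close> on \<open>X\<close> therefore falls
  linearly from \<open>2 * \<mu>\<close> at time 0 to \<open>\<mu>\<close> at time \<open>t\<close>: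
  its decrease contributes \<open>\<mu> / t\<close> times that integral, which absorbs the quadratic
  cost of at most \<open>8 * \<mu>\<^sup>2\<close> times it.\<close>

lemma exponential_moment:
  assumes t: "0 < t" and \<mu>: "0 < \<mu>" "\<mu> \<le> 1 / (8 * t)"
  shows "(\<integral>\<^sup>+ x. ennreal (exp (\<mu> * X t x)) \<partial>M) \<le> ennreal (exp (2 * \<mu> * z))"
proof -
  define g where "g L l = t * real l / real L" for L l :: nat
  define lam where "lam L l = \<mu> * (2 - real l / real L)" for L l :: nat
  define \<Phi> where "\<Phi> L x = exp (\<Sum>l<L. (2 * lam L l) * (J (g L (Suc l)) x - J (g L l) x) + 0 * (\<beta> (g L (Suc l)) x - \<beta> (g L l) x)
      - (LBINT s:{g L l..g L (Suc l)}. (2 * lam L l * sqrt (X s x) + 0)\<^sup>2) / 2)" for L x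
  have g0: "g L 0 = 0" "g L l \<le> g L (Suc l)" for L l
    using t by (simp_all add: g_def divide_right_mono)
  have gnn: "0 \<le> g L l" for L l using t by (simp add: g_def)
  have \<Phi>: "\<Phi> L \<in> borel_measurable (F (g L L))" "(\<integral>\<^sup>+ x. ennreal (\<Phi> L x) \<partial>M) \<le> 1" for L
    using ito_exponential_grid_le[OF ito, of "g L" "\<lambda>l x. 2 * lam L l" "\<lambda>_ _. 0" L] g0[of L]
    unfolding \<Phi>_def[abs_def] by auto
  have ae: "AE x in M. ennreal (exp (\<mu> * X t x - 2 * \<mu> * z)) \<le> liminf (\<lambda>L. ennreal (\<Phi> L x))"
    using J_diff X_0 AE_space
  proof eventually_elim
    case (elim x)
    let ?I = "LBINT s:{0..t}. X s x" and ?R = "\<lambda>L. t / real L * (\<Sum>l<L. X (t * real (Suc l) / real L) x)"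
    have cX: "continuous_on {0..t} (\<lambda>s. X s x)"
      using X_continuous_on[OF elim(3)] by (rule continuous_on_subset) auto
    have R: "?R \<longlonglongrightarrow> ?I" by (rule right_riemann_sum_tendsto[OF t cX])
    have I0: "0 \<le> ?I"
      unfolding set_lebesgue_integral_def using X_nonneg[OF _ elim(3)] by (intro integral_nonneg_AE AE_I2) (auto split: split_indicator)
    let ?B = "\<lambda>L. exp (\<mu> * X t x - 2 * \<mu> * z + \<mu> / t * ?R L - 8 * \<mu>\<^sup>2 * ?I)"
    have le: "?B L \<le> \<Phi> L x" if L: "0 < L" for L
    proof -
      have gt: "g L L = t" using L by (simp add: g_def)
      \<comment> \<open>Summation by parts: the weight drops by \<open>\<mu> / L\<close> in each
        cell, and the drops collect \<open>X\<close> at the right endpoints.\<close>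
      have parts: "(\<Sum>l<k. lam L l * (X (g L (Suc l)) x - X (g L l) x))
        = lam L k * X (g L k) x - lam L 0 * X (g L 0) x + \<mu> / real L * (\<Sum>l<k. X (g L (Suc l)) x)" for k
      proof (induction k)
        case (Suc k)
        have e: "lam L k = lam L (Suc k) + \<mu> / real L"
          using L by (simp add: lam_def field_simps)
        show ?case unfolding sum.lessThan_Suc Suc.IH by (simp add: e algebra_simps)
      qed simp
      have lamL: "lam L L = \<mu>" "lam L 0 = 2 * \<mu>" using L by (simp_all add: lam_def)
      have lin: "(\<Sum>l<L. (2 * lam L l) * (J (g L (Suc l)) x - J (g L l) x)) = \<mu> * X t x - 2 * \<mu> * z + \<mu> / t * ?R L"
      proof -
        have "(\<Sum>l<L. (2 * lam L l) * (J (g L (Suc l)) x - J (g L l) x)) = (\<Sum>l<L. lam L l * (X (g L (Suc l)) x - X (g L l) x))"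
        proof (rule sum.cong[OF refl])
          fix l
          have "J (g L (Suc l)) x - J (g L l) x = (X (g L (Suc l)) x - X (g L l) x) / 2"
            using elim(1) gnn by blast
          then show "2 * lam L l * (J (g L (Suc l)) x - J (g L l) x) = lam L l * (X (g L (Suc l)) x - X (g L l) x)"
            by simp
        qed
        also have "\<dots> = \<mu> * X t x - 2 * \<mu> * z + \<mu> / real L * (\<Sum>l<L. X (g L (Suc l)) x)"
          unfolding parts lamL gt g0 elim(2) by simp
        also have "\<mu> / real L * (\<Sum>l<L. X (g L (Suc l)) x) = \<mu> / t * ?R L"
          using t by (simp add: g_def)
        finally show ?thesis .
      qed
      have cell0: "0 \<le> (LBINT s:{g L l..g L (Suc l)}. X s x)" for l
        unfolding set_lebesgue_integral_def using X_nonneg[OF _ elim(3)] gnn[of L l]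
        by (intro integral_nonneg_AE AE_I2) (auto split: split_indicator)
      have quad: "(\<Sum>l<L. (LBINT s:{g L l..g L (Suc l)}. (2 * lam L l * sqrt (X s x) + 0)\<^sup>2) / 2) \<le> 8 * \<mu>\<^sup>2 * ?I"
      proof -
        have "(\<Sum>l<L. (LBINT s:{g L l..g L (Suc l)}. (2 * lam L l * sqrt (X s x) + 0)\<^sup>2) / 2)
          \<le> (\<Sum>l<L. 8 * \<mu>\<^sup>2 * (LBINT s:{g L l..g L (Suc l)}. X s x))"
        proof (rule sum_mono)
          fix l assume "l \<in> {..<L}"
          then have "real l / real L \<le> 1" by simp
          then have "0 \<le> lam L l" "lam L l \<le> 2 * \<mu>" using \<mu> by (simp_all add: lam_def)
          then have "(lam L l)\<^sup>2 \<le> (2 * \<mu>)\<^sup>2" by (intro power_mono) auto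
          then have "(2 * lam L l)\<^sup>2 / 2 \<le> 8 * \<mu>\<^sup>2" by (simp add: power_mult_distrib)
          then show "(LBINT s:{g L l..g L (Suc l)}. (2 * lam L l * sqrt (X s x) + 0)\<^sup>2) / 2
            \<le> 8 * \<mu>\<^sup>2 * (LBINT s:{g L l..g L (Suc l)}. X s x)"
            unfolding set_integral_sqrt_sq[OF elim(3) gnn] using mult_right_mono[OF _ cell0[of l]] by fastforce
        qed
        also have "\<dots> = 8 * \<mu>\<^sup>2 * ?I"
          using set_integral_cells[of "g L" L "\<lambda>s. X s x"] g0[of L] gt cX by (simp add: sum_distrib_left)
        finally show ?thesis .
      qed
      show ?thesis
        using lin quad unfolding \<Phi>_def by (simp add: sum_subtractf sum.distrib)
    qed
    have "(\<lambda>L. ennreal (?B L)) \<longlonglongrightarrow> ennreal (exp (\<mu> * X t x - 2 * \<mu> * z + \<mu> / t * ?I - 8 * \<mu>\<^sup>2 * ?I))"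
      by (intro tendsto_ennrealI tendsto_intros R)
    from lim_imp_Liminf[OF _ this]
    have "ennreal (exp (\<mu> * X t x - 2 * \<mu> * z + \<mu> / t * ?I - 8 * \<mu>\<^sup>2 * ?I)) = liminf (\<lambda>L. ennreal (?B L))" by simp
    also have "\<dots> \<le> liminf (\<lambda>L. ennreal (\<Phi> L x))"
      by (intro Liminf_mono eventually_mono[OF eventually_gt_at_top[of 0]] ennreal_leI le)
    finally have fin: "ennreal (exp (\<mu> * X t x - 2 * \<mu> * z + \<mu> / t * ?I - 8 * \<mu>\<^sup>2 * ?I)) \<le> liminf (\<lambda>L. ennreal (\<Phi> L x))" .
    \<comment> \<open>The bound \<open>\<mu> \<le> 1 / (8 * t)\<close> enters here: the gain from
      the falling weight exceeds the quadratic cost.\<close>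
    have "8 * \<mu>\<^sup>2 * ?I \<le> \<mu> / t * ?I"
    proof (rule mult_right_mono[OF _ I0])
      have "\<mu> * (8 * \<mu>) \<le> \<mu> * (1 / t)" using \<mu> t by (intro mult_left_mono) (auto simp: field_simps)
      then show "8 * \<mu>\<^sup>2 \<le> \<mu> / t" by (simp add: power2_eq_square)
    qed
    then have "ennreal (exp (\<mu> * X t x - 2 * \<mu> * z))
        \<le> ennreal (exp (\<mu> * X t x - 2 * \<mu> * z + \<mu> / t * ?I - 8 * \<mu>\<^sup>2 * ?I))"
      by (intro ennreal_leI) simp
    with fin show ?case by (rule order_trans[rotated])
  qed
  have "(\<integral>\<^sup>+ x. ennreal (exp (\<mu> * X t x - 2 * \<mu> * z)) \<partial>M) \<le> (\<integral>\<^sup>+ x. liminf (\<lambda>L. ennreal (\<Phi> L x)) \<partial>completion M)"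
    unfolding nn_integral_completion by (rule nn_integral_mono_AE[OF ae])
  also have "\<dots> \<le> liminf (\<lambda>L. \<integral>\<^sup>+ x. ennreal (\<Phi> L x) \<partial>completion M)"
    using measurable_F_completion[OF \<Phi>(1)] by (intro nn_integral_liminf) auto
  also have "\<dots> \<le> liminf (\<lambda>L. 1)"
    unfolding nn_integral_completion by (intro Liminf_mono always_eventually allI \<Phi>(2))
  also have "\<dots> = 1" by (simp add: Liminf_const)
  finally have *: "(\<integral>\<^sup>+ x. ennreal (exp (\<mu> * X t x - 2 * \<mu> * z)) \<partial>M) \<le> 1" .
  have "(\<integral>\<^sup>+ x. ennreal (exp (\<mu> * X t x)) \<partial>M) = (\<integral>\<^sup>+ x. ennreal (exp (2 * \<mu> * z)) * ennreal (exp (\<mu> * X t x - 2 * \<mu> * z)) \<partial>M)"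
    by (intro nn_integral_cong) (simp add: ennreal_mult[symmetric] exp_add[symmetric])
  also have "\<dots> = ennreal (exp (2 * \<mu> * z)) * (\<integral>\<^sup>+ x. ennreal (exp (\<mu> * X t x - 2 * \<mu> * z)) \<partial>M)"
    using X_measurable[of t] t by (intro nn_integral_cmult) auto
  also have "\<dots> \<le> ennreal (exp (2 * \<mu> * z)) * 1"
    by (intro mult_left_mono *) simp
  finally show ?thesis by simp
qed

text \<open>The exponent \<open>1 / (8 * t)\<close> is admissible for every earlier positive time
  \<open>v\<close>, and the exponential bound does not depend on \<open>v\<close>; hence one
  constant for the whole interval. The summand \<open>z\<close> covers \<open>v = 0\<close>.\<close>

lemma first_moment_bound:
  assumes t: "0 < t"
  obtains K where "\<And>v. 0 \<le> v \<Longrightarrow> v \<le> t \<Longrightarrow> (\<integral>\<^sup>+ x. ennreal (X v x) \<partial>M) \<le> ennreal K"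
proof
  fix v assume v: "0 \<le> v" "v \<le> t"
  let ?\<mu> = "1 / (8 * t)"
  show "(\<integral>\<^sup>+ x. ennreal (X v x) \<partial>M) \<le> ennreal (8 * t * exp (2 * ?\<mu> * z) + z)"
  proof (cases "v = 0")
    case True
    have "(\<integral>\<^sup>+ x. ennreal (X v x) \<partial>M) = (\<integral>\<^sup>+ x. ennreal z \<partial>M)"
      using X_0 True by (intro nn_integral_cong_AE) auto
    then show ?thesis using t by (simp add: emeasure_space_1 ennreal_leI)
  next
    case False
    have "X v x \<le> 8 * t * exp (?\<mu> * X v x)" for x
    proof -
      have "?\<mu> * X v x \<le> exp (?\<mu> * X v x)" using exp_ge_add_one_self[of "?\<mu> * X v x"] by linarith
      then show ?thesis using t by (simp add: field_simps)
    qed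
    then have "(\<integral>\<^sup>+ x. ennreal (X v x) \<partial>M) \<le> (\<integral>\<^sup>+ x. ennreal (8 * t) * ennreal (exp (?\<mu> * X v x)) \<partial>M)"
      using t by (intro nn_integral_mono) (simp add: ennreal_mult[symmetric] ennreal_leI)
    also have "\<dots> = ennreal (8 * t) * (\<integral>\<^sup>+ x. ennreal (exp (?\<mu> * X v x)) \<partial>M)"
      using v by (intro nn_integral_cmult) auto
    also have "\<dots> \<le> ennreal (8 * t) * ennreal (exp (2 * ?\<mu> * z))"
      using t v False by (intro mult_left_mono exponential_moment) (auto simp: field_simps)
    also have "\<dots> = ennreal (8 * t * exp (2 * ?\<mu> * z))" using t by (simp add: ennreal_mult)
    also have "\<dots> \<le> ennreal (8 * t * exp (2 * ?\<mu> * z) + z)" using z_nonneg by (intro ennreal_leI) simp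
    finally show ?thesis .
  qed
qed

lemma X_integrable: "0 \<le> t \<Longrightarrow> integrable M (X t)"
proof -
  assume t: "0 \<le> t"
  \<comment> \<open>The horizon \<open>t + 1\<close> is positive even for
    \<open>t = 0\<close>.\<close>
  obtain K where K: "\<And>v. 0 \<le> v \<Longrightarrow> v \<le> t + 1 \<Longrightarrow> (\<integral>\<^sup>+ x. ennreal (X v x) \<partial>M) \<le> ennreal K"
    using first_moment_bound[of "t + 1"] t by auto
  show ?thesis
    by (rule integrableI_nonneg) (use t X_nonneg K[of t] in \<open>auto intro!: AE_I2 order.strict_trans1[OF K]\<close>)
qed

lemma joint_measurable_X [measurable]: "(\<lambda>(x, s). X (max 0 s) x) \<in> borel_measurable (M \<Otimes>\<^sub>M borel)"
  by (rule jointly_measurable_continuous[OF X_measurable X_cont])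

text \<open>Tonelli's theorem with the first moment bound that is uniform in time.\<close>

lemma integrable_time_integral:
  assumes "0 \<le> s" "s \<le> t"
  shows "integrable M (\<lambda>x. LBINT v:{s..t}. X v x)"
proof -
  obtain K where K: "\<And>v. 0 \<le> v \<Longrightarrow> v \<le> t + 1 \<Longrightarrow> (\<integral>\<^sup>+ x. ennreal (X v x) \<partial>M) \<le> ennreal K"
    using first_moment_bound[of "t + 1"] assms by auto
  have eq: "(LBINT v:{s..t}. X v x) = (\<integral>v. indicator {s..t} v *\<^sub>R X (max 0 v) x \<partial>lborel)" for x
    unfolding set_lebesgue_integral_def using assms
    by (intro Bochner_Integration.integral_cong) (auto split: split_indicator simp: max_absorb2)
  show ?thesis
  proof (rule integrableI_nonneg)
    show "(\<lambda>x. LBINT v:{s..t}. X v x) \<in> borel_measurable M"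
      unfolding eq by measurable
    show "AE x in M. 0 \<le> (LBINT v:{s..t}. X v x)"
      unfolding eq using X_nonneg by (intro AE_I2 integral_nonneg_AE) (auto split: split_indicator)
    have "(\<integral>\<^sup>+ x. ennreal (LBINT v:{s..t}. X v x) \<partial>M) = (\<integral>\<^sup>+ x. \<integral>\<^sup>+ v. ennreal (indicator {s..t} v * X (max 0 v) x) \<partial>lborel \<partial>M)"
    proof (rule nn_integral_cong)
      fix x assume x: "x \<in> space M"
      have "set_integrable lborel {s..t} (\<lambda>v. X v x)"
        using assms by (intro borel_integrable_atLeastAtMost' continuous_on_subset[OF X_continuous_on[OF x]]) auto
      also have "set_integrable lborel {s..t} (\<lambda>v. X v x) \<longleftrightarrow> integrable lborel (\<lambda>v. indicator {s..t} v *\<^sub>R X (max 0 v) x)"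
        unfolding set_integrable_def using assms
        by (intro Bochner_Integration.integrable_cong) (auto split: split_indicator simp: max_absorb2)
      finally show "ennreal (LBINT v:{s..t}. X v x) = (\<integral>\<^sup>+ v. ennreal (indicator {s..t} v * X (max 0 v) x) \<partial>lborel)"
        unfolding eq using X_nonneg x by (subst nn_integral_eq_integral) (auto split: split_indicator)
    qed
    also have "\<dots> = (\<integral>\<^sup>+ v. \<integral>\<^sup>+ x. ennreal (indicator {s..t} v * X (max 0 v) x) \<partial>M \<partial>lborel)"
    proof -
      interpret pair_sigma_finite M lborel by unfold_locales
      show ?thesis
        by (rule Fubini'[symmetric]) (simp add: split_beta')
    qed
    also have "\<dots> \<le> (\<integral>\<^sup>+ v. ennreal K * indicator {s..t} v \<partial>lborel)"
      using assms K by (intro nn_integral_mono) (auto split: split_indicator simp: max_absorb2)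
    also have "\<dots> = ennreal K * ennreal (t - s)"
      using assms by (subst nn_integral_cmult_indicator) auto
    also have "\<dots> < \<infinity>" by (simp add: ennreal_mult_less_top)
    finally show "(\<integral>\<^sup>+ x. ennreal (LBINT v:{s..t}. X v x) \<partial>M) < \<infinity>" .
  qed
qed

text \<open>With a constant weight \<open>2 * \<mu>\<close> and the estimate
  \<open>1 + x \<le> exp x\<close>, the exponential inequality becomes
  \<open>\<mu> * d \<le> 2 * \<mu>\<^sup>2 * K\<close>, where \<open>d\<close> is the difference of
  the two sides and \<open>K\<close> the mean of the time integral on \<open>A\<close>. This holds
  for \<mu> of either sign, and small \<mu> force \<open>d = 0\<close>.\<close>

lemma X_martingale:
  assumes st: "0 \<le> s" "s \<le> t" and A: "A \<in> sets M" "A \<in> sets (F s)"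
  shows "(\<integral>x\<in>A. X t x \<partial>M) = (\<integral>x\<in>A. X s x \<partial>M)"
proof -
  define I where "I x = (LBINT v:{s..t}. X v x)" for x
  have int: "integrable M (X t)" "integrable M (X s)" "integrable M I"
    using st X_integrable integrable_time_integral[of s t] by (auto simp: I_def[abs_def])
  note A(1) [measurable]
  have iA: "integrable M (\<lambda>x. indicator A x * f x)" if "integrable M f" for f :: "'a \<Rightarrow> real"
    using integrable_mult_indicator[OF A(1) that] by simp
  define K where "K = (\<integral>x. indicator A x * I x \<partial>M)"
  have K0: "0 \<le> K"
    unfolding K_def I_def set_lebesgue_integral_def using st X_nonneg
    by (intro integral_nonneg_AE AE_I2 mult_nonneg_nonneg) (auto split: split_indicator)
  define d where "d = (\<integral>x. indicator A x * X t x \<partial>M) - (\<integral>x. indicator A x * X s x \<partial>M)"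
  have main: "\<mu> * d \<le> 2 * \<mu>\<^sup>2 * K" for \<mu>
  proof -
    let ?E = "\<lambda>x. indicator A x * exp (\<mu> * (X t x - X s x) - 2 * \<mu>\<^sup>2 * I x)"
    have "(\<integral>\<^sup>+ x. ennreal (indicator A x * exp (2 * \<mu> * (J t x - J s x) + 0 * (\<beta> t x - \<beta> s x) - (LBINT v:{s..t}. (2 * \<mu> * sqrt (X v x) + 0)\<^sup>2) / 2)) \<partial>M)
      \<le> (\<integral>\<^sup>+ x. ennreal (indicator A x) \<partial>M)"
      using A by (intro ito_exponential_le[OF ito st, of "indicator A" "\<lambda>_. 2 * \<mu>" "\<lambda>_. 0"]) auto
    also have "(\<integral>\<^sup>+ x. ennreal (indicator A x) \<partial>M) = ennreal (prob A)"
      using A by (simp add: ennreal_indicator emeasure_eq_measure)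
    also have "(\<integral>\<^sup>+ x. ennreal (indicator A x * exp (2 * \<mu> * (J t x - J s x) + 0 * (\<beta> t x - \<beta> s x) - (LBINT v:{s..t}. (2 * \<mu> * sqrt (X v x) + 0)\<^sup>2) / 2)) \<partial>M)
      = (\<integral>\<^sup>+ x. ennreal (?E x) \<partial>M)"
    proof (rule nn_integral_cong_AE)
      show "AE x in M. ennreal (indicator A x * exp (2 * \<mu> * (J t x - J s x) + 0 * (\<beta> t x - \<beta> s x) - (LBINT v:{s..t}. (2 * \<mu> * sqrt (X v x) + 0)\<^sup>2) / 2)) = ennreal (?E x)"
        using J_diff AE_space
      proof eventually_elim
        case (elim x)
        then have "J t x - J s x = (X t x - X s x) / 2" using st by simp
        then show ?case
          unfolding set_integral_sqrt_sq[OF elim(2) st(1)] I_def by (simp add: power_mult_distrib)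
      qed
    qed
    finally have le: "(\<integral>\<^sup>+ x. ennreal (?E x) \<partial>M) \<le> ennreal (prob A)" .
    have iE: "integrable M ?E"
      using int st by (intro integrableI_nonneg) (auto intro!: order.strict_trans1[OF le])
    have "(\<integral>x. ?E x \<partial>M) \<le> prob A"
      using le iE by (subst (asm) nn_integral_eq_integral) auto
    moreover have "(\<integral>x. indicator A x + \<mu> * (indicator A x * X t x) - \<mu> * (indicator A x * X s x) - 2 * \<mu>\<^sup>2 * (indicator A x * I x) \<partial>M) \<le> (\<integral>x. ?E x \<partial>M)"
    proof (rule integral_mono)
      show "integrable M (\<lambda>x. indicator A x + \<mu> * (indicator A x * X t x) - \<mu> * (indicator A x * X s x) - 2 * \<mu>\<^sup>2 * (indicator A x * I x))"
        using iA[OF int(1)] iA[OF int(2)] iA[OF int(3)] A(1) by (auto simp: emeasure_eq_measure)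
      fix x
      have "1 + (\<mu> * (X t x - X s x) - 2 * \<mu>\<^sup>2 * I x) \<le> exp (\<mu> * (X t x - X s x) - 2 * \<mu>\<^sup>2 * I x)"
        by (rule exp_ge_add_one_self)
      then show "indicator A x + \<mu> * (indicator A x * X t x) - \<mu> * (indicator A x * X s x) - 2 * \<mu>\<^sup>2 * (indicator A x * I x) \<le> ?E x"
        by (auto split: split_indicator simp: algebra_simps)
    qed (rule iE)
    moreover have "(\<integral>x. indicator A x + \<mu> * (indicator A x * X t x) - \<mu> * (indicator A x * X s x) - 2 * \<mu>\<^sup>2 * (indicator A x * I x) \<partial>M) = prob A + \<mu> * d - 2 * \<mu>\<^sup>2 * K"
      using iA[OF int(1)] iA[OF int(2)] iA[OF int(3)] A(1)
      by (simp add: d_def K_def emeasure_eq_measure right_diff_distrib)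
    ultimately show ?thesis by simp
  qed
  have "d = 0"
  proof (rule ccontr)
    assume "d \<noteq> 0"
    then have d2: "0 < d * d" by (simp add: zero_less_mult_iff) linarith
    \<comment> \<open>Choosing \<open>\<mu> = d / (4 * K + 4)\<close> would give
      \<open>d * d * (4 * K + 4) \<le> d * d * (2 * K)\<close>, which is impossible for
      \<open>d \<noteq> 0\<close> and \<open>K \<ge> 0\<close>.\<close>
    let ?k = "4 * K + 4"
    have "d / ?k * d \<le> 2 * (d / ?k)\<^sup>2 * K" by (rule main)
    then have "(d / ?k * d) * (?k * ?k) \<le> (2 * (d / ?k)\<^sup>2 * K) * (?k * ?k)"
      using K0 by (intro mult_right_mono) auto
    also have "(d / ?k * d) * (?k * ?k) = (d * d) * ?k" using K0 by (simp add: field_simps)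
    also have "(2 * (d / ?k)\<^sup>2 * K) * (?k * ?k) = (d * d) * (2 * K)" using K0 by (simp add: power2_eq_square)
    finally show False using mult_le_cancel_left_pos[OF d2, of ?k "2 * K"] K0 by linarith
  qed
  then show ?thesis by (simp add: d_def set_lebesgue_integral_def)
qed

text \<open>Weight \<open>k / sqrt X\<close> on \<open>J\<close> and \<open>- k\<close> on the
  driver. While \<open>X\<close> is positive the combined integrand
  \<open>k / sqrt X * sqrt X - k\<close> is 0 up to grid errors, so the quadratic cost stays
  bounded. By concavity of the square root the linear part is at least
  \<open>k * (sqrt (X 1) - sqrt z - (\<beta> 1 - \<beta> 0))\<close>, which is at least
  \<open>k\<close> when the driver is low. So a variable of mean at most 1 would be at least
  \<open>exp (k - 1)\<close> for every \<open>k\<close>. Concavity stands in for Ito's formula for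
  \<open>sqrt X\<close>, whose drift is singular at 0.\<close>

lemma hits_zero_if_driver_low:
  "AE x in M. \<beta> 1 x - \<beta> 0 x < - sqrt z - 1 \<longrightarrow> (\<exists>s\<in>{0..1}. X s x = 0)"
proof -
  define g where "g L l = 1 * real l / real L" for L l :: nat
  \<comment> \<open>If \<open>X\<close> is 0 at a grid point, the quotient is 0, so the weights are
    measurable on the whole space; the lower bound for \<open>\<Phi>\<close> is derived on paths
    without zeros in the unit interval.\<close>
  define \<Phi> where "\<Phi> k L x = exp (\<Sum>l<L. (real k / sqrt (X (g L l) x)) * (J (g L (Suc l)) x - J (g L l) x) + (- real k) * (\<beta> (g L (Suc l)) x - \<beta> (g L l) x)
      - (LBINT s:{g L l..g L (Suc l)}. ((real k / sqrt (X (g L l) x)) * sqrt (X s x) + (- real k))\<^sup>2) / 2)" for k L :: nat and x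
  have g0: "g L 0 = 0" "g L l \<le> g L (Suc l)" and gnn: "0 \<le> g L l" for L l
    by (simp_all add: g_def divide_right_mono)
  have \<Phi>: "\<Phi> k L \<in> borel_measurable (F (g L L))" "(\<integral>\<^sup>+ x. ennreal (\<Phi> k L x) \<partial>M) \<le> 1" for k L
  proof -
    have "X (g L l) \<in> borel_measurable (F (g L l))" for l
      using X_adapted gnn by (simp add: adapted_def)
    then have "(\<lambda>x. real k / sqrt (X (g L l) x)) \<in> borel_measurable (F (g L l))" for l by measurable
    from ito_exponential_grid_le[OF ito, of "g L" "\<lambda>l x. real k / sqrt (X (g L l) x)" "\<lambda>_ _. - real k" L] this g0[of L]
    show "\<Phi> k L \<in> borel_measurable (F (g L L))" "(\<integral>\<^sup>+ x. ennreal (\<Phi> k L x) \<partial>M) \<le> 1"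
      unfolding \<Phi>_def[abs_def] by auto
  qed
  define f where "f k x = liminf (\<lambda>L. ennreal (\<Phi> k L x))" for k x
  have fm [measurable]: "f k \<in> borel_measurable (completion M)" for k
    unfolding f_def using measurable_F_completion[OF \<Phi>(1)] by measurable
  have f1: "(\<integral>\<^sup>+ x. f k x \<partial>completion M) \<le> 1" for k
  proof -
    have "(\<integral>\<^sup>+ x. f k x \<partial>completion M) \<le> liminf (\<lambda>L. \<integral>\<^sup>+ x. ennreal (\<Phi> k L x) \<partial>completion M)"
      unfolding f_def using measurable_F_completion[OF \<Phi>(1)] by (intro nn_integral_liminf) auto
    also have "\<dots> \<le> liminf (\<lambda>L. 1)"
      unfolding nn_integral_completion by (intro Liminf_mono always_eventually allI \<Phi>(2))
    finally show ?thesis by (simp add: Liminf_const)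
  qed
  \<comment> \<open>By Markov's inequality \<open>B k\<close> has mass at most
    \<open>exp (1 - k)\<close>, so the intersection over all \<open>k\<close> is null. Paths with a
    low driver and no zero are shown to lie in every \<open>B k\<close>.\<close>
  define B where "B k = {x \<in> space (completion M). ennreal (exp (real k - 1)) \<le> f k x}" for k
  have Bm: "B k \<in> sets (completion M)" for k unfolding B_def by measurable
  have B: "emeasure (completion M) (B k) \<le> ennreal (exp (1 - real k))" for k
  proof -
    have "emeasure (completion M) (B k) = (\<integral>\<^sup>+ x. indicator (B k) x \<partial>completion M)" using Bm by simp
    also have "\<dots> \<le> (\<integral>\<^sup>+ x. ennreal (exp (1 - real k)) * f k x \<partial>completion M)"
    proof (rule nn_integral_mono)
      fix x
      show "indicator (B k) x \<le> ennreal (exp (1 - real k)) * f k x"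
      proof (cases "x \<in> B k")
        case True
        then have "ennreal (exp (1 - real k)) * ennreal (exp (real k - 1)) \<le> ennreal (exp (1 - real k)) * f k x"
          by (intro mult_left_mono) (auto simp: B_def)
        then show ?thesis using True by (simp add: ennreal_mult[symmetric] exp_add[symmetric])
      qed simp
    qed
    also have "\<dots> = ennreal (exp (1 - real k)) * (\<integral>\<^sup>+ x. f k x \<partial>completion M)"
      by (rule nn_integral_cmult) measurable
    also have "\<dots> \<le> ennreal (exp (1 - real k)) * 1" by (intro mult_left_mono f1) simp
    finally show ?thesis by simp
  qed
  have null: "(\<Inter>k. B k) \<in> null_sets (completion M)"
  proof (rule null_setsI)
    have "emeasure (completion M) (\<Inter>k. B k) \<le> ennreal (exp (1 - real k))" for k
      using B[of k] Bm by (intro order_trans[OF emeasure_mono B]) auto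
    moreover have "(\<lambda>k. ennreal (exp (1 - real k))) \<longlonglongrightarrow> ennreal 0"
      by (intro tendsto_ennrealI) real_asymp
    ultimately have "emeasure (completion M) (\<Inter>k. B k) \<le> ennreal 0"
      by (intro LIMSEQ_le_const[of _ "ennreal 0"]) auto
    then show "emeasure (completion M) (\<Inter>k. B k) = 0" by simp
    show "(\<Inter>k. B k) \<in> sets (completion M)" using Bm by (intro sets.countable_INT) auto
  qed
  have "AE x in M. x \<notin> (\<Inter>k. B k)"
    using AE_not_in[OF null] by (simp add: AE_completion_iff)
  with J_diff X_0 AE_space show ?thesis
  proof eventually_elim
    case (elim x)
    show ?case
    proof (rule impI, rule ccontr)
      assume low: "\<beta> 1 x - \<beta> 0 x < - sqrt z - 1" and "\<not> (\<exists>s\<in>{0..1}. X s x = 0)"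
      then have pos: "0 < X s x" if "s \<in> {0..1}" for s
        using X_nonneg[OF _ elim(3), of s] that by (auto simp: less_le)
      have cs: "continuous_on {0..1} (\<lambda>s. sqrt (X s x))"
        by (intro continuous_intros continuous_on_subset[OF X_continuous_on[OF elim(3)]]) auto
      obtain s0 where s0: "s0 \<in> {0..1}" "\<And>s. s \<in> {0..1} \<Longrightarrow> sqrt (X s0 x) \<le> sqrt (X s x)"
        using continuous_attains_inf[OF _ _ cs] by auto
      define m where "m = sqrt (X s0 x)"
      have m: "0 < m" "\<And>s. s \<in> {0..1} \<Longrightarrow> m \<le> sqrt (X s x)" using s0 pos by (auto simp: m_def)
      have "x \<in> B k" for k
      proof -
        \<comment> \<open>If \<open>sqrt X\<close>, with minimum \<open>m\<close>, oscillates by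
          less than \<open>m / (k + 1)\<close> in each cell, the combined integrand is at most 1 in
          absolute value. The total quadratic cost is then at most 1/2.\<close>
        have "0 < m / (real k + 1)" using m by simp
        from uniform_cells[OF zero_less_one cs this]
        have ev: "\<forall>\<^sub>F L in sequentially. exp (real k - 1) \<le> \<Phi> k L x"
          using eventually_gt_at_top[of 0]
        proof eventually_elim
          case (elim L)
          note cells = elim(1) and L = elim(2)
          have gL: "g L L = 1" using L by (simp add: g_def)
          have g1: "g L l \<in> {0..1}" if "l \<le> L" for l using that L by (simp add: g_def)
          have q: "(LBINT s:{g L l..g L (Suc l)}. ((real k / sqrt (X (g L l) x)) * sqrt (X s x) + (- real k))\<^sup>2) \<le> 1 / real L"
            if l: "l < L" for l
          proof -
            have sub: "{g L l..g L (Suc l)} \<subseteq> {0..1}" using g1[of l] g1[of "Suc l"] l by auto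
            let ?a = "sqrt (X (g L l) x)"
            have a: "m \<le> ?a" using m g1[of l] l by auto
            have a0: "0 < ?a" using a m(1) by linarith
            have "(LBINT s:{g L l..g L (Suc l)}. (real k / ?a * sqrt (X s x) + (- real k))\<^sup>2) \<le> (LBINT s:{g L l..g L (Suc l)}. 1)"
            proof (rule set_integral_mono)
              show "set_integrable lborel {g L l..g L (Suc l)} (\<lambda>s. (real k / ?a * sqrt (X s x) + (- real k))\<^sup>2)"
                by (intro borel_integrable_atLeastAtMost' continuous_intros continuous_on_subset[OF cs sub])
              show "set_integrable lborel {g L l..g L (Suc l)} (\<lambda>s. 1 :: real)"
                by (rule borel_integrable_atLeastAtMost') simp
              fix s assume s: "s \<in> {g L l..g L (Suc l)}"
              have "g L l \<in> {g L l..g L (Suc l)}" using g0(2)[of L l] by simp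
              with cells l s have "\<bar>sqrt (X s x) - ?a\<bar> < m / (real k + 1)"
                unfolding g_def by blast
              then have "real k * \<bar>sqrt (X s x) - ?a\<bar> \<le> real k * (m / (real k + 1))"
                by (intro mult_left_mono) auto
              also have "\<dots> \<le> m" using m by (simp add: field_simps)
              also note a
              finally have "\<bar>real k * (sqrt (X s x) - ?a)\<bar> / ?a \<le> 1"
                using a0 by (simp add: abs_mult divide_le_eq del: real_sqrt_gt_0_iff)
              moreover have "\<bar>r / u * v + (- r)\<bar> = \<bar>r * (v - u)\<bar> / u" if "0 < u" for r u v :: real
              proof -
                have "r / u * v + (- r) = r * (v - u) / u" using that by (simp add: field_simps)
                then show ?thesis using that by simp
              qed
              ultimately have "\<bar>real k / ?a * sqrt (X s x) + (- real k)\<bar> \<le> 1"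
                using a0 by presburger
              then show "(real k / ?a * sqrt (X s x) + (- real k))\<^sup>2 \<le> 1"
                by (simp add: abs_square_le_1)
            qed
            also have "\<dots> = 1 / real L"
              using g0(2)[of L l] by (subst set_integral_const) (auto simp: g_def diff_divide_distrib[symmetric])
            finally show ?thesis .
          qed
          have lin: "real k * (sqrt (X (g L (Suc l)) x) - sqrt (X (g L l) x)) \<le> (real k / sqrt (X (g L l) x)) * (J (g L (Suc l)) x - J (g L l) x)"
            if l: "l < L" for l
          proof -
            let ?a = "sqrt (X (g L l) x)" and ?b = "sqrt (X (g L (Suc l)) x)"
            have a: "0 < ?a" using pos[OF g1[of l]] l by simp
            have "J (g L (Suc l)) x - J (g L l) x = (?b\<^sup>2 - ?a\<^sup>2) / 2"
              using \<open>\<forall>s\<ge>0. \<forall>t\<ge>0. J t x - J s x = (X t x - X s x) / 2\<close> gnn pos[OF g1[of l]] pos[OF g1[of "Suc l"]] l by simp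
            moreover have "(?b - ?a) * (2 * ?a) \<le> ?b\<^sup>2 - ?a\<^sup>2"
              \<comment> \<open>The tangent of the square root at the left grid point lies above its
                graph, in the form of a square being nonnegative.\<close>
              using zero_le_power2[of "?b - ?a"] by (simp add: power2_eq_square algebra_simps)
            ultimately have "(?b - ?a) * ?a \<le> J (g L (Suc l)) x - J (g L l) x" by simp
            then have "?b - ?a \<le> (J (g L (Suc l)) x - J (g L l) x) / ?a" using a by (simp add: le_divide_eq)
            from mult_left_mono[OF this, of "real k"] show ?thesis by simp
          qed
          have "real k - 1 \<le> real k * (sqrt (X 1 x) - sqrt z - (\<beta> 1 x - \<beta> 0 x)) - 1 / 2"
          proof -
            have "(1 :: real) \<in> {0..1}" by simp
            note pos = pos[OF this]
            have "1 \<le> sqrt (X 1 x) - sqrt z - (\<beta> 1 x - \<beta> 0 x)" using low real_sqrt_ge_zero[OF less_imp_le[OF pos]] by linarith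
            from mult_left_mono[OF this, of "real k"] show ?thesis by simp
          qed
          also have "\<dots> = (\<Sum>l<L. real k * (sqrt (X (g L (Suc l)) x) - sqrt (X (g L l) x)) + (- real k) * (\<beta> (g L (Suc l)) x - \<beta> (g L l) x) - (1 / real L) / 2)"
          proof -
            have "(\<Sum>l<L. sqrt (X (g L (Suc l)) x) - sqrt (X (g L l) x)) = sqrt (X 1 x) - sqrt z"
              using sum_lessThan_telescope[of "\<lambda>l. sqrt (X (g L l) x)" L] gL g0(1) \<open>X 0 x = z\<close> by simp
            moreover have "(\<Sum>l<L. \<beta> (g L (Suc l)) x - \<beta> (g L l) x) = \<beta> 1 x - \<beta> 0 x"
              using sum_lessThan_telescope[of "\<lambda>l. \<beta> (g L l) x" L] gL g0(1) by simp
            moreover have "(\<Sum>l<L. r * a l + (- r) * b l - (1 / real L) / 2) = r * (\<Sum>l<L. a l) - r * (\<Sum>l<L. b l) - 1 / 2"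
              for r and a b :: "nat \<Rightarrow> real"
              using L by (simp add: sum.distrib sum_subtractf sum_distrib_left sum_negf)
            ultimately show ?thesis by (simp only:) (simp add: algebra_simps)
          qed
          also have "\<dots> \<le> (\<Sum>l<L. (real k / sqrt (X (g L l) x)) * (J (g L (Suc l)) x - J (g L l) x) + (- real k) * (\<beta> (g L (Suc l)) x - \<beta> (g L l) x)
      - (LBINT s:{g L l..g L (Suc l)}. ((real k / sqrt (X (g L l) x)) * sqrt (X s x) + (- real k))\<^sup>2) / 2)"
            by (intro sum_mono diff_mono add_mono lin divide_right_mono q) auto
          finally show ?case unfolding \<Phi>_def by simp
        qed
        have "ennreal (exp (real k - 1)) \<le> f k x"
          unfolding f_def by (intro Liminf_bounded eventually_mono[OF ev] ennreal_leI)
        then show ?thesis using elim(3) by (simp add: B_def)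
      qed
      then show False using elim(4) by blast
    qed
  qed
qed

lemma driver_low_positive: "0 < prob {x \<in> space M. \<beta> 1 x - \<beta> 0 x < c}"
proof -
  have D: "distributed M lborel (\<lambda>x. \<beta> 1 x - \<beta> 0 x) (normal_density 0 (sqrt (1 - 0)))"
    using bm unfolding brownian_motion_def by (elim conjE allE[of _ 0] allE[of _ 1]) simp
  have "emeasure M ((\<lambda>x. \<beta> 1 x - \<beta> 0 x) -` {..<c} \<inter> space M) = (\<integral>\<^sup>+ d. ennreal (normal_density 0 1 d) * indicator {..<c} d \<partial>lborel)"
    using distributed_emeasure[OF D, of "{..<c}"] by simp
  moreover have "\<dots> \<noteq> 0"
  proof
    assume "(\<integral>\<^sup>+ d. ennreal (normal_density 0 1 d) * indicator {..<c} d \<partial>lborel) = 0"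
    then have "AE d in lborel. ennreal (normal_density 0 1 d) * indicator {..<c} d = 0"
      by (subst (asm) nn_integral_0_iff_AE) auto
    then have "AE d in lborel. d \<notin> {c - 1<..<c}"
    proof eventually_elim
      case (elim d)
      have "0 < normal_density 0 1 d" by (rule normal_density_pos) simp
      with elim show ?case by (auto split: split_indicator_asm simp: ennreal_eq_0_iff)
    qed
    then have "{c - 1<..<c} \<in> null_sets lborel"
      by (subst AE_iff_null_sets) auto
    then show False by (auto dest: null_setsD1)
  qed
  moreover have "(\<lambda>x. \<beta> 1 x - \<beta> 0 x) -` {..<c} \<inter> space M = {x \<in> space M. \<beta> 1 x - \<beta> 0 x < c}" by auto
  ultimately have "prob {x \<in> space M. \<beta> 1 x - \<beta> 0 x < c} \<noteq> 0"
    by (auto simp: emeasure_eq_measure)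
  then show ?thesis by (meson zero_less_measure_iff)
qed

end

section \<open>Nonnegative continuous martingales\<close>

text \<open>The discrete first passage event: \<open>C\<close> occurs at \<open>q\<close> and at no
  earlier time of \<open>T\<close>. It involves no later times, so it stays in the filtration at
  \<open>q\<close>, while the union over \<open>T\<close> becomes disjoint.\<close>

definition first_in :: "real set \<Rightarrow> (real \<Rightarrow> 'a set) \<Rightarrow> real \<Rightarrow> 'a set" where
  "first_in T C q = C q - (\<Union>r\<in>T \<inter> {..<q}. C r)"

lemma disjoint_first_in: "disjoint_family_on (first_in T C) T"
  unfolding disjoint_family_on_def first_in_def
proof (intro ballI impI)
  fix m n assume "m \<in> T" "n \<in> T" "m \<noteq> n"
  then show "(C m - (\<Union>r\<in>T \<inter> {..<m}. C r)) \<inter> (C n - (\<Union>r\<in>T \<inter> {..<n}. C r)) = {}"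
    by (cases m n rule: linorder_cases) auto
qed

lemma UN_first_in: "finite T \<Longrightarrow> (\<Union>q\<in>T. first_in T C q) = (\<Union>q\<in>T. C q)"
proof (intro equalityI subsetI)
  fix x assume fin: "finite T" and "x \<in> (\<Union>q\<in>T. C q)"
  then have ne: "{q\<in>T. x \<in> C q} \<noteq> {}" by auto
  let ?q = "Min {q\<in>T. x \<in> C q}"
  have "?q \<in> {q\<in>T. x \<in> C q}" using fin ne by (intro Min_in) auto
  moreover have "x \<notin> C r" if "r \<in> T" "r < ?q" for r
  proof
    assume "x \<in> C r"
    then have "?q \<le> r" using fin that by (intro Min_le) auto
    then show False using that by simp
  qed
  ultimately show "x \<in> (\<Union>q\<in>T. first_in T C q)" by (auto simp: first_in_def)
qed (auto simp: first_in_def)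

lemma (in augmented) sets_first_in:
  assumes "finite T" "\<And>q. q \<in> T \<Longrightarrow> C q \<in> sets (N q)" "q \<in> T"
  shows "first_in T C q \<in> sets (N q)"
  unfolding first_in_def
proof (intro sets.Diff sets.finite_UN)
  show "C r \<in> sets (N q)" if "r \<in> T \<inter> {..<q}" for r
    using assms(2)[of r] sets_N_mono[of r q] that by auto
qed (use assms in auto)

text \<open>After a zero at \<open>s\<close>, every rational time beyond \<open>s\<close> has
  rational times before it with arbitrarily small values, so \<open>f\<close> vanishes there; an
  arbitrary \<open>t > s\<close> is a limit of such times from the right. This reduces absorption, a
  statement about uncountably many times, to countably many conditions.\<close>

lemma absorbed_at_zero_if_rational:
  fixes f :: "real \<Rightarrow> real"
  assumes cont: "continuous_on {0..} f"
    and rat: "\<forall>t\<in>\<rat> \<inter> {0..}. (\<forall>e>0. \<exists>q\<in>\<rat> \<inter> {0..t}. f q < e) \<longrightarrow> f t = 0"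
  shows "\<forall>s\<ge>0. \<forall>t\<ge>s. f s = 0 \<longrightarrow> f t = 0"
proof (intro allI impI)
  fix s t assume st: "0 \<le> s" "s \<le> t" and 0: "f s = 0"
  show "f t = 0"
  proof (cases "s = t")
    case False
    with st have "s < t" by simp
    have near: "\<exists>q\<in>\<rat> \<inter> {0..r}. f q < e" if "s < r" "0 < e" for r e
    proof -
      have "((\<lambda>u. f u) \<longlongrightarrow> 0) (at_right s)"
      proof -
        have "((\<lambda>u. f u) \<longlongrightarrow> f s) (at s within {0..})" using cont st by (simp add: continuous_on)
        then show ?thesis unfolding 0 by (rule tendsto_within_subset) (use st in auto)
      qed
      then have "\<forall>\<^sub>F u in at_right s. f u < e" using that by (auto dest: order_tendstoD)
      then obtain b where b: "s < b" "\<And>u. s < u \<Longrightarrow> u < b \<Longrightarrow> f u < e"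
        unfolding eventually_at_right_field by blast
      have "s < min b r" using b(1) that(1) by simp
      from Rats_dense_in_real[OF this] obtain q where q: "q \<in> \<rat>" "s < q" "q < min b r"
        by blast
      then show ?thesis using b st by (intro bexI[of _ q]) auto
    qed
    define u where "u k = (SOME q. q \<in> \<rat> \<and> t < q \<and> q < t + 1 / real (Suc k))" for k
    have u: "u k \<in> \<rat>" "t < u k" "u k < t + 1 / real (Suc k)" for k
    proof -
      have "\<exists>q. q \<in> \<rat> \<and> t < q \<and> q < t + 1 / real (Suc k)"
        using Rats_dense_in_real[of t "t + 1 / real (Suc k)"] by auto
      from someI_ex[OF this] show "u k \<in> \<rat>" "t < u k" "u k < t + 1 / real (Suc k)"
        unfolding u_def by auto
    qed
    have "f (u k) = 0" for k
    proof -
      have "u k \<in> \<rat> \<inter> {0..}" using u[of k] st by auto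
      moreover have "\<forall>e>0. \<exists>q\<in>\<rat> \<inter> {0..u k}. f q < e" using near[of "u k"] u(2)[of k] st by auto
      ultimately show ?thesis using rat by blast
    qed
    moreover have "(\<lambda>k. f (u k)) \<longlonglongrightarrow> f t"
    proof (rule continuous_on_tendsto_compose[OF cont])
      show "u \<longlonglongrightarrow> t"
      proof (rule tendsto_sandwich[OF _ _ tendsto_const])
        show "(\<lambda>k. t + 1 / real (Suc k)) \<longlonglongrightarrow> t" by real_asymp
      qed (use u in \<open>auto intro!: always_eventually less_imp_le\<close>)
      show "\<forall>\<^sub>F k in sequentially. u k \<in> {0..}"
      proof (intro always_eventually allI)
        fix k show "u k \<in> {0..}" using u(2)[of k] st by simp
      qed
    qed (use st in auto)
    ultimately show ?thesis by (simp add: LIMSEQ_const_iff)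
  qed (use 0 in simp)
qed

text \<open>The martingale property is phrased by integrals over events of the raw filtration, the
  form in which it passes to products of coordinates, to sums and to image measures.\<close>

locale pos_martingale = prob_space M + augmented M N for M :: "'a measure" and N +
  fixes Y :: "real \<Rightarrow> 'a \<Rightarrow> real"
  assumes Y_measurable: "0 \<le> t \<Longrightarrow> Y t \<in> borel_measurable (N t)"
    and Y_integrable: "0 \<le> t \<Longrightarrow> integrable M (Y t)"
    and Y_continuous: "x \<in> space M \<Longrightarrow> continuous_on {0..} (\<lambda>t. Y t x)"
    and Y_nonneg: "AE x in M. \<forall>t\<ge>0. 0 \<le> Y t x"
    and Y_martingale: "0 \<le> s \<Longrightarrow> s \<le> t \<Longrightarrow> A \<in> sets (N s) \<Longrightarrow>
      (\<integral>x\<in>A. Y t x \<partial>M) = (\<integral>x\<in>A. Y s x \<partial>M)"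
begin

lemma Y_measurable_M [measurable]: "0 \<le> t \<Longrightarrow> Y t \<in> borel_measurable M"
  by (rule measurable_N_M[OF Y_measurable])

lemma Y_set_integrable: "0 \<le> t \<Longrightarrow> A \<in> sets M \<Longrightarrow> set_integrable M A (Y t)"
  unfolding set_integrable_def by (rule integrable_mult_indicator[OF _ Y_integrable])

lemma nn_set_integral_Y:
  assumes "0 \<le> t" "A \<in> sets M"
  shows "(\<integral>\<^sup>+ x. ennreal (Y t x) * indicator A x \<partial>M) = ennreal (\<integral>x\<in>A. Y t x \<partial>M)"
proof -
  have "(\<integral>\<^sup>+ x. ennreal (Y t x) * indicator A x \<partial>M) = (\<integral>\<^sup>+ x. ennreal (indicator A x *\<^sub>R Y t x) \<partial>M)"
    by (intro nn_integral_cong) (auto split: split_indicator)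
  also have "\<dots> = ennreal (\<integral>x\<in>A. Y t x \<partial>M)"
    unfolding set_lebesgue_integral_def
    using Y_set_integrable[OF assms] Y_nonneg assms(1)
    by (intro nn_integral_eq_integral) (auto simp: set_integrable_def split: split_indicator)
  finally show ?thesis .
qed

lemma nn_Y_martingale:
  assumes "0 \<le> s" "s \<le> t" "A \<in> sets (N s)"
  shows "(\<integral>\<^sup>+ x. ennreal (Y t x) * indicator A x \<partial>M) = (\<integral>\<^sup>+ x. ennreal (Y s x) * indicator A x \<partial>M)"
  using assms sets_N[of s] Y_martingale[OF assms] nn_set_integral_Y[of _ A] by auto

text \<open>On the event that \<open>q\<close> is the first time of \<open>T\<close> with
  \<open>Y q < e\<close>, the martingale property replaces \<open>Y t\<close> by \<open>Y q\<close>,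
  which is below \<open>e\<close>; these events are disjoint.\<close>

lemma set_integral_running_min_le:
  assumes T: "finite T" "T \<subseteq> {0..t}" and e: "0 < e"
  shows "(\<integral>x\<in>(\<Union>q\<in>T. {x\<in>space M. Y q x < e}). Y t x \<partial>M) \<le> e"
proof -
  let ?C = "\<lambda>q. {x\<in>space M. Y q x < e}" and ?D = "first_in T (\<lambda>q. {x\<in>space M. Y q x < e})"
  have C: "?C q \<in> sets (N q)" if "q \<in> T" for q
  proof -
    have [measurable]: "Y q \<in> borel_measurable (N q)" using T that by (intro Y_measurable) auto
    have "{x\<in>space (N q). Y q x < e} \<in> sets (N q)" by measurable
    then show ?thesis by simp
  qed
  have D: "?D q \<in> sets (N q)" if "q \<in> T" for q by (rule sets_first_in[OF T(1) C that])
  have DM: "?D q \<in> sets M" if "q \<in> T" for q using D[OF that] sets_N by blast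
  have t: "0 \<le> t" if "T \<noteq> {}" using T that by auto
  show ?thesis
  proof (cases "T = {}")
    case False
    have "(\<integral>x\<in>(\<Union>q\<in>T. ?C q). Y t x \<partial>M) = (\<integral>x\<in>(\<Union>q\<in>T. ?D q). Y t x \<partial>M)"
      by (simp add: UN_first_in[OF T(1)])
    also have "\<dots> = (\<Sum>q\<in>T. \<integral>x\<in>?D q. Y t x \<partial>M)"
      using T(1) DM t[OF False] by (intro set_integral_finite_Union disjoint_first_in Y_set_integrable) auto
    also have "\<dots> = (\<Sum>q\<in>T. \<integral>x\<in>?D q. Y q x \<partial>M)"
      using T D by (intro sum.cong Y_martingale) auto
    also have "\<dots> \<le> (\<Sum>q\<in>T. \<integral>x\<in>?D q. e \<partial>M)"
    proof (rule sum_mono)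
      fix q assume q: "q \<in> T"
      have "set_integrable M (?D q) (\<lambda>_. e)"
        using DM[OF q] by (auto simp: set_integrable_def emeasure_eq_measure)
      then show "(\<integral>x\<in>?D q. Y q x \<partial>M) \<le> (\<integral>x\<in>?D q. e \<partial>M)"
        using Y_set_integrable[OF _ DM[OF q], of q] q T by (intro set_integral_mono) (auto simp: first_in_def)
    qed
    also have "\<dots> = (\<Sum>q\<in>T. measure M (?D q)) * e"
      using DM by (simp add: set_integral_const emeasure_eq_measure sum_distrib_right)
    also have "(\<Sum>q\<in>T. measure M (?D q)) = measure M (\<Union>q\<in>T. ?D q)"
      using T(1) DM by (intro finite_measure_finite_Union[symmetric] disjoint_first_in) auto
    also have "measure M (\<Union>q\<in>T. ?D q) * e \<le> 1 * e"
      using e by (intro mult_right_mono prob_le_1) auto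
    finally show ?thesis by simp
  qed (use e in \<open>simp add: set_lebesgue_integral_def\<close>)
qed

text \<open>The bound by \<open>e\<close> does not depend on the finite set of times, so it extends
  to all rational times up to \<open>t\<close>. With \<open>e = 1 / Suc k\<close> the nonnegative
  \<open>Y t\<close> has integral 0 over the event that the running infimum is not positive.\<close>

lemma zero_if_running_inf_zero:
  assumes t: "0 \<le> t"
  shows "AE x in M. (\<forall>e>0. \<exists>q\<in>\<rat> \<inter> {0..t}. Y q x < e) \<longrightarrow> Y t x = 0"
proof -
  let ?R = "\<rat> \<inter> {0..t}"
  have R: "countable ?R" "?R \<noteq> {}" using countable_rat t by auto
  define U where "U e n = (\<Union>q\<in>from_nat_into ?R ` {..n}. {x\<in>space M. Y q x < e})" for e and n :: nat
  have sub: "from_nat_into ?R ` {..n} \<subseteq> {0..t}" for n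
    using from_nat_into[OF R(2)] by auto
  have Um: "U e n \<in> sets M" for e n
  proof -
    have "{x\<in>space M. Y q x < e} \<in> sets M" if "0 \<le> q" for q using that by measurable
    then show ?thesis unfolding U_def using sub[of n] by (intro sets.finite_UN) auto
  qed
  have le: "(\<integral>x\<in>(\<Union>n. U e n). Y t x \<partial>M) \<le> e" if "0 < e" for e
  proof -
    have "(\<lambda>n. \<integral>x\<in>U e n. Y t x \<partial>M) \<longlonglongrightarrow> (\<integral>x\<in>(\<Union>n. U e n). Y t x \<partial>M)"
    proof (intro set_integral_cont_up Y_set_integrable t)
      show "incseq (U e)" unfolding incseq_def U_def by (intro allI impI UN_mono image_mono) auto
    qed (use Um in auto)
    moreover have "(\<integral>x\<in>U e n. Y t x \<partial>M) \<le> e" for n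
      unfolding U_def by (intro set_integral_running_min_le that sub) auto
    ultimately show ?thesis by (meson LIMSEQ_le_const2)
  qed
  define A where "A = (\<Inter>k. \<Union>n. U (1 / real (Suc k)) n)"
  have Am: "A \<in> sets M" unfolding A_def using Um by (intro sets.countable_INT) auto
  have nn: "AE x in M. 0 \<le> indicator A x * Y t x"
    using Y_nonneg t by (auto split: split_indicator)
  have Ale: "(\<integral>x\<in>A. Y t x \<partial>M) \<le> 1 / real (Suc k)" for k
  proof -
    have "(\<integral>x\<in>A. Y t x \<partial>M) \<le> (\<integral>x\<in>(\<Union>n. U (1 / real (Suc k)) n). Y t x \<partial>M)"
      unfolding set_lebesgue_integral_def
    proof (rule integral_mono_AE)
      show "integrable M (\<lambda>x. indicator A x *\<^sub>R Y t x)" "integrable M (\<lambda>x. indicator (\<Union>n. U (1 / real (Suc k)) n) x *\<^sub>R Y t x)"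
        using Y_set_integrable[OF t] Am Um by (auto simp: set_integrable_def)
      show "AE x in M. indicator A x *\<^sub>R Y t x \<le> indicator (\<Union>n. U (1 / real (Suc k)) n) x *\<^sub>R Y t x"
        using Y_nonneg by eventually_elim (use t in \<open>auto simp: A_def split: split_indicator\<close>)
    qed
    also have "\<dots> \<le> 1 / real (Suc k)" by (rule le) simp
    finally show ?thesis .
  qed
  have "(\<integral>x\<in>A. Y t x \<partial>M) \<le> 0"
      proof (rule LIMSEQ_le_const)
    show "(\<lambda>k. 1 / real (Suc k)) \<longlonglongrightarrow> 0" by real_asymp
  qed (use Ale in auto)
  then have "(\<integral>x. indicator A x * Y t x \<partial>M) = 0"
    using integral_nonneg_AE[OF nn] by (simp add: set_lebesgue_integral_def)
  then have "AE x in M. indicator A x * Y t x = 0"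
    using Y_set_integrable[OF t Am] nn by (subst (asm) integral_nonneg_eq_0_iff_AE) (auto simp: set_integrable_def)
  then show ?thesis
    using AE_space
  proof eventually_elim
    case (elim x)
    show ?case
    proof
      assume *: "\<forall>e>0. \<exists>q\<in>?R. Y q x < e"
      have "x \<in> A"
        unfolding A_def
      proof
        fix k
        obtain q where q: "q \<in> ?R" "Y q x < 1 / real (Suc k)"
          using *[rule_format, of "1 / real (Suc k)"] by auto
        obtain n where "from_nat_into ?R n = q" using from_nat_into_surj[OF R(1) q(1)] by auto
        then show "x \<in> (\<Union>n. U (1 / real (Suc k)) n)" using q elim by (auto simp: U_def intro!: exI[of _ n])
      qed
      then show "Y t x = 0" using elim(1) by simp
    qed
  qed
qed

lemma absorbed_at_zero: "AE x in M. \<forall>s\<ge>0. \<forall>t\<ge>s. Y s x = 0 \<longrightarrow> Y t x = 0"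
proof -
  have "AE x in M. \<forall>t\<in>\<rat> \<inter> {0..}. (\<forall>e>0. \<exists>q\<in>\<rat> \<inter> {0..t}. Y q x < e) \<longrightarrow> Y t x = 0"
    using countable_rat zero_if_running_inf_zero by (subst AE_ball_countable) auto
  then show ?thesis
    using AE_space
  proof eventually_elim
    case (elim x)
    show ?case by (rule absorbed_at_zero_if_rational[OF Y_continuous[OF elim(2)] elim(1)])
  qed
qed

end

section \<open>Optional stopping by rounding up to a grid\<close>

definition grid_point :: "real \<Rightarrow> real \<Rightarrow> nat \<Rightarrow> nat \<Rightarrow> real" where
  "grid_point s t N j = s + (t - s) * real j / real N"

text \<open>The first point after \<open>\<tau>\<close> if \<open>s \<le> \<tau> < t\<close>, and \<open>t\<close> if \<open>t \<le> \<tau>\<close>; for \<open>\<tau> < s\<close> the maximum is over the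
  empty set.\<close>

definition grid_after :: "real \<Rightarrow> real \<Rightarrow> nat \<Rightarrow> real \<Rightarrow> real" where
  "grid_after s t N \<tau> = grid_point s t N (Suc (Max {j. j < N \<and> grid_point s t N j \<le> \<tau>}))"

text \<open>The alternative \<open>Suc j = N\<close> lets the last cell collect all late times, so
  that each \<tau> from \<open>s\<close> on lies in exactly one cell.\<close>

definition in_cell :: "real \<Rightarrow> real \<Rightarrow> nat \<Rightarrow> nat \<Rightarrow> real \<Rightarrow> bool" where
  "in_cell s t N j \<tau> \<longleftrightarrow> grid_point s t N j \<le> \<tau> \<and> (\<tau> < grid_point s t N (Suc j) \<or> Suc j = N)"

context
  fixes s t \<tau> :: real and N :: nat
  assumes st: "s < t" and N: "0 < N"
begin

lemma grid_point_mono: "i \<le> j \<Longrightarrow> grid_point s t N i \<le> grid_point s t N j"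
  unfolding grid_point_def using st by (intro add_left_mono divide_right_mono mult_left_mono) auto

lemma grid_point_0: "grid_point s t N 0 = s" and grid_point_N: "grid_point s t N N = t"
  using N by (simp_all add: grid_point_def)

lemma grid_point_bounds: "j \<le> N \<Longrightarrow> s \<le> grid_point s t N j" "j \<le> N \<Longrightarrow> grid_point s t N j \<le> t"
  using grid_point_mono[of 0 j] grid_point_mono[of j N] grid_point_0 grid_point_N by auto

context
  assumes \<tau>: "s \<le> \<tau>"
begin

lemma grid_after_cell:
  "\<exists>j<N. in_cell s t N j \<tau> \<and> grid_after s t N \<tau> = grid_point s t N (Suc j) \<and>
    (\<forall>i<N. in_cell s t N i \<tau> \<longrightarrow> i = j)"
proof -
  let ?S = "{j. j < N \<and> grid_point s t N j \<le> \<tau>}" and ?j = "Max {j. j < N \<and> grid_point s t N j \<le> \<tau>}"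
  have "0 \<in> ?S" using N \<tau> grid_point_0 by simp
  then have jS: "?j \<in> ?S" by (intro Max_in) auto
  have mx: "i \<le> ?j" if "i \<in> ?S" for i using that by (intro Max_ge) auto
  have cell: "in_cell s t N ?j \<tau>"
  proof -
    have "\<tau> < grid_point s t N (Suc ?j)" if "Suc ?j \<noteq> N"
    proof (rule ccontr)
      assume "\<not> \<tau> < grid_point s t N (Suc ?j)"
      then have "Suc ?j \<in> ?S" using that jS by auto
      from mx[OF this] show False by simp
    qed
    then show ?thesis using jS by (auto simp: in_cell_def)
  qed
  have uniq: "i = ?j" if i: "i < N" "in_cell s t N i \<tau>" for i
  proof -
    have "i \<le> ?j" using i by (intro mx) (auto simp: in_cell_def)
    moreover have "\<not> i < ?j"
    proof
      assume "i < ?j"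
      then have "grid_point s t N (Suc i) \<le> \<tau>" using grid_point_mono[of "Suc i" ?j] jS by auto
      then show False using i \<open>i < ?j\<close> jS by (auto simp: in_cell_def)
    qed
    ultimately show ?thesis by simp
  qed
  show ?thesis
    by (rule exI[of _ ?j]) (use jS cell uniq in \<open>simp add: grid_after_def\<close>)
qed

text \<open>Writes a value at a random time as a finite sum of values at deterministic times, one
  per cell; measurability and the martingale property are then applied cell by cell.\<close>

lemma sum_grid_after:
  fixes f :: "real \<Rightarrow> 'b :: semiring_1"
  shows "(\<Sum>j<N. f (grid_point s t N (Suc j)) * of_bool (in_cell s t N j \<tau>)) = f (grid_after s t N \<tau>)"
proof -
  obtain j where j: "j < N" "in_cell s t N j \<tau>" "grid_after s t N \<tau> = grid_point s t N (Suc j)"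
    "\<forall>i<N. in_cell s t N i \<tau> \<longrightarrow> i = j" using grid_after_cell by metis
  have "(\<Sum>i<N. f (grid_point s t N (Suc i)) * of_bool (in_cell s t N i \<tau>)) = (\<Sum>i<N. if i = j then f (grid_after s t N \<tau>) else 0)"
  proof (rule sum.cong[OF refl])
    fix i assume "i \<in> {..<N}"
    then have "in_cell s t N i \<tau> \<longleftrightarrow> i = j" using j(2,4) by blast
    then show "f (grid_point s t N (Suc i)) * of_bool (in_cell s t N i \<tau>) = (if i = j then f (grid_after s t N \<tau>) else 0)"
      using j(3) by simp
  qed
  then show ?thesis using j(1) by simp
qed

lemma grid_after_ge: "min t \<tau> \<le> grid_after s t N \<tau>"
  and grid_after_le: "grid_after s t N \<tau> \<le> t"
  and grid_after_near: "grid_after s t N \<tau> \<le> min t \<tau> + (t - s) / real N"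
proof -
  obtain j where j: "j < N" "in_cell s t N j \<tau>" "grid_after s t N \<tau> = grid_point s t N (Suc j)"
    "\<forall>i<N. in_cell s t N i \<tau> \<longrightarrow> i = j" using grid_after_cell by metis
  show "min t \<tau> \<le> grid_after s t N \<tau>"
    using j(1,2) grid_point_N unfolding j(3) by (auto simp: in_cell_def)
  show "grid_after s t N \<tau> \<le> t" unfolding j(3) using j(1) by (intro grid_point_bounds) auto
  have "grid_point s t N (Suc j) = grid_point s t N j + (t - s) / real N"
    by (simp add: grid_point_def algebra_simps add_divide_distrib[symmetric])
  moreover have "grid_point s t N j \<le> min t \<tau>"
    using j(1,2) grid_point_bounds(2)[of j] by (auto simp: in_cell_def)
  ultimately show "grid_after s t N \<tau> \<le> min t \<tau> + (t - s) / real N" using j(3) by simp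
qed

end

end

lemma grid_after_tendsto:
  assumes "s < t" "s \<le> \<tau>"
  shows "(\<lambda>k. grid_after s t (Suc k) \<tau>) \<longlonglongrightarrow> min t \<tau>"
proof (rule tendsto_sandwich[OF _ _ tendsto_const])
  show "\<forall>\<^sub>F k in sequentially. min t \<tau> \<le> grid_after s t (Suc k) \<tau>"
    by (intro always_eventually allI grid_after_ge[OF assms(1) _ assms(2)]) simp
  show "\<forall>\<^sub>F k in sequentially. grid_after s t (Suc k) \<tau> \<le> min t \<tau> + (t - s) / real (Suc k)"
    by (intro always_eventually allI grid_after_near[OF assms(1) _ assms(2)]) simp
  show "(\<lambda>k. min t \<tau> + (t - s) / real (Suc k)) \<longlonglongrightarrow> min t \<tau>" by real_asymp
qed

text \<open>The cell is decided by \<open>{\<tau> < r}\<close> for its two endpoints, hence known at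
  the right one. This is why \<tau> is rounded up, and strictly so, to a grid point after
  it.\<close>

lemma (in augmented) in_cell_sets:
  assumes \<tau>: "\<And>r. 0 \<le> r \<Longrightarrow> {x\<in>space M. \<tau> x < r} \<in> sets (N r)"
    and st: "0 \<le> s" "s < t" and j: "j < n"
  shows "{x\<in>space M. in_cell s t n j (\<tau> x)} \<in> sets (N (grid_point s t n (Suc j)))"
proof -
  let ?a = "grid_point s t n j" and ?b = "grid_point s t n (Suc j)"
  have n: "0 < n" using j by simp
  have ab: "0 \<le> ?a" "?a \<le> ?b" "0 \<le> ?b"
    using grid_point_bounds(1)[OF st(2) n, of j] grid_point_bounds(1)[OF st(2) n, of "Suc j"] grid_point_mono[OF st(2) n, of j "Suc j"] j st by auto
  have 1: "{x\<in>space M. \<tau> x < ?a} \<in> sets (N ?b)" using \<tau>[OF ab(1)] sets_N_mono[OF ab(2)] by blast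
  have 2: "{x\<in>space M. \<tau> x < ?b} \<in> sets (N ?b)" by (rule \<tau>[OF ab(3)])
  have "space M \<in> sets (N ?b)" using sets.top[of "N ?b"] by simp
  moreover have "{x\<in>space M. in_cell s t n j (\<tau> x)} =
    (if Suc j = n then space M - {x\<in>space M. \<tau> x < ?a} else {x\<in>space M. \<tau> x < ?b} - {x\<in>space M. \<tau> x < ?a})"
    by (auto simp: in_cell_def)
  ultimately show ?thesis using 1 2 by auto
qed

context pos_martingale
begin

text \<open>The event that \<tau> lies in a cell and that the value at its right endpoint lies in
  \<open>S\<close> is known at that endpoint, so the martingale property moves the value on to
  \<open>t\<close>. The set \<open>S\<close> makes room for the tail events in the uniform
  integrability argument.\<close>

lemma nn_stopped_on_grid:
  assumes \<tau>: "\<And>r. 0 \<le> r \<Longrightarrow> {x\<in>space M. \<tau> x < r} \<in> sets (N r)"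
    and st: "0 \<le> s" "s < t" and n: "0 < n" and B: "B \<in> sets (N s)" "\<And>x. x \<in> B \<Longrightarrow> s \<le> \<tau> x"
    and S: "S \<in> sets borel"
  shows "(\<integral>\<^sup>+ x. ennreal (Y (grid_after s t n (\<tau> x)) x) * indicator {x. Y (grid_after s t n (\<tau> x)) x \<in> S} x * indicator B x \<partial>M)
    = (\<integral>\<^sup>+ x. ennreal (Y t x) * indicator {x. Y (grid_after s t n (\<tau> x)) x \<in> S} x * indicator B x \<partial>M)"
    (is "?L = ?R")
    and "(\<lambda>x. Y (grid_after s t n (\<tau> x)) x * indicator B x) \<in> borel_measurable M"
proof -
  let ?g = "\<lambda>j. grid_point s t n (Suc j)"
  define E where "E j = {x\<in>space M. in_cell s t n j (\<tau> x) \<and> Y (?g j) x \<in> S} \<inter> B" for j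
  have g: "0 \<le> ?g j" "?g j \<le> t" "s \<le> ?g j" if "j < n" for j
    using grid_point_bounds[OF st(2) n, of "Suc j"] that st by auto
  have BM: "B \<in> sets M" using B sets_N by blast
  have cN: "{x\<in>space M. in_cell s t n j (\<tau> x)} \<in> sets (N (?g j))" if "j < n" for j
    by (rule in_cell_sets[OF \<tau> st that])
  have EN: "E j \<in> sets (N (?g j))" if "j < n" for j
  proof -
    have "{x\<in>space M. Y (?g j) x \<in> S} \<in> sets (N (?g j))"
      using measurable_sets[OF Y_measurable[OF g(1)[OF that]] S] by (simp add: vimage_def Int_def conj_commute)
    then have "{x\<in>space M. in_cell s t n j (\<tau> x)} \<inter> {x\<in>space M. Y (?g j) x \<in> S} \<inter> B \<in> sets (N (?g j))"
      using cN[OF that] B(1) sets_N_mono[OF g(3)[OF that]] by blast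
    also have "{x\<in>space M. in_cell s t n j (\<tau> x)} \<inter> {x\<in>space M. Y (?g j) x \<in> S} \<inter> B = E j" by (auto simp: E_def)
    finally show ?thesis .
  qed
  have EM: "E j \<in> sets M" if "j < n" for j using EN[OF that] sets_N by blast
  have sum: "f (grid_after s t n (\<tau> x)) * indicator {x. Y (grid_after s t n (\<tau> x)) x \<in> S} x * indicator B x
    = (\<Sum>j<n. f (?g j) * indicator (E j) x)" if "x \<in> space M" for x and f :: "real \<Rightarrow> ennreal"
  proof (cases "x \<in> B")
    case True
    have "f (grid_after s t n (\<tau> x)) * indicator {x. Y (grid_after s t n (\<tau> x)) x \<in> S} x * indicator B x
      = (\<lambda>r. f r * of_bool (Y r x \<in> S)) (grid_after s t n (\<tau> x))" using True by (simp split: split_indicator)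
    also have "\<dots> = (\<Sum>j<n. (f (?g j) * of_bool (Y (?g j) x \<in> S)) * of_bool (in_cell s t n j (\<tau> x)))"
      by (rule sum_grid_after[OF st(2) n B(2)[OF True], symmetric])
    also have "\<dots> = (\<Sum>j<n. f (?g j) * indicator (E j) x)"
      using True that by (intro sum.cong) (auto simp: E_def split: split_indicator)
    finally show ?thesis .
  qed (simp add: E_def)
  have "?L = (\<integral>\<^sup>+ x. (\<Sum>j<n. ennreal (Y (?g j) x) * indicator (E j) x) \<partial>M)"
    by (intro nn_integral_cong) (rule sum[of _ "\<lambda>r. ennreal (Y r _)"])
  also have "\<dots> = (\<Sum>j<n. \<integral>\<^sup>+ x. ennreal (Y (?g j) x) * indicator (E j) x \<partial>M)"
    using g EM by (intro nn_integral_sum) (auto intro!: borel_measurable_times_ennreal)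
  also have "\<dots> = (\<Sum>j<n. \<integral>\<^sup>+ x. ennreal (Y t x) * indicator (E j) x \<partial>M)"
    using g EN by (intro sum.cong nn_Y_martingale[symmetric]) auto
  also have "\<dots> = (\<integral>\<^sup>+ x. (\<Sum>j<n. ennreal (Y t x) * indicator (E j) x) \<partial>M)"
    using EM st by (intro nn_integral_sum[symmetric]) (auto intro!: borel_measurable_times_ennreal)
  also have "\<dots> = ?R"
    by (intro nn_integral_cong) (rule sum[of _ "\<lambda>r. ennreal (Y t _)", symmetric])
  finally show "?L = ?R" .
  have "(\<lambda>x. \<Sum>j<n. Y (?g j) x * indicator {x\<in>space M. in_cell s t n j (\<tau> x)} x * indicator B x) \<in> borel_measurable M"
  proof (rule borel_measurable_sum)
    fix j assume "j \<in> {..<n}"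
    then have [measurable]: "Y (?g j) \<in> borel_measurable M" "{x\<in>space M. in_cell s t n j (\<tau> x)} \<in> sets M"
      using g(1)[of j] cN[of j] sets_N by (auto intro: Y_measurable_M)
    show "(\<lambda>x. Y (?g j) x * indicator {x\<in>space M. in_cell s t n j (\<tau> x)} x * indicator B x) \<in> borel_measurable M"
      using BM by measurable
  qed
  also have "?this \<longleftrightarrow> (\<lambda>x. Y (grid_after s t n (\<tau> x)) x * indicator B x) \<in> borel_measurable M"
  proof (rule measurable_cong)
    fix x assume x: "x \<in> space M"
    show "(\<Sum>j<n. Y (?g j) x * indicator {x\<in>space M. in_cell s t n j (\<tau> x)} x * indicator B x) = Y (grid_after s t n (\<tau> x)) x * indicator B x"
    proof (cases "x \<in> B")
      case True
      show ?thesis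
        using sum_grid_after[OF st(2) n B(2)[OF True], of "\<lambda>r. Y r x"] x True by (simp add: indicator_def)
    qed simp
  qed
  finally show "(\<lambda>x. Y (grid_after s t n (\<tau> x)) x * indicator B x) \<in> borel_measurable M" .
qed

lemma tail_small:
  assumes "0 \<le> t" "0 < e"
  obtains L :: real where "0 < L" "(\<integral>\<^sup>+ x. ennreal (Y t x) * indicator {x. L < Y t x} x \<partial>M) \<le> ennreal e"
proof -
  note [measurable] = Y_measurable_M[OF assms(1)]
  have "(\<lambda>k. \<integral>x. Y t x * indicator {x. real (Suc k) < Y t x} x \<partial>M) \<longlonglongrightarrow> (\<integral>x. 0 \<partial>M)"
  proof (rule integral_dominated_convergence[where w="\<lambda>x. \<bar>Y t x\<bar>"])
    show "AE x in M. (\<lambda>k. Y t x * indicator {x. real (Suc k) < Y t x} x) \<longlonglongrightarrow> 0"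
    proof (rule AE_I2)
      fix x
      obtain k0 :: nat where k0: "Y t x \<le> real k0" using real_arch_simple by blast
      have "\<forall>\<^sub>F k in sequentially. Y t x * indicator {x. real (Suc k) < Y t x} x = 0"
        using eventually_ge_at_top[of k0] by eventually_elim (use k0 in auto)
      then show "(\<lambda>k. Y t x * indicator {x. real (Suc k) < Y t x} x) \<longlonglongrightarrow> 0" by (rule tendsto_eventually)
    qed
  qed (use Y_integrable[OF assms(1)] in \<open>auto split: split_indicator\<close>)
  then have "(\<lambda>k. \<integral>x. Y t x * indicator {x. real (Suc k) < Y t x} x \<partial>M) \<longlonglongrightarrow> 0" by simp
  from LIMSEQ_D[OF this assms(2)] obtain k where k: "norm ((\<integral>x. Y t x * indicator {x. real (Suc k) < Y t x} x \<partial>M) - 0) < e" by blast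
  show thesis
  proof (rule that[of "real (Suc k)"])
    have "(\<integral>\<^sup>+ x. ennreal (Y t x) * indicator {x. real (Suc k) < Y t x} x \<partial>M) = (\<integral>\<^sup>+ x. ennreal (Y t x * indicator {x. real (Suc k) < Y t x} x) \<partial>M)"
      by (intro nn_integral_cong) (auto split: split_indicator)
    also have "\<dots> = ennreal (\<integral>x. Y t x * indicator {x. real (Suc k) < Y t x} x \<partial>M)"
      by (intro nn_integral_eq_integral Bochner_Integration.integrable_bound[OF Y_integrable[OF assms(1)]] AE_I2) (auto split: split_indicator)
    also have "\<dots> \<le> ennreal e" using k by (intro ennreal_leI) auto
    finally show "(\<integral>\<^sup>+ x. ennreal (Y t x) * indicator {x. real (Suc k) < Y t x} x \<partial>M) \<le> ennreal e" .
  qed simp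
qed

text \<open>Discrete stopping on ever finer grids. The upper bound is Fatou's lemma; for the lower bound
  the values on the grid are conditional expectations of \<open>Y t\<close>, hence uniformly integrable.\<close>

lemma optional_stopping:
  assumes \<tau>: "\<And>r. 0 \<le> r \<Longrightarrow> {x\<in>space M. \<tau> x < r} \<in> sets (N r)"
    and st: "0 \<le> s" "s < t" and B: "B \<in> sets (N s)" "\<And>x. x \<in> B \<Longrightarrow> s \<le> \<tau> x"
  shows "(\<integral>\<^sup>+ x. ennreal (Y (min t (\<tau> x)) x) * indicator B x \<partial>M) = (\<integral>\<^sup>+ x. ennreal (Y s x) * indicator B x \<partial>M)"
    and "(\<lambda>x. Y (min t (\<tau> x)) x * indicator B x) \<in> borel_measurable M"
proof -
  have BM [measurable]: "B \<in> sets M" using B sets_N by blast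
  have Bsp: "B \<subseteq> space M" using sets.sets_into_space[OF BM] .
  let ?\<rho> = "\<lambda>k x. grid_after s t (Suc k) (\<tau> x)"
  let ?f = "\<lambda>k x. Y (?\<rho> k x) x * indicator B x" and ?F = "\<lambda>x. Y (min t (\<tau> x)) x * indicator B x"
  note st_grid = nn_stopped_on_grid[OF \<tau> st zero_less_Suc B]
  have fm [measurable]: "?f k \<in> borel_measurable M" for k by (rule st_grid(2)) auto
  have lim: "(\<lambda>k. ?f k x) \<longlonglongrightarrow> ?F x" if "x \<in> space M" for x
  proof (cases "x \<in> B")
    case True
    have "(\<lambda>k. Y (?\<rho> k x) x) \<longlonglongrightarrow> Y (min t (\<tau> x)) x"
    proof (rule continuous_on_tendsto_compose[OF Y_continuous[OF that]])
      show "(\<lambda>k. ?\<rho> k x) \<longlonglongrightarrow> min t (\<tau> x)" by (rule grid_after_tendsto[OF st(2) B(2)[OF True]])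
      show "\<forall>\<^sub>F k in sequentially. ?\<rho> k x \<in> {0..}"
      proof (intro always_eventually allI)
        fix k show "?\<rho> k x \<in> {0..}"
          using grid_after_ge[OF st(2) zero_less_Suc B(2)[OF True], of k] B(2)[OF True] st by auto
      qed
      show "min t (\<tau> x) \<in> {0..}" using B(2)[OF True] st by auto
    qed
    then show ?thesis using True by simp
  qed simp
  show Fm [measurable]: "?F \<in> borel_measurable M"
    by (rule borel_measurable_LIMSEQ_real[OF lim fm])
  have tot: "(\<integral>\<^sup>+ x. ennreal (?f k x) \<partial>M) = (\<integral>\<^sup>+ x. ennreal (Y s x) * indicator B x \<partial>M)" for k
  proof -
    have "(\<integral>\<^sup>+ x. ennreal (?f k x) \<partial>M) = (\<integral>\<^sup>+ x. ennreal (Y (?\<rho> k x) x) * indicator {x. Y (?\<rho> k x) x \<in> UNIV} x * indicator B x \<partial>M)"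
      by (intro nn_integral_cong) (auto split: split_indicator)
    also have "\<dots> = (\<integral>\<^sup>+ x. ennreal (Y t x) * indicator B x \<partial>M)"
      by (subst st_grid(1)) auto
    also have "\<dots> = (\<integral>\<^sup>+ x. ennreal (Y s x) * indicator B x \<partial>M)"
      using st B by (intro nn_Y_martingale) auto
    finally show ?thesis .
  qed
  let ?I = "\<integral>\<^sup>+ x. ennreal (?F x) \<partial>M" and ?c = "\<integral>\<^sup>+ x. ennreal (Y s x) * indicator B x \<partial>M"
  have conv: "?I = (\<integral>\<^sup>+ x. ennreal (Y (min t (\<tau> x)) x) * indicator B x \<partial>M)"
    by (intro nn_integral_cong) (auto split: split_indicator)
  have "?I = (\<integral>\<^sup>+ x. liminf (\<lambda>k. ennreal (?f k x)) \<partial>M)"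
    by (intro nn_integral_cong) (use lim in \<open>auto intro!: lim_imp_Liminf[symmetric] tendsto_ennrealI\<close>)
  also have "\<dots> \<le> liminf (\<lambda>k. \<integral>\<^sup>+ x. ennreal (?f k x) \<partial>M)"
    by (rule nn_integral_liminf) measurable
  also have "\<dots> = ?c" unfolding tot by (simp add: Liminf_const)
  finally have le: "?I \<le> ?c" .
  have cfin: "?c = ennreal (\<integral>x\<in>B. Y s x \<partial>M)" (is "_ = ennreal ?m") by (rule nn_set_integral_Y[OF st(1) BM])
  have ge: "?c \<le> ?I + ennreal e" if e: "0 < e" for e
  proof -
    obtain L where L: "0 < L" "(\<integral>\<^sup>+ x. ennreal (Y t x) * indicator {x. L < Y t x} x \<partial>M) \<le> ennreal (e / 2)"
      using tail_small[of t "e / 2"] st e by auto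
    \<comment> \<open>Chosen so that \<open>L / K\<close> times the common mean is at most
      \<open>e / 2\<close>; the added 1 keeps \<open>K\<close> positive when the mean is 0.\<close>
    define K where "K = 2 * L * (\<bar>?m\<bar> + 1) / e"
    have K: "0 < K" using L e by (simp add: K_def)
    have "?c \<le> (\<integral>\<^sup>+ x. ennreal (min (?f k x) K) \<partial>M) + ennreal e" for k
    proof -
      have nonneg: "AE x in M. 0 \<le> ?f k x \<and> 0 \<le> Y t x"
        using Y_nonneg
      proof eventually_elim
        case (elim x)
        have "0 \<le> ?\<rho> k x" if "x \<in> B"
          using grid_after_ge[OF st(2) zero_less_Suc B(2)[OF that], of k] B(2)[OF that] st by auto
        then show ?case using elim st by (auto split: split_indicator)
      qed
      have "?c = (\<integral>\<^sup>+ x. ennreal (?f k x) \<partial>M)" by (simp add: tot)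
      also have "\<dots> \<le> (\<integral>\<^sup>+ x. ennreal (min (?f k x) K) + ennreal (Y (?\<rho> k x) x) * indicator {x. Y (?\<rho> k x) x \<in> {K<..}} x * indicator B x \<partial>M)"
        using nonneg by (intro nn_integral_mono_AE) (auto simp: min_def split: split_indicator elim!: eventually_mono intro: order_trans[OF _ add_increasing])
      also have "\<dots> = (\<integral>\<^sup>+ x. ennreal (min (?f k x) K) \<partial>M) + (\<integral>\<^sup>+ x. ennreal (Y (?\<rho> k x) x) * indicator {x. Y (?\<rho> k x) x \<in> {K<..}} x * indicator B x \<partial>M)"
      proof (rule nn_integral_add)
        have "(\<lambda>x. ennreal (Y (?\<rho> k x) x) * indicator {x. Y (?\<rho> k x) x \<in> {K<..}} x * indicator B x) = (\<lambda>x. ennreal (?f k x) * indicator {x. K < ?f k x} x)"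
          using K by (intro ext) (auto split: split_indicator)
        also have "\<dots> \<in> borel_measurable M" by measurable
        finally show "(\<lambda>x. ennreal (Y (?\<rho> k x) x) * indicator {x. Y (?\<rho> k x) x \<in> {K<..}} x * indicator B x) \<in> borel_measurable M" .
      qed measurable
      also have "(\<integral>\<^sup>+ x. ennreal (Y (?\<rho> k x) x) * indicator {x. Y (?\<rho> k x) x \<in> {K<..}} x * indicator B x \<partial>M)
        = (\<integral>\<^sup>+ x. ennreal (Y t x) * indicator {x. Y (?\<rho> k x) x \<in> {K<..}} x * indicator B x \<partial>M)"
        by (subst st_grid(1)) auto
      \<comment> \<open>The part above \<open>K\<close> has been rewritten with \<open>Y t\<close>.
        Where \<open>Y t\<close> exceeds \<open>L\<close>, its tail is small; where it does not,
        \<open>L\<close> is at most \<open>L / K\<close> times the value on the grid, which is above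
        \<open>K\<close> there.\<close>
      also have "\<dots> \<le> (\<integral>\<^sup>+ x. ennreal (Y t x) * indicator {x. L < Y t x} x + ennreal (L / K) * ennreal (?f k x) \<partial>M)"
      proof (rule nn_integral_mono_AE)
        show "AE x in M. ennreal (Y t x) * indicator {x. Y (?\<rho> k x) x \<in> {K<..}} x * indicator B x
          \<le> ennreal (Y t x) * indicator {x. L < Y t x} x + ennreal (L / K) * ennreal (?f k x)"
          using nonneg
        proof eventually_elim
          case (elim x)
          show ?case
          proof (cases "x \<in> B \<and> K < Y (?\<rho> k x) x \<and> Y t x \<le> L")
            case True
            have "Y t x \<le> L / K * Y (?\<rho> k x) x"
            proof -
              have "L * K \<le> L * Y (?\<rho> k x) x" using True L by (intro mult_left_mono) auto
              then have "L \<le> L / K * Y (?\<rho> k x) x" using K by (simp add: field_simps)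
              then show ?thesis using True by simp
            qed
            then have "ennreal (Y t x) \<le> ennreal (L / K) * ennreal (?f k x)"
              using True L K elim by (simp add: ennreal_mult[symmetric] ennreal_leI)
            then show ?thesis using True by simp
          qed (auto split: split_indicator)
        qed
      qed
      also have "\<dots> = (\<integral>\<^sup>+ x. ennreal (Y t x) * indicator {x. L < Y t x} x \<partial>M) + ennreal (L / K) * ?c"
        using st by (subst nn_integral_add) (auto simp: nn_integral_cmult tot)
      also have "\<dots> \<le> ennreal (e / 2) + ennreal (e / 2)"
      proof (rule add_mono[OF L(2)])
        have "ennreal (L / K) * ?c \<le> ennreal (L / K) * ennreal \<bar>?m\<bar>"
          unfolding cfin by (intro mult_left_mono ennreal_leI) auto
        also have "\<dots> = ennreal (L / K * \<bar>?m\<bar>)" using L K by (intro ennreal_mult[symmetric]) auto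
        also have "L / K * \<bar>?m\<bar> \<le> e / 2"
        proof -
          have "L / (2 * L * b / e) = e / (2 * b)" if "0 < b" for b
            using L(1) e that by (simp add: field_simps)
          from this[of "\<bar>?m\<bar> + 1"] have "L / K = e / (2 * (\<bar>?m\<bar> + 1))" by (simp add: K_def)
          then have "L / K * \<bar>?m\<bar> = e / 2 * (\<bar>?m\<bar> / (\<bar>?m\<bar> + 1))" by simp
          also have "\<dots> \<le> e / 2 * 1" using e by (intro mult_left_mono) auto
          finally show ?thesis by simp
        qed
        finally show "ennreal (L / K) * ?c \<le> ennreal (e / 2)" by (simp add: ennreal_leI)
      qed
      also have "\<dots> = ennreal e" using e by (simp add: ennreal_plus[symmetric] del: ennreal_plus)
      finally show ?thesis by (simp add: add_left_mono)
    qed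
    moreover have "(\<lambda>k. (\<integral>\<^sup>+ x. ennreal (min (?f k x) K) \<partial>M) + ennreal e) \<longlonglongrightarrow> (\<integral>\<^sup>+ x. ennreal (min (?F x) K) \<partial>M) + ennreal e"
    proof (intro tendsto_add tendsto_const nn_integral_dominated_convergence[where w="\<lambda>_. ennreal K"])
      show "AE x in M. (\<lambda>k. ennreal (min (?f k x) K)) \<longlonglongrightarrow> ennreal (min (?F x) K)"
        using lim by (intro AE_I2 tendsto_ennrealI tendsto_min tendsto_const)
    qed (auto simp: emeasure_space_1 ennreal_leI)
    ultimately have "?c \<le> (\<integral>\<^sup>+ x. ennreal (min (?F x) K) \<partial>M) + ennreal e"
      by (meson LIMSEQ_le_const)
    also have "\<dots> \<le> ?I + ennreal e"
      by (intro add_right_mono nn_integral_mono ennreal_leI) simp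
    finally show ?thesis .
  qed
  have "?c \<le> ?I" by (rule ennreal_le_epsilon) (rule ge)
  with le show "(\<integral>\<^sup>+ x. ennreal (Y (min t (\<tau> x)) x) * indicator B x \<partial>M) = ?c"
    unfolding conv by (rule antisym)
qed

end

section \<open>BESQ(0) in its own filtration\<close>

context besq0_solution
begin

lemma natural_filtration_sub:
  "sets (natural_filtration (space M) (UNIV :: unit set) (\<lambda>_. X) s) \<subseteq> sets M \<inter> sets (F s)"
proof -
  let ?G = "{X s' -` B \<inter> space M | (i :: unit) s' B. i \<in> UNIV \<and> 0 \<le> s' \<and> s' \<le> s \<and> B \<in> sets borel}"
  have G: "?G \<subseteq> Pow (space M)" by auto
  have "X u -` B \<inter> space M \<in> sets (F s)" if "0 \<le> u" "u \<le> s" "B \<in> sets borel" for u B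
    using measurable_sets[OF measurable_F_mono[OF that(2)] that(3), of "X u"] X_adapted that by (simp add: adapted_def)
  then have "?G \<subseteq> sets (F s)" "?G \<subseteq> sets M" using X_measurable by (auto intro: measurable_sets)
  then show ?thesis
    unfolding natural_filtration_def sets_measure_of[OF G]
    using sets.sigma_sets_subset[of ?G "F s"] sets.sigma_sets_subset[of ?G M] by auto
qed

lemma pos_martingale_X: "pos_martingale M (natural_filtration (space M) (UNIV :: unit set) (\<lambda>_. X)) X"
proof (unfold_locales)
  show "filtered M (natural_filtration (space M) (UNIV :: unit set) (\<lambda>_. X))"
    by (rule filtered_natural_filtration) simp
  show "X t \<in> borel_measurable (natural_filtration (space M) (UNIV :: unit set) (\<lambda>_. X) t)" if "0 \<le> t" for t
    by (rule natural_filtration_measurable[where Y="\<lambda>_ :: unit. X"]) (use that in auto)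
  show "AE x in M. \<forall>t\<ge>0. 0 \<le> X t x" using X_nonneg by (intro AE_I2) auto
  show "(\<integral>x\<in>A. X t x \<partial>M) = (\<integral>x\<in>A. X s x \<partial>M)"
    if "0 \<le> s" "s \<le> t" "A \<in> sets (natural_filtration (space M) (UNIV :: unit set) (\<lambda>_. X) s)" for s t A
    using that natural_filtration_sub by (intro X_martingale) auto
qed (auto intro: X_integrable X_continuous_on)

text \<open>A low driver forces a zero by time 1, absorption keeps the process there, and the
  Gaussian increment of the driver is low with positive probability.\<close>

lemma zero_positive_prob: "0 < prob {x \<in> space M. X 1 x = 0}"
proof -
  interpret Y: pos_martingale M "natural_filtration (space M) (UNIV :: unit set) (\<lambda>_. X)" X
    by (rule pos_martingale_X)
  have "0 < prob {x \<in> space M. \<beta> 1 x - \<beta> 0 x < - sqrt z - 1}" by (rule driver_low_positive)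
  also have "\<dots> \<le> prob {x \<in> space M. X 1 x = 0}"
  proof (rule finite_measure_mono_AE)
    show "AE x in M. x \<in> {x \<in> space M. \<beta> 1 x - \<beta> 0 x < - sqrt z - 1} \<longrightarrow> x \<in> {x \<in> space M. X 1 x = 0}"
      using hits_zero_if_driver_low Y.absorbed_at_zero by eventually_elim force
    show "{x \<in> space M. X 1 x = 0} \<in> events" using X_measurable[of 1] by simp
  qed
  finally show ?thesis .
qed

end

lemma besq0_obtains_solution:
  assumes "besq0 M z X" "0 \<le> z"
  obtains \<beta> J where "besq0_solution M \<beta> X J z"
proof -
  obtain \<beta> F J where *: "brownian_motion M \<beta>"
    "F = usual_augmentation M (natural_filtration (space M) (UNIV :: unit set) (\<lambda>_. \<beta>))"
    "adapted F X" "ito_integral (completion M) F \<beta> (\<lambda>t x. sqrt (X t x)) J" "AE x in M. \<forall>t\<ge>0. X t x = z + 2 * J t x"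
    using assms(1) unfolding besq0_def by blast
  interpret brownian M \<beta> by unfold_locales (rule *)
  have "besq0_solution M \<beta> X J z"
    by unfold_locales (use assms * in \<open>auto simp: besq0_def random_process_def N_def\<close>)
  then show thesis by (rule that)
qed

section \<open>Independent BESQ(0) processes on path space\<close>

abbreviation coord_filtration :: "nat \<Rightarrow> real \<Rightarrow> (nat \<Rightarrow> real \<Rightarrow> real) measure" where
  "coord_filtration n \<equiv> natural_filtration (cont_paths n) {1..n} (\<lambda>i t \<omega>. \<omega> i t)"

lemma space_path_space [simp]: "space (path_space n) = cont_paths n"
  by (auto simp: path_space_def space_restrict_space space_PiM cont_paths_def)

lemma coord_measurable: "i \<in> {1..n} \<Longrightarrow> 0 \<le> t \<Longrightarrow> (\<lambda>\<omega>. \<omega> i t) \<in> borel_measurable (path_space n)"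
  unfolding path_space_def
  by (rule measurable_restrict_space1, rule measurable_compose[where f="\<lambda>\<omega>. \<omega> i" and g="\<lambda>f. f t"])
    (auto intro: measurable_component_singleton[where M="\<lambda>_. \<Pi>\<^sub>M t\<in>{0..}. borel"]
      measurable_component_singleton[where M="\<lambda>_. borel"])

lemma joint_path_measurable:
  assumes "\<And>i. i \<in> {1..n} \<Longrightarrow> random_process M (Z i) \<and> continuous_paths M (Z i)"
  shows "joint_path n Z \<in> measurable M (path_space n)"
  unfolding path_space_def joint_path_def[abs_def]
proof (rule measurable_restrict_space2)
  show "(\<lambda>x. \<lambda>i\<in>{1..n}. \<lambda>t\<in>{0..}. Z i t x) \<in> space M \<rightarrow> cont_paths n"
    using assms by (auto simp: cont_paths_def continuous_paths_def cong: continuous_on_cong_simp)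
  show "(\<lambda>x. \<lambda>i\<in>{1..n}. \<lambda>t\<in>{0..}. Z i t x) \<in> measurable M (\<Pi>\<^sub>M i\<in>{1..n}. \<Pi>\<^sub>M t\<in>{0 :: real..}. (borel :: real measure))"
    using assms by (intro measurable_restrict) (auto simp: random_process_def)
qed

lemma augmented_path:
  assumes "sets Q = sets (path_space n)"
  shows "augmented Q (coord_filtration n)"
proof
  have "space Q = cont_paths n" using sets_eq_imp_space_eq[OF assms] by simp
  moreover have "filtered Q (natural_filtration (space Q) {1..n} (\<lambda>i t \<omega>. \<omega> i t))"
    by (rule filtered_natural_filtration) (use coord_measurable in \<open>simp add: measurable_cong_sets[OF assms refl]\<close>)
  ultimately show "filtered Q (coord_filtration n)" by simp
qed

text \<open>One finite set of times is shared by all coordinates, with \<open>UNIV\<close> where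
  nothing is demanded. In this form the events are closed under intersection and factor over the
  coordinates.\<close>

definition cylinders :: "nat \<Rightarrow> real \<Rightarrow> (nat \<Rightarrow> real \<Rightarrow> real) set set" where
  "cylinders n s = {{\<omega> \<in> cont_paths n. \<forall>i\<in>{1..n}. \<forall>u\<in>T. \<omega> i u \<in> B i u} | T B.
     finite T \<and> T \<subseteq> {0..s} \<and> (\<forall>i u. B i u \<in> sets borel)}"

lemma cylindersI:
  assumes "finite T" "T \<subseteq> {0..s}" "\<And>i u. B i u \<in> sets borel"
  shows "{\<omega> \<in> cont_paths n. \<forall>i\<in>{1..n}. \<forall>u\<in>T. \<omega> i u \<in> B i u} \<in> cylinders n s"
  unfolding cylinders_def mem_Collect_eq using assms by (intro exI[of _ T] exI[of _ B]) simp

lemma cylindersE: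
  assumes "A \<in> cylinders n s"
  obtains T B where "A = {\<omega> \<in> cont_paths n. \<forall>i\<in>{1..n}. \<forall>u\<in>T. \<omega> i u \<in> B i u}"
    "finite T" "T \<subseteq> {0..s}" "\<forall>i u. B i u \<in> sets borel"
  using assms unfolding cylinders_def mem_Collect_eq by (elim exE conjE)

lemma Int_stable_cylinders: "Int_stable (cylinders n s)"
proof (rule Int_stableI)
  fix A A' assume "A \<in> cylinders n s" "A' \<in> cylinders n s"
  obtain T B where A: "A = {\<omega> \<in> cont_paths n. \<forall>i\<in>{1..n}. \<forall>u\<in>T. \<omega> i u \<in> B i u}" "finite T" "T \<subseteq> {0..s}" "\<forall>i u. B i u \<in> sets borel"
    by (rule cylindersE[OF \<open>A \<in> cylinders n s\<close>])
  obtain T' B' where A': "A' = {\<omega> \<in> cont_paths n. \<forall>i\<in>{1..n}. \<forall>u\<in>T'. \<omega> i u \<in> B' i u}" "finite T'" "T' \<subseteq> {0..s}" "\<forall>i u. B' i u \<in> sets borel"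
    by (rule cylindersE[OF \<open>A' \<in> cylinders n s\<close>])
  let ?B = "\<lambda>i u. (if u \<in> T then B i u else UNIV) \<inter> (if u \<in> T' then B' i u else UNIV)"
  have "A \<inter> A' = {\<omega> \<in> cont_paths n. \<forall>i\<in>{1..n}. \<forall>u\<in>T \<union> T'. \<omega> i u \<in> ?B i u}"
    unfolding A(1) A'(1) by auto
  also have "\<dots> \<in> cylinders n s"
    by (rule cylindersI) (use A(2-) A'(2-) in auto)
  finally show "A \<inter> A' \<in> cylinders n s" .
qed

lemma sets_coord_filtration: "sets (coord_filtration n s) = sigma_sets (cont_paths n) (cylinders n s)"
proof -
  let ?G = "{(\<lambda>\<omega>. \<omega> i u) -` B \<inter> cont_paths n | i u B. i \<in> {1..n} \<and> 0 \<le> u \<and> u \<le> s \<and> B \<in> sets (borel :: real measure)}"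
  have G: "?G \<subseteq> Pow (cont_paths n)" by auto
  have C: "cylinders n s \<subseteq> Pow (cont_paths n)" by (auto simp: cylinders_def)
  have "sigma_sets (cont_paths n) ?G = sigma_sets (cont_paths n) (cylinders n s)"
  proof (rule sigma_sets_eqI)
    fix A assume "A \<in> ?G"
    then obtain i u B where A: "A = (\<lambda>\<omega>. \<omega> i u) -` B \<inter> cont_paths n" "i \<in> {1..n}" "0 \<le> u" "u \<le> s" "B \<in> sets (borel :: real measure)" by blast
    have "A = {\<omega> \<in> cont_paths n. \<forall>j\<in>{1..n}. \<forall>v\<in>{u}. \<omega> j v \<in> (if j = i then B else UNIV)}" using A by auto
    also have "\<dots> \<in> cylinders n s"
      by (rule cylindersI) (use A in auto)
    finally show "A \<in> sigma_sets (cont_paths n) (cylinders n s)" by (rule sigma_sets.Basic)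
  next
    fix A assume "A \<in> cylinders n s"
    obtain T B where A: "A = {\<omega> \<in> cont_paths n. \<forall>i\<in>{1..n}. \<forall>u\<in>T. \<omega> i u \<in> B i u}" "finite T" "T \<subseteq> {0..s}" "\<forall>i u. B i u \<in> sets borel"
      by (rule cylindersE[OF \<open>A \<in> cylinders n s\<close>])
    interpret sigma_algebra "cont_paths n" "sigma_sets (cont_paths n) ?G" by (rule sigma_algebra_sigma_sets[OF G])
    have gen: "(\<lambda>\<omega>. \<omega> i u) -` B i u \<inter> cont_paths n \<in> sigma_sets (cont_paths n) ?G" if "i \<in> {1..n}" "u \<in> T" for i u
    proof -
      have "0 \<le> u" "u \<le> s" using A(3) that by auto
      moreover have "B i u \<in> sets borel" using A(4) by simp
      ultimately have "(\<lambda>\<omega>. \<omega> i u) -` B i u \<inter> cont_paths n \<in> ?G"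
        using that(1) by - (rule CollectI, rule exI[of _ i], rule exI[of _ u], rule exI[of _ "B i u"], simp only: simp_thms)
      then show ?thesis by (rule sigma_sets.Basic)
    qed
    define C where "C i u = (\<lambda>\<omega>. \<omega> i u) -` B i u \<inter> cont_paths n" for i u
    have "A = cont_paths n - (\<Union>i\<in>{1..n}. \<Union>u\<in>T. cont_paths n - C i u)"
      unfolding A(1) C_def by blast
    also have "\<dots> \<in> sigma_sets (cont_paths n) ?G"
    proof (intro Diff top finite_UN finite_atLeastAtMost A(2))
      fix i u assume "i \<in> {1..n}" "u \<in> T"
      from gen[OF this] show "C i u \<in> sigma_sets (cont_paths n) ?G" unfolding C_def .
    qed
    finally show "A \<in> sigma_sets (cont_paths n) ?G" .
  qed
  then show ?thesis unfolding natural_filtration_def sets_measure_of[OF G] .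
qed

text \<open>What is needed of the law of independent processes, in a form that is stable under
  permutations of the coordinates.\<close>

locale product_law = prob_space Q for Q :: "(nat \<Rightarrow> real \<Rightarrow> real) measure" +
  fixes n :: nat and z :: real
  assumes sets_Q: "sets Q = sets (path_space n)" and n: "2 \<le> n" and z: "0 < z"
    and nonneg: "AE \<omega> in Q. \<forall>i\<in>{1..n}. \<forall>t\<ge>0. 0 \<le> \<omega> i t"
    and start: "AE \<omega> in Q. \<forall>i\<in>{1..n}. \<omega> i 0 = z"
    and prod_integrable: "\<And>I t. I \<subseteq> {1..n} \<Longrightarrow> 0 \<le> t \<Longrightarrow> integrable Q (\<lambda>\<omega>. \<Prod>i\<in>I. \<omega> i t)"
    and prod_martingale: "\<And>I s t A. I \<subseteq> {1..n} \<Longrightarrow> 0 \<le> s \<Longrightarrow> s \<le> t \<Longrightarrow> A \<in> sets (coord_filtration n s) \<Longrightarrow>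
      (\<integral>\<omega>\<in>A. (\<Prod>i\<in>I. \<omega> i t) \<partial>Q) = (\<integral>\<omega>\<in>A. (\<Prod>i\<in>I. \<omega> i s) \<partial>Q)"
    and prod_dead_positive: "\<And>I k. I \<subseteq> {1..n} \<Longrightarrow> k \<in> {1..n} - I \<Longrightarrow>
      0 < (\<integral>\<omega>. indicator {\<omega>. \<omega> k 1 = 0} \<omega> * (\<Prod>i\<in>I. \<omega> i 1) \<partial>Q)"

section \<open>Products of independent coordinates\<close>

locale indep_besq0 = prob_space W for W :: "'w measure" +
  fixes n :: nat and z :: real and X :: "nat \<Rightarrow> real \<Rightarrow> 'w \<Rightarrow> real"
  assumes n: "2 \<le> n" and z: "0 < z"
    and besq: "\<And>i. i \<in> {1..n} \<Longrightarrow> besq0 W z (X i)"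
    and indep: "indep_vars (\<lambda>_. \<Pi>\<^sub>M t\<in>{0 :: real..}. (borel :: real measure)) (\<lambda>i x. \<lambda>t\<in>{0..}. X i t x) {1..n}"
begin

lemma X_process: "i \<in> {1..n} \<Longrightarrow> random_process W (X i) \<and> continuous_paths W (X i)"
  using besq by (auto simp: besq0_def)

lemma X_meas: "i \<in> {1..n} \<Longrightarrow> 0 \<le> t \<Longrightarrow> X i t \<in> borel_measurable W"
  using X_process by (simp add: random_process_def)

lemma X_nn: "i \<in> {1..n} \<Longrightarrow> 0 \<le> t \<Longrightarrow> x \<in> space W \<Longrightarrow> 0 \<le> X i t x"
  using besq by (auto simp: besq0_def)

text \<open>The driver of a coordinate and its filtration are eliminated here. What remains speaks
  of \<open>X i\<close> alone, with the past tested by finitely many of its own values, and can be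
  combined across coordinates by independence.\<close>

lemma X_single:
  assumes i: "i \<in> {1..n}"
  shows "AE x in W. X i 0 x = z" "0 < prob {x \<in> space W. X i 1 x = 0}"
    "0 \<le> t \<Longrightarrow> integrable W (X i t)"
    "0 \<le> s \<Longrightarrow> s \<le> t \<Longrightarrow> finite T \<Longrightarrow> T \<subseteq> {0..s} \<Longrightarrow> (\<And>u. B u \<in> sets borel) \<Longrightarrow>
      (\<integral>x. (\<Prod>u\<in>T. indicator (B u) (X i u x)) * X i t x \<partial>W) = (\<integral>x. (\<Prod>u\<in>T. indicator (B u) (X i u x)) * X i s x \<partial>W)"
proof -
  obtain \<beta> J where "besq0_solution W \<beta> (X i) J z"
    using besq0_obtains_solution[OF besq[OF i]] z by auto
  then interpret S: besq0_solution W \<beta> "X i" J z .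
  show "AE x in W. X i 0 x = z" by (rule S.X_0)
  show "0 < prob {x \<in> space W. X i 1 x = 0}" by (rule S.zero_positive_prob)
  show "integrable W (X i t)" if "0 \<le> t" by (rule S.X_integrable[OF that])
  assume st: "0 \<le> s" "s \<le> t" and T: "finite T" "T \<subseteq> {0..s}" and B: "\<And>u. B u \<in> sets borel"
  let ?A = "{x \<in> space W. \<forall>u\<in>T. X i u x \<in> B u}"
  define C where "C u = {x \<in> space W. X i u x \<in> B u}" for u
  have sub: "C u \<in> sets W \<inter> sets (S.F s)" if "u \<in> T" for u
  proof -
    have u: "0 \<le> u" "u \<le> s" using T that by auto
    have "X i u \<in> borel_measurable (S.F s)"
      using S.X_adapted u by (intro S.measurable_F_mono[OF u(2)]) (simp add: adapted_def)
    from measurable_sets[OF this B[of u]] measurable_sets[OF X_meas[OF i u(1)] B[of u]]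
    show ?thesis by (auto simp: C_def vimage_def Int_def conj_commute)
  qed
  have eq: "?A = space W - (\<Union>u\<in>T. space W - C u)" by (auto simp: C_def)
  have "space W \<in> sets (S.F s)" using sets.top[of "S.F s"] by simp
  then have A: "?A \<in> sets W" "?A \<in> sets (S.F s)"
    unfolding eq using sub by (intro sets.Diff sets.finite_UN T(1); blast)+
  have "(\<integral>x. (\<Prod>u\<in>T. indicator (B u) (X i u x)) * X i v x \<partial>W) = (\<integral>x\<in>?A. X i v x \<partial>W)" for v
    unfolding set_lebesgue_integral_def
  proof (rule Bochner_Integration.integral_cong[OF refl])
    fix x assume x: "x \<in> space W"
    have "(\<Prod>u\<in>T. indicator (B u) (X i u x)) = (indicator ?A x :: real)"
    proof (cases "x \<in> ?A")
      case False
      then obtain u where u: "u \<in> T" "X i u x \<notin> B u" using x by auto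
      have "(\<Prod>u\<in>T. indicator (B u) (X i u x) :: real) = 0"
        by (rule prod_zero[OF T(1)]) (use u in \<open>auto intro!: bexI[of _ u]\<close>)
      then show ?thesis using False by simp
    qed (auto intro: prod.neutral)
    then show "(\<Prod>u\<in>T. indicator (B u) (X i u x)) * X i v x = indicator ?A x *\<^sub>R X i v x" by simp
  qed
  then show "(\<integral>x. (\<Prod>u\<in>T. indicator (B u) (X i u x)) * X i t x \<partial>W) = (\<integral>x. (\<Prod>u\<in>T. indicator (B u) (X i u x)) * X i s x \<partial>W)"
    using S.X_martingale[OF st A] by simp
qed

lemma indep_functionals:
  assumes g: "\<And>i. i \<in> {1..n} \<Longrightarrow> g i \<in> borel_measurable (\<Pi>\<^sub>M t\<in>{0 :: real..}. (borel :: real measure))"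
    and int: "\<And>i. i \<in> {1..n} \<Longrightarrow> integrable W (\<lambda>x. g i (\<lambda>t\<in>{0..}. X i t x) :: real)"
  shows "(\<integral>x. (\<Prod>i\<in>{1..n}. g i (\<lambda>t\<in>{0..}. X i t x)) \<partial>W) = (\<Prod>i\<in>{1..n}. \<integral>x. g i (\<lambda>t\<in>{0..}. X i t x) \<partial>W)"
    "integrable W (\<lambda>x. \<Prod>i\<in>{1..n}. g i (\<lambda>t\<in>{0..}. X i t x))"
proof -
  have "indep_vars (\<lambda>_. borel) (\<lambda>i x. g i (\<lambda>t\<in>{0..}. X i t x)) {1..n}"
    by (rule indep_vars_compose2[OF indep]) (rule g)
  from indep_vars_lebesgue_integral[OF _ this int] indep_vars_integrable[OF _ this int]
  show "(\<integral>x. (\<Prod>i\<in>{1..n}. g i (\<lambda>t\<in>{0..}. X i t x)) \<partial>W) = (\<Prod>i\<in>{1..n}. \<integral>x. g i (\<lambda>t\<in>{0..}. X i t x) \<partial>W)"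
    "integrable W (\<lambda>x. \<Prod>i\<in>{1..n}. g i (\<lambda>t\<in>{0..}. X i t x))" by auto
qed

text \<open>The indicator of a cylinder event is a product over coordinates and times, so the whole
  integrand is a product of functionals of single coordinates; coordinates outside \<open>I\<close>
  contribute only their indicators.\<close>

lemma cylinder_product:
  assumes I: "I \<subseteq> {1..n}" and T: "finite T" "T \<subseteq> {0..}" and B: "\<And>i u. B i u \<in> sets borel" and v: "0 \<le> v"
  defines "f \<equiv> \<lambda>i x. (\<Prod>u\<in>T. indicator (B i u) (X i u x)) * (if i \<in> I then X i v x else 1)"
  shows "(\<integral>x. indicator {x. \<forall>i\<in>{1..n}. \<forall>u\<in>T. X i u x \<in> B i u} x * (\<Prod>i\<in>I. X i v x) \<partial>W) = (\<Prod>i\<in>{1..n}. \<integral>x. f i x \<partial>W)"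
    and "integrable W (\<lambda>x. indicator {x. \<forall>i\<in>{1..n}. \<forall>u\<in>T. X i u x \<in> B i u} x * (\<Prod>i\<in>I. X i v x))"
    and "i \<in> {1..n} \<Longrightarrow> integrable W (f i)"
proof -
  define g where "g i \<omega> = (\<Prod>u\<in>T. indicator (B i u) (\<omega> u)) * (if i \<in> I then \<omega> v else 1)" for i and \<omega> :: "real \<Rightarrow> real"
  have gf: "g i (\<lambda>t\<in>{0..}. X i t x) = f i x" for i x
  proof -
    have "(\<Prod>u\<in>T. indicator (B i u) ((\<lambda>t\<in>{0..}. X i t x) u) :: real) = (\<Prod>u\<in>T. indicator (B i u) (X i u x))"
      using T by (intro prod.cong) auto
    then show ?thesis using v by (simp add: g_def f_def)
  qed
  have g: "g i \<in> borel_measurable (\<Pi>\<^sub>M t\<in>{0 :: real..}. (borel :: real measure))" for i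
  proof -
    have c: "(\<lambda>\<omega>. \<omega> u) \<in> borel_measurable (\<Pi>\<^sub>M t\<in>{0 :: real..}. (borel :: real measure))" if "0 \<le> u" for u
      using that by (intro measurable_component_singleton) auto
    have "(\<lambda>\<omega>. \<Prod>u\<in>T. indicator (B i u) (\<omega> u) :: real) \<in> borel_measurable (\<Pi>\<^sub>M t\<in>{0 :: real..}. (borel :: real measure))"
    proof (rule borel_measurable_prod)
      fix u assume "u \<in> T"
      then have "0 \<le> u" using T by auto
      from measurable_compose[OF c[OF this] borel_measurable_indicator[OF B]]
      show "(\<lambda>\<omega>. indicator (B i u) (\<omega> u) :: real) \<in> borel_measurable (\<Pi>\<^sub>M t\<in>{0 :: real..}. (borel :: real measure))" .
    qed
    then show ?thesis unfolding g_def[abs_def] using c[OF v] by (intro borel_measurable_times) auto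
  qed
  have int: "integrable W (f i)" if i: "i \<in> {1..n}" for i
  proof (rule Bochner_Integration.integrable_bound)
    show "integrable W (\<lambda>x. if i \<in> I then X i v x else 1)" using X_single(3)[OF i v] by (cases "i \<in> I") auto
    have "(\<lambda>x. \<lambda>t\<in>{0..}. X i t x) \<in> measurable W (\<Pi>\<^sub>M t\<in>{0 :: real..}. (borel :: real measure))"
      using X_meas[OF i] by (intro measurable_restrict) auto
    from measurable_compose[OF this g[of i]] show "f i \<in> borel_measurable W" by (simp add: gf)
    have "\<bar>\<Prod>u\<in>T. indicator (B i u) (X i u x) :: real\<bar> \<le> 1" for x
      unfolding abs_prod by (rule prod_le_1) auto
    then show "AE x in W. norm (f i x) \<le> norm (if i \<in> I then X i v x else 1)"
      unfolding f_def by (intro AE_I2) (auto simp: abs_mult intro: mult_left_le_one_le)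
  qed
  then show "i \<in> {1..n} \<Longrightarrow> integrable W (f i)" .
  have eq: "(\<Prod>i\<in>{1..n}. f i x) = indicator {x. \<forall>i\<in>{1..n}. \<forall>u\<in>T. X i u x \<in> B i u} x * (\<Prod>i\<in>I. X i v x)" for x
  proof -
    have "(\<Prod>i\<in>{1..n}. if i \<in> I then X i v x else 1) = (\<Prod>i\<in>I. X i v x)"
      using I by (simp add: prod.If_cases Int_absorb1)
    moreover have "(\<Prod>i\<in>{1..n}. \<Prod>u\<in>T. indicator (B i u) (X i u x) :: real) = indicator {x. \<forall>i\<in>{1..n}. \<forall>u\<in>T. X i u x \<in> B i u} x"
    proof (cases "x \<in> {x. \<forall>i\<in>{1..n}. \<forall>u\<in>T. X i u x \<in> B i u}")
      case False
      then obtain i u where iu: "i \<in> {1..n}" "u \<in> T" "X i u x \<notin> B i u" by auto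
      then have "(\<Prod>u\<in>T. indicator (B i u) (X i u x) :: real) = 0" using T(1) by (intro prod_zero bexI[of _ u]) auto
      then have "(\<Prod>i\<in>{1..n}. \<Prod>u\<in>T. indicator (B i u) (X i u x) :: real) = 0" by - (rule prod_zero[OF finite_atLeastAtMost], rule bexI[OF _ iu(1)])
      then show ?thesis using False by simp
    qed (auto intro!: prod.neutral)
    ultimately show ?thesis by (simp add: f_def prod.distrib)
  qed
  show "(\<integral>x. indicator {x. \<forall>i\<in>{1..n}. \<forall>u\<in>T. X i u x \<in> B i u} x * (\<Prod>i\<in>I. X i v x) \<partial>W) = (\<Prod>i\<in>{1..n}. \<integral>x. f i x \<partial>W)"
    "integrable W (\<lambda>x. indicator {x. \<forall>i\<in>{1..n}. \<forall>u\<in>T. X i u x \<in> B i u} x * (\<Prod>i\<in>I. X i v x))"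
    unfolding eq[symmetric] by (rule indep_functionals[of g, OF g, unfolded gf, OF int], assumption)+
qed

text \<open>After factoring at both times, each factor agrees by the martingale property of its own
  coordinate, so the drivers never have to be considered jointly.\<close>

lemma cylinder_martingale:
  assumes I: "I \<subseteq> {1..n}" and T: "finite T" "T \<subseteq> {0..s}" and B: "\<And>i u. B i u \<in> sets borel" and st: "0 \<le> s" "s \<le> t"
  shows "(\<integral>x. indicator {x. \<forall>i\<in>{1..n}. \<forall>u\<in>T. X i u x \<in> B i u} x * (\<Prod>i\<in>I. X i t x) \<partial>W)
    = (\<integral>x. indicator {x. \<forall>i\<in>{1..n}. \<forall>u\<in>T. X i u x \<in> B i u} x * (\<Prod>i\<in>I. X i s x) \<partial>W)"
proof -
  have T': "T \<subseteq> {0..}" and t: "0 \<le> t" using T st by auto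
  show ?thesis
    unfolding cylinder_product(1)[OF I T(1) T' B t] cylinder_product(1)[OF I T(1) T' B st(1)]
  proof (rule prod.cong[OF refl])
    fix i assume i: "i \<in> {1..n}"
    show "(\<integral>x. (\<Prod>u\<in>T. indicator (B i u) (X i u x)) * (if i \<in> I then X i t x else 1) \<partial>W)
      = (\<integral>x. (\<Prod>u\<in>T. indicator (B i u) (X i u x)) * (if i \<in> I then X i s x else 1) \<partial>W)"
      using X_single(4)[OF i st T, of "B i"] B by (cases "i \<in> I") auto
  qed
qed

end

lemma coord_filtration_measurable:
  "i \<in> {1..n} \<Longrightarrow> 0 \<le> s \<Longrightarrow> s \<le> t \<Longrightarrow> (\<lambda>\<omega>. \<omega> i s) \<in> borel_measurable (coord_filtration n t)"
  by (rule natural_filtration_measurable[where Y="\<lambda>i t \<omega>. \<omega> i t"])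

lemma sets_Collect_Ball:
  assumes "countable I" "\<And>i. i \<in> I \<Longrightarrow> {x \<in> space M. P i x} \<in> sets M"
  shows "{x \<in> space M. \<forall>i\<in>I. P i x} \<in> sets M"
proof -
  have "{x \<in> space M. \<forall>i\<in>I. P i x} = space M - (\<Union>i\<in>I. space M - {x \<in> space M. P i x})" by blast
  also have "\<dots> \<in> sets M" using assms by (intro sets.Diff sets.top sets.countable_UN'') auto
  finally show ?thesis .
qed

lemma coord_zero_sets:
  assumes "i \<in> {1..n}" "0 \<le> t"
  shows "{\<omega> \<in> space (path_space n). \<omega> i t = c} \<in> sets (path_space n)"
proof -
  note [measurable] = coord_measurable[OF assms]
  show ?thesis by measurable
qed

lemma start_sets: "{\<omega> \<in> space (path_space n). \<forall>i\<in>{1..n}. \<omega> i 0 = z} \<in> sets (path_space n)"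
  by (intro sets_Collect_Ball coord_zero_sets) auto

lemma nonneg_iff_rational:
  assumes f: "continuous_on {0..} (f :: real \<Rightarrow> real)"
  shows "(\<forall>t\<ge>0. 0 \<le> f t) \<longleftrightarrow> (\<forall>q\<in>\<rat> \<inter> {0..}. 0 \<le> f q)"
proof (intro iffI ballI allI impI)
  fix t :: real assume q: "\<forall>q\<in>\<rat> \<inter> {0..}. 0 \<le> f q" and t: "0 \<le> t"
  have "(\<lambda>k. f (real (nat \<lfloor>t * real (Suc k)\<rfloor>) / real (Suc k))) \<longlonglongrightarrow> f t"
    by (rule continuous_on_tendsto_compose[OF f grid_time_tendsto[OF t]]) (use t in auto)
  moreover have "0 \<le> f (real (nat \<lfloor>t * real (Suc k)\<rfloor>) / real (Suc k))" for k
  proof -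
    have "real (nat \<lfloor>t * real (Suc k)\<rfloor>) / real (Suc k) \<in> \<rat>" by (intro Rats_divide Rats_of_nat)
    then show ?thesis using q by auto
  qed
  ultimately show "0 \<le> f t" by (meson LIMSEQ_le_const)
qed auto

lemma nonneg_sets: "{\<omega> \<in> space (path_space n). \<forall>i\<in>{1..n}. \<forall>t\<ge>0. 0 \<le> \<omega> i t} \<in> sets (path_space n)"
proof -
  have "{\<omega> \<in> space (path_space n). \<forall>i\<in>{1..n}. \<forall>q\<in>\<rat> \<inter> {0..}. 0 \<le> \<omega> i q} \<in> sets (path_space n)"
  proof (intro sets_Collect_Ball)
    fix i and q :: real assume "i \<in> {1..n}" "q \<in> \<rat> \<inter> {0..}"
    then have [measurable]: "(\<lambda>\<omega>. \<omega> i q) \<in> borel_measurable (path_space n)" by (intro coord_measurable) auto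
    show "{\<omega> \<in> space (path_space n). 0 \<le> \<omega> i q} \<in> sets (path_space n)" by measurable
  qed (use countable_rat in auto)
  also have "{\<omega> \<in> space (path_space n). \<forall>i\<in>{1..n}. \<forall>q\<in>\<rat> \<inter> {0..}. 0 \<le> \<omega> i q}
    = {\<omega> \<in> space (path_space n). \<forall>i\<in>{1..n}. \<forall>t\<ge>0. 0 \<le> \<omega> i t}"
    by (intro Collect_cong conj_cong refl ball_cong nonneg_iff_rational[symmetric]) (simp add: cont_paths_def)
  finally show ?thesis .
qed

context indep_besq0
begin

text \<open>The events on which the martingale identity holds are closed under complements and
  disjoint unions, so the identity on the intersection-stable cylinders extends to the whole
  filtration.\<close>

lemma product_law_joint_path: "product_law (distr W (path_space n) (joint_path n X)) n z"
proof -
  let ?Q = "distr W (path_space n) (joint_path n X)"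
  have jm: "joint_path n X \<in> measurable W (path_space n)"
    by (rule joint_path_measurable) (rule X_process)
  interpret Q: prob_space ?Q by (rule prob_space_distr[OF jm])
  have jp: "joint_path n X x i t = X i t x" if "i \<in> {1..n}" "0 \<le> t" for x i t
    using that by (simp add: joint_path_def)
  have pm: "(\<lambda>\<omega>. \<Prod>i\<in>I. \<omega> i t) \<in> borel_measurable (path_space n)" if "I \<subseteq> {1..n}" "0 \<le> t" for I and t :: real
    using that by (intro borel_measurable_prod coord_measurable) auto
  have pj: "(\<Prod>i\<in>I. joint_path n X x i t) = (\<Prod>i\<in>I. X i t x)" if "I \<subseteq> {1..n}" "0 \<le> t" for I t x
    using that by (intro prod.cong jp) auto
  have int: "integrable ?Q (\<lambda>\<omega>. \<Prod>i\<in>I. \<omega> i t)" if I: "I \<subseteq> {1..n}" and t: "0 \<le> t" for I t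
  proof -
    have "integrable W (\<lambda>x. \<Prod>i\<in>I. X i t x)"
      using cylinder_product(2)[OF I, of "{}" "\<lambda>_ _. UNIV" t] t by simp
    then show ?thesis
      using pm[OF I t] by (subst integrable_distr_eq[OF jm]) (auto simp: pj[OF I t])
  qed
  have aug: "augmented ?Q (coord_filtration n)" by (rule augmented_path) simp
  show ?thesis
  proof (unfold_locales)
    show "2 \<le> n" "0 < z" by (rule n, rule z)
    show "sets ?Q = sets (path_space n)" by simp
    have "AE x in W. \<forall>i\<in>{1..n}. X i 0 x = z" using X_single(1) by (subst AE_ball_countable) auto
    then show "AE \<omega> in ?Q. \<forall>i\<in>{1..n}. \<omega> i 0 = z"
      using start_sets[of n z] by (subst AE_distr_iff[OF jm]) (auto simp: jp elim!: eventually_mono)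
    show "AE \<omega> in ?Q. \<forall>i\<in>{1..n}. \<forall>t\<ge>0. 0 \<le> \<omega> i t"
      using nonneg_sets[of n] X_nn by (subst AE_distr_iff[OF jm]) (auto simp: jp)
    show "integrable ?Q (\<lambda>\<omega>. \<Prod>i\<in>I. \<omega> i t)" if "I \<subseteq> {1..n}" "0 \<le> t" for I t
      by (rule int[OF that])
    fix I :: "nat set" assume I: "I \<subseteq> {1..n}"
    show "0 < (\<integral>\<omega>. indicator {\<omega>. \<omega> k 1 = 0} \<omega> * (\<Prod>i\<in>I. \<omega> i 1) \<partial>?Q)" if k: "k \<in> {1..n} - I" for k
    proof -
      \<comment> \<open>A cylinder at the single time 1 that forces coordinate \<open>k\<close> to
        be 0. After factoring, coordinate \<open>k\<close> contributes its probability of being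
        dead, each coordinate in \<open>I\<close> its mean \<open>z\<close>, and every other
        coordinate 1.\<close>
      let ?B = "\<lambda>i (u :: real). if i = k then {0 :: real} else UNIV"
      have km: "{\<omega> \<in> space (path_space n). \<omega> k 1 = 0} \<in> sets (path_space n)"
        using coord_zero_sets[of k n 1 0] k by simp
      have "(\<integral>\<omega>. indicator {\<omega>. \<omega> k 1 = 0} \<omega> * (\<Prod>i\<in>I. \<omega> i 1) \<partial>?Q) = (\<integral>\<omega>. indicator {\<omega> \<in> space (path_space n). \<omega> k 1 = 0} \<omega> * (\<Prod>i\<in>I. \<omega> i 1) \<partial>?Q)"
        by (intro Bochner_Integration.integral_cong) (auto split: split_indicator)
      also have "\<dots> = (\<integral>x. indicator {\<omega> \<in> space (path_space n). \<omega> k 1 = 0} (joint_path n X x) * (\<Prod>i\<in>I. joint_path n X x i 1) \<partial>W)"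
        using km pm[OF I, of 1] by (intro integral_distr[OF jm]) auto
      also have "\<dots> = (\<integral>x. indicator {x. \<forall>i\<in>{1..n}. \<forall>u\<in>{1}. X i u x \<in> ?B i u} x * (\<Prod>i\<in>I. X i 1 x) \<partial>W)"
      proof (rule Bochner_Integration.integral_cong[OF refl])
        fix x assume "x \<in> space W"
        then have "joint_path n X x \<in> space (path_space n)" using measurable_space[OF jm] by simp
        then show "indicator {\<omega> \<in> space (path_space n). \<omega> k 1 = 0} (joint_path n X x) * (\<Prod>i\<in>I. joint_path n X x i 1)
          = indicator {x. \<forall>i\<in>{1..n}. \<forall>u\<in>{1}. X i u x \<in> ?B i u} x * (\<Prod>i\<in>I. X i 1 x)"
          using k pj[OF I, of 1 x] jp[of k 1 x] by (auto split: split_indicator)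
      qed
      also have "\<dots> = (\<Prod>i\<in>{1..n}. \<integral>x. (\<Prod>u\<in>{1}. indicator (?B i u) (X i u x)) * (if i \<in> I then X i 1 x else 1) \<partial>W)"
        by (rule cylinder_product(1)[OF I]) auto
      also have "0 < \<dots>"
      proof (rule prod_pos)
        fix i assume i: "i \<in> {1..n}"
        consider "i = k" | "i \<in> I" "i \<noteq> k" | "i \<notin> I" "i \<noteq> k" by blast
        then show "0 < (\<integral>x. (\<Prod>u\<in>{1}. indicator (?B i u) (X i u x)) * (if i \<in> I then X i 1 x else 1) \<partial>W)"
        proof cases
          case 1
          have "(\<integral>x. (\<Prod>u\<in>{1}. indicator (?B i u) (X i u x)) * (if i \<in> I then X i 1 x else 1) \<partial>W) = (\<integral>x. indicator {x \<in> space W. X i 1 x = 0} x \<partial>W)"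
            using 1 k by (intro Bochner_Integration.integral_cong) (auto split: split_indicator)
          then show ?thesis using X_single(2)[OF i] X_meas[OF i, of 1] by simp
        next
          case 2
          have "(\<integral>x. X i 1 x \<partial>W) = (\<integral>x. X i 0 x \<partial>W)"
            using X_single(4)[OF i, of 0 1 "{}" "\<lambda>_. UNIV"] by simp
          also have "\<dots> = (\<integral>x. z \<partial>W)"
            using X_single(1)[OF i] X_meas[OF i, of 0] by (intro integral_cong_AE) auto
          finally show ?thesis using 2 z by (simp add: prob_space)
        qed (simp add: prob_space)
      qed
      finally show ?thesis .
    qed
    fix s t A assume st: "0 \<le> s" "s \<le> t" and A: "A \<in> sets (coord_filtration n s)"
    have t: "0 \<le> t" using st by simp
    have sig_sub: "B \<in> sets ?Q" if "B \<in> sigma_sets (cont_paths n) (cylinders n s)" for B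
      using augmented.sets_N[OF aug, of s] that unfolding sets_coord_filtration by blast
    have si: "set_integrable ?Q B (\<lambda>\<omega>. \<Prod>i\<in>I. \<omega> i v)" if "0 \<le> v" "B \<in> sets ?Q" for v B
      unfolding set_integrable_def by (rule integrable_mult_indicator[OF that(2) int[OF I that(1)]])
    have cyl: "(\<integral>\<omega>\<in>B. (\<Prod>i\<in>I. \<omega> i t) \<partial>?Q) = (\<integral>\<omega>\<in>B. (\<Prod>i\<in>I. \<omega> i s) \<partial>?Q)" if B: "B \<in> cylinders n s" for B
    proof -
      obtain T C where TC: "B = {\<omega> \<in> cont_paths n. \<forall>i\<in>{1..n}. \<forall>u\<in>T. \<omega> i u \<in> C i u}" "finite T" "T \<subseteq> {0..s}" "\<forall>i u. C i u \<in> sets borel"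
        by (rule cylindersE[OF B])
      have BQ: "B \<in> sets (path_space n)" using sig_sub[of B] B by auto
      have "(\<integral>\<omega>\<in>B. (\<Prod>i\<in>I. \<omega> i v) \<partial>?Q) = (\<integral>x. indicator {x. \<forall>i\<in>{1..n}. \<forall>u\<in>T. X i u x \<in> C i u} x * (\<Prod>i\<in>I. X i v x) \<partial>W)" if v: "0 \<le> v" for v
      proof -
        have "(\<integral>\<omega>\<in>B. (\<Prod>i\<in>I. \<omega> i v) \<partial>?Q) = (\<integral>x. indicator B (joint_path n X x) *\<^sub>R (\<Prod>i\<in>I. joint_path n X x i v) \<partial>W)"
          unfolding set_lebesgue_integral_def using BQ pm[OF I v] by (intro integral_distr[OF jm]) auto
        also have "\<dots> = (\<integral>x. indicator {x. \<forall>i\<in>{1..n}. \<forall>u\<in>T. X i u x \<in> C i u} x * (\<Prod>i\<in>I. X i v x) \<partial>W)"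
        proof (rule Bochner_Integration.integral_cong[OF refl])
          fix x assume "x \<in> space W"
          then have "joint_path n X x \<in> cont_paths n" using measurable_space[OF jm] by simp
          moreover have "joint_path n X x i u = X i u x" if "i \<in> {1..n}" "u \<in> T" for i u
            using that TC(3) by (intro jp) auto
          ultimately have "joint_path n X x \<in> B \<longleftrightarrow> (\<forall>i\<in>{1..n}. \<forall>u\<in>T. X i u x \<in> C i u)"
            unfolding TC(1) by simp
          then show "indicator B (joint_path n X x) *\<^sub>R (\<Prod>i\<in>I. joint_path n X x i v) = indicator {x. \<forall>i\<in>{1..n}. \<forall>u\<in>T. X i u x \<in> C i u} x * (\<Prod>i\<in>I. X i v x)"
            using pj[OF I v] by (simp add: indicator_def)
        qed
        finally show ?thesis .
      qed
      then show ?thesis using cylinder_martingale[OF I TC(2,3) _ st, of C] TC(4) st t by simp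
    qed
    have C: "cylinders n s \<subseteq> Pow (cont_paths n)" by (auto simp: cylinders_def)
    show "(\<integral>\<omega>\<in>A. (\<Prod>i\<in>I. \<omega> i t) \<partial>?Q) = (\<integral>\<omega>\<in>A. (\<Prod>i\<in>I. \<omega> i s) \<partial>?Q)"
      using A unfolding sets_coord_filtration
    proof (induction rule: sigma_sets_induct_disjoint[OF Int_stable_cylinders C, consumes 1])
      case (1 A) then show ?case by (rule cyl)
    next
      case 2 show ?case by (simp add: set_lebesgue_integral_def)
    next
      case (3 A)
      have top: "cont_paths n \<in> cylinders n s"
        using cylindersI[of "{}" s "\<lambda>_ _. UNIV" n] by simp
      have "(\<integral>\<omega>\<in>cont_paths n - A. (\<Prod>i\<in>I. \<omega> i v) \<partial>?Q) = (\<integral>\<omega>\<in>cont_paths n. (\<Prod>i\<in>I. \<omega> i v) \<partial>?Q) - (\<integral>\<omega>\<in>A. (\<Prod>i\<in>I. \<omega> i v) \<partial>?Q)" if "0 \<le> v" for v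
      proof -
        have AQ: "A \<in> sets ?Q" by (rule sig_sub[OF 3(1)])
        have TQ: "cont_paths n \<in> sets ?Q" using sets.top[of ?Q] by simp
        have "(\<integral>\<omega>\<in>A \<union> (cont_paths n - A). (\<Prod>i\<in>I. \<omega> i v) \<partial>?Q) = (\<integral>\<omega>\<in>A. (\<Prod>i\<in>I. \<omega> i v) \<partial>?Q) + (\<integral>\<omega>\<in>cont_paths n - A. (\<Prod>i\<in>I. \<omega> i v) \<partial>?Q)"
          using AQ TQ by (intro set_integral_Un si that sets.Diff) auto
        moreover have "A \<union> (cont_paths n - A) = cont_paths n" using sets.sets_into_space[OF AQ] by auto
        ultimately show ?thesis by simp
      qed
      then show ?case using 3(2) cyl[OF top] st t by simp
    next
      case (4 A)
      have AQ: "A i \<in> sets ?Q" for i using sig_sub 4(2) by blast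
      have "(\<integral>\<omega>\<in>(\<Union>i. A i). (\<Prod>i\<in>I. \<omega> i v) \<partial>?Q) = (\<Sum>i. \<integral>\<omega>\<in>A i. (\<Prod>i\<in>I. \<omega> i v) \<partial>?Q)" if "0 \<le> v" for v
        using 4(1) AQ by (intro lebesgue_integral_countable_add si that) (auto simp: disjoint_family_on_def)
      then show ?case using 4(3) st t by simp
    qed
  qed
qed

end

text \<open>The permutation of indices behind \<open>move_to_front\<close>: position
  \<open>j\<close> of the new path holds the old coordinate \<open>front_perm i j\<close>. Sums and
  products are reindexed along it.\<close>

definition front_perm :: "nat \<Rightarrow> nat \<Rightarrow> nat" where
  "front_perm i j = (if j = 1 then i else if j \<le> i then j - 1 else j)"

lemma move_to_front_eq: "move_to_front n i \<omega> = (\<lambda>j\<in>{1..n}. \<omega> (front_perm i j))"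
  by (auto simp: move_to_front_def front_perm_def)

lemma front_perm_bij:
  assumes "i \<in> {1..n}"
  shows "bij_betw (front_perm i) {1..n} {1..n}"
proof (rule bij_betw_byWitness[where f'="\<lambda>j. if j = i then 1 else if j < i then j + 1 else j"])
qed (use assms in \<open>auto simp: front_perm_def\<close>)

lemma move_to_front_measurable:
  assumes i: "i \<in> {1..n}"
  shows "move_to_front n i \<in> measurable (path_space n) (path_space n)"
proof -
  have p: "front_perm i j \<in> {1..n}" if "j \<in> {1..n}" for j
    using front_perm_bij[OF i] that by (auto simp: bij_betw_def)
  have "move_to_front n i \<in> measurable (path_space n) (\<Pi>\<^sub>M i\<in>{1..n}. \<Pi>\<^sub>M t\<in>{0 :: real..}. (borel :: real measure))"
    unfolding move_to_front_eq[abs_def]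
  proof (rule measurable_restrict)
    fix j assume "j \<in> {1..n}"
    from measurable_component_singleton[OF p[OF this], of "\<lambda>_. \<Pi>\<^sub>M t\<in>{0 :: real..}. (borel :: real measure)"]
    show "(\<lambda>\<omega>. \<omega> (front_perm i j)) \<in> measurable (path_space n) (\<Pi>\<^sub>M t\<in>{0 :: real..}. (borel :: real measure))"
      unfolding path_space_def by (rule measurable_restrict_space1)
  qed
  moreover have "move_to_front n i \<in> space (path_space n) \<rightarrow> cont_paths n"
    using p by (auto simp: move_to_front_eq cont_paths_def PiE_iff extensional_def)
  ultimately show ?thesis
    unfolding path_space_def[of n] by (intro measurable_restrict_space2) (auto simp: path_space_def)
qed

lemma move_to_front_vimage:
  assumes i: "i \<in> {1..n}" and A: "A \<in> sets (coord_filtration n s)"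
  shows "move_to_front n i -` A \<inter> cont_paths n \<in> sets (coord_filtration n s)"
proof -
  have p: "front_perm i j \<in> {1..n}" if "j \<in> {1..n}" for j
    using front_perm_bij[OF i] that by (auto simp: bij_betw_def)
  have sp: "space (coord_filtration n s) = cont_paths n"
    unfolding natural_filtration_def by (rule space_measure_of) auto
  have "move_to_front n i \<in> measurable (coord_filtration n s) (coord_filtration n s)"
    unfolding natural_filtration_def[of _ _ _ s]
  proof (rule measurable_measure_of)
    show "move_to_front n i \<in> space (sigma (cont_paths n) {(\<lambda>\<omega>. \<omega> i u) -` B \<inter> cont_paths n |i u B. i \<in> {1..n} \<and> 0 \<le> u \<and> u \<le> s \<and> B \<in> sets borel}) \<rightarrow> cont_paths n"
      using measurable_space[OF move_to_front_measurable[OF i]] sp by (auto simp: natural_filtration_def)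
    fix A assume "A \<in> {(\<lambda>\<omega>. \<omega> i u) -` B \<inter> cont_paths n |i u B. i \<in> {1..n} \<and> 0 \<le> u \<and> u \<le> s \<and> B \<in> sets (borel :: real measure)}"
    then obtain j u B where A: "A = (\<lambda>\<omega>. \<omega> j u) -` B \<inter> cont_paths n" "j \<in> {1..n}" "0 \<le> u" "u \<le> s" "B \<in> sets (borel :: real measure)" by blast
    have "move_to_front n i -` A \<inter> cont_paths n = (\<lambda>\<omega>. \<omega> (front_perm i j) u) -` B \<inter> cont_paths n"
      using A(2) measurable_space[OF move_to_front_measurable[OF i]] by (auto simp: A(1) move_to_front_eq)
    also have "\<dots> \<in> sets (coord_filtration n s)"
      using measurable_sets[OF coord_filtration_measurable[OF p[OF A(2)] A(3,4)] A(5)] sp by simp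
    finally show "move_to_front n i -` A \<inter> space (sigma (cont_paths n) {(\<lambda>\<omega>. \<omega> i u) -` B \<inter> cont_paths n |i u B. i \<in> {1..n} \<and> 0 \<le> u \<and> u \<le> s \<and> B \<in> sets borel})
      \<in> sets (sigma (cont_paths n) {(\<lambda>\<omega>. \<omega> i u) -` B \<inter> cont_paths n |i u B. i \<in> {1..n} \<and> 0 \<le> u \<and> u \<le> s \<and> B \<in> sets borel})"
      using sp by (simp add: natural_filtration_def)
  qed auto
  from measurable_sets[OF this A] sp show ?thesis by simp
qed

text \<open>The conditions on products are required for all index sets, so permuting the coordinates
  merely replaces \<open>I\<close> by its image and an event by its preimage, which has the same
  time horizon.\<close>

lemma (in product_law) product_law_move_to_front:
  assumes i: "i \<in> {1..n}"
  shows "product_law (distr Q (path_space n) (move_to_front n i)) n z"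
proof -
  let ?T = "move_to_front n i" and ?p = "front_perm i"
  let ?R = "distr Q (path_space n) ?T"
  have Tm: "?T \<in> measurable Q (path_space n)"
    using move_to_front_measurable[OF i] by (simp add: measurable_cong_sets[OF sets_Q refl])
  have sp: "space Q = cont_paths n" using sets_eq_imp_space_eq[OF sets_Q] by simp
  interpret R: prob_space ?R by (rule prob_space_distr[OF Tm])
  have p: "?p j \<in> {1..n}" if "j \<in> {1..n}" for j
    using front_perm_bij[OF i] that by (auto simp: bij_betw_def)
  have inj: "inj_on ?p I" if "I \<subseteq> {1..n}" for I
    using front_perm_bij[OF i] that by (auto simp: bij_betw_def intro: inj_on_subset)
  have pI: "?p ` I \<subseteq> {1..n}" if "I \<subseteq> {1..n}" for I using p that by auto
  have T: "?T \<omega> j = \<omega> (?p j)" if "j \<in> {1..n}" for \<omega> j using that by (simp add: move_to_front_eq)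
  have prodT: "(\<Prod>j\<in>I. ?T \<omega> j t) = (\<Prod>j\<in>?p ` I. \<omega> j t)" if "I \<subseteq> {1..n}" for I \<omega> t
    using that by (subst prod.reindex[OF inj[OF that]]) (auto intro!: prod.cong simp: T)
  have pm: "(\<lambda>\<omega>. \<Prod>i\<in>I. \<omega> i t) \<in> borel_measurable (path_space n)" if "I \<subseteq> {1..n}" "0 \<le> t" for I and t :: real
    using that by (intro borel_measurable_prod coord_measurable) auto
  have aug: "augmented ?R (coord_filtration n)" by (rule augmented_path) simp
  show ?thesis
  proof (unfold_locales)
    show "2 \<le> n" "0 < z" by (rule n, rule z)
    show "sets ?R = sets (path_space n)" by simp
    show "AE \<omega> in ?R. \<forall>i\<in>{1..n}. \<omega> i 0 = z"
    proof -
      show ?thesis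
        using start start_sets[of n z] p by (subst AE_distr_iff[OF Tm]) (auto simp: T elim!: eventually_mono)
    qed
    show "AE \<omega> in ?R. \<forall>i\<in>{1..n}. \<forall>t\<ge>0. 0 \<le> \<omega> i t"
      using nonneg nonneg_sets[of n] p by (subst AE_distr_iff[OF Tm]) (auto simp: T elim!: eventually_mono)
    fix I :: "nat set" assume I: "I \<subseteq> {1..n}"
    show "integrable ?R (\<lambda>\<omega>. \<Prod>i\<in>I. \<omega> i t)" if "0 \<le> t" for t
      using prod_integrable[OF pI[OF I] that] pm[OF I that]
      by (subst integrable_distr_eq[OF Tm]) (auto simp: prodT[OF I])
    show "0 < (\<integral>\<omega>. indicator {\<omega>. \<omega> k 1 = 0} \<omega> * (\<Prod>i\<in>I. \<omega> i 1) \<partial>?R)" if k: "k \<in> {1..n} - I" for k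
    proof -
      have km: "{\<omega> \<in> space (path_space n). \<omega> k 1 = 0} \<in> sets (path_space n)"
        using coord_zero_sets[of k n 1 0] k by simp
      have "(\<integral>\<omega>. indicator {\<omega>. \<omega> k 1 = 0} \<omega> * (\<Prod>i\<in>I. \<omega> i 1) \<partial>?R) = (\<integral>\<omega>. indicator {\<omega> \<in> space (path_space n). \<omega> k 1 = 0} \<omega> * (\<Prod>i\<in>I. \<omega> i 1) \<partial>?R)"
        by (intro Bochner_Integration.integral_cong) (auto split: split_indicator)
      also have "\<dots> = (\<integral>x. indicator {\<omega> \<in> space (path_space n). \<omega> k 1 = 0} (?T x) * (\<Prod>i\<in>I. ?T x i 1) \<partial>Q)"
        using km pm[OF I, of 1] by (intro integral_distr[OF Tm]) auto
      also have "\<dots> = (\<integral>x. indicator {\<omega>. \<omega> (?p k) 1 = 0} x * (\<Prod>i\<in>?p ` I. x i 1) \<partial>Q)"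
        unfolding prodT[OF I] using k measurable_space[OF Tm]
        by (intro Bochner_Integration.integral_cong) (auto simp: T split: split_indicator)
      also have "?p k \<notin> ?p ` I"
        using inj_on_image_mem_iff[OF inj[OF order_refl], of k I] k I by auto
      then have "0 < (\<integral>x. indicator {\<omega>. \<omega> (?p k) 1 = 0} x * (\<Prod>i\<in>?p ` I. x i 1) \<partial>Q)"
        using p[of k] k by (intro prod_dead_positive[OF pI[OF I]]) auto
      finally show ?thesis .
    qed
    fix s t A assume st: "0 \<le> s" "s \<le> t" and A: "A \<in> sets (coord_filtration n s)"
    have AR: "A \<in> sets (path_space n)" using augmented.sets_N[OF aug, of s] A by auto
    have tr: "(\<integral>\<omega>\<in>A. (\<Prod>i\<in>I. \<omega> i v) \<partial>?R) = (\<integral>\<omega>\<in>?T -` A \<inter> cont_paths n. (\<Prod>i\<in>?p ` I. \<omega> i v) \<partial>Q)" if "0 \<le> v" for v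
    proof -
      have "(\<integral>\<omega>\<in>A. (\<Prod>i\<in>I. \<omega> i v) \<partial>?R) = (\<integral>x. indicator A (?T x) *\<^sub>R (\<Prod>i\<in>I. ?T x i v) \<partial>Q)"
        unfolding set_lebesgue_integral_def using AR pm[OF I that] by (intro integral_distr[OF Tm]) auto
      also have "\<dots> = (\<integral>\<omega>\<in>?T -` A \<inter> cont_paths n. (\<Prod>i\<in>?p ` I. \<omega> i v) \<partial>Q)"
        unfolding set_lebesgue_integral_def prodT[OF I]
        by (intro Bochner_Integration.integral_cong) (auto simp: sp split: split_indicator)
      finally show ?thesis .
    qed
    show "(\<integral>\<omega>\<in>A. (\<Prod>i\<in>I. \<omega> i t) \<partial>?R) = (\<integral>\<omega>\<in>A. (\<Prod>i\<in>I. \<omega> i s) \<partial>?R)"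
      using prod_martingale[OF pI[OF I] st move_to_front_vimage[OF i A]] st by (simp add: tr)
  qed
qed

lemma space_natural_filtration [simp]: "space (natural_filtration \<Omega> I Y t) = \<Omega>"
  unfolding natural_filtration_def by (rule space_measure_of) auto

section \<open>The size-biased law\<close>

lemma total_mass_move_to_front:
  assumes "i \<in> {1..n}"
  shows "total_mass n (move_to_front n i \<omega>) t = total_mass n \<omega> t"
proof -
  have "total_mass n (move_to_front n i \<omega>) t = (\<Sum>j=1..n. \<omega> (front_perm i j) t)"
    unfolding total_mass_def by (intro sum.cong) (auto simp: move_to_front_eq)
  also have "\<dots> = total_mass n \<omega> t"
    unfolding total_mass_def by (rule sum.reindex_bij_betw[OF front_perm_bij[OF assms], of "\<lambda>j. \<omega> j t"])
  finally show ?thesis .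
qed

lemma total_mass_continuous: "\<omega> \<in> cont_paths n \<Longrightarrow> continuous_on {0..} (\<lambda>t. total_mass n \<omega> t)"
  unfolding total_mass_def by (intro continuous_on_sum) (simp add: cont_paths_def)

lemma total_mass_measurable: "0 \<le> s \<Longrightarrow> s \<le> t \<Longrightarrow> (\<lambda>\<omega>. total_mass n \<omega> s) \<in> borel_measurable (coord_filtration n t)"
  unfolding total_mass_def by (intro borel_measurable_sum coord_filtration_measurable)

text \<open>The almost sure properties that are used path by path. Absorption of the total mass
  ensures that a path alive at \<open>t\<close> was alive before, which is the condition under which
  \<open>ratio\<close> is the plain quotient.\<close>

definition good_path :: "nat \<Rightarrow> real \<Rightarrow> (nat \<Rightarrow> real \<Rightarrow> real) \<Rightarrow> bool" where
  "good_path n z \<omega> \<longleftrightarrow> \<omega> \<in> cont_paths n \<and> (\<forall>i\<in>{1..n}. \<forall>t\<ge>0. 0 \<le> \<omega> i t) \<and> (\<forall>i\<in>{1..n}. \<omega> i 0 = z) \<and>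
    (\<forall>s\<ge>0. \<forall>t\<ge>s. total_mass n \<omega> s = 0 \<longrightarrow> total_mass n \<omega> t = 0)"

context product_law
begin

sublocale A: augmented Q "coord_filtration n"
  by (rule augmented_path[OF sets_Q])

lemma space_Q: "space Q = cont_paths n"
  using sets_eq_imp_space_eq[OF sets_Q] by simp

lemma pos_martingale_prod:
  assumes I: "I \<subseteq> {1..n}"
  shows "pos_martingale Q (coord_filtration n) (\<lambda>t \<omega>. \<Prod>i\<in>I. \<omega> i t)"
proof unfold_locales
  show "(\<lambda>\<omega>. \<Prod>i\<in>I. \<omega> i t) \<in> borel_measurable (coord_filtration n t)" if "0 \<le> t" for t
    using I that by (intro borel_measurable_prod coord_filtration_measurable) auto
  show "continuous_on {0..} (\<lambda>t. \<Prod>i\<in>I. x i t)" if "x \<in> space Q" for x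
    using I that by (intro continuous_on_prod) (auto simp: space_Q cont_paths_def)
  show "AE x in Q. \<forall>t\<ge>0. 0 \<le> (\<Prod>i\<in>I. x i t)"
    using nonneg by eventually_elim (use I in \<open>auto intro!: prod_nonneg\<close>)
qed (rule prod_integrable[OF I], assumption, rule prod_martingale[OF I])

lemma pos_martingale_total: "pos_martingale Q (coord_filtration n) (\<lambda>t \<omega>. total_mass n \<omega> t)"
proof unfold_locales
  have one: "integrable Q (\<lambda>\<omega>. \<omega> i t)" if "i \<in> {1..n}" "0 \<le> t" for i t
    using prod_integrable[of "{i}" t] that by simp
  show "(\<lambda>\<omega>. total_mass n \<omega> t) \<in> borel_measurable (coord_filtration n t)" if "0 \<le> t" for t
    by (rule total_mass_measurable[OF that order_refl])
  show int: "integrable Q (\<lambda>\<omega>. total_mass n \<omega> t)" if "0 \<le> t" for t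
    unfolding total_mass_def by (intro Bochner_Integration.integrable_sum one that)
  show "continuous_on {0..} (\<lambda>t. total_mass n x t)" if "x \<in> space Q" for x
    using that by (intro total_mass_continuous) (simp add: space_Q)
  show "AE x in Q. \<forall>t\<ge>0. 0 \<le> total_mass n x t"
    using nonneg by eventually_elim (auto simp: total_mass_def intro!: sum_nonneg)
  fix s t A assume st: "0 \<le> s" "s \<le> t" and A: "A \<in> sets (coord_filtration n s)"
  have AQ: "A \<in> sets Q" using A A.sets_N by blast
  have sum: "(\<integral>\<omega>\<in>A. total_mass n \<omega> v \<partial>Q) = (\<Sum>i=1..n. \<integral>\<omega>\<in>A. \<omega> i v \<partial>Q)" if "0 \<le> v" for v
    unfolding total_mass_def set_lebesgue_integral_def scaleR_sum_right
    using integrable_mult_indicator[OF AQ one[OF _ that]] by (intro Bochner_Integration.integral_sum) auto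
  have "(\<integral>\<omega>\<in>A. \<omega> i t \<partial>Q) = (\<integral>\<omega>\<in>A. \<omega> i s \<partial>Q)" if "i \<in> {1..n}" for i
    using prod_martingale[of "{i}", OF _ st A] that by simp
  then show "(\<integral>\<omega>\<in>A. total_mass n \<omega> t \<partial>Q) = (\<integral>\<omega>\<in>A. total_mass n \<omega> s \<partial>Q)"
    using sum st by simp
qed

lemma AE_good_path: "AE \<omega> in Q. good_path n z \<omega>"
proof -
  interpret Z: pos_martingale Q "coord_filtration n" "\<lambda>t \<omega>. total_mass n \<omega> t" by (rule pos_martingale_total)
  show ?thesis
    using nonneg start Z.absorbed_at_zero AE_space
    by eventually_elim (auto simp: good_path_def space_Q)
qed

end

lemma good_path_total_nonneg: "good_path n z \<omega> \<Longrightarrow> 0 \<le> t \<Longrightarrow> 0 \<le> total_mass n \<omega> t"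
  unfolding total_mass_def good_path_def by (intro sum_nonneg) auto

lemma good_path_le_total:
  assumes "good_path n z \<omega>" "0 \<le> t" "i \<in> {1..n}"
  shows "\<omega> i t \<le> total_mass n \<omega> t"
  unfolding total_mass_def using assms by (intro member_le_sum) (auto simp: good_path_def)

lemma good_path_ratio:
  assumes "good_path n z \<omega>" "0 \<le> t" "total_mass n \<omega> t \<noteq> 0"
  shows "ratio n \<omega> i t = \<omega> i t / total_mass n \<omega> t"
  using assms by (auto simp: ratio_def good_path_def)

lemma good_path_move_to_front:
  assumes "good_path n z \<omega>" "i \<in> {1..n}"
  shows "good_path n z (move_to_front n i \<omega>)"
proof -
  have p: "front_perm i j \<in> {1..n}" if "j \<in> {1..n}" for j
    using front_perm_bij[OF assms(2)] that by (auto simp: bij_betw_def)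
  have "move_to_front n i \<omega> \<in> cont_paths n"
    using measurable_space[OF move_to_front_measurable[OF assms(2)]] assms(1) by (auto simp: good_path_def)
  then show ?thesis
    using assms p unfolding good_path_def total_mass_move_to_front[OF assms(2)]
    by (auto simp: move_to_front_eq)
qed

section \<open>Change of measure between the size-biased and the permuted laws\<close>

locale size_biased = Q: product_law Q n z for Q :: "(nat \<Rightarrow> real \<Rightarrow> real) measure" and n z +
  fixes P :: "(nat \<Rightarrow> real \<Rightarrow> real) measure"
  assumes size_biased: "size_biased_law n Q P"
begin

sublocale P: prob_space P
  using size_biased by (simp add: size_biased_law_def)

lemma sets_P: "sets P = sets (path_space n)"
  using size_biased by (simp add: size_biased_law_def)

lemma space_P: "space P = cont_paths n"
  using sets_eq_imp_space_eq[OF sets_P] by simp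

sublocale PA: augmented P "coord_filtration n"
  by (rule augmented_path[OF sets_P])

definition front_law :: "nat \<Rightarrow> (nat \<Rightarrow> real \<Rightarrow> real) measure" where
  "front_law i = distr Q (path_space n) (move_to_front n i)"

lemma front_law: "i \<in> {1..n} \<Longrightarrow> product_law (front_law i) n z"
  unfolding front_law_def by (rule Q.product_law_move_to_front)

lemma P_sets:
  assumes t: "0 \<le> t" and A: "A \<in> sets (coord_filtration n t)"
  shows "measure P A = (\<integral>\<omega>. (\<Sum>i=1..n. ratio n \<omega> i t * indicator A (move_to_front n i \<omega>)) \<partial>completion Q)"
proof -
  have "A \<in> sets (path_filtration n Q t)"
    using A Q.A.sets_N_F[of t] unfolding path_filtration_def by blast
  then have "measure (completion P) A = (\<integral>\<omega>. (\<Sum>i=1..n. ratio n \<omega> i t * indicator A (move_to_front n i \<omega>)) \<partial>completion Q)"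
    using size_biased t by (auto simp: size_biased_law_def)
  moreover have "A \<in> sets P" using A PA.sets_N by blast
  ultimately show ?thesis by simp
qed

lemma move_to_front_measurable_Q: "i \<in> {1..n} \<Longrightarrow> move_to_front n i \<in> measurable Q (path_space n)"
  using move_to_front_measurable[of i n] by (simp add: measurable_cong_sets[OF Q.sets_Q refl])

lemma null_P:
  assumes t: "0 \<le> t" and A: "A \<in> sets (coord_filtration n t)"
    and null: "\<And>i. i \<in> {1..n} \<Longrightarrow> AE \<omega> in front_law i. \<omega> \<notin> A"
  shows "AE \<omega> in P. \<omega> \<notin> A"
proof -
  have AP: "A \<in> sets (path_space n)" using A PA.sets_N sets_P by blast
  have "AE \<omega> in Q. \<forall>i\<in>{1..n}. move_to_front n i \<omega> \<notin> A"
  proof (subst AE_ball_countable)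
    show "\<forall>i\<in>{1..n}. AE \<omega> in Q. move_to_front n i \<omega> \<notin> A"
      using null unfolding front_law_def by (auto intro: AE_distrD[OF move_to_front_measurable_Q])
  qed simp
  then have "AE \<omega> in completion Q. (\<Sum>i=1..n. ratio n \<omega> i t * indicator A (move_to_front n i \<omega>)) = 0"
    by (intro AE_completion) (auto elim!: eventually_mono intro!: sum.neutral)
  then have "measure P A = 0" unfolding P_sets[OF t A] by (rule integral_eq_zero_AE)
  then have "A \<in> null_sets P" using AP sets_P by (auto simp: null_sets_def P.emeasure_eq_measure)
  then show ?thesis by (rule AE_not_in)
qed

text \<open>\<open>null_P\<close> handles events with a finite time horizon. Being a good path is
  therefore split into countably many conditions at rational times, which path continuity puts
  together again.\<close>

lemma AE_P_good_path: "AE \<omega> in P. good_path n z \<omega>"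
proof -
  have null: "AE \<omega> in P. \<omega> \<in> A" if t: "0 \<le> t" and A: "{\<omega> \<in> cont_paths n. \<omega> \<notin> A} \<in> sets (coord_filtration n t)"
    and AE: "\<And>Q'. product_law Q' n z \<Longrightarrow> AE \<omega> in Q'. \<omega> \<in> A" for t A
  proof -
    have "AE \<omega> in P. \<omega> \<notin> {\<omega> \<in> cont_paths n. \<omega> \<notin> A}"
    proof (rule null_P[OF t A])
      fix i assume "i \<in> {1..n}"
      from AE[OF front_law[OF this]] show "AE \<omega> in front_law i. \<omega> \<notin> {\<omega> \<in> cont_paths n. \<omega> \<notin> A}"
        by eventually_elim simp
    qed
    with AE_space show ?thesis by eventually_elim (auto simp: space_P)
  qed
  have 1: "AE \<omega> in P. \<forall>i\<in>{1..n}. \<omega> i 0 = z"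
  proof (subst AE_ball_countable)
    show "\<forall>i\<in>{1..n}. AE \<omega> in P. \<omega> i 0 = z"
    proof
      fix i assume i: "i \<in> {1..n}"
      have [measurable]: "(\<lambda>\<omega>. \<omega> i 0) \<in> borel_measurable (coord_filtration n 0)"
        by (rule coord_filtration_measurable[OF i]) auto
      have "{\<omega> \<in> space (coord_filtration n 0). \<omega> i 0 \<noteq> z} \<in> sets (coord_filtration n 0)" by measurable
      then have "AE \<omega> in P. \<omega> \<in> {\<omega>. \<omega> i 0 = z}"
        using i by (intro null[of 0]) (auto simp: space_P dest: product_law.start elim!: eventually_mono)
      then show "AE \<omega> in P. \<omega> i 0 = z" by simp
    qed
  qed simp
  have 2: "AE \<omega> in P. \<forall>i\<in>{1..n}. \<forall>q\<in>\<rat> \<inter> {0..}. 0 \<le> \<omega> i q"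
  proof (subst AE_ball_countable)
    show "\<forall>i\<in>{1..n}. AE \<omega> in P. \<forall>q\<in>\<rat> \<inter> {0..}. 0 \<le> \<omega> i q"
    proof
      fix i assume i: "i \<in> {1..n}"
      show "AE \<omega> in P. \<forall>q\<in>\<rat> \<inter> {0..}. 0 \<le> \<omega> i q"
      proof (subst AE_ball_countable)
        show "\<forall>q\<in>\<rat> \<inter> {0..}. AE \<omega> in P. 0 \<le> \<omega> i q"
        proof
          fix q :: real assume "q \<in> \<rat> \<inter> {0..}"
          then have q: "0 \<le> q" by simp
          have [measurable]: "(\<lambda>\<omega>. \<omega> i q) \<in> borel_measurable (coord_filtration n q)"
            by (rule coord_filtration_measurable[OF i q order_refl])
          have "{\<omega> \<in> space (coord_filtration n q). \<not> 0 \<le> \<omega> i q} \<in> sets (coord_filtration n q)" by measurable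
          then have "AE \<omega> in P. \<omega> \<in> {\<omega>. 0 \<le> \<omega> i q}"
            using i q by (intro null[of q]) (auto simp: space_P dest: product_law.nonneg elim!: eventually_mono)
          then show "AE \<omega> in P. 0 \<le> \<omega> i q" by simp
        qed
      qed (use countable_rat in auto)
    qed
  qed simp
  \<comment> \<open>Absorption is expressed by infima over rational times up to \<open>t\<close>, so
    that each condition depends on the path up to \<open>t\<close> only.\<close>
  have 3: "AE \<omega> in P. \<forall>t\<in>\<rat> \<inter> {0..}. (\<forall>e>0. \<exists>q\<in>\<rat> \<inter> {0..t}. total_mass n \<omega> q < e) \<longrightarrow> total_mass n \<omega> t = 0"
  proof (subst AE_ball_countable)
    show "\<forall>t\<in>\<rat> \<inter> {0..}. AE \<omega> in P. (\<forall>e>0. \<exists>q\<in>\<rat> \<inter> {0..t}. total_mass n \<omega> q < e) \<longrightarrow> total_mass n \<omega> t = 0"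
    proof
      fix t :: real assume "t \<in> \<rat> \<inter> {0..}"
      then have t: "0 \<le> t" by simp
      have iff: "(\<forall>e>0. \<exists>q\<in>\<rat> \<inter> {0..t}. f q < e) \<longleftrightarrow> (\<forall>k :: nat. \<exists>q\<in>\<rat> \<inter> {0..t}. f q < 1 / real (Suc k))" for f :: "real \<Rightarrow> real"
      proof
        assume *: "\<forall>k :: nat. \<exists>q\<in>\<rat> \<inter> {0..t}. f q < 1 / real (Suc k)"
        show "\<forall>e>0. \<exists>q\<in>\<rat> \<inter> {0..t}. f q < e"
        proof (intro allI impI)
          fix e :: real assume "0 < e"
          then obtain k where "inverse (real (Suc k)) < e" using reals_Archimedean by blast
          then show "\<exists>q\<in>\<rat> \<inter> {0..t}. f q < e" using *[rule_format, of k] by (force simp: inverse_eq_divide)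
        qed
      qed auto
      have m: "{\<omega> \<in> cont_paths n. \<not> ((\<forall>k :: nat. \<exists>q\<in>\<rat> \<inter> {0..t}. total_mass n \<omega> q < 1 / real (Suc k)) \<longrightarrow> total_mass n \<omega> t = 0)} \<in> sets (coord_filtration n t)"
      proof -
        have q: "{\<omega> \<in> cont_paths n. total_mass n \<omega> q < e} \<in> sets (coord_filtration n t)" if "q \<in> \<rat> \<inter> {0..t}" for q e
        proof -
          have [measurable]: "(\<lambda>\<omega>. total_mass n \<omega> q) \<in> borel_measurable (coord_filtration n t)"
            by (rule total_mass_measurable) (use that in auto)
          have "{\<omega> \<in> space (coord_filtration n t). total_mass n \<omega> q < e} \<in> sets (coord_filtration n t)" by measurable
          then show ?thesis by (simp add: space_P)
        qed
        have "{\<omega> \<in> space (coord_filtration n t). total_mass n \<omega> t \<noteq> 0} \<in> sets (coord_filtration n t)"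
        proof -
          have [measurable]: "(\<lambda>\<omega>. total_mass n \<omega> t) \<in> borel_measurable (coord_filtration n t)"
            by (rule total_mass_measurable[OF t order_refl])
          show ?thesis by measurable
        qed
        then have z: "{\<omega> \<in> cont_paths n. total_mass n \<omega> t \<noteq> 0} \<in> sets (coord_filtration n t)" by (simp add: space_P)
        have "{\<omega> \<in> cont_paths n. \<not> ((\<forall>k :: nat. \<exists>q\<in>\<rat> \<inter> {0..t}. total_mass n \<omega> q < 1 / real (Suc k)) \<longrightarrow> total_mass n \<omega> t = 0)}
          = (\<Inter>k :: nat. \<Union>q\<in>\<rat> \<inter> {0..t}. {\<omega> \<in> cont_paths n. total_mass n \<omega> q < 1 / real (Suc k)}) \<inter> {\<omega> \<in> cont_paths n. total_mass n \<omega> t \<noteq> 0}"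
          by blast
        also have "\<dots> \<in> sets (coord_filtration n t)"
        proof -
          have "(\<Union>q\<in>\<rat> \<inter> {0..t}. {\<omega> \<in> cont_paths n. total_mass n \<omega> q < 1 / real (Suc k)}) \<in> sets (coord_filtration n t)" for k
            using q countable_rat by (intro sets.countable_UN'') auto
          then show ?thesis by (intro sets.Int z sets.countable_INT image_subsetI) simp_all
        qed
        finally show ?thesis .
      qed
      have "AE \<omega> in P. \<omega> \<in> {\<omega>. (\<forall>k :: nat. \<exists>q\<in>\<rat> \<inter> {0..t}. total_mass n \<omega> q < 1 / real (Suc k)) \<longrightarrow> total_mass n \<omega> t = 0}"
      proof (rule null[OF t])
        show "{\<omega> \<in> cont_paths n. \<omega> \<notin> {\<omega>. (\<forall>k :: nat. \<exists>q\<in>\<rat> \<inter> {0..t}. total_mass n \<omega> q < 1 / real (Suc k)) \<longrightarrow> total_mass n \<omega> t = 0}} \<in> sets (coord_filtration n t)"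
          using m by simp
        fix Q' assume "product_law Q' n z"
        then interpret Q': product_law Q' n z .
        interpret Z: pos_martingale Q' "coord_filtration n" "\<lambda>t \<omega>. total_mass n \<omega> t" by (rule Q'.pos_martingale_total)
        show "AE \<omega> in Q'. \<omega> \<in> {\<omega>. (\<forall>k :: nat. \<exists>q\<in>\<rat> \<inter> {0..t}. total_mass n \<omega> q < 1 / real (Suc k)) \<longrightarrow> total_mass n \<omega> t = 0}"
          using Z.zero_if_running_inf_zero[OF t] unfolding iff by simp
      qed
      then show "AE \<omega> in P. (\<forall>e>0. \<exists>q\<in>\<rat> \<inter> {0..t}. total_mass n \<omega> q < e) \<longrightarrow> total_mass n \<omega> t = 0"
        unfolding iff by simp
    qed
  qed (use countable_rat in auto)
  show ?thesis
    using 1 2 3 AE_space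
  proof eventually_elim
    case (elim \<omega>)
    then have w: "\<omega> \<in> cont_paths n" by (simp add: space_P)
    have "\<forall>t\<ge>0. 0 \<le> \<omega> i t" if "i \<in> {1..n}" for i
      using nonneg_iff_rational[of "\<omega> i"] elim(2) w that by (auto simp: cont_paths_def)
    moreover have "\<forall>s\<ge>0. \<forall>t\<ge>s. total_mass n \<omega> s = 0 \<longrightarrow> total_mass n \<omega> t = 0"
      by (rule absorbed_at_zero_if_rational[OF total_mass_continuous[OF w] elim(3)])
    ultimately show ?case using elim(1) w by (auto simp: good_path_def)
  qed
qed

lemma alive_sets: "0 \<le> t \<Longrightarrow> {\<omega> \<in> cont_paths n. total_mass n \<omega> t \<noteq> 0} \<in> sets (coord_filtration n t)"
proof -
  assume t: "0 \<le> t"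
  have [measurable]: "(\<lambda>\<omega>. total_mass n \<omega> t) \<in> borel_measurable (coord_filtration n t)"
    by (rule total_mass_measurable[OF t order_refl])
  have "{\<omega> \<in> space (coord_filtration n t). total_mass n \<omega> t \<noteq> 0} \<in> sets (coord_filtration n t)" by measurable
  then show ?thesis by (simp add: space_P)
qed

definition fraction :: "real \<Rightarrow> (nat \<Rightarrow> real \<Rightarrow> real) \<Rightarrow> real" where
  "fraction t \<omega> = \<omega> 1 t / total_mass n \<omega> t"

lemma one_in: "1 \<in> {1..n}" using Q.n by simp

lemma fraction_measurable: "0 \<le> t \<Longrightarrow> fraction t \<in> borel_measurable (coord_filtration n t)"
  unfolding fraction_def[abs_def]
  using coord_filtration_measurable[OF one_in, of t t] total_mass_measurable[of t t n] by measurable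

lemma good_path_fraction:
  assumes "good_path n z \<omega>" "0 \<le> t"
  shows "0 \<le> fraction t \<omega>" "fraction t \<omega> \<le> 1"
proof -
  have "0 \<le> \<omega> 1 t" using assms one_in by (auto simp: good_path_def)
  moreover have "\<omega> 1 t \<le> total_mass n \<omega> t" by (rule good_path_le_total[OF assms one_in])
  ultimately show "0 \<le> fraction t \<omega>" "fraction t \<omega> \<le> 1"
    unfolding fraction_def by (auto simp: divide_le_eq_1 less_le)
qed

text \<open>Only events on which the total mass is still alive are transferred, so that the frozen
  values of the ratios never enter.\<close>

lemma P_alive_sets:
  assumes t: "0 \<le> t" and A: "A \<in> sets (coord_filtration n t)"
  shows "emeasure P (A \<inter> {\<omega> \<in> cont_paths n. total_mass n \<omega> t \<noteq> 0})
    = (\<Sum>i=1..n. \<integral>\<^sup>+ \<omega>. ennreal (fraction t \<omega>) * indicator A \<omega> \<partial>front_law i)"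
proof -
  let ?A = "A \<inter> {\<omega> \<in> cont_paths n. total_mass n \<omega> t \<noteq> 0}"
  have A': "?A \<in> sets (coord_filtration n t)" using A alive_sets[OF t] by blast
  have AP: "A \<in> sets (path_space n)" using A PA.sets_N sets_P by blast
  have A'P: "?A \<in> sets (path_space n)" using A' PA.sets_N sets_P by blast
  have fm: "fraction t \<in> borel_measurable (path_space n)"
    using PA.measurable_N_M[OF fraction_measurable[OF t]] by (simp add: measurable_cong_sets[OF sets_P refl])
  let ?h = "\<lambda>i \<omega>. fraction t (move_to_front n i \<omega>) * indicator A (move_to_front n i \<omega>)"
  have hm: "?h i \<in> borel_measurable Q" if "i \<in> {1..n}" for i
  proof -
    have "(\<lambda>\<omega>. fraction t \<omega> * indicator A \<omega>) \<in> borel_measurable (path_space n)"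
      using fm AP by measurable
    from measurable_compose[OF move_to_front_measurable_Q[OF that] this] show ?thesis .
  qed
  have bnd: "AE \<omega> in Q. 0 \<le> ?h i \<omega> \<and> ?h i \<omega> \<le> 1" if "i \<in> {1..n}" for i
    using Q.AE_good_path
  proof eventually_elim
    case (elim \<omega>)
    show ?case
      using good_path_fraction[OF good_path_move_to_front[OF elim that] t] by (auto split: split_indicator)
  qed
  have int: "integrable Q (?h i)" if "i \<in> {1..n}" for i
    using bnd[OF that] hm[OF that] by (intro Q.integrable_const_bound[of _ 1]) auto
  \<comment> \<open>Alive paths have the plain quotient as ratio. For dead paths the left side is
    killed by the indicator and the right side by division by zero.\<close>
  have eq: "AE \<omega> in Q. (\<Sum>i=1..n. ratio n \<omega> i t * indicator ?A (move_to_front n i \<omega>)) = (\<Sum>i=1..n. ?h i \<omega>)"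
    using Q.AE_good_path
  proof eventually_elim
    case (elim \<omega>)
    show ?case
    proof (rule sum.cong[OF refl])
      fix i assume i: "i \<in> {1..n}"
      have w: "move_to_front n i \<omega> \<in> cont_paths n"
        using good_path_move_to_front[OF elim i] by (simp add: good_path_def)
      have 1: "move_to_front n i \<omega> 1 = \<omega> i" using one_in by (simp add: move_to_front_def)
      show "ratio n \<omega> i t * indicator ?A (move_to_front n i \<omega>) = ?h i \<omega>"
        using w good_path_ratio[OF elim t, of i]
        by (cases "total_mass n \<omega> t = 0") (auto simp del: One_nat_def simp: fraction_def total_mass_move_to_front[OF i] 1 split: split_indicator)
    qed
  qed
  have sm: "(\<lambda>\<omega>. \<Sum>i=1..n. ?h i \<omega>) \<in> borel_measurable Q" using hm by (intro borel_measurable_sum) auto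
  have smF: "(\<lambda>\<omega>. \<Sum>i=1..n. ratio n \<omega> i t * indicator ?A (move_to_front n i \<omega>)) \<in> borel_measurable (completion Q)"
  proof -
    let ?g = "\<lambda>\<omega>. \<Sum>i=1..n. ratio n \<omega> i t * indicator ?A (move_to_front n i \<omega>)"
    show ?thesis
    proof (rule measurableI)
      fix B :: "real set" assume B: "B \<in> sets borel"
      have 1: "(\<lambda>\<omega>. \<Sum>i=1..n. ?h i \<omega>) -` B \<inter> space Q \<in> sets (completion Q)"
        using measurable_sets[OF sm B] by blast
      have 2: "AE \<omega> in completion Q. \<omega> \<in> (\<lambda>\<omega>. \<Sum>i=1..n. ?h i \<omega>) -` B \<inter> space Q \<longleftrightarrow> \<omega> \<in> ?g -` B \<inter> space Q"
        using AE_completion[OF eq] by eventually_elim auto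
      have 3: "?g -` B \<inter> space Q \<subseteq> space (completion Q)" by auto
      show "?g -` B \<inter> space (completion Q) \<in> sets (completion Q)"
        using completion.in_sets_AE[OF 2 1 3] by simp
    qed simp
  qed
  have "measure P ?A = (\<integral>\<omega>. (\<Sum>i=1..n. ratio n \<omega> i t * indicator ?A (move_to_front n i \<omega>)) \<partial>completion Q)"
    by (rule P_sets[OF t A'])
  also have "\<dots> = (\<integral>\<omega>. (\<Sum>i=1..n. ?h i \<omega>) \<partial>completion Q)"
    using AE_completion[OF eq] by (intro integral_cong_AE smF measurable_completion sm)
  also have "\<dots> = (\<integral>\<omega>. (\<Sum>i=1..n. ?h i \<omega>) \<partial>Q)" by (rule integral_completion[OF sm])
  also have "\<dots> = (\<Sum>i=1..n. \<integral>\<omega>. ?h i \<omega> \<partial>Q)" by (intro Bochner_Integration.integral_sum int)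
  finally have "emeasure P ?A = ennreal (\<Sum>i=1..n. \<integral>\<omega>. ?h i \<omega> \<partial>Q)" by (simp add: P.emeasure_eq_measure)
  also have "\<dots> = (\<Sum>i=1..n. ennreal (\<integral>\<omega>. ?h i \<omega> \<partial>Q))"
    by (intro sum_ennreal[symmetric] integral_nonneg_AE) (use bnd in \<open>auto elim!: eventually_mono\<close>)
  also have "\<dots> = (\<Sum>i=1..n. \<integral>\<^sup>+ \<omega>. ennreal (fraction t \<omega>) * indicator A \<omega> \<partial>front_law i)"
  proof (rule sum.cong[OF refl])
    fix i assume i: "i \<in> {1..n}"
    have "ennreal (\<integral>\<omega>. ?h i \<omega> \<partial>Q) = (\<integral>\<^sup>+ \<omega>. ennreal (?h i \<omega>) \<partial>Q)"
      using bnd[OF i] by (intro nn_integral_eq_integral[symmetric] int i) (auto elim!: eventually_mono)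
    also have "\<dots> = (\<integral>\<^sup>+ \<omega>. ennreal (fraction t (move_to_front n i \<omega>)) * indicator A (move_to_front n i \<omega>) \<partial>Q)"
      by (intro nn_integral_cong) (auto split: split_indicator)
    also have "\<dots> = (\<integral>\<^sup>+ \<omega>. ennreal (fraction t \<omega>) * indicator A \<omega> \<partial>front_law i)"
      unfolding front_law_def using fm AP by (subst nn_integral_distr[OF move_to_front_measurable_Q[OF i]]) auto
    finally show "ennreal (\<integral>\<omega>. ?h i \<omega> \<partial>Q) = (\<integral>\<^sup>+ \<omega>. ennreal (fraction t \<omega>) * indicator A \<omega> \<partial>front_law i)" .
  qed
  finally show ?thesis .
qed

end

section \<open>Localization\<close>

text \<open>The first time at which \<open>\<zeta> / Z(1)\<close> or \<open>\<zeta>\<close> exceeds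
  \<kappa>, written without division so that it makes sense at zeros. The element \<kappa> caps the
  time and keeps the set nonempty; strict inequalities make crossings visible at rational
  times.\<close>

definition level_time :: "nat \<Rightarrow> real \<Rightarrow> (nat \<Rightarrow> real \<Rightarrow> real) \<Rightarrow> real" where
  "level_time n \<kappa> \<omega> = Inf ({s. 0 \<le> s \<and> (\<kappa> * \<omega> 1 s < total_mass n \<omega> s \<or> \<kappa> < total_mass n \<omega> s)} \<union> {\<kappa>})"

context
  fixes n :: nat and \<kappa> :: real and \<omega> :: "nat \<Rightarrow> real \<Rightarrow> real"
  assumes \<kappa>: "0 \<le> \<kappa>"
begin

lemma level_time_set:
  "{s. 0 \<le> s \<and> (\<kappa> * \<omega> 1 s < total_mass n \<omega> s \<or> \<kappa> < total_mass n \<omega> s)} \<union> {\<kappa>} \<noteq> {}"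
  "bdd_below ({s. 0 \<le> s \<and> (\<kappa> * \<omega> 1 s < total_mass n \<omega> s \<or> \<kappa> < total_mass n \<omega> s)} \<union> {\<kappa>})"
  using \<kappa> by (auto intro!: bdd_belowI[of _ 0])

lemma level_time_nonneg: "0 \<le> level_time n \<kappa> \<omega>"
  unfolding level_time_def using level_time_set(1) \<kappa> by (intro cInf_greatest) auto

lemma level_time_less_iff:
  "level_time n \<kappa> \<omega> < r \<longleftrightarrow> \<kappa> < r \<or>
    (\<exists>s. 0 \<le> s \<and> s < r \<and> (\<kappa> * \<omega> 1 s < total_mass n \<omega> s \<or> \<kappa> < total_mass n \<omega> s))"
  unfolding level_time_def cInf_less_iff[OF level_time_set] by auto

end

lemma eventually_rational_right:
  assumes "s < (r :: real)" "\<forall>\<^sub>F u in at_right s. R u"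
  shows "\<exists>q\<in>\<rat>. s < q \<and> q < r \<and> R q"
proof -
  obtain b where b: "s < b" "\<And>u. s < u \<Longrightarrow> u < b \<Longrightarrow> R u"
    using assms(2) unfolding eventually_at_right_field by blast
  have "s < min b r" using b assms by simp
  from Rats_dense_in_real[OF this] obtain q where "q \<in> \<rat>" "s < q" "q < min b r" by blast
  then show ?thesis using b(2)[of q] by (intro bexI[of _ q]) simp_all
qed

text \<open>Both crossing conditions are strict inequalities between continuous functions, so a
  crossing at \<open>s\<close> persists immediately to the right of \<open>s\<close>, in particular
  at a rational time before \<open>r\<close>.\<close>

lemma level_time_less_iff_rational:
  assumes w: "\<omega> \<in> cont_paths n" and n: "1 \<in> {1..n}" and \<kappa>: "0 \<le> \<kappa>"
  shows "level_time n \<kappa> \<omega> < r \<longleftrightarrow> \<kappa> < r \<or>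
    (\<exists>q\<in>\<rat> \<inter> {0..<r}. \<kappa> * \<omega> 1 q < total_mass n \<omega> q \<or> \<kappa> < total_mass n \<omega> q)"
proof -
  have "\<exists>q\<in>\<rat> \<inter> {0..<r}. \<kappa> * \<omega> 1 q < total_mass n \<omega> q \<or> \<kappa> < total_mass n \<omega> q"
    if s: "0 \<le> s" "s < r" and c: "\<kappa> * \<omega> 1 s < total_mass n \<omega> s \<or> \<kappa> < total_mass n \<omega> s" for s
  proof -
    have right: "(f \<longlongrightarrow> f s) (at_right s)" if "continuous_on {0..} f" for f :: "real \<Rightarrow> real"
    proof -
      have "(f \<longlongrightarrow> f s) (at s within {0..})" using that s by (simp add: continuous_on)
      then show ?thesis by (rule tendsto_within_subset) (use s in auto)
    qed
    have T: "((\<lambda>u. total_mass n \<omega> u) \<longlongrightarrow> total_mass n \<omega> s) (at_right s)"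
      by (rule right[OF total_mass_continuous[OF w]])
    have 1: "((\<lambda>u. \<kappa> * \<omega> 1 u) \<longlongrightarrow> \<kappa> * \<omega> 1 s) (at_right s)"
      using w n by (intro tendsto_mult_left right) (auto simp: cont_paths_def)
    have "\<forall>\<^sub>F u in at_right s. \<kappa> * \<omega> 1 u < total_mass n \<omega> u \<or> \<kappa> < total_mass n \<omega> u"
      using c
    proof
      assume "\<kappa> * \<omega> 1 s < total_mass n \<omega> s"
      from order_tendstoD(1)[OF tendsto_diff[OF T 1], of 0] this
      show ?thesis by (auto elim!: eventually_mono)
    next
      assume "\<kappa> < total_mass n \<omega> s"
      from order_tendstoD(1)[OF T this] show ?thesis by (auto elim!: eventually_mono)
    qed
    from eventually_rational_right[OF s(2) this] obtain q where "q \<in> \<rat>" "s < q" "q < r"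
      "\<kappa> * \<omega> 1 q < total_mass n \<omega> q \<or> \<kappa> < total_mass n \<omega> q" by blast
    then show ?thesis using s by (intro bexI[of _ q]) auto
  qed
  then show ?thesis unfolding level_time_less_iff[OF \<kappa>] by (auto; fastforce)
qed

lemma level_time_mono:
  assumes good: "good_path n z \<omega>" and n: "1 \<in> {1..n}" and \<kappa>: "0 \<le> \<kappa>" "\<kappa> \<le> \<kappa>'"
  shows "level_time n \<kappa> \<omega> \<le> level_time n \<kappa>' \<omega>"
proof (rule ccontr)
  assume "\<not> ?thesis"
  then have "level_time n \<kappa>' \<omega> < level_time n \<kappa> \<omega>" by simp
  moreover have "0 \<le> \<kappa>'" using \<kappa> by simp
  ultimately consider "\<kappa>' < level_time n \<kappa> \<omega>"
    | s where "0 \<le> s" "s < level_time n \<kappa> \<omega>" "\<kappa>' * \<omega> 1 s < total_mass n \<omega> s \<or> \<kappa>' < total_mass n \<omega> s"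
    using level_time_less_iff[of \<kappa>' n \<omega>] by blast
  then show False
  proof cases
    case 1
    then show False using level_time_less_iff[OF \<kappa>(1), of n \<omega> "level_time n \<kappa> \<omega>"] \<kappa> by auto
  next
    case 2
    have "\<kappa> * \<omega> 1 s \<le> \<kappa>' * \<omega> 1 s" using good n 2(1) \<kappa> by (intro mult_right_mono) (auto simp: good_path_def)
    then have "\<kappa> * \<omega> 1 s < total_mass n \<omega> s \<or> \<kappa> < total_mass n \<omega> s" using 2(3) \<kappa> by linarith
    then show False using level_time_less_iff[OF \<kappa>(1), of n \<omega> "level_time n \<kappa> \<omega>"] 2(1,2) by blast
  qed
qed

text \<open>Strictly before the level time no crossing has happened, and left limits extend both
  bounds to the level time itself. At time 0, where no left limit exists, the bounds follow from the
  initial values \<open>n * z\<close> of the total and \<open>z\<close> of the first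
  coordinate.\<close>

lemma level_time_bounds:
  assumes good: "good_path n z \<omega>" and n: "1 \<in> {1..n}" and z: "0 < z"
    and \<kappa>: "0 \<le> \<kappa>" "real n < \<kappa>" "real n * z < \<kappa>" and u: "0 \<le> u" "u \<le> level_time n \<kappa> \<omega>"
  shows "total_mass n \<omega> u \<le> \<kappa> * \<omega> 1 u" "total_mass n \<omega> u \<le> \<kappa>"
proof -
  have w: "\<omega> \<in> cont_paths n" using good by (simp add: good_path_def)
  have before: "total_mass n \<omega> v \<le> \<kappa> * \<omega> 1 v \<and> total_mass n \<omega> v \<le> \<kappa>" if "0 \<le> v" "v < level_time n \<kappa> \<omega>" for v
    using level_time_less_iff[OF \<kappa>(1), of n \<omega> "level_time n \<kappa> \<omega>"] that by force
  have "total_mass n \<omega> u \<le> \<kappa> * \<omega> 1 u \<and> total_mass n \<omega> u \<le> \<kappa>"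
  proof (cases "u < level_time n \<kappa> \<omega>")
    case False
    show ?thesis
    proof (cases "u = 0")
      case True
      have "total_mass n \<omega> 0 = real n * z" using good by (simp add: total_mass_def good_path_def)
      moreover have "\<omega> 1 0 = z" using good n by (simp add: good_path_def)
      ultimately show ?thesis using True \<kappa> z by (simp add: mult_right_mono)
    next
      case u0: False
      have left: "(f \<longlongrightarrow> f u) (at_left u)" if "continuous_on {0..} f" for f :: "real \<Rightarrow> real"
      proof -
        have "(f \<longlongrightarrow> f u) (at u within {0..})" using that u by (simp add: continuous_on)
        then have "(f \<longlongrightarrow> f u) (at u within {0<..<u})" by (rule tendsto_within_subset) auto
        moreover have "at u within {0<..<u} = at_left u"
          using u u0 by (intro at_within_nhd[of _ "{0<..}"]) auto
        ultimately show ?thesis by simp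
      qed
      have ev: "\<forall>\<^sub>F v in at_left u. 0 \<le> v \<and> v < level_time n \<kappa> \<omega>"
        using u u0 False by (auto simp: eventually_at_left_field intro!: exI[of _ 0])
      have T: "((\<lambda>u. total_mass n \<omega> u) \<longlongrightarrow> total_mass n \<omega> u) (at_left u)"
        by (rule left[OF total_mass_continuous[OF w]])
      have 1: "((\<lambda>u. \<kappa> * \<omega> 1 u) \<longlongrightarrow> \<kappa> * \<omega> 1 u) (at_left u)"
        using w n by (intro tendsto_mult_left left) (auto simp: cont_paths_def)
      have nb: "\<not> trivial_limit (at_left u)" by simp
      have "total_mass n \<omega> u \<le> \<kappa> * \<omega> 1 u"
        by (rule tendsto_le[OF nb 1 T]) (use ev before in \<open>auto elim!: eventually_mono\<close>)
      moreover have "total_mass n \<omega> u \<le> \<kappa>"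
        by (rule tendsto_le[OF nb tendsto_const T]) (use ev before in \<open>auto elim!: eventually_mono\<close>)
      ultimately show ?thesis by simp
    qed
  qed (use before u in auto)
  then show "total_mass n \<omega> u \<le> \<kappa> * \<omega> 1 u" "total_mass n \<omega> u \<le> \<kappa>" by auto
qed

text \<open>Once \<kappa> exceeds \<open>k\<close>, the maximum of the total mass up to
  \<open>T\<close>, and \<open>T\<close> itself, neither crossing nor the cap can occur before
  \<open>T\<close>.\<close>

lemma level_time_tendsto:
  assumes good: "good_path n z \<omega>" and n: "1 \<in> {1..n}" and k: "\<And>t. 0 \<le> t \<Longrightarrow> total_mass n \<omega> t \<le> k * \<omega> 1 t"
  shows "filterlim (\<lambda>\<kappa>. level_time n \<kappa> \<omega>) at_top at_top"
  unfolding filterlim_at_top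
proof
  fix T :: real
  have w: "\<omega> \<in> cont_paths n" using good by (simp add: good_path_def)
  have "continuous_on {0..max T 0} (\<lambda>t. total_mass n \<omega> t)"
    by (rule continuous_on_subset[OF total_mass_continuous[OF w]]) auto
  from compact_imp_bounded[OF compact_continuous_image[OF this compact_Icc]]
  obtain K where "\<forall>v\<in>(\<lambda>t. total_mass n \<omega> t) ` {0..max T 0}. norm v \<le> K"
    unfolding bounded_iff by blast
  then have K: "\<bar>total_mass n \<omega> t\<bar> \<le> K" if "0 \<le> t" "t \<le> max T 0" for t
    using that by simp
  show "\<forall>\<^sub>F \<kappa> in at_top. T \<le> level_time n \<kappa> \<omega>"
    using eventually_ge_at_top[of "max (max k K) (max T 0)"]
  proof eventually_elim
    case (elim \<kappa>)
    have "\<not> level_time n \<kappa> \<omega> < T"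
    proof
      assume "level_time n \<kappa> \<omega> < T"
      then obtain s where s: "0 \<le> s" "s < T" "\<kappa> * \<omega> 1 s < total_mass n \<omega> s \<or> \<kappa> < total_mass n \<omega> s"
        using level_time_less_iff[of \<kappa> n \<omega> T] elim by auto
      have "k * \<omega> 1 s \<le> \<kappa> * \<omega> 1 s" using good n s(1) elim by (intro mult_right_mono) (auto simp: good_path_def)
      then have "total_mass n \<omega> s \<le> \<kappa> * \<omega> 1 s" using k[OF s(1)] by linarith
      moreover have "total_mass n \<omega> s \<le> \<kappa>" using K[of s] s elim by auto
      ultimately show False using s(3) by linarith
    qed
    then show ?case by simp
  qed
qed

context size_biased
begin

text \<open>On alive paths \<open>P\<close> has density \<open>fraction t\<close> with respect to
  the sum of the permuted laws. The identity is \<open>P_alive_sets\<close> for indicators and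
  passes through linear combinations and monotone limits.\<close>

lemma transfer:
  assumes t: "0 \<le> t" and g: "g \<in> borel_measurable (coord_filtration n t)"
  shows "(\<integral>\<^sup>+ \<omega>. g \<omega> * indicator {\<omega>. total_mass n \<omega> t \<noteq> 0} \<omega> \<partial>P)
    = (\<Sum>i=1..n. \<integral>\<^sup>+ \<omega>. ennreal (fraction t \<omega>) * g \<omega> \<partial>front_law i)"
  using g
proof (induction rule: borel_measurable_induct)
  have sets_front: "sets (front_law i) = sets (path_space n)" for i by (simp add: front_law_def)
  have mP: "h \<in> borel_measurable P" if "h \<in> borel_measurable (coord_filtration n t)" for h :: "_ \<Rightarrow> ennreal"
    using PA.measurable_N_M[OF that] .
  have mF: "h \<in> borel_measurable (front_law i)" if "h \<in> borel_measurable (coord_filtration n t)" for h :: "_ \<Rightarrow> ennreal" and i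
    using PA.measurable_N_M[OF that] by (simp add: measurable_cong_sets[OF sets_P refl] measurable_cong_sets[OF sets_front refl])
  have fr: "(\<lambda>\<omega>. ennreal (fraction t \<omega>)) \<in> borel_measurable (front_law i)" for i
    by (rule mF) (use fraction_measurable[OF t] in measurable)
  have alive: "(indicator {\<omega>. total_mass n \<omega> t \<noteq> 0} :: _ \<Rightarrow> ennreal) \<in> borel_measurable P"
  proof -
    have "{\<omega> \<in> cont_paths n. total_mass n \<omega> t \<noteq> 0} \<in> sets P" using alive_sets[OF t] PA.sets_N by blast
    then show ?thesis by (simp add: borel_measurable_indicator_iff space_P Int_def conj_commute)
  qed
  {
    case (cong f g)
    have "(\<integral>\<^sup>+ \<omega>. f \<omega> * indicator {\<omega>. total_mass n \<omega> t \<noteq> 0} \<omega> \<partial>P) = (\<integral>\<^sup>+ \<omega>. g \<omega> * indicator {\<omega>. total_mass n \<omega> t \<noteq> 0} \<omega> \<partial>P)"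
      using cong(3) by (intro nn_integral_cong) (simp add: space_P)
    moreover have "(\<integral>\<^sup>+ \<omega>. ennreal (fraction t \<omega>) * f \<omega> \<partial>front_law i) = (\<integral>\<^sup>+ \<omega>. ennreal (fraction t \<omega>) * g \<omega> \<partial>front_law i)" for i
      using cong(3) by (intro nn_integral_cong) (simp add: front_law_def)
    ultimately show ?case using cong(4) by simp
  next
    case (set A)
    have "(\<integral>\<^sup>+ \<omega>. indicator A \<omega> * indicator {\<omega>. total_mass n \<omega> t \<noteq> 0} \<omega> \<partial>P) = (\<integral>\<^sup>+ \<omega>. indicator (A \<inter> {\<omega> \<in> cont_paths n. total_mass n \<omega> t \<noteq> 0}) \<omega> \<partial>P)"
      by (intro nn_integral_cong) (auto simp: space_P split: split_indicator)
    also have "\<dots> = emeasure P (A \<inter> {\<omega> \<in> cont_paths n. total_mass n \<omega> t \<noteq> 0})"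
      using set alive_sets[OF t] PA.sets_N by (intro nn_integral_indicator) blast
    finally show ?case using P_alive_sets[OF t set] by simp
  next
    case (mult u c)
    have "(\<integral>\<^sup>+ \<omega>. c * u \<omega> * indicator {\<omega>. total_mass n \<omega> t \<noteq> 0} \<omega> \<partial>P) = c * (\<integral>\<^sup>+ \<omega>. u \<omega> * indicator {\<omega>. total_mass n \<omega> t \<noteq> 0} \<omega> \<partial>P)"
      unfolding mult.assoc using mP[OF mult.hyps(2)] alive by (intro nn_integral_cmult) auto
    moreover have "(\<integral>\<^sup>+ \<omega>. ennreal (fraction t \<omega>) * (c * u \<omega>) \<partial>front_law i) = c * (\<integral>\<^sup>+ \<omega>. ennreal (fraction t \<omega>) * u \<omega> \<partial>front_law i)" for i
      unfolding mult.left_commute[of _ c] using mF[OF mult.hyps(2)] fr by (intro nn_integral_cmult) auto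
    ultimately show ?case using mult.IH by (simp add: sum_distrib_left)
  next
    case (add u v)
    have "(\<integral>\<^sup>+ \<omega>. (v \<omega> + u \<omega>) * indicator {\<omega>. total_mass n \<omega> t \<noteq> 0} \<omega> \<partial>P)
      = (\<integral>\<^sup>+ \<omega>. v \<omega> * indicator {\<omega>. total_mass n \<omega> t \<noteq> 0} \<omega> \<partial>P) + (\<integral>\<^sup>+ \<omega>. u \<omega> * indicator {\<omega>. total_mass n \<omega> t \<noteq> 0} \<omega> \<partial>P)"
      unfolding distrib_right using mP[OF add.hyps(1)] mP[OF add.hyps(3)] alive by (intro nn_integral_add) auto
    moreover have "(\<integral>\<^sup>+ \<omega>. ennreal (fraction t \<omega>) * (v \<omega> + u \<omega>) \<partial>front_law i)
      = (\<integral>\<^sup>+ \<omega>. ennreal (fraction t \<omega>) * v \<omega> \<partial>front_law i) + (\<integral>\<^sup>+ \<omega>. ennreal (fraction t \<omega>) * u \<omega> \<partial>front_law i)" for i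
      unfolding distrib_left using mF[OF add.hyps(1)] mF[OF add.hyps(3)] fr by (intro nn_integral_add) auto
    ultimately show ?case using add.IH by (simp add: sum.distrib)
  next
    case (seq U)
    have "(\<integral>\<^sup>+ \<omega>. (SUP i. U i) \<omega> * indicator {\<omega>. total_mass n \<omega> t \<noteq> 0} \<omega> \<partial>P)
      = (SUP k. \<integral>\<^sup>+ \<omega>. U k \<omega> * indicator {\<omega>. total_mass n \<omega> t \<noteq> 0} \<omega> \<partial>P)"
    proof -
      have "(\<integral>\<^sup>+ \<omega>. (SUP i. U i) \<omega> * indicator {\<omega>. total_mass n \<omega> t \<noteq> 0} \<omega> \<partial>P) = (\<integral>\<^sup>+ \<omega>. (SUP k. U k \<omega> * indicator {\<omega>. total_mass n \<omega> t \<noteq> 0} \<omega>) \<partial>P)"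
        by (intro nn_integral_cong) (simp only: SUP_apply SUP_mult_right_ennreal)
      also have "\<dots> = (SUP k. \<integral>\<^sup>+ \<omega>. U k \<omega> * indicator {\<omega>. total_mass n \<omega> t \<noteq> 0} \<omega> \<partial>P)"
        using mP[OF seq.hyps(1)] alive seq.hyps(3)
        by (intro nn_integral_monotone_convergence_SUP) (auto simp: incseq_def le_fun_def intro!: mult_right_mono)
      finally show ?thesis .
    qed
    moreover have "(\<integral>\<^sup>+ \<omega>. ennreal (fraction t \<omega>) * (SUP i. U i) \<omega> \<partial>front_law i)
      = (SUP k. \<integral>\<^sup>+ \<omega>. ennreal (fraction t \<omega>) * U k \<omega> \<partial>front_law i)" for i
    proof -
      have "(\<integral>\<^sup>+ \<omega>. ennreal (fraction t \<omega>) * (SUP i. U i) \<omega> \<partial>front_law i) = (\<integral>\<^sup>+ \<omega>. (SUP k. ennreal (fraction t \<omega>) * U k \<omega>) \<partial>front_law i)"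
        by (intro nn_integral_cong) (simp only: SUP_apply SUP_mult_left_ennreal)
      also have "\<dots> = (SUP k. \<integral>\<^sup>+ \<omega>. ennreal (fraction t \<omega>) * U k \<omega> \<partial>front_law i)"
        using mF[OF seq.hyps(1)] fr seq.hyps(3)
        by (intro nn_integral_monotone_convergence_SUP) (auto simp: incseq_def le_fun_def intro!: mult_left_mono)
      finally show ?thesis .
    qed
    moreover have "(\<Sum>i=1..n. SUP k. \<integral>\<^sup>+ \<omega>. ennreal (fraction t \<omega>) * U k \<omega> \<partial>front_law i)
      = (SUP k. \<Sum>i=1..n. \<integral>\<^sup>+ \<omega>. ennreal (fraction t \<omega>) * U k \<omega> \<partial>front_law i)"
      using seq.hyps(3) by (intro ennreal_SUP_sum[symmetric])
        (auto simp: incseq_def le_fun_def intro!: nn_integral_mono mult_left_mono)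
    ultimately show ?case using seq.IH by simp
  }
qed

text \<open>Positivity of the total mass is built in, so that the event consists of alive paths even
  outside the good ones and \<open>P_alive_sets\<close> computes its mass.\<close>

definition low_fraction :: "real \<Rightarrow> real \<Rightarrow> (nat \<Rightarrow> real \<Rightarrow> real) set" where
  "low_fraction \<kappa> q = {\<omega> \<in> cont_paths n. \<kappa> * \<omega> 1 q < total_mass n \<omega> q \<and> 0 < total_mass n \<omega> q}"

lemma sets_low_fraction: "0 \<le> q \<Longrightarrow> low_fraction \<kappa> q \<in> sets (coord_filtration n q)"
proof -
  assume q: "0 \<le> q"
  have [measurable]: "(\<lambda>\<omega>. total_mass n \<omega> q) \<in> borel_measurable (coord_filtration n q)"
    "(\<lambda>\<omega>. \<omega> 1 q) \<in> borel_measurable (coord_filtration n q)"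
    using total_mass_measurable[OF q order_refl] coord_filtration_measurable[OF one_in q order_refl] by auto
  have "{\<omega> \<in> space (coord_filtration n q). \<kappa> * \<omega> 1 q < total_mass n \<omega> q \<and> 0 < total_mass n \<omega> q} \<in> sets (coord_filtration n q)"
    by measurable
  then show ?thesis by (simp add: low_fraction_def)
qed

text \<open>Under the size-biased law the event that the fraction is below \<open>1/\<kappa>\<close> for the first time
  at \<open>q\<close> has weight at most \<open>1/\<kappa>\<close> relative to the unbiased laws.\<close>

lemma low_fraction_finite:
  assumes T: "finite T" "T \<subseteq> {0..}" and \<kappa>: "0 < \<kappa>"
  shows "emeasure P (\<Union>q\<in>T. low_fraction \<kappa> q) \<le> ennreal (real n / \<kappa>)"
proof -
  let ?D = "first_in T (low_fraction \<kappa>)"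
  have D: "?D q \<in> sets (coord_filtration n q)" if "q \<in> T" for q
    by (rule PA.sets_first_in[OF T(1) sets_low_fraction that]) (use T in auto)
  have DP: "?D q \<in> sets P" if "q \<in> T" for q using D[OF that] PA.sets_N by blast
  have DF: "?D q \<in> sets (front_law i)" if "q \<in> T" for q i
    using DP[OF that] by (simp add: sets_P front_law_def)
  have "emeasure P (\<Union>q\<in>T. low_fraction \<kappa> q) = emeasure P (\<Union>q\<in>T. ?D q)"
    by (simp only: UN_first_in[OF T(1)])
  also have "\<dots> = (\<Sum>q\<in>T. emeasure P (?D q))"
    by (rule sum_emeasure[symmetric, OF image_subsetI disjoint_first_in T(1)]) (rule DP)
  also have "\<dots> \<le> (\<Sum>q\<in>T. \<Sum>i=1..n. ennreal (1 / \<kappa>) * emeasure (front_law i) (?D q))"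
  proof (rule sum_mono)
    fix q assume q: "q \<in> T"
    have q0: "0 \<le> q" using T q by auto
    have "?D q = ?D q \<inter> {\<omega> \<in> cont_paths n. total_mass n \<omega> q \<noteq> 0}"
      by (auto simp: first_in_def low_fraction_def)
    then have "emeasure P (?D q) = (\<Sum>i=1..n. \<integral>\<^sup>+ \<omega>. ennreal (fraction q \<omega>) * indicator (?D q) \<omega> \<partial>front_law i)"
      using P_alive_sets[OF q0 D[OF q]] by simp
    also have "\<dots> \<le> (\<Sum>i=1..n. \<integral>\<^sup>+ \<omega>. ennreal (1 / \<kappa>) * indicator (?D q) \<omega> \<partial>front_law i)"
    proof (intro sum_mono nn_integral_mono)
      fix \<omega>
      show "ennreal (fraction q \<omega>) * indicator (?D q) \<omega> \<le> ennreal (1 / \<kappa>) * indicator (?D q) \<omega>"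
      proof (cases "\<omega> \<in> ?D q")
        case True
        then have "fraction q \<omega> \<le> 1 / \<kappa>"
          using \<kappa> by (auto simp: first_in_def low_fraction_def fraction_def field_simps)
        then show ?thesis by (intro mult_right_mono ennreal_leI) auto
      qed simp
    qed
    also have "\<dots> = (\<Sum>i=1..n. ennreal (1 / \<kappa>) * emeasure (front_law i) (?D q))"
      using DF[OF q] by (intro sum.cong) (simp_all add: nn_integral_cmult_indicator)
    finally show "emeasure P (?D q) \<le> (\<Sum>i=1..n. ennreal (1 / \<kappa>) * emeasure (front_law i) (?D q))" .
  qed
  also have "\<dots> = (\<Sum>i=1..n. ennreal (1 / \<kappa>) * (\<Sum>q\<in>T. emeasure (front_law i) (?D q)))"
    by (subst sum.swap) (simp add: sum_distrib_left)
  also have "\<dots> \<le> (\<Sum>i=1..n. ennreal (1 / \<kappa>) * 1)"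
  proof (intro sum_mono mult_left_mono)
    fix i assume i: "i \<in> {1..n}"
    interpret R: product_law "front_law i" n z by (rule front_law[OF i])
    have "(\<Sum>q\<in>T. emeasure (front_law i) (?D q)) = emeasure (front_law i) (\<Union>q\<in>T. ?D q)"
      by (rule sum_emeasure[OF image_subsetI disjoint_first_in T(1)]) (rule DF)
    also have "\<dots> \<le> 1" by (rule R.emeasure_le_1)
    finally show "(\<Sum>q\<in>T. emeasure (front_law i) (?D q)) \<le> 1" .
  qed simp
  also have "\<dots> = ennreal (real n / \<kappa>)"
    using \<kappa> by (simp add: ennreal_of_nat_eq_real_of_nat ennreal_mult[symmetric])
  finally show ?thesis .
qed

text \<open>The bound \<open>n / \<kappa>\<close> is uniform over finite sets of times and so
  extends to all rational times. Letting \<kappa> run through the positive integers, almost every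
  path avoids the low fraction for some level at all rational times, and continuity covers the
  remaining ones.\<close>

lemma AE_P_ratio_bound: "AE \<omega> in P. \<exists>k. \<forall>t\<ge>0. total_mass n \<omega> t \<le> k * \<omega> 1 t"
proof -
  let ?R = "\<rat> \<inter> {0 :: real..}"
  have R: "countable ?R" "?R \<noteq> {}" using countable_rat by auto
  define U where "U \<kappa> m = (\<Union>q\<in>from_nat_into ?R ` {..m}. low_fraction \<kappa> q)" for \<kappa> and m :: nat
  have sub: "from_nat_into ?R ` {..m} \<subseteq> {0..}" for m using from_nat_into[OF R(2)] by auto
  have lP: "low_fraction \<kappa> q \<in> sets P" if "0 \<le> q" for \<kappa> q using sets_low_fraction[OF that] PA.sets_N by blast
  have Um: "U \<kappa> m \<in> sets P" for \<kappa> m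
    unfolding U_def using sub[of m] by (intro sets.finite_UN lP) auto
  have le: "emeasure P (\<Union>m. U \<kappa> m) \<le> ennreal (real n / \<kappa>)" if "0 < \<kappa>" for \<kappa>
  proof -
    have "incseq (U \<kappa>)" unfolding incseq_def U_def by (intro allI impI UN_mono image_mono) auto
    then have "(SUP m. emeasure P (U \<kappa> m)) = emeasure P (\<Union>m. U \<kappa> m)"
      using Um by (intro SUP_emeasure_incseq) auto
    moreover have "(SUP m. emeasure P (U \<kappa> m)) \<le> ennreal (real n / \<kappa>)"
      unfolding U_def by (intro SUP_least low_fraction_finite sub that) auto
    ultimately show ?thesis by simp
  qed
  define A where "A = (\<Inter>k. \<Union>m. U (real (Suc k)) m)"
  have Am: "A \<in> sets P" unfolding A_def using Um by (intro sets.countable_INT) auto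
  have "emeasure P A \<le> ennreal (real n / real (Suc k))" for k
  proof -
    have "emeasure P A \<le> emeasure P (\<Union>m. U (real (Suc k)) m)"
      unfolding A_def using Um by (intro emeasure_mono) auto
    also have "\<dots> \<le> ennreal (real n / real (Suc k))" by (rule le) simp
    finally show ?thesis .
  qed
  moreover have "(\<lambda>k. ennreal (real n / real (Suc k))) \<longlonglongrightarrow> ennreal 0"
    by (intro tendsto_ennrealI) real_asymp
  ultimately have "emeasure P A \<le> ennreal 0" by (intro LIMSEQ_le_const[of _ "ennreal 0"]) auto
  then have "A \<in> null_sets P" using Am by (auto simp: null_sets_def)
  then have "AE \<omega> in P. \<omega> \<notin> A" by (rule AE_not_in)
  then show ?thesis
    using AE_P_good_path
  proof eventually_elim
    case (elim \<omega>)
    then obtain k where k: "\<omega> \<notin> (\<Union>m. U (real (Suc k)) m)" by (auto simp: A_def)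
    have w: "\<omega> \<in> cont_paths n" using elim by (simp add: good_path_def)
    have cont: "continuous_on {0..} (\<lambda>t. real (Suc k) * \<omega> 1 t - total_mass n \<omega> t)"
      using w one_in by (intro continuous_intros total_mass_continuous) (auto simp: cont_paths_def)
    have "0 \<le> real (Suc k) * \<omega> 1 q - total_mass n \<omega> q" if q: "q \<in> ?R" for q
    proof -
      obtain m where "from_nat_into ?R m = q" using from_nat_into_surj[OF R(1) q] by auto
      then have "\<omega> \<notin> low_fraction (real (Suc k)) q" using k by (auto simp: U_def)
      moreover have "0 \<le> \<omega> 1 q" using elim(2) one_in q by (auto simp: good_path_def)
      moreover have "0 \<le> real (Suc k) * \<omega> 1 q" using \<open>0 \<le> \<omega> 1 q\<close> by (intro mult_nonneg_nonneg) auto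
      moreover have "0 \<le> total_mass n \<omega> q" using good_path_total_nonneg[OF elim(2)] q by simp
      ultimately show ?thesis using w unfolding low_fraction_def mem_Collect_eq by linarith
    qed
    then have "\<forall>t\<ge>0. 0 \<le> real (Suc k) * \<omega> 1 t - total_mass n \<omega> t"
      using nonneg_iff_rational[OF cont] by blast
    then show ?case by (intro exI[of _ "real (Suc k)"]) auto
  qed
qed

end

text \<open>Common interface of the three numerators. \<open>Y_dead\<close> settles the time after
  death, when the ratio is frozen; \<open>Y_bounded\<close> bounds the process up to a level time;
  \<open>Y_survives\<close> is the mass that is lost when the first coordinate has died by time
  1.\<close>

locale numerator = size_biased Q n z P for Q :: "(nat \<Rightarrow> real \<Rightarrow> real) measure" and n z P +
  fixes Y :: "real \<Rightarrow> (nat \<Rightarrow> real \<Rightarrow> real) \<Rightarrow> real"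
  assumes Y_martingale: "\<And>i. i \<in> {1..n} \<Longrightarrow> pos_martingale (front_law i) (coord_filtration n) Y"
    and Y_measurable: "\<And>t. 0 \<le> t \<Longrightarrow> Y t \<in> borel_measurable (coord_filtration n t)"
    and Y_continuous: "\<And>\<omega>. \<omega> \<in> cont_paths n \<Longrightarrow> continuous_on {0..} (\<lambda>t. Y t \<omega>)"
    and Y_nonneg: "\<And>\<omega> t. good_path n z \<omega> \<Longrightarrow> 0 \<le> t \<Longrightarrow> 0 \<le> Y t \<omega>"
    and Y_dead: "\<And>\<omega> t. good_path n z \<omega> \<Longrightarrow> 0 \<le> t \<Longrightarrow> total_mass n \<omega> t = 0 \<Longrightarrow> Y t \<omega> = 0"
    and Y_bounded: "\<And>\<kappa>. \<exists>C. \<forall>\<omega> t. good_path n z \<omega> \<longrightarrow> 0 \<le> t \<longrightarrow> total_mass n \<omega> t \<le> \<kappa> \<longrightarrow> Y t \<omega> \<le> C"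
    and Y_survives: "\<And>i. i \<in> {1..n} \<Longrightarrow> 0 < (\<integral>\<omega>. indicator {\<omega>. \<omega> 1 1 = 0} \<omega> * Y 1 \<omega> \<partial>front_law i)"
begin

definition D :: "real \<Rightarrow> (nat \<Rightarrow> real \<Rightarrow> real) \<Rightarrow> real" where
  "D t \<omega> = Y t \<omega> * total_mass n \<omega> t / \<omega> 1 t"

lemma D_measurable: "0 \<le> t \<Longrightarrow> D t \<in> borel_measurable (coord_filtration n t)"
  unfolding D_def[abs_def]
  using Y_measurable[of t] coord_filtration_measurable[OF one_in, of t t] total_mass_measurable[of t t n] by measurable

lemma first_nonneg: "good_path n z \<omega> \<Longrightarrow> 0 \<le> t \<Longrightarrow> 0 \<le> \<omega> 1 t"
  using one_in by (auto simp: good_path_def)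

lemma D_nonneg: "good_path n z \<omega> \<Longrightarrow> 0 \<le> t \<Longrightarrow> 0 \<le> D t \<omega>"
  using Y_nonneg[of \<omega> t] good_path_total_nonneg[of n z \<omega> t] first_nonneg[of \<omega> t] by (simp add: D_def)

lemma D_dead: "good_path n z \<omega> \<Longrightarrow> 0 \<le> t \<Longrightarrow> total_mass n \<omega> t = 0 \<Longrightarrow> D t \<omega> = 0"
  by (simp add: D_def)

text \<open>The cancellation of the density together with its defect: where the first coordinate is
  0, the product is 0 rather than \<open>Y\<close>.\<close>

lemma fraction_D:
  assumes "good_path n z \<omega>" "0 \<le> t"
  shows "fraction t \<omega> * D t \<omega> = (if \<omega> 1 t = 0 then 0 else Y t \<omega>)"
proof (cases "total_mass n \<omega> t = 0")
  case True
  then have "\<omega> 1 t = 0" using good_path_le_total[OF assms one_in] first_nonneg[OF assms] by simp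
  then show ?thesis by (simp add: fraction_def)
qed (simp add: fraction_def D_def)

lemma AE_front_good: "i \<in> {1..n} \<Longrightarrow> AE \<omega> in front_law i. good_path n z \<omega>"
  using product_law.AE_good_path[OF front_law] .

text \<open>Since \<open>D\<close> is 0 on dead paths and \<open>f 0 = 0\<close>, restricting to
  alive paths changes nothing. Besides the identity, \<open>f\<close> will be a truncation at a
  nonnegative level.\<close>

lemma D_transfer:
  assumes t: "0 \<le> t" and B: "B \<in> sets (coord_filtration n t)" and f: "f \<in> borel_measurable borel" "f 0 = 0"
  shows "(\<integral>\<^sup>+ \<omega>. ennreal (f (D t \<omega>)) * indicator B \<omega> \<partial>P)
    = (\<Sum>i=1..n. \<integral>\<^sup>+ \<omega>. ennreal (fraction t \<omega> * f (D t \<omega>)) * indicator B \<omega> \<partial>front_law i)"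
proof -
  have m: "(\<lambda>\<omega>. ennreal (f (D t \<omega>)) * indicator B \<omega>) \<in> borel_measurable (coord_filtration n t)"
    using measurable_compose[OF D_measurable[OF t] f(1)] B by measurable
  have "(\<integral>\<^sup>+ \<omega>. ennreal (f (D t \<omega>)) * indicator B \<omega> \<partial>P) = (\<integral>\<^sup>+ \<omega>. (ennreal (f (D t \<omega>)) * indicator B \<omega>) * indicator {\<omega>. total_mass n \<omega> t \<noteq> 0} \<omega> \<partial>P)"
    using AE_P_good_path by (intro nn_integral_cong_AE) (auto simp: D_dead[OF _ t] f(2) elim!: eventually_mono split: split_indicator)
  also have "\<dots> = (\<Sum>i=1..n. \<integral>\<^sup>+ \<omega>. ennreal (fraction t \<omega>) * (ennreal (f (D t \<omega>)) * indicator B \<omega>) \<partial>front_law i)"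
    by (rule transfer[OF t m])
  also have "\<dots> = (\<Sum>i=1..n. \<integral>\<^sup>+ \<omega>. ennreal (fraction t \<omega> * f (D t \<omega>)) * indicator B \<omega> \<partial>front_law i)"
  proof (intro sum.cong refl nn_integral_cong_AE)
    fix i assume i: "i \<in> {1..n}"
    show "AE \<omega> in front_law i. ennreal (fraction t \<omega>) * (ennreal (f (D t \<omega>)) * indicator B \<omega>) = ennreal (fraction t \<omega> * f (D t \<omega>)) * indicator B \<omega>"
      using AE_front_good[OF i] by eventually_elim (simp add: ennreal_mult' good_path_fraction(1)[OF _ t] mult.assoc)
  qed
  finally show ?thesis .
qed

text \<open>Under each permuted law the mean of \<open>Y\<close> is the same at times 0 and 1. At
  time 0 the first coordinate is \<open>z > 0\<close>, so nothing is missing; at time 1 the amount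
  in \<open>Y_survives\<close> is.\<close>

lemma D_decreases: "(\<integral>\<^sup>+ \<omega>. ennreal (D 1 \<omega>) \<partial>P) < (\<integral>\<^sup>+ \<omega>. ennreal (D 0 \<omega>) \<partial>P)"
proof -
  have sp: "cont_paths n \<in> sets (coord_filtration n t)" for t
    using sets.top[of "coord_filtration n t"] by simp
  have D: "(\<integral>\<^sup>+ \<omega>. ennreal (D t \<omega>) \<partial>P) = (\<Sum>i=1..n. ennreal (\<integral>\<omega>. (1 - indicator {\<omega>. \<omega> 1 t = 0} \<omega>) * Y t \<omega> \<partial>front_law i))"
    (is "_ = (\<Sum>i=1..n. ennreal (?e i t))")
    and e: "i \<in> {1..n} \<Longrightarrow> 0 \<le> (\<integral>\<omega>. (1 - indicator {\<omega>. \<omega> 1 t = 0} \<omega>) * Y t \<omega> \<partial>front_law i)"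
    and int: "i \<in> {1..n} \<Longrightarrow> integrable (front_law i) (\<lambda>\<omega>. indicator {\<omega>. \<omega> 1 t = 0} \<omega> * Y t \<omega>)"
    if t: "0 \<le> t" for t i
  proof -
    have int': "integrable (front_law i) (\<lambda>\<omega>. indicator {\<omega>. \<omega> 1 t = 0} \<omega> * Y t \<omega>)"
      "integrable (front_law i) (\<lambda>\<omega>. (1 - indicator {\<omega>. \<omega> 1 t = 0} \<omega>) * Y t \<omega>)" if i: "i \<in> {1..n}" for i
    proof -
      interpret R: product_law "front_law i" n z by (rule front_law[OF i])
      interpret Y: pos_martingale "front_law i" "coord_filtration n" Y by (rule Y_martingale[OF i])
      have m: "{\<omega> \<in> space (front_law i). \<omega> 1 t = 0} \<in> sets (front_law i)"
        using coord_zero_sets[OF one_in t, of 0] by (simp add: front_law_def)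
      have "integrable (front_law i) (\<lambda>\<omega>. indicator {\<omega> \<in> space (front_law i). \<omega> 1 t = 0} \<omega> *\<^sub>R Y t \<omega>)"
        by (rule integrable_mult_indicator[OF m Y.Y_integrable[OF t]])
      also have "?this \<longleftrightarrow> integrable (front_law i) (\<lambda>\<omega>. indicator {\<omega>. \<omega> 1 t = 0} \<omega> * Y t \<omega>)"
        by (intro Bochner_Integration.integrable_cong) (auto split: split_indicator)
      finally show 1: "integrable (front_law i) (\<lambda>\<omega>. indicator {\<omega>. \<omega> 1 t = 0} \<omega> * Y t \<omega>)" .
      show "integrable (front_law i) (\<lambda>\<omega>. (1 - indicator {\<omega>. \<omega> 1 t = 0} \<omega>) * Y t \<omega>)"
        using Bochner_Integration.integrable_diff[OF Y.Y_integrable[OF t] 1] by (simp add: left_diff_distrib)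
    qed
    then show "i \<in> {1..n} \<Longrightarrow> integrable (front_law i) (\<lambda>\<omega>. indicator {\<omega>. \<omega> 1 t = 0} \<omega> * Y t \<omega>)" by blast
    have nn: "AE \<omega> in front_law i. 0 \<le> (1 - indicator {\<omega>. \<omega> 1 t = 0} \<omega>) * Y t \<omega>" if i: "i \<in> {1..n}" for i
      using AE_front_good[OF i] by eventually_elim (simp add: Y_nonneg[OF _ t] split: split_indicator)
    then show "i \<in> {1..n} \<Longrightarrow> 0 \<le> ?e i t" by (intro integral_nonneg_AE)
    have "(\<integral>\<^sup>+ \<omega>. ennreal (D t \<omega>) \<partial>P) = (\<integral>\<^sup>+ \<omega>. ennreal (D t \<omega>) * indicator (cont_paths n) \<omega> \<partial>P)"
      by (intro nn_integral_cong) (simp add: space_P)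
    also have "\<dots> = (\<Sum>i=1..n. \<integral>\<^sup>+ \<omega>. ennreal (fraction t \<omega> * D t \<omega>) * indicator (cont_paths n) \<omega> \<partial>front_law i)"
      using D_transfer[OF t sp, of "\<lambda>x. x"] by simp
    also have "\<dots> = (\<Sum>i=1..n. ennreal (?e i t))"
    proof (rule sum.cong[OF refl])
      fix i assume i: "i \<in> {1..n}"
      have "(\<integral>\<^sup>+ \<omega>. ennreal (fraction t \<omega> * D t \<omega>) * indicator (cont_paths n) \<omega> \<partial>front_law i)
        = (\<integral>\<^sup>+ \<omega>. ennreal ((1 - indicator {\<omega>. \<omega> 1 t = 0} \<omega>) * Y t \<omega>) \<partial>front_law i)"
      proof (rule nn_integral_cong_AE)
        show "AE \<omega> in front_law i. ennreal (fraction t \<omega> * D t \<omega>) * indicator (cont_paths n) \<omega>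
          = ennreal ((1 - indicator {\<omega>. \<omega> 1 t = 0} \<omega>) * Y t \<omega>)"
          using AE_front_good[OF i]
        proof eventually_elim
          case (elim \<omega>)
          then have "\<omega> \<in> cont_paths n" by (simp add: good_path_def)
          then show ?case by (simp add: fraction_D[OF elim t])
        qed
      qed
      also have "\<dots> = ennreal (?e i t)" by (intro nn_integral_eq_integral int' i nn)
      finally show "(\<integral>\<^sup>+ \<omega>. ennreal (fraction t \<omega> * D t \<omega>) * indicator (cont_paths n) \<omega> \<partial>front_law i) = ennreal (?e i t)" .
    qed
    finally show "(\<integral>\<^sup>+ \<omega>. ennreal (D t \<omega>) \<partial>P) = (\<Sum>i=1..n. ennreal (?e i t))" .
  qed
  have lt: "(\<integral>\<omega>. (1 - indicator {\<omega>. \<omega> 1 1 = 0} \<omega>) * Y 1 \<omega> \<partial>front_law i) < (\<integral>\<omega>. (1 - indicator {\<omega>. \<omega> 1 0 = 0} \<omega>) * Y 0 \<omega> \<partial>front_law i)"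
    if i: "i \<in> {1..n}" for i
  proof -
    interpret R: product_law "front_law i" n z by (rule front_law[OF i])
    interpret Y: pos_martingale "front_law i" "coord_filtration n" Y by (rule Y_martingale[OF i])
    have m: "(\<lambda>\<omega>. indicator {\<omega>. \<omega> 1 0 = 0} \<omega> * Y 0 \<omega>) \<in> borel_measurable (front_law i)"
      using int[OF order_refl i] by auto
    have "(\<integral>\<omega>. (1 - indicator {\<omega>. \<omega> 1 1 = 0} \<omega>) * Y 1 \<omega> \<partial>front_law i) = (\<integral>\<omega>. Y 1 \<omega> \<partial>front_law i) - (\<integral>\<omega>. indicator {\<omega>. \<omega> 1 1 = 0} \<omega> * Y 1 \<omega> \<partial>front_law i)"
      unfolding left_diff_distrib using Y.Y_integrable[of 1] int[of 1, OF _ i] by simp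
    also have "\<dots> < (\<integral>\<omega>. Y 1 \<omega> \<partial>front_law i)" using Y_survives[OF i] by simp
    also have "\<dots> = (\<integral>\<omega>. Y 0 \<omega> \<partial>front_law i)"
      using Y.Y_martingale[of 0 1 "cont_paths n"] sp R.space_Q set_integral_space[OF Y.Y_integrable] by simp
    also have "\<dots> = (\<integral>\<omega>. (1 - indicator {\<omega>. \<omega> 1 0 = 0} \<omega>) * Y 0 \<omega> \<partial>front_law i)"
    proof (rule integral_cong_AE)
      show "AE \<omega> in front_law i. Y 0 \<omega> = (1 - indicator {\<omega>. \<omega> 1 0 = 0} \<omega>) * Y 0 \<omega>"
        using AE_front_good[OF i] by eventually_elim (use one_in Q.z in \<open>auto simp: good_path_def\<close>)
    qed (use m Y.Y_measurable_M[of 0] in \<open>simp_all add: left_diff_distrib\<close>)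
    finally show ?thesis .
  qed
  have "(\<Sum>i=1..n. ?e i 1) < (\<Sum>i=1..n. ?e i 0)"
    using one_in lt by (intro sum_strict_mono) auto
  moreover have "0 \<le> (\<Sum>i=1..n. ?e i 1)" by (intro sum_nonneg e) auto
  moreover have "(\<integral>\<^sup>+ \<omega>. ennreal (D t \<omega>) \<partial>P) = ennreal (\<Sum>i=1..n. ?e i t)" if "0 \<le> t" for t
    unfolding D[OF that] by (intro sum_ennreal e[OF that])
  ultimately show ?thesis by (simp only: ennreal_less_iff zero_le_one order_refl)
qed

context
  fixes \<kappa> :: real
  assumes \<kappa>: "0 \<le> \<kappa>" "real n < \<kappa>" "real n * z < \<kappa>"
begin

abbreviation \<tau> :: "(nat \<Rightarrow> real \<Rightarrow> real) \<Rightarrow> real" where "\<tau> \<equiv> level_time n \<kappa>"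

lemma level_time_sets: "0 \<le> r \<Longrightarrow> {\<omega> \<in> cont_paths n. \<tau> \<omega> < r} \<in> sets (coord_filtration n r)"
proof -
  assume r: "0 \<le> r"
  have top: "cont_paths n \<in> sets (coord_filtration n r)" using sets.top[of "coord_filtration n r"] by simp
  show ?thesis
  proof (cases "\<kappa> < r")
    case True
    then have "{\<omega> \<in> cont_paths n. \<tau> \<omega> < r} = cont_paths n"
      using level_time_less_iff[OF \<kappa>(1)] by auto
    then show ?thesis using top by simp
  next
    case False
    have "{\<omega> \<in> cont_paths n. \<tau> \<omega> < r} = (\<Union>q\<in>\<rat> \<inter> {0..<r}. {\<omega> \<in> cont_paths n. \<kappa> * \<omega> 1 q < total_mass n \<omega> q \<or> \<kappa> < total_mass n \<omega> q})"
      using False level_time_less_iff_rational[OF _ one_in \<kappa>(1)] by blast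
    also have "\<dots> \<in> sets (coord_filtration n r)"
    proof (rule sets.countable_UN'')
      fix q assume "q \<in> \<rat> \<inter> {0..<r}"
      then have q: "0 \<le> q" "q \<le> r" by auto
      have [measurable]: "(\<lambda>\<omega>. total_mass n \<omega> q) \<in> borel_measurable (coord_filtration n r)"
        "(\<lambda>\<omega>. \<omega> 1 q) \<in> borel_measurable (coord_filtration n r)"
        using total_mass_measurable[OF q] coord_filtration_measurable[OF one_in q] by auto
      have "{\<omega> \<in> space (coord_filtration n r). \<kappa> * \<omega> 1 q < total_mass n \<omega> q \<or> \<kappa> < total_mass n \<omega> q} \<in> sets (coord_filtration n r)"
        by measurable
      then show "{\<omega> \<in> cont_paths n. \<kappa> * \<omega> 1 q < total_mass n \<omega> q \<or> \<kappa> < total_mass n \<omega> q} \<in> sets (coord_filtration n r)" by simp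
    qed (use countable_rat in auto)
    finally show ?thesis .
  qed
qed

lemma total_bounds:
  assumes "good_path n z \<omega>" "0 \<le> u" "u \<le> \<tau> \<omega>"
  shows "total_mass n \<omega> u \<le> \<kappa> * \<omega> 1 u" "total_mass n \<omega> u \<le> \<kappa>"
  by (rule level_time_bounds[OF assms(1) one_in Q.z \<kappa> assms(2,3)])+

lemma alive_first_pos:
  assumes "good_path n z \<omega>" "0 \<le> u" "u \<le> \<tau> \<omega>" "total_mass n \<omega> u \<noteq> 0"
  shows "0 < \<omega> 1 u"
proof -
  have "0 \<le> total_mass n \<omega> u" by (rule good_path_total_nonneg[OF assms(1,2)])
  then have "\<omega> 1 u \<noteq> 0" using total_bounds(1)[OF assms(1-3)] assms(4) by auto
  then show ?thesis using first_nonneg[OF assms(1,2)] by simp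
qed

text \<open>Up to the level time the two level conditions bound \<open>\<zeta> / Z(1)\<close>
  directly and \<open>Y\<close> through \<open>Y_bounded\<close>; at dead times \<open>D\<close> is
  0.\<close>

lemma D_bounded: "\<exists>K\<ge>0. \<forall>\<omega> u. good_path n z \<omega> \<longrightarrow> 0 \<le> u \<longrightarrow> u \<le> \<tau> \<omega> \<longrightarrow> D u \<omega> \<le> K"
proof -
  obtain C where C: "\<And>\<omega> t. good_path n z \<omega> \<Longrightarrow> 0 \<le> t \<Longrightarrow> total_mass n \<omega> t \<le> \<kappa> \<Longrightarrow> Y t \<omega> \<le> C"
    using Y_bounded[of \<kappa>] by blast
  have "D u \<omega> \<le> \<bar>C\<bar> * \<kappa>" if g: "good_path n z \<omega>" and u: "0 \<le> u" "u \<le> \<tau> \<omega>" for \<omega> u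
  proof (cases "total_mass n \<omega> u = 0")
    case True
    then show ?thesis using D_dead[OF g u(1)] \<kappa> by simp
  next
    case False
    have p: "0 < \<omega> 1 u" by (rule alive_first_pos[OF g u False])
    have "total_mass n \<omega> u / \<omega> 1 u \<le> \<kappa>" using total_bounds(1)[OF g u] p by (simp add: divide_le_eq)
    moreover have "Y u \<omega> \<le> \<bar>C\<bar>" using C[OF g u(1) total_bounds(2)[OF g u]] by simp
    moreover have "0 \<le> total_mass n \<omega> u / \<omega> 1 u" using p good_path_total_nonneg[OF g u(1)] by simp
    ultimately have "Y u \<omega> * (total_mass n \<omega> u / \<omega> 1 u) \<le> \<bar>C\<bar> * \<kappa>" by (intro mult_mono) auto
    then show ?thesis by (simp add: D_def)
  qed
  then show ?thesis using \<kappa> by (intro exI[of _ "\<bar>C\<bar> * \<kappa>"]) auto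
qed

text \<open>If the path is dead at \<open>v\<close>, it is dead at all later times and every value
  is 0; otherwise the first coordinate is positive at \<open>v\<close> and the quotients are
  continuous there. The truncation at \<open>K\<close> disappears in the limit because
  \<open>D v\<close> is at most \<open>K\<close>.\<close>

lemma right_limits:
  assumes g: "good_path n z \<omega>" and v: "0 \<le> v" "v \<le> \<tau> \<omega>" and r: "\<And>k. v \<le> r k" "r \<longlonglongrightarrow> v"
    and K: "D v \<omega> \<le> K"
  shows "(\<lambda>k. D (r k) \<omega>) \<longlonglongrightarrow> D v \<omega>" "(\<lambda>k. fraction (r k) \<omega> * min (D (r k) \<omega>) K) \<longlonglongrightarrow> Y v \<omega>"
proof -
  have w: "\<omega> \<in> cont_paths n" using g by (simp add: good_path_def)
  have r0: "0 \<le> r k" for k using r(1)[of k] v by simp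
  have lim: "(\<lambda>k. f (r k)) \<longlonglongrightarrow> f v" if "continuous_on {0..} f" for f :: "real \<Rightarrow> real"
    by (rule continuous_on_tendsto_compose[OF that r(2)]) (use r0 v in auto)
  have Y: "(\<lambda>k. Y (r k) \<omega>) \<longlonglongrightarrow> Y v \<omega>" by (rule lim[OF Y_continuous[OF w]])
  have T: "(\<lambda>k. total_mass n \<omega> (r k)) \<longlonglongrightarrow> total_mass n \<omega> v" by (rule lim[OF total_mass_continuous[OF w]])
  have 1: "(\<lambda>k. \<omega> 1 (r k)) \<longlonglongrightarrow> \<omega> 1 v" by (rule lim) (use w one_in in \<open>simp add: cont_paths_def\<close>)
  have "(\<lambda>k. D (r k) \<omega>) \<longlonglongrightarrow> D v \<omega> \<and> (\<lambda>k. fraction (r k) \<omega> * min (D (r k) \<omega>) K) \<longlonglongrightarrow> Y v \<omega>"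
  proof (cases "total_mass n \<omega> v = 0")
    case True
    then have "total_mass n \<omega> (r k) = 0" for k using g v r(1)[of k] by (auto simp: good_path_def)
    then show ?thesis using True by (simp add: D_def fraction_def Y_dead[OF g v(1)])
  next
    case False
    have p: "\<omega> 1 v \<noteq> 0" using alive_first_pos[OF g v False] by simp
    have D: "(\<lambda>k. D (r k) \<omega>) \<longlonglongrightarrow> D v \<omega>"
      unfolding D_def by (intro tendsto_intros Y T 1 p)
    have "(\<lambda>k. fraction (r k) \<omega>) \<longlonglongrightarrow> fraction v \<omega>"
      unfolding fraction_def by (intro tendsto_divide T 1 False)
    then have "(\<lambda>k. fraction (r k) \<omega> * min (D (r k) \<omega>) K) \<longlonglongrightarrow> fraction v \<omega> * min (D v \<omega>) K"
      by (intro tendsto_mult tendsto_min D tendsto_const)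
    moreover have "fraction v \<omega> * min (D v \<omega>) K = Y v \<omega>"
      using fraction_D[OF g v(1)] p K by (simp add: min_absorb1)
    ultimately show ?thesis using D by simp
  qed
  then show "(\<lambda>k. D (r k) \<omega>) \<longlonglongrightarrow> D v \<omega>" "(\<lambda>k. fraction (r k) \<omega> * min (D (r k) \<omega>) K) \<longlonglongrightarrow> Y v \<omega>" by auto
qed

lemma grid_limits:
  assumes g: "good_path n z \<omega>" and st: "0 \<le> s" "s < t" "s \<le> \<tau> \<omega>" and K: "D (min t (\<tau> \<omega>)) \<omega> \<le> K"
  shows "(\<lambda>k. D (grid_after s t (Suc k) (\<tau> \<omega>)) \<omega>) \<longlonglongrightarrow> D (min t (\<tau> \<omega>)) \<omega>"
    "(\<lambda>k. fraction (grid_after s t (Suc k) (\<tau> \<omega>)) \<omega> * min (D (grid_after s t (Suc k) (\<tau> \<omega>)) \<omega>) K) \<longlonglongrightarrow> Y (min t (\<tau> \<omega>)) \<omega>"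
  by (rule right_limits[OF g _ _ grid_after_ge[OF st(2) zero_less_Suc st(3)] grid_after_tendsto[OF st(2,3)] K];
    use st in simp)+

text \<open>The stopped value is the limit of its versions on finer grids, each a finite sum of
  terms known by time \<open>t\<close>. Convergence is available on good paths, hence equality
  almost everywhere.\<close>

lemma stopped_measurable:
  assumes t: "0 \<le> t"
  shows "\<exists>g\<in>borel_measurable (coord_filtration n t). AE \<omega> in P. D (min t (\<tau> \<omega>)) \<omega> = g \<omega>"
proof (cases "t = 0")
  case True
  then show ?thesis
    using D_measurable[OF t] level_time_nonneg[OF \<kappa>(1)] by (intro bexI[of _ "D t"]) (auto simp: min_absorb1)
next
  case False
  with t have t0: "0 < t" by simp
  let ?g = "\<lambda>k j. grid_point 0 t (Suc k) (Suc j)"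
  define f where "f k \<omega> = (\<Sum>j<Suc k. D (?g k j) \<omega> * indicator {\<omega> \<in> cont_paths n. in_cell 0 t (Suc k) j (\<tau> \<omega>)} \<omega>)" for k \<omega>
  have fm: "f k \<in> borel_measurable (coord_filtration n t)" for k
    unfolding f_def[abs_def]
  proof (rule borel_measurable_sum)
    fix j assume "j \<in> {..<Suc k}"
    then have j: "j < Suc k" by simp
    have g: "0 \<le> ?g k j" "?g k j \<le> t" using grid_point_bounds[OF t0 zero_less_Suc, of "Suc j" k] j by auto
    have "{\<omega> \<in> cont_paths n. in_cell 0 t (Suc k) j (\<tau> \<omega>)} \<in> sets (coord_filtration n (?g k j))"
      using PA.in_cell_sets[OF _ order_refl t0 j, of \<tau>] level_time_sets by (simp add: space_P)
    then have [measurable]: "{\<omega> \<in> cont_paths n. in_cell 0 t (Suc k) j (\<tau> \<omega>)} \<in> sets (coord_filtration n t)"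
      using PA.sets_N_mono[OF g(2)] by blast
    have [measurable]: "D (?g k j) \<in> borel_measurable (coord_filtration n t)"
      by (rule PA.measurable_N_mono[OF g(2) D_measurable[OF g(1)]])
    show "(\<lambda>\<omega>. D (?g k j) \<omega> * indicator {\<omega> \<in> cont_paths n. in_cell 0 t (Suc k) j (\<tau> \<omega>)} \<omega>) \<in> borel_measurable (coord_filtration n t)"
      by measurable
  qed
  have "AE \<omega> in P. D (min t (\<tau> \<omega>)) \<omega> = lim (\<lambda>k. f k \<omega>)"
    using AE_P_good_path
  proof eventually_elim
    case (elim \<omega>)
    have w: "\<omega> \<in> cont_paths n" using elim by (simp add: good_path_def)
    have "f k \<omega> = D (grid_after 0 t (Suc k) (\<tau> \<omega>)) \<omega>" for k
      using sum_grid_after[OF t0 zero_less_Suc level_time_nonneg[OF \<kappa>(1)], of "\<lambda>r. D r \<omega>" k n \<omega>] w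
      by (simp add: f_def indicator_def of_bool_def)
    then show ?case
      using grid_limits(1)[OF elim order_refl t0 level_time_nonneg[OF \<kappa>(1)] order_refl] by (simp add: limI)
  qed
  then show ?thesis using borel_measurable_lim_metric[OF fm] by (intro bexI[of _ "\<lambda>\<omega>. lim (\<lambda>k. f k \<omega>)"]) auto
qed

text \<open>On a grid the stopped value is a sum over deterministic times, so the change of measure
  applies cell by cell to \<open>min D K\<close>. Just after \<tau> the process \<open>D\<close> may
  exceed \<open>K\<close>; the truncation provides the bound for dominated convergence on both
  sides. The limits are the mean of stopped \<open>D\<close> under \<open>P\<close> and of stopped
  \<open>Y\<close> under the permuted laws, where optional stopping brings \<open>Y\<close> back to
  time \<open>s\<close>.\<close>

lemma stopped_eq_after:
  assumes st: "0 \<le> s" "s < t" and B: "B \<in> sets (coord_filtration n s)" "\<And>\<omega>. \<omega> \<in> B \<Longrightarrow> s \<le> \<tau> \<omega>"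
  shows "(\<integral>\<^sup>+ \<omega>. ennreal (D (min t (\<tau> \<omega>)) \<omega>) * indicator B \<omega> \<partial>P) = (\<integral>\<^sup>+ \<omega>. ennreal (D s \<omega>) * indicator B \<omega> \<partial>P)"
proof -
  obtain K where K: "0 \<le> K" "\<And>\<omega> u. good_path n z \<omega> \<Longrightarrow> 0 \<le> u \<Longrightarrow> u \<le> \<tau> \<omega> \<Longrightarrow> D u \<omega> \<le> K"
    using D_bounded by blast
  let ?\<rho> = "\<lambda>k \<omega>. grid_after s t (Suc k) (\<tau> \<omega>)" and ?g = "\<lambda>k j. grid_point s t (Suc k) (Suc j)"
  define E where "E k j = {\<omega> \<in> cont_paths n. in_cell s t (Suc k) j (\<tau> \<omega>)} \<inter> B" for k j
  have bounds: "0 \<le> ?g k j" "s \<le> ?g k j" "?g k j \<le> t" if "j < Suc k" for k j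
    using grid_point_bounds[OF st(2) zero_less_Suc, of "Suc j" k] that st by auto
  have E: "E k j \<in> sets (coord_filtration n (?g k j))" if j: "j < Suc k" for k j
  proof -
    have "{\<omega> \<in> cont_paths n. in_cell s t (Suc k) j (\<tau> \<omega>)} \<in> sets (coord_filtration n (?g k j))"
      using PA.in_cell_sets[OF _ st j, of \<tau>] level_time_sets by (simp add: space_P)
    then show ?thesis unfolding E_def using B(1) PA.sets_N_mono[OF bounds(2)[OF j]] by blast
  qed
  have Bsp: "B \<subseteq> cont_paths n" using sets.sets_into_space[OF B(1)] by simp
  have sum: "f (?\<rho> k \<omega>) * indicator B \<omega> = (\<Sum>j<Suc k. f (?g k j) * indicator (E k j) \<omega>)" for f :: "real \<Rightarrow> ennreal" and k \<omega>
  proof (cases "\<omega> \<in> B")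
    case True
    have "f (?\<rho> k \<omega>) = (\<Sum>j<Suc k. f (?g k j) * of_bool (in_cell s t (Suc k) j (\<tau> \<omega>)))"
      by (rule sum_grid_after[OF st(2) zero_less_Suc B(2)[OF True], symmetric])
    also have "\<dots> = (\<Sum>j<Suc k. f (?g k j) * indicator (E k j) \<omega>)"
      using True Bsp by (intro sum.cong) (auto simp: E_def indicator_def)
    finally show ?thesis using True by simp
  qed (simp add: E_def)
  have mP: "(\<lambda>\<omega>. ennreal (min (D (?g k j) \<omega>) K) * indicator (E k j) \<omega>) \<in> borel_measurable (coord_filtration n (?g k j))"
    if "j < Suc k" for k j
    using D_measurable[OF bounds(1)[OF that]] E[OF that] by measurable
  have mF: "(\<lambda>\<omega>. ennreal (fraction (?g k j) \<omega> * min (D (?g k j) \<omega>) K) * indicator (E k j) \<omega>) \<in> borel_measurable (coord_filtration n (?g k j))"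
    if "j < Suc k" for k j
    using D_measurable[OF bounds(1)[OF that]] fraction_measurable[OF bounds(1)[OF that]] E[OF that] by measurable
  have toF: "h \<in> borel_measurable (front_law i)" if "h \<in> borel_measurable (coord_filtration n u)" for h :: "_ \<Rightarrow> ennreal" and u i
    using PA.measurable_N_M[OF that] by (simp add: measurable_cong_sets[OF sets_P refl] front_law_def)
  let ?a = "\<lambda>k. \<integral>\<^sup>+ \<omega>. ennreal (min (D (?\<rho> k \<omega>) \<omega>) K) * indicator B \<omega> \<partial>P"
  let ?b = "\<lambda>k i. \<integral>\<^sup>+ \<omega>. ennreal (fraction (?\<rho> k \<omega>) \<omega> * min (D (?\<rho> k \<omega>) \<omega>) K) * indicator B \<omega> \<partial>front_law i"
  have ab: "?a k = (\<Sum>i=1..n. ?b k i)" for k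
  proof -
    have "?a k = (\<integral>\<^sup>+ \<omega>. (\<Sum>j<Suc k. ennreal (min (D (?g k j) \<omega>) K) * indicator (E k j) \<omega>) \<partial>P)"
      by (intro nn_integral_cong) (rule sum)
    also have "\<dots> = (\<Sum>j<Suc k. \<integral>\<^sup>+ \<omega>. ennreal (min (D (?g k j) \<omega>) K) * indicator (E k j) \<omega> \<partial>P)"
      by (rule nn_integral_sum) (rule PA.measurable_N_M[OF mP], simp)
    also have "\<dots> = (\<Sum>j<Suc k. \<Sum>i=1..n. \<integral>\<^sup>+ \<omega>. ennreal (fraction (?g k j) \<omega> * min (D (?g k j) \<omega>) K) * indicator (E k j) \<omega> \<partial>front_law i)"
      using bounds(1) E K(1) by (intro sum.cong refl D_transfer[of _ _ "\<lambda>x. min x K"]) auto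
    also have "\<dots> = (\<Sum>i=1..n. \<Sum>j<Suc k. \<integral>\<^sup>+ \<omega>. ennreal (fraction (?g k j) \<omega> * min (D (?g k j) \<omega>) K) * indicator (E k j) \<omega> \<partial>front_law i)"
      by (rule sum.swap)
    also have "\<dots> = (\<Sum>i=1..n. \<integral>\<^sup>+ \<omega>. (\<Sum>j<Suc k. ennreal (fraction (?g k j) \<omega> * min (D (?g k j) \<omega>) K) * indicator (E k j) \<omega>) \<partial>front_law i)"
      by (intro sum.cong refl nn_integral_sum[symmetric]) (rule toF[OF mF], simp)
    also have "\<dots> = (\<Sum>i=1..n. ?b k i)"
      by (intro sum.cong refl nn_integral_cong) (rule sum[symmetric])
    finally show ?thesis .
  qed
  have meas_a: "(\<lambda>\<omega>. ennreal (min (D (?\<rho> k \<omega>) \<omega>) K) * indicator B \<omega>) \<in> borel_measurable P" for k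
    unfolding sum[of "\<lambda>r. ennreal (min (D r _) K)"]
    by (rule borel_measurable_sum) (rule PA.measurable_N_M[OF mP], simp)
  have meas_b: "(\<lambda>\<omega>. ennreal (fraction (?\<rho> k \<omega>) \<omega> * min (D (?\<rho> k \<omega>) \<omega>) K) * indicator B \<omega>) \<in> borel_measurable (front_law i)" for k i
    unfolding sum[of "\<lambda>r. ennreal (fraction r _ * min (D r _) K)"]
    by (rule borel_measurable_sum) (rule toF[OF mF], simp)
  have lim: "(\<lambda>k. D (?\<rho> k \<omega>) \<omega>) \<longlonglongrightarrow> D (min t (\<tau> \<omega>)) \<omega>" "D (min t (\<tau> \<omega>)) \<omega> \<le> K"
    "(\<lambda>k. fraction (?\<rho> k \<omega>) \<omega> * min (D (?\<rho> k \<omega>) \<omega>) K) \<longlonglongrightarrow> Y (min t (\<tau> \<omega>)) \<omega>"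
    if g: "good_path n z \<omega>" and w: "\<omega> \<in> B" for \<omega>
  proof -
    show le: "D (min t (\<tau> \<omega>)) \<omega> \<le> K" using st B(2)[OF w] by (intro K(2)[OF g]) auto
    show "(\<lambda>k. D (?\<rho> k \<omega>) \<omega>) \<longlonglongrightarrow> D (min t (\<tau> \<omega>)) \<omega>"
      "(\<lambda>k. fraction (?\<rho> k \<omega>) \<omega> * min (D (?\<rho> k \<omega>) \<omega>) K) \<longlonglongrightarrow> Y (min t (\<tau> \<omega>)) \<omega>"
      by (rule grid_limits[OF g st B(2)[OF w] le])+
  qed
  have lima: "?a \<longlonglongrightarrow> (\<integral>\<^sup>+ \<omega>. ennreal (D (min t (\<tau> \<omega>)) \<omega>) * indicator B \<omega> \<partial>P)"
  proof -
    obtain g where g: "g \<in> borel_measurable (coord_filtration n t)" "AE \<omega> in P. D (min t (\<tau> \<omega>)) \<omega> = g \<omega>"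
      using stopped_measurable[of t] st by auto
    have BP: "B \<in> sets P" using B(1) PA.sets_N by blast
    have "?a \<longlonglongrightarrow> (\<integral>\<^sup>+ \<omega>. ennreal (g \<omega>) * indicator B \<omega> \<partial>P)"
    proof (rule nn_integral_dominated_convergence[where w="\<lambda>_. ennreal K"])
      show "(\<lambda>\<omega>. ennreal (g \<omega>) * indicator B \<omega>) \<in> borel_measurable P"
        using PA.measurable_N_M[OF g(1)] BP by measurable
      show "AE \<omega> in P. (\<lambda>k. ennreal (min (D (?\<rho> k \<omega>) \<omega>) K) * indicator B \<omega>) \<longlonglongrightarrow> ennreal (g \<omega>) * indicator B \<omega>"
        using AE_P_good_path g(2)
      proof eventually_elim
        case (elim \<omega>)
        show ?case
        proof (cases "\<omega> \<in> B")
          case True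
          have "(\<lambda>k. min (D (?\<rho> k \<omega>) \<omega>) K) \<longlonglongrightarrow> min (D (min t (\<tau> \<omega>)) \<omega>) K"
            by (intro tendsto_min lim(1)[OF elim(1) True] tendsto_const)
          then have "(\<lambda>k. min (D (?\<rho> k \<omega>) \<omega>) K) \<longlonglongrightarrow> g \<omega>"
            using lim(2)[OF elim(1) True] elim(2) by (simp add: min_absorb1)
          then show ?thesis using True by (simp add: tendsto_ennrealI)
        qed simp
      qed
      show "AE \<omega> in P. ennreal (min (D (?\<rho> k \<omega>) \<omega>) K) * indicator B \<omega> \<le> ennreal K" for k
        by (intro AE_I2) (simp add: ennreal_leI split: split_indicator)
    qed (use meas_a P.emeasure_space_1 in auto)
    also have "(\<integral>\<^sup>+ \<omega>. ennreal (g \<omega>) * indicator B \<omega> \<partial>P) = (\<integral>\<^sup>+ \<omega>. ennreal (D (min t (\<tau> \<omega>)) \<omega>) * indicator B \<omega> \<partial>P)"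
      using g(2) by (intro nn_integral_cong_AE) auto
    finally show ?thesis .
  qed
  have limb: "(\<lambda>k. ?b k i) \<longlonglongrightarrow> (\<integral>\<^sup>+ \<omega>. ennreal (Y s \<omega>) * indicator B \<omega> \<partial>front_law i)" if i: "i \<in> {1..n}" for i
  proof -
    interpret R: product_law "front_law i" n z by (rule front_law[OF i])
    interpret Y: pos_martingale "front_law i" "coord_filtration n" Y by (rule Y_martingale[OF i])
    have ts: "\<And>r. 0 \<le> r \<Longrightarrow> {\<omega> \<in> space (front_law i). \<tau> \<omega> < r} \<in> sets (coord_filtration n r)"
      unfolding R.space_Q by (rule level_time_sets)
    note os = Y.optional_stopping[OF ts st B]
    have "(\<lambda>k. ?b k i) \<longlonglongrightarrow> (\<integral>\<^sup>+ \<omega>. ennreal (Y (min t (\<tau> \<omega>)) \<omega> * indicator B \<omega>) \<partial>front_law i)"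
    proof (rule nn_integral_dominated_convergence[where w="\<lambda>_. ennreal K"])
      show "(\<lambda>\<omega>. ennreal (Y (min t (\<tau> \<omega>)) \<omega> * indicator B \<omega>)) \<in> borel_measurable (front_law i)"
        by (rule measurable_compose[OF os(2) measurable_ennreal])
      show "AE \<omega> in front_law i. (\<lambda>k. ennreal (fraction (?\<rho> k \<omega>) \<omega> * min (D (?\<rho> k \<omega>) \<omega>) K) * indicator B \<omega>) \<longlonglongrightarrow> ennreal (Y (min t (\<tau> \<omega>)) \<omega> * indicator B \<omega>)"
        using AE_front_good[OF i]
      proof eventually_elim
        case (elim \<omega>)
        show ?case
          using lim(3)[OF elim] by (cases "\<omega> \<in> B") (simp_all add: tendsto_ennrealI)
      qed
      show "AE \<omega> in front_law i. ennreal (fraction (?\<rho> k \<omega>) \<omega> * min (D (?\<rho> k \<omega>) \<omega>) K) * indicator B \<omega> \<le> ennreal K" for k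
        using AE_front_good[OF i]
      proof eventually_elim
        case (elim \<omega>)
        show ?case
        proof (cases "\<omega> \<in> B")
          case True
          have "0 \<le> ?\<rho> k \<omega>" using grid_after_ge[OF st(2) zero_less_Suc B(2)[OF True], of k] B(2)[OF True] st by auto
          note f = good_path_fraction[OF elim this] D_nonneg[OF elim this]
          have "fraction (?\<rho> k \<omega>) \<omega> * min (D (?\<rho> k \<omega>) \<omega>) K \<le> 1 * K"
            using f K(1) by (intro mult_mono) auto
          then show ?thesis using True by (simp add: ennreal_leI)
        qed simp
      qed
    qed (use meas_b R.emeasure_space_1 in \<open>auto\<close>)
    also have "(\<integral>\<^sup>+ \<omega>. ennreal (Y (min t (\<tau> \<omega>)) \<omega> * indicator B \<omega>) \<partial>front_law i)
      = (\<integral>\<^sup>+ \<omega>. ennreal (Y (min t (\<tau> \<omega>)) \<omega>) * indicator B \<omega> \<partial>front_law i)"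
      by (intro nn_integral_cong) (auto split: split_indicator)
    also have "\<dots> = (\<integral>\<^sup>+ \<omega>. ennreal (Y s \<omega>) * indicator B \<omega> \<partial>front_law i)" by (rule os(1))
    finally show ?thesis .
  qed
  have "(\<lambda>k. \<Sum>i=1..n. ?b k i) \<longlonglongrightarrow> (\<Sum>i=1..n. \<integral>\<^sup>+ \<omega>. ennreal (Y s \<omega>) * indicator B \<omega> \<partial>front_law i)"
    by (intro tendsto_sum limb)
  then have "(\<integral>\<^sup>+ \<omega>. ennreal (D (min t (\<tau> \<omega>)) \<omega>) * indicator B \<omega> \<partial>P) = (\<Sum>i=1..n. \<integral>\<^sup>+ \<omega>. ennreal (Y s \<omega>) * indicator B \<omega> \<partial>front_law i)"
    using lima unfolding ab[symmetric] by (rule LIMSEQ_unique[rotated])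
  \<comment> \<open>On \<open>B\<close> the level time has not passed by \<open>s\<close>, so a zero
    first coordinate means a dead path, where \<open>Y\<close> is 0 as well; changing the measure
    back at time \<open>s\<close> therefore loses nothing.\<close>
  also have "\<dots> = (\<Sum>i=1..n. \<integral>\<^sup>+ \<omega>. ennreal (fraction s \<omega> * D s \<omega>) * indicator B \<omega> \<partial>front_law i)"
  proof (intro sum.cong refl nn_integral_cong_AE)
    fix i assume i: "i \<in> {1..n}"
    show "AE \<omega> in front_law i. ennreal (Y s \<omega>) * indicator B \<omega> = ennreal (fraction s \<omega> * D s \<omega>) * indicator B \<omega>"
      using AE_front_good[OF i]
    proof eventually_elim
      case (elim \<omega>)
      show ?case
      proof (cases "\<omega> \<in> B")
        case True
        have "Y s \<omega> = 0" if "\<omega> 1 s = 0"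
          using alive_first_pos[OF elim st(1) B(2)[OF True]] Y_dead[OF elim st(1)] that by fastforce
        then show ?thesis using fraction_D[OF elim st(1)] by auto
      qed simp
    qed
  qed
  also have "\<dots> = (\<integral>\<^sup>+ \<omega>. ennreal (D s \<omega>) * indicator B \<omega> \<partial>P)"
    using D_transfer[OF st(1) B(1), of "\<lambda>x. x"] by simp
  finally show ?thesis .
qed

text \<open>Where \<tau> lies before \<open>s\<close>, both stopped values are the value at \<tau>;
  the remaining event is known at \<open>s\<close> and falls under
  \<open>stopped_eq_after\<close>.\<close>

lemma stopped_eq:
  assumes st: "0 \<le> s" "s < t" and A: "A \<in> sets (coord_filtration n s)"
  shows "(\<integral>\<^sup>+ \<omega>. ennreal (D (min t (\<tau> \<omega>)) \<omega>) * indicator A \<omega> \<partial>P)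
    = (\<integral>\<^sup>+ \<omega>. ennreal (D (min s (\<tau> \<omega>)) \<omega>) * indicator A \<omega> \<partial>P)"
proof -
  let ?C = "{\<omega> \<in> cont_paths n. \<tau> \<omega> < s}"
  have C: "?C \<in> sets (coord_filtration n s)" by (rule level_time_sets[OF st(1)])
  have split: "(\<integral>\<^sup>+ \<omega>. ennreal (D (min u (\<tau> \<omega>)) \<omega>) * indicator A \<omega> \<partial>P)
    = (\<integral>\<^sup>+ \<omega>. ennreal (D (min u (\<tau> \<omega>)) \<omega>) * indicator (A - ?C) \<omega> \<partial>P) + (\<integral>\<^sup>+ \<omega>. ennreal (D (min u (\<tau> \<omega>)) \<omega>) * indicator (A \<inter> ?C) \<omega> \<partial>P)"
    if u: "0 \<le> u" for u
  proof -
    obtain g where g: "g \<in> borel_measurable (coord_filtration n u)" "AE \<omega> in P. D (min u (\<tau> \<omega>)) \<omega> = g \<omega>"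
      using stopped_measurable[OF u] by blast
    have eq: "(\<integral>\<^sup>+ \<omega>. ennreal (D (min u (\<tau> \<omega>)) \<omega>) * indicator B \<omega> \<partial>P) = (\<integral>\<^sup>+ \<omega>. ennreal (g \<omega>) * indicator B \<omega> \<partial>P)" for B
      using g(2) by (intro nn_integral_cong_AE) auto
    have add: "(\<integral>\<^sup>+ \<omega>. ennreal (g \<omega>) * indicator S \<omega> + ennreal (g \<omega>) * indicator S' \<omega> \<partial>P)
      = (\<integral>\<^sup>+ \<omega>. ennreal (g \<omega>) * indicator S \<omega> \<partial>P) + (\<integral>\<^sup>+ \<omega>. ennreal (g \<omega>) * indicator S' \<omega> \<partial>P)"
      if [measurable]: "S \<in> sets P" "S' \<in> sets P" for S S'
    proof -
      note PA.measurable_N_M[OF g(1), measurable]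
      show ?thesis by (intro nn_integral_add) measurable
    qed
    have "A - ?C \<in> sets P" "A \<inter> ?C \<in> sets P" using A C PA.sets_N by blast+
    note add[OF this]
    moreover have "ennreal (g \<omega>) * indicator (A - ?C) \<omega> + ennreal (g \<omega>) * indicator (A \<inter> ?C) \<omega> = ennreal (g \<omega>) * indicator A \<omega>" for \<omega>
      by (auto split: split_indicator)
    ultimately show ?thesis unfolding eq by simp
  qed
  have Asp: "A \<subseteq> cont_paths n" using sets.sets_into_space[OF A] by simp
  have "(\<integral>\<^sup>+ \<omega>. ennreal (D (min t (\<tau> \<omega>)) \<omega>) * indicator (A - ?C) \<omega> \<partial>P) = (\<integral>\<^sup>+ \<omega>. ennreal (D s \<omega>) * indicator (A - ?C) \<omega> \<partial>P)"
    by (rule stopped_eq_after[OF st]) (use A C Asp in auto)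
  also have "\<dots> = (\<integral>\<^sup>+ \<omega>. ennreal (D (min s (\<tau> \<omega>)) \<omega>) * indicator (A - ?C) \<omega> \<partial>P)"
    using Asp by (intro nn_integral_cong) (auto simp: min_def split: split_indicator)
  finally have 1: "(\<integral>\<^sup>+ \<omega>. ennreal (D (min t (\<tau> \<omega>)) \<omega>) * indicator (A - ?C) \<omega> \<partial>P) = (\<integral>\<^sup>+ \<omega>. ennreal (D (min s (\<tau> \<omega>)) \<omega>) * indicator (A - ?C) \<omega> \<partial>P)" .
  have 2: "(\<integral>\<^sup>+ \<omega>. ennreal (D (min t (\<tau> \<omega>)) \<omega>) * indicator (A \<inter> ?C) \<omega> \<partial>P) = (\<integral>\<^sup>+ \<omega>. ennreal (D (min s (\<tau> \<omega>)) \<omega>) * indicator (A \<inter> ?C) \<omega> \<partial>P)"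
    using st by (intro nn_integral_cong) (auto simp: min_def split: split_indicator)
  show ?thesis unfolding split[OF st(1)] using split[of t] st 1 2 by simp
qed

end

end

section \<open>The numerators and the true martingale\<close>

context size_biased
begin

text \<open>Because \<open>I\<close> avoids coordinate 1, the product can survive the death of that
  coordinate, by independence; because \<open>I\<close> is nonempty, it dies with the total
  mass.\<close>

lemma numerator_prod:
  assumes I: "I \<subseteq> {2..n}" "I \<noteq> {}"
  shows "numerator Q n z P (\<lambda>t \<omega>. \<Prod>i\<in>I. \<omega> i t)"
proof (rule numerator.intro[OF size_biased_axioms numerator_axioms.intro])
  have I1: "I \<subseteq> {1..n}" using I by auto
  show "pos_martingale (front_law i) (coord_filtration n) (\<lambda>t \<omega>. \<Prod>i\<in>I. \<omega> i t)" if "i \<in> {1..n}" for i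
    by (rule product_law.pos_martingale_prod[OF front_law[OF that] I1])
  show "(\<lambda>\<omega>. \<Prod>i\<in>I. \<omega> i t) \<in> borel_measurable (coord_filtration n t)" if "0 \<le> t" for t
    using I1 that by (intro borel_measurable_prod coord_filtration_measurable) auto
  show "continuous_on {0..} (\<lambda>t. \<Prod>i\<in>I. \<omega> i t)" if "\<omega> \<in> cont_paths n" for \<omega>
    using I1 that by (intro continuous_on_prod) (auto simp: cont_paths_def)
  show "0 \<le> (\<Prod>i\<in>I. \<omega> i t)" if "good_path n z \<omega>" "0 \<le> t" for \<omega> t
    using I1 that by (intro prod_nonneg) (auto simp: good_path_def)
  have fin: "finite I" using I1 by (rule finite_subset) simp
  show "(\<Prod>i\<in>I. \<omega> i t) = 0" if g: "good_path n z \<omega>" "0 \<le> t" and 0: "total_mass n \<omega> t = 0" for \<omega> t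
  proof -
    obtain i where i: "i \<in> I" using I(2) by blast
    then have "i \<in> {1..n}" using I1 by blast
    moreover have "0 \<le> \<omega> i t" using g \<open>i \<in> {1..n}\<close> by (simp add: good_path_def)
    ultimately have "\<omega> i t = 0" using good_path_le_total[OF g, of i] 0 by simp
    then show ?thesis using i fin by (intro prod_zero bexI[of _ i]) auto
  qed
  show "\<exists>C. \<forall>\<omega> t. good_path n z \<omega> \<longrightarrow> 0 \<le> t \<longrightarrow> total_mass n \<omega> t \<le> \<kappa> \<longrightarrow> (\<Prod>i\<in>I. \<omega> i t) \<le> C" for \<kappa>
  proof (intro exI[of _ "\<Prod>i\<in>I. \<kappa>"] allI impI prod_mono)
    fix \<omega> t i assume g: "good_path n z \<omega>" "0 \<le> t" "total_mass n \<omega> t \<le> \<kappa>" and "i \<in> I"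
    then have "i \<in> {1..n}" using I1 by blast
    then show "0 \<le> \<omega> i t \<and> \<omega> i t \<le> \<kappa>"
      using good_path_le_total[OF g(1,2), of i] g by (auto simp: good_path_def)
  qed
  show "0 < (\<integral>\<omega>. indicator {\<omega>. \<omega> 1 1 = 0} \<omega> * (\<Prod>i\<in>I. \<omega> i 1) \<partial>front_law i)" if "i \<in> {1..n}" for i
    using I by (intro product_law.prod_dead_positive[OF front_law[OF that] I1]) (use one_in in auto)
qed

lemma numerator_total: "numerator Q n z P (\<lambda>t \<omega>. total_mass n \<omega> t)"
proof (rule numerator.intro[OF size_biased_axioms numerator_axioms.intro])
  show "pos_martingale (front_law i) (coord_filtration n) (\<lambda>t \<omega>. total_mass n \<omega> t)" if "i \<in> {1..n}" for i
    by (rule product_law.pos_martingale_total[OF front_law[OF that]])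
  show "0 < (\<integral>\<omega>. indicator {\<omega>. \<omega> 1 1 = 0} \<omega> * total_mass n \<omega> 1 \<partial>front_law i)" if i: "i \<in> {1..n}" for i
  proof -
    interpret R: product_law "front_law i" n z by (rule front_law[OF i])
    interpret T: pos_martingale "front_law i" "coord_filtration n" "\<lambda>t \<omega>. total_mass n \<omega> t" by (rule R.pos_martingale_total)
    have two: "2 \<in> {1..n}" using Q.n by simp
    have m: "{\<omega> \<in> space (front_law i). \<omega> 1 1 = 0} \<in> sets (front_law i)"
      using coord_zero_sets[OF one_in, of 1 0] by (simp add: front_law_def)
    have int: "integrable (front_law i) (\<lambda>\<omega>. indicator {\<omega>. \<omega> 1 1 = 0} \<omega> * f \<omega>)" if "integrable (front_law i) f" for f :: "_ \<Rightarrow> real"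
    proof -
      have "integrable (front_law i) (\<lambda>\<omega>. indicator {\<omega> \<in> space (front_law i). \<omega> 1 1 = 0} \<omega> *\<^sub>R f \<omega>)"
        by (rule integrable_mult_indicator[OF m that])
      also have "?this \<longleftrightarrow> ?thesis" by (intro Bochner_Integration.integrable_cong) (auto split: split_indicator)
      finally show ?thesis .
    qed
    \<comment> \<open>The total mass dominates the second coordinate, which has positive mean on the
      event that the first one is dead.\<close>
    have "0 < (\<integral>\<omega>. indicator {\<omega>. \<omega> 1 1 = 0} \<omega> * (\<Prod>i\<in>{2}. \<omega> i 1) \<partial>front_law i)"
      using two one_in by (intro R.prod_dead_positive) auto
    also have "\<dots> \<le> (\<integral>\<omega>. indicator {\<omega>. \<omega> 1 1 = 0} \<omega> * total_mass n \<omega> 1 \<partial>front_law i)"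
    proof (rule integral_mono_AE)
      show "integrable (front_law i) (\<lambda>\<omega>. indicator {\<omega>. \<omega> 1 1 = 0} \<omega> * (\<Prod>i\<in>{2}. \<omega> i 1))"
        using two by (intro int R.prod_integrable) auto
      show "integrable (front_law i) (\<lambda>\<omega>. indicator {\<omega>. \<omega> 1 1 = 0} \<omega> * total_mass n \<omega> 1)"
        by (intro int T.Y_integrable) simp
      show "AE \<omega> in front_law i. indicator {\<omega>. \<omega> 1 1 = 0} \<omega> * (\<Prod>i\<in>{2}. \<omega> i 1) \<le> indicator {\<omega>. \<omega> 1 1 = 0} \<omega> * total_mass n \<omega> 1"
        using R.AE_good_path by eventually_elim (use good_path_le_total[OF _ zero_le_one two] in \<open>auto intro!: mult_left_mono\<close>)
    qed
    finally show ?thesis .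
  qed
  show "(\<lambda>\<omega>. total_mass n \<omega> t) \<in> borel_measurable (coord_filtration n t)" if "0 \<le> t" for t
    by (rule total_mass_measurable[OF that order_refl])
qed (auto intro: total_mass_continuous good_path_total_nonneg)

text \<open>The factor \<open>\<zeta>\<close> compensates the density, so no mass is lost when the first coordinate dies.\<close>

lemma total_prod_transfer:
  assumes t: "0 \<le> t" and A: "A \<in> sets (coord_filtration n t)"
  shows "(\<integral>\<^sup>+ \<omega>. ennreal (total_mass n \<omega> t * (\<Prod>i=2..n. \<omega> i t)) * indicator A \<omega> \<partial>P)
    = (\<Sum>i=1..n. \<integral>\<^sup>+ \<omega>. ennreal (\<Prod>i=1..n. \<omega> i t) * indicator A \<omega> \<partial>front_law i)"
proof -
  have m: "(\<lambda>\<omega>. ennreal (total_mass n \<omega> t * (\<Prod>i=2..n. \<omega> i t)) * indicator A \<omega>) \<in> borel_measurable (coord_filtration n t)"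
  proof -
    have [measurable]: "(\<lambda>\<omega>. \<Prod>i=2..n. \<omega> i t) \<in> borel_measurable (coord_filtration n t)"
      using t by (intro borel_measurable_prod coord_filtration_measurable) auto
    note total_mass_measurable[OF t order_refl, measurable] A[measurable]
    show ?thesis by measurable
  qed
  have "(\<integral>\<^sup>+ \<omega>. ennreal (total_mass n \<omega> t * (\<Prod>i=2..n. \<omega> i t)) * indicator A \<omega> \<partial>P)
    = (\<integral>\<^sup>+ \<omega>. (ennreal (total_mass n \<omega> t * (\<Prod>i=2..n. \<omega> i t)) * indicator A \<omega>) * indicator {\<omega>. total_mass n \<omega> t \<noteq> 0} \<omega> \<partial>P)"
    by (intro nn_integral_cong) (auto split: split_indicator)
  also have "\<dots> = (\<Sum>i=1..n. \<integral>\<^sup>+ \<omega>. ennreal (fraction t \<omega>) * (ennreal (total_mass n \<omega> t * (\<Prod>i=2..n. \<omega> i t)) * indicator A \<omega>) \<partial>front_law i)"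
    by (rule transfer[OF t m])
  also have "\<dots> = (\<Sum>i=1..n. \<integral>\<^sup>+ \<omega>. ennreal (\<Prod>i=1..n. \<omega> i t) * indicator A \<omega> \<partial>front_law i)"
  proof (intro sum.cong refl nn_integral_cong_AE)
    fix i assume i: "i \<in> {1..n}"
    show "AE \<omega> in front_law i. ennreal (fraction t \<omega>) * (ennreal (total_mass n \<omega> t * (\<Prod>i=2..n. \<omega> i t)) * indicator A \<omega>)
      = ennreal (\<Prod>i=1..n. \<omega> i t) * indicator A \<omega>"
      using product_law.AE_good_path[OF front_law[OF i]]
    proof eventually_elim
      case (elim \<omega>)
      have "0 \<le> \<omega> 1 t" using elim one_in t by (simp add: good_path_def)
      then have "\<omega> 1 t = 0" if "total_mass n \<omega> t = 0" using good_path_le_total[OF elim t one_in] that by simp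
      then have "fraction t \<omega> * total_mass n \<omega> t = \<omega> 1 t" by (auto simp: fraction_def)
      moreover have "(\<Prod>i=1..n. \<omega> i t) = \<omega> 1 t * (\<Prod>i=2..n. \<omega> i t)"
        using one_in by (simp add: prod.atLeast_Suc_atMost numeral_2_eq_2)
      ultimately have "fraction t \<omega> * (total_mass n \<omega> t * (\<Prod>i=2..n. \<omega> i t)) = (\<Prod>i=1..n. \<omega> i t)"
        by (simp only: mult.assoc[symmetric])
      then have "ennreal (fraction t \<omega>) * ennreal (total_mass n \<omega> t * (\<Prod>i=2..n. \<omega> i t)) = ennreal (\<Prod>i=1..n. \<omega> i t)"
        using good_path_fraction(1)[OF elim t] by (simp only: ennreal_mult'[symmetric])
      then show ?case by (metis mult.assoc)
    qed
  qed
  finally show ?thesis .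
qed

end

section \<open>Processes with the size-biased law\<close>

locale realisation = size_biased Q n z P + M: prob_space M
  for Q :: "(nat \<Rightarrow> real \<Rightarrow> real) measure" and n z P and M :: "'a measure" +
  fixes Z :: "nat \<Rightarrow> real \<Rightarrow> 'a \<Rightarrow> real"
  assumes Z_process: "\<And>i. i \<in> {1..n} \<Longrightarrow> random_process M (Z i) \<and> continuous_paths M (Z i)"
    and law_Z: "distr M (path_space n) (joint_path n Z) = P"
begin

abbreviation "J \<equiv> joint_path n Z"
abbreviation "NZ \<equiv> natural_filtration (space M) {1..n} Z"

lemma J_measurable: "J \<in> measurable M (path_space n)"
  by (rule joint_path_measurable[OF Z_process])

lemma J_apply: "i \<in> {1..n} \<Longrightarrow> 0 \<le> t \<Longrightarrow> J x i t = Z i t x"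
  by (simp add: joint_path_def)

lemma J_cont: "x \<in> space M \<Longrightarrow> J x \<in> cont_paths n"
  using measurable_space[OF J_measurable] by simp

sublocale MA: augmented M NZ
  by unfold_locales (rule filtered_natural_filtration, use Z_process in \<open>simp add: random_process_def\<close>)

text \<open>Generated \<sigma>-algebras commute with preimages, so the filtration of
  \<open>Z\<close> is the preimage of the coordinate filtration under the joint path map. Every
  statement about events of the past can thus be moved to path space.\<close>

lemma sets_NZ: "sets (NZ s) = {J -` B \<inter> space M | B. B \<in> sets (coord_filtration n s)}"
proof -
  let ?G = "{Z i u -` B \<inter> space M | i u B. i \<in> {1..n} \<and> 0 \<le> u \<and> u \<le> s \<and> B \<in> sets (borel :: real measure)}"
  let ?H = "{(\<lambda>\<omega>. \<omega> i u) -` B \<inter> cont_paths n | i u B. i \<in> {1..n} \<and> 0 \<le> u \<and> u \<le> s \<and> B \<in> sets (borel :: real measure)}"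
  have pre: "J -` ((\<lambda>\<omega>. \<omega> i u) -` B \<inter> cont_paths n) \<inter> space M = Z i u -` B \<inter> space M"
    if "i \<in> {1..n}" "0 \<le> u" for i u and B :: "real set"
    using J_cont J_apply[OF that] by auto
  have "?G = {J -` A \<inter> space M | A. A \<in> ?H}"
  proof (intro equalityI subsetI)
    fix S assume "S \<in> ?G"
    then obtain i u B where S: "S = Z i u -` B \<inter> space M" "i \<in> {1..n}" "0 \<le> u" "u \<le> s" "B \<in> sets (borel :: real measure)" by blast
    then have "S = J -` ((\<lambda>\<omega>. \<omega> i u) -` B \<inter> cont_paths n) \<inter> space M" using pre by simp
    then show "S \<in> {J -` A \<inter> space M | A. A \<in> ?H}" using S by blast
  next
    fix S assume "S \<in> {J -` A \<inter> space M | A. A \<in> ?H}"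
    then obtain i u B where S: "S = J -` ((\<lambda>\<omega>. \<omega> i u) -` B \<inter> cont_paths n) \<inter> space M" "i \<in> {1..n}" "0 \<le> u" "u \<le> s" "B \<in> sets (borel :: real measure)" by blast
    then have "S = Z i u -` B \<inter> space M" using pre by simp
    then show "S \<in> ?G" using S by blast
  qed
  moreover have "J \<in> space M \<rightarrow> cont_paths n" using J_cont by auto
  from sigma_sets_vimage_commute[OF this, of ?H]
  have "{J -` A \<inter> space M | A. A \<in> sigma_sets (cont_paths n) ?H} = sigma_sets (space M) {J -` A \<inter> space M | A. A \<in> ?H}" .
  moreover have "sets (NZ s) = sigma_sets (space M) ?G" unfolding natural_filtration_def by (rule sets_measure_of) auto
  moreover have "sets (coord_filtration n s) = sigma_sets (cont_paths n) ?H" unfolding natural_filtration_def by (rule sets_measure_of) auto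
  ultimately show ?thesis by simp
qed

lemma measurable_J: "g \<in> measurable (coord_filtration n t) L \<Longrightarrow> (\<lambda>x. g (J x)) \<in> measurable (NZ t) L"
proof (rule measurable_compose[of J "NZ t" "coord_filtration n t" g L])
  show "J \<in> measurable (NZ t) (coord_filtration n t)"
    by (rule measurableI) (use J_cont sets_NZ in auto)
qed

lemma AE_J: "(AE \<omega> in P. R \<omega>) \<Longrightarrow> AE x in M. R (J x)"
  unfolding law_Z[symmetric] by (rule AE_distrD[OF J_measurable])

lemma nn_integral_J:
  assumes "g \<in> borel_measurable P"
  shows "(\<integral>\<^sup>+ x. g (J x) \<partial>M) = (\<integral>\<^sup>+ \<omega>. g \<omega> \<partial>P)"
  using assms unfolding law_Z[symmetric] by (subst nn_integral_distr[OF J_measurable]) (auto simp: law_Z)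

lemma nn_set_integral_J:
  assumes f: "\<exists>g\<in>borel_measurable (coord_filtration n t). AE \<omega> in P. f \<omega> = g \<omega>" and B: "B \<in> sets (coord_filtration n s)"
  shows "(\<integral>\<^sup>+ x. ennreal (f (J x)) * indicator (J -` B \<inter> space M) x \<partial>M) = (\<integral>\<^sup>+ \<omega>. ennreal (f \<omega>) * indicator B \<omega> \<partial>P)"
proof -
  obtain g where g: "g \<in> borel_measurable (coord_filtration n t)" "AE \<omega> in P. f \<omega> = g \<omega>" using f by blast
  have [measurable]: "g \<in> borel_measurable P" "B \<in> sets P" using PA.measurable_N_M[OF g(1)] B PA.sets_N by auto
  have "(\<integral>\<^sup>+ x. ennreal (f (J x)) * indicator (J -` B \<inter> space M) x \<partial>M) = (\<integral>\<^sup>+ x. ennreal (g (J x)) * indicator B (J x) \<partial>M)"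
    using AE_J[OF g(2)] by (intro nn_integral_cong_AE) (auto split: split_indicator)
  also have "\<dots> = (\<integral>\<^sup>+ \<omega>. ennreal (g \<omega>) * indicator B \<omega> \<partial>P)" by (rule nn_integral_J) measurable
  also have "\<dots> = (\<integral>\<^sup>+ \<omega>. ennreal (f \<omega>) * indicator B \<omega> \<partial>P)" using g(2) by (intro nn_integral_cong_AE) auto
  finally show ?thesis .
qed

lemma measurable_F_J:
  assumes f: "\<exists>g\<in>borel_measurable (coord_filtration n t). AE \<omega> in P. f \<omega> = g \<omega>"
    and V: "AE x in M. V x = f (J x)"
  shows "V \<in> borel_measurable (MA.F t)"
proof -
  obtain g where g: "g \<in> borel_measurable (coord_filtration n t)" "AE \<omega> in P. f \<omega> = g \<omega>" using f by blast
  have "AE x in M. g (J x) = V x" using V AE_J[OF g(2)] by eventually_elim simp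
  then show ?thesis
    using MA.measurable_F_cong_AE[OF MA.measurable_N_F[OF measurable_J[OF g(1)]], of V] by simp
qed

text \<open>Reduces the martingale property for the augmented filtration to identities on path space
  under \<open>P\<close>. Agreement of \<open>V\<close> with \<open>f\<close> is almost sure but
  simultaneous in \<open>t\<close>, so right continuity carries over too; \<open>f t\<close> itself
  has to be measurable only up to a null set, as is the case for stopped processes.\<close>

lemma martingale_J:
  assumes V: "AE x in M. \<forall>t\<ge>0. V t x = f t (J x)"
    and meas: "\<And>t. 0 \<le> t \<Longrightarrow> \<exists>g\<in>borel_measurable (coord_filtration n t). AE \<omega> in P. f t \<omega> = g \<omega>"
    and nonneg: "AE \<omega> in P. \<forall>t\<ge>0. 0 \<le> f t \<omega>"
    and cont: "AE \<omega> in P. continuous_on {0..} (\<lambda>t. f t \<omega>)"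
    and fin: "(\<integral>\<^sup>+ \<omega>. ennreal (f 0 \<omega>) \<partial>P) < \<infinity>"
    and eq: "\<And>s t B. 0 \<le> s \<Longrightarrow> s < t \<Longrightarrow> B \<in> sets (coord_filtration n s) \<Longrightarrow>
        (\<integral>\<^sup>+ \<omega>. ennreal (f t \<omega>) * indicator B \<omega> \<partial>P) = (\<integral>\<^sup>+ \<omega>. ennreal (f s \<omega>) * indicator B \<omega> \<partial>P)"
  shows "martingale (completion M) MA.F V"
proof (rule MA.martingale_augmentedI[OF M.prob_space_axioms])
  have Vt: "AE x in M. V t x = f t (J x)" if "0 \<le> t" for t
    using V by eventually_elim (use that in simp)
  show "V t \<in> borel_measurable (MA.F t)" if "0 \<le> t" for t
    by (rule measurable_F_J[OF meas[OF that] Vt[OF that]])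
  show "AE x in M. 0 \<le> V t x" if "0 \<le> t" for t
    using Vt[OF that] AE_J[OF nonneg] by eventually_elim (use that in simp)
  show "AE x in M. ((\<lambda>t. V t x) \<longlongrightarrow> V s x) (at_right s)" if s: "0 \<le> s" for s
    using V AE_J[OF cont]
  proof eventually_elim
    case (elim x)
    have "((\<lambda>t. f t (J x)) \<longlongrightarrow> f s (J x)) (at s within {0..})" using elim(2) s by (simp add: continuous_on)
    then have "((\<lambda>t. f t (J x)) \<longlongrightarrow> f s (J x)) (at_right s)" by (rule tendsto_within_subset) (use s in auto)
    moreover have "\<forall>\<^sub>F t in at_right s. f t (J x) = V t x"
      unfolding eventually_at_right_field using elim(1) s by (intro exI[of _ "s + 1"]) auto
    ultimately have "((\<lambda>t. V t x) \<longlongrightarrow> f s (J x)) (at_right s)" by (rule Lim_transform_eventually)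
    moreover have "V s x = f s (J x)" using elim(1) s by blast
    ultimately show ?case by simp
  qed
  have nnV: "(\<integral>\<^sup>+ x. ennreal (V t x) * indicator (J -` B \<inter> space M) x \<partial>M) = (\<integral>\<^sup>+ \<omega>. ennreal (f t \<omega>) * indicator B \<omega> \<partial>P)"
    if "0 \<le> t" "B \<in> sets (coord_filtration n s)" for t s B
  proof -
    have "(\<integral>\<^sup>+ x. ennreal (V t x) * indicator (J -` B \<inter> space M) x \<partial>M) = (\<integral>\<^sup>+ x. ennreal (f t (J x)) * indicator (J -` B \<inter> space M) x \<partial>M)"
      using Vt[OF that(1)] by (intro nn_integral_cong_AE) auto
    then show ?thesis using nn_set_integral_J[OF meas[OF that(1)] that(2)] by simp
  qed
  have top: "cont_paths n \<in> sets (coord_filtration n 0)" using sets.top[of "coord_filtration n 0"] by simp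
  have "(\<integral>\<^sup>+ x. ennreal (V 0 x) \<partial>M) = (\<integral>\<^sup>+ x. ennreal (V 0 x) * indicator (J -` cont_paths n \<inter> space M) x \<partial>M)"
    using J_cont by (intro nn_integral_cong) auto
  also have "\<dots> = (\<integral>\<^sup>+ \<omega>. ennreal (f 0 \<omega>) * indicator (cont_paths n) \<omega> \<partial>P)" by (rule nnV[OF order_refl top])
  also have "\<dots> = (\<integral>\<^sup>+ \<omega>. ennreal (f 0 \<omega>) \<partial>P)" by (intro nn_integral_cong) (simp add: space_P)
  finally show "(\<integral>\<^sup>+ x. ennreal (V 0 x) \<partial>M) < \<infinity>" using fin by simp
  fix s t :: real and A assume st: "0 \<le> s" "s < t" and "A \<in> sets (NZ s)"
  then obtain B where B: "A = J -` B \<inter> space M" "B \<in> sets (coord_filtration n s)" unfolding sets_NZ by blast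
  show "(\<integral>\<^sup>+ x. ennreal (V t x) * indicator A x \<partial>M) = (\<integral>\<^sup>+ x. ennreal (V s x) * indicator A x \<partial>M)"
    unfolding B(1) using nnV[OF _ B(2), of t] nnV[OF st(1) B(2)] eq[OF st B(2)] st by simp
qed

text \<open>\<open>{\<tau> \<le> t}\<close> is the intersection of \<open>{\<tau> < u k}\<close> for
  times \<open>u k\<close> decreasing to \<open>t\<close>, taken below any given
  \<open>s > t\<close>. It therefore lies in the right limit of the raw filtration, which the
  augmentation contains.\<close>

lemma stopping_time_level:
  assumes \<kappa>: "0 \<le> \<kappa>" and ls: "\<And>r. 0 \<le> r \<Longrightarrow> {\<omega> \<in> cont_paths n. level_time n \<kappa> \<omega> < r} \<in> sets (coord_filtration n r)"
  shows "stopping_time MA.F (\<lambda>x. level_time n \<kappa> (J x))"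
proof
  fix t :: real
  have "{x \<in> space M. level_time n \<kappa> (J x) \<le> t} \<in> sets (MA.F t)"
  proof (cases "t < 0")
    case True
    have "\<not> level_time n \<kappa> (J x) \<le> t" for x using level_time_nonneg[OF \<kappa>, of n "J x"] True by linarith
    then show ?thesis by simp
  next
    case False
    show ?thesis
    proof (rule MA.sets_F_right)
      fix s assume s: "t < s"
      define u where "u k = t + (s - t) / real (Suc k)" for k
      have u: "t < u k" "u k \<le> s" for k
      proof -
        have "(s - t) / real (Suc k) \<le> (s - t) / 1" using s by (intro divide_left_mono) auto
        then show "u k \<le> s" by (simp add: u_def)
        show "t < u k" using s by (simp add: u_def)
      qed
      have "u \<longlonglongrightarrow> t" unfolding u_def by real_asymp
      have iff: "v \<le> t \<longleftrightarrow> (\<forall>k. v < u k)" for v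
      proof
        show "\<forall>k. v < u k" if "v \<le> t" using that u(1) by (blast intro: le_less_trans)
        show "v \<le> t" if "\<forall>k. v < u k"
          using \<open>u \<longlonglongrightarrow> t\<close> by (rule LIMSEQ_le_const) (use that less_imp_le in blast)
      qed
      have uk: "{x \<in> space M. level_time n \<kappa> (J x) < u k} \<in> sets (NZ s)" for k
      proof -
        have "0 \<le> u k" using u(1)[of k] False by simp
        from ls[OF this] have "J -` {\<omega> \<in> cont_paths n. level_time n \<kappa> \<omega> < u k} \<inter> space M \<in> sets (NZ (u k))"
          unfolding sets_NZ by blast
        moreover have "J -` {\<omega> \<in> cont_paths n. level_time n \<kappa> \<omega> < u k} \<inter> space M = {x \<in> space M. level_time n \<kappa> (J x) < u k}"
          using J_cont by auto
        ultimately show ?thesis using MA.sets_N_mono[OF u(2)] by auto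
      qed
      have "{x \<in> space M. level_time n \<kappa> (J x) \<le> t} = (\<Inter>k. {x \<in> space M. level_time n \<kappa> (J x) < u k})"
        using iff by auto
      also have "\<dots> \<in> sets (NZ s)" using uk by (intro sets.countable_INT) auto
      finally show "{x \<in> space M. level_time n \<kappa> (J x) \<le> t} \<in> sets (NZ s)" .
    qed
  qed
  then show "Measurable.pred (MA.F t) (\<lambda>x. level_time n \<kappa> (J x) \<le> t)"
    by (simp add: pred_def usual_augmentation_def space_measure_of_conv)
qed

end

section \<open>Strict local martingales on the given space\<close>

locale realised_numerator = realisation Q n z P M Z + numerator Q n z P Y
  for Q :: "(nat \<Rightarrow> real \<Rightarrow> real) measure" and n z P and M :: "'a measure" and Z Y
begin

text \<open>While the path is alive, the bound on \<open>\<zeta> / Z(1)\<close> keeps the first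
  coordinate positive and \<open>D\<close> is a continuous quotient. At a dead time \<open>D\<close>
  is squeezed between 0 and a multiple of \<open>Y\<close>, which tends to 0.\<close>

lemma continuous_D:
  assumes g: "good_path n z \<omega>" and k: "\<forall>t\<ge>0. total_mass n \<omega> t \<le> k * \<omega> 1 t"
  shows "continuous_on {0..} (\<lambda>t. D t \<omega>)"
  unfolding continuous_on
proof
  fix t :: real assume "t \<in> {0..}"
  then have t: "0 \<le> t" by simp
  have w: "\<omega> \<in> cont_paths n" using g by (simp add: good_path_def)
  have Y: "((\<lambda>t. Y t \<omega>) \<longlongrightarrow> Y t \<omega>) (at t within {0..})"
    using Y_continuous[OF w] t by (simp add: continuous_on)
  have T: "((\<lambda>t. total_mass n \<omega> t) \<longlongrightarrow> total_mass n \<omega> t) (at t within {0..})"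
    using total_mass_continuous[OF w] t by (simp add: continuous_on)
  have 1: "((\<lambda>t. \<omega> 1 t) \<longlongrightarrow> \<omega> 1 t) (at t within {0..})"
    using w one_in t by (auto simp: cont_paths_def continuous_on)
  show "((\<lambda>t. D t \<omega>) \<longlongrightarrow> D t \<omega>) (at t within {0..})"
  proof (cases "total_mass n \<omega> t = 0")
    case False
    then have "0 < total_mass n \<omega> t" using good_path_total_nonneg[OF g t] by simp
    also have "\<dots> \<le> k * \<omega> 1 t" using k t by simp
    finally have "\<omega> 1 t \<noteq> 0" by auto
    then show ?thesis unfolding D_def by (intro tendsto_intros Y T 1)
  next
    case True
    have le: "D u \<omega> \<le> \<bar>k\<bar> * Y u \<omega>" if u: "0 \<le> u" for u
    proof (cases "\<omega> 1 u = 0")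
      case False
      then have p: "0 < \<omega> 1 u" using first_nonneg[OF g u] by simp
      have "total_mass n \<omega> u \<le> k * \<omega> 1 u" using k u by simp
      also have "\<dots> \<le> \<bar>k\<bar> * \<omega> 1 u" using p by (intro mult_right_mono) auto
      finally have "total_mass n \<omega> u / \<omega> 1 u \<le> \<bar>k\<bar>" using p by (simp add: divide_le_eq)
      from mult_right_mono[OF this Y_nonneg[OF g u]] show ?thesis by (simp add: D_def mult.commute)
    qed (simp add: D_def Y_nonneg[OF g u])
    have "((\<lambda>t. D t \<omega>) \<longlongrightarrow> 0) (at t within {0..})"
    proof (rule tendsto_sandwich[OF _ _ tendsto_const])
      show "\<forall>\<^sub>F u in at t within {0..}. 0 \<le> D u \<omega>" "\<forall>\<^sub>F u in at t within {0..}. D u \<omega> \<le> \<bar>k\<bar> * Y u \<omega>"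
        using D_nonneg[OF g] le by (auto simp: eventually_at_filter)
      show "((\<lambda>u. \<bar>k\<bar> * Y u \<omega>) \<longlongrightarrow> 0) (at t within {0..})"
        using tendsto_mult_left[OF Y, of "\<bar>k\<bar>"] Y_dead[OF g t True] by simp
    qed
    then show ?thesis using D_dead[OF g t True] by simp
  qed
qed

lemma strict_local_martingale_D:
  assumes V: "AE x in M. \<forall>t\<ge>0. V t x = D t (J x)"
  shows "strict_local_martingale (completion M) MA.F V"
proof -
  have good: "AE x in M. good_path n z (J x)" by (rule AE_J[OF AE_P_good_path])
  have bound: "AE x in M. \<exists>k. \<forall>t\<ge>0. total_mass n (J x) t \<le> k * J x 1 t" by (rule AE_J[OF AE_P_ratio_bound])
  have contP: "AE \<omega> in P. continuous_on {0..} (\<lambda>t. D t \<omega>)"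
    using AE_P_good_path AE_P_ratio_bound by eventually_elim (blast intro: continuous_D)
  have Dm: "\<exists>g\<in>borel_measurable (coord_filtration n t). AE \<omega> in P. D t \<omega> = g \<omega>" if "0 \<le> t" for t
    using D_measurable[OF that] by (intro bexI[of _ "D t"]) auto
  have adapted: "adapted MA.F V"
    unfolding adapted_def
  proof (intro allI impI)
    fix t :: real assume t: "0 \<le> t"
    have "AE x in M. V t x = D t (J x)" using V by eventually_elim (use t in simp)
    then show "V t \<in> borel_measurable (MA.F t)" by (rule measurable_F_J[OF Dm[OF t]])
  qed
  have cadlag: "AE x in completion M. cadlag (\<lambda>t. V t x)"
  proof (rule AE_completion)
    show "AE x in M. cadlag (\<lambda>t. V t x)"
      using V AE_J[OF contP]
    proof eventually_elim
      case (elim x)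
      have lim: "((\<lambda>t. D t (J x)) \<longlongrightarrow> D t (J x)) (at t within {0..})" if "0 \<le> t" for t
        using elim(2) that by (simp add: continuous_on)
      show ?case
        unfolding cadlag_def
      proof (intro conjI allI impI)
        fix t :: real assume t: "0 \<le> t"
        have "((\<lambda>t. D t (J x)) \<longlongrightarrow> D t (J x)) (at_right t)"
          by (rule tendsto_within_subset[OF lim[OF t]]) (use t in auto)
        moreover have "\<forall>\<^sub>F u in at_right t. D u (J x) = V u x"
          unfolding eventually_at_right_field using elim(1) t by (intro exI[of _ "t + 1"]) auto
        ultimately have "((\<lambda>t. V t x) \<longlongrightarrow> D t (J x)) (at_right t)" by (rule Lim_transform_eventually)
        moreover have "V t x = D t (J x)" using elim(1) t by blast
        ultimately show "((\<lambda>t. V t x) \<longlongrightarrow> V t x) (at_right t)" by simp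
      next
        fix t :: real assume t: "0 < t"
        have "((\<lambda>t. D t (J x)) \<longlongrightarrow> D t (J x)) (at t within {0<..<t})"
          by (rule tendsto_within_subset[OF lim]) (use t in auto)
        moreover have "at t within {0<..<t} = at_left t"
          using t by (intro at_within_nhd[of _ "{0<..}"]) auto
        ultimately have "((\<lambda>t. D t (J x)) \<longlongrightarrow> D t (J x)) (at_left t)" by simp
        moreover have "\<forall>\<^sub>F u in at_left t. D u (J x) = V u x"
          unfolding eventually_at_left_field using elim(1) t by (intro exI[of _ 0]) auto
        ultimately show "\<exists>l. ((\<lambda>t. V t x) \<longlongrightarrow> l) (at_left t)"
          by (blast intro: Lim_transform_eventually)
      qed
    qed
  qed
  \<comment> \<open>The shift places every level above the initial values \<open>n\<close> of
    \<open>\<zeta> / Z(1)\<close> and \<open>n * z\<close> of \<open>\<zeta>\<close>, as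
    \<open>level_time_bounds\<close> requires.\<close>
  define \<kappa> where "\<kappa> k = real k + real n + real n * z + 1" for k
  have \<kappa>: "0 \<le> \<kappa> k" "real n < \<kappa> k" "real n * z < \<kappa> k" for k
    using Q.z by (auto simp: \<kappa>_def add_nonneg_pos intro!: add_nonneg_nonneg)
  define T where "T k x = level_time n (\<kappa> k) (J x)" for k x
  have T0: "0 \<le> T k x" for k x unfolding T_def by (rule level_time_nonneg[OF \<kappa>(1)])
  have stop: "stopping_time MA.F (T k)" for k
    unfolding T_def[abs_def] by (rule stopping_time_level[OF \<kappa>(1) level_time_sets[OF \<kappa>]])
  have incr: "AE x in completion M. incseq (\<lambda>k. T k x) \<and> filterlim (\<lambda>k. T k x) at_top sequentially"
  proof (rule AE_completion)
    show "AE x in M. incseq (\<lambda>k. T k x) \<and> filterlim (\<lambda>k. T k x) at_top sequentially"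
      using good bound
    proof eventually_elim
      case (elim x)
      obtain k where k: "\<And>t. 0 \<le> t \<Longrightarrow> total_mass n (J x) t \<le> k * J x 1 t" using elim(2) by blast
      have "filterlim (\<lambda>\<kappa>. level_time n \<kappa> (J x)) at_top at_top"
        by (rule level_time_tendsto[OF elim(1) one_in]) (rule k)
      moreover have "filterlim \<kappa> at_top sequentially" unfolding \<kappa>_def by real_asymp
      ultimately have "filterlim (\<lambda>k. T k x) at_top sequentially"
        unfolding T_def by (rule filterlim_compose)
      moreover have "incseq (\<lambda>k. T k x)"
        unfolding incseq_def T_def by (intro allI impI level_time_mono[OF elim(1) one_in \<kappa>(1)]) (simp add: \<kappa>_def)
      ultimately show ?case by simp
    qed
  qed
  have stopped: "martingale (completion M) MA.F (\<lambda>t x. V (min t (T k x)) x)" for k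
  proof (rule martingale_J[where f="\<lambda>t \<omega>. D (min t (level_time n (\<kappa> k) \<omega>)) \<omega>"])
    show "AE x in M. \<forall>t\<ge>0. V (min t (T k x)) x = D (min t (level_time n (\<kappa> k) (J x))) (J x)"
      using V by eventually_elim (use T0 in \<open>simp add: T_def\<close>)
    show "\<exists>g\<in>borel_measurable (coord_filtration n t). AE \<omega> in P. D (min t (level_time n (\<kappa> k) \<omega>)) \<omega> = g \<omega>" if "0 \<le> t" for t
      by (rule stopped_measurable[OF \<kappa> that])
    show "AE \<omega> in P. \<forall>t\<ge>0. 0 \<le> D (min t (level_time n (\<kappa> k) \<omega>)) \<omega>"
      using AE_P_good_path by eventually_elim (simp add: D_nonneg level_time_nonneg[OF \<kappa>(1)])
    show "AE \<omega> in P. continuous_on {0..} (\<lambda>t. D (min t (level_time n (\<kappa> k) \<omega>)) \<omega>)"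
      using contP
    proof eventually_elim
      case (elim \<omega>)
      then show ?case
        by (rule continuous_on_compose2) (auto intro!: continuous_intros simp: level_time_nonneg[OF \<kappa>(1)])
    qed
    obtain K where K: "0 \<le> K" "\<And>\<omega> u. good_path n z \<omega> \<Longrightarrow> 0 \<le> u \<Longrightarrow> u \<le> level_time n (\<kappa> k) \<omega> \<Longrightarrow> D u \<omega> \<le> K"
      using D_bounded[OF \<kappa>] by blast
    have "(\<integral>\<^sup>+ \<omega>. ennreal (D (min 0 (level_time n (\<kappa> k) \<omega>)) \<omega>) \<partial>P) \<le> (\<integral>\<^sup>+ \<omega>. ennreal K \<partial>P)"
      using AE_P_good_path by (intro nn_integral_mono_AE) (auto elim!: eventually_mono intro!: ennreal_leI K(2) simp: level_time_nonneg[OF \<kappa>(1)])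
    also have "\<dots> < \<infinity>" by (simp add: P.emeasure_space_1)
    finally show "(\<integral>\<^sup>+ \<omega>. ennreal (D (min 0 (level_time n (\<kappa> k) \<omega>)) \<omega>) \<partial>P) < \<infinity>" .
  qed (rule stopped_eq[OF \<kappa>])
  have "local_martingale (completion M) MA.F V"
    unfolding local_martingale_def using MA.filtered_F adapted cadlag stop T0 incr stopped by blast
  moreover have "\<not> martingale (completion M) MA.F V"
  proof
    \<comment> \<open>The conditional expectation of \<open>V 1\<close> given time 0 would force
      equal means at times 0 and 1, against \<open>D_decreases\<close>.\<close>
    assume mart: "martingale (completion M) MA.F V"
    interpret CM: prob_space "completion M" by (rule prob_spaceI) (simp add: M.emeasure_space_1)
    interpret C: finite_measure_subalgebra "completion M" "MA.F 0" by unfold_locales (rule MA.subalgebra_F)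
    have int: "integrable (completion M) (V t)" if "0 \<le> t" for t using mart that by (simp add: martingale_def)
    have "AE x in completion M. real_cond_exp (completion M) (MA.F 0) (V 1) x = V 0 x"
      using mart unfolding martingale_def by (metis order_refl zero_le_one)
    then have "(\<integral>x. real_cond_exp (completion M) (MA.F 0) (V 1) x \<partial>completion M) = (\<integral>x. V 0 x \<partial>completion M)"
      using int[of 0] by (intro integral_cong_AE) auto
    then have eq: "(\<integral>x. V 1 x \<partial>completion M) = (\<integral>x. V 0 x \<partial>completion M)"
      using C.real_cond_exp_int(2)[OF int[of 1]] by simp
    have "(\<integral>\<^sup>+ \<omega>. ennreal (D t \<omega>) \<partial>P) = ennreal (\<integral>x. V t x \<partial>completion M)" if t: "0 \<le> t" for t
    proof -
      have Vt: "AE x in M. V t x = D t (J x)" using V by eventually_elim (use t in simp)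
      have nn: "AE x in M. 0 \<le> V t x" using Vt good by eventually_elim (simp add: D_nonneg[OF _ t])
      have "(\<integral>\<^sup>+ \<omega>. ennreal (D t \<omega>) \<partial>P) = (\<integral>\<^sup>+ x. ennreal (D t (J x)) \<partial>M)"
        using PA.measurable_N_M[OF D_measurable[OF t]] by (intro nn_integral_J[symmetric]) measurable
      also have "\<dots> = (\<integral>\<^sup>+ x. ennreal (V t x) \<partial>completion M)"
        unfolding nn_integral_completion using Vt by (intro nn_integral_cong_AE) auto
      also have "\<dots> = ennreal (\<integral>x. V t x \<partial>completion M)"
        by (intro nn_integral_eq_integral int t AE_completion nn)
      finally show ?thesis .
    qed
    then show False using D_decreases eq by simp
  qed
  ultimately show ?thesis by (simp add: strict_local_martingale_def)
qed

text \<open>Before death the ratio is the plain quotient. Afterwards \<open>Y\<close> is 0, and the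
  product vanishes whatever value the ratio is frozen at.\<close>

lemma numerator_over_ratio:
  assumes g: "good_path n z (J x)" and t: "0 \<le> t"
  shows "Y t (J x) * (1 / ratio n (\<lambda>i s. Z i s x) 1 t) = D t (J x)"
proof (cases "total_mass n (J x) t = 0")
  case False
  have tot: "total_mass n (\<lambda>i s. Z i s x) u = total_mass n (J x) u" if "0 \<le> u" for u
    unfolding total_mass_def by (intro sum.cong refl) (simp add: J_apply that)
  have "total_mass n (\<lambda>i s. Z i s x) s \<noteq> 0" if "s \<in> {0..t}" for s
    using g that False tot[of s] by (auto simp: good_path_def)
  then have "ratio n (\<lambda>i s. Z i s x) 1 t = J x 1 t / total_mass n (J x) t"
    using tot[OF t] J_apply[OF one_in t, of x] by (simp add: ratio_def)
  then show ?thesis by (simp add: D_def)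
qed (simp add: D_def Y_dead[OF g t])

end

context realisation
begin

lemma total_J: "0 \<le> t \<Longrightarrow> total_mass n (J x) t = total_mass n (\<lambda>i s. Z i s x) t"
  unfolding total_mass_def by (intro sum.cong refl) (simp add: J_apply)

lemma strict_local_martingale_over_ratio:
  assumes Y: "numerator Q n z P Y" and V: "\<And>t x. 0 \<le> t \<Longrightarrow> V t x = Y t (J x) * (1 / ratio n (\<lambda>i s. Z i s x) 1 t)"
  shows "strict_local_martingale (completion M) MA.F V"
proof -
  interpret realised_numerator Q n z P M Z Y by (rule realised_numerator.intro[OF realisation_axioms Y])
  show ?thesis
  proof (rule strict_local_martingale_D)
    show "AE x in M. \<forall>t\<ge>0. V t x = D t (J x)"
      using AE_J[OF AE_P_good_path] by eventually_elim (intro allI impI, simp only: V numerator_over_ratio)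
  qed
qed

lemma martingale_total_prod:
  "martingale (completion M) MA.F (\<lambda>t x. total_mass n (\<lambda>i s. Z i s x) t * (\<Prod>i=2..n. Z i t x))"
proof (rule martingale_J[where f="\<lambda>t \<omega>. total_mass n \<omega> t * (\<Prod>i=2..n. \<omega> i t)"])
  have J2: "(\<Prod>i=2..n. J x i t) = (\<Prod>i=2..n. Z i t x)" if "0 \<le> t" for x t
    using that by (intro prod.cong refl J_apply) auto
  show "AE x in M. \<forall>t\<ge>0. total_mass n (\<lambda>i s. Z i s x) t * (\<Prod>i=2..n. Z i t x)
      = total_mass n (J x) t * (\<Prod>i=2..n. J x i t)"
    by (simp add: J2 total_J)
  show "\<exists>g\<in>borel_measurable (coord_filtration n t). AE \<omega> in P. total_mass n \<omega> t * (\<Prod>i=2..n. \<omega> i t) = g \<omega>"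
    if t: "0 \<le> t" for t
  proof (rule bexI[of _ "\<lambda>\<omega>. total_mass n \<omega> t * (\<Prod>i=2..n. \<omega> i t)"])
    have "(\<lambda>\<omega>. \<Prod>i=2..n. \<omega> i t) \<in> borel_measurable (coord_filtration n t)"
      using t by (intro borel_measurable_prod coord_filtration_measurable) auto
    then show "(\<lambda>\<omega>. total_mass n \<omega> t * (\<Prod>i=2..n. \<omega> i t)) \<in> borel_measurable (coord_filtration n t)"
      by (rule borel_measurable_times[OF total_mass_measurable[OF t order_refl]])
  qed simp
  show "AE \<omega> in P. \<forall>t\<ge>0. 0 \<le> total_mass n \<omega> t * (\<Prod>i=2..n. \<omega> i t)"
    using AE_P_good_path
  proof eventually_elim
    case (elim \<omega>)
    then show ?case
      by (intro allI impI mult_nonneg_nonneg good_path_total_nonneg prod_nonneg) (auto simp: good_path_def)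
  qed
  show "AE \<omega> in P. continuous_on {0..} (\<lambda>t. total_mass n \<omega> t * (\<Prod>i=2..n. \<omega> i t))"
    using AE_P_good_path
  proof eventually_elim
    case (elim \<omega>)
    then have w: "\<omega> \<in> cont_paths n" by (simp add: good_path_def)
    then have "continuous_on {0..} (\<omega> i)" if "i \<in> {2..n}" for i using that by (simp add: cont_paths_def)
    then show ?case by (intro continuous_on_mult total_mass_continuous[OF w] continuous_on_prod)
  qed
  have mart: "pos_martingale (front_law i) (coord_filtration n) (\<lambda>t \<omega>. \<Prod>i=1..n. \<omega> i t)" if "i \<in> {1..n}" for i
    by (rule product_law.pos_martingale_prod[OF front_law[OF that] order_refl])
  show "(\<integral>\<^sup>+ \<omega>. ennreal (total_mass n \<omega> t * (\<Prod>i=2..n. \<omega> i t)) * indicator B \<omega> \<partial>P)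
      = (\<integral>\<^sup>+ \<omega>. ennreal (total_mass n \<omega> s * (\<Prod>i=2..n. \<omega> i s)) * indicator B \<omega> \<partial>P)"
    if st: "0 \<le> s" "s < t" and B: "B \<in> sets (coord_filtration n s)" for s t B
  proof -
    have "B \<in> sets (coord_filtration n t)" using PA.sets_N_mono[of s t] st B by auto
    then have "(\<integral>\<^sup>+ \<omega>. ennreal (total_mass n \<omega> t * (\<Prod>i=2..n. \<omega> i t)) * indicator B \<omega> \<partial>P)
        = (\<Sum>i=1..n. \<integral>\<^sup>+ \<omega>. ennreal (\<Prod>i=1..n. \<omega> i t) * indicator B \<omega> \<partial>front_law i)"
      using st by (intro total_prod_transfer) auto
    also have "\<dots> = (\<Sum>i=1..n. \<integral>\<^sup>+ \<omega>. ennreal (\<Prod>i=1..n. \<omega> i s) * indicator B \<omega> \<partial>front_law i)"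
      by (rule sum.cong[OF refl], rule pos_martingale.nn_Y_martingale[OF mart]) (use st B in auto)
    also have "\<dots> = (\<integral>\<^sup>+ \<omega>. ennreal (total_mass n \<omega> s * (\<Prod>i=2..n. \<omega> i s)) * indicator B \<omega> \<partial>P)"
      by (rule total_prod_transfer[OF st(1) B, symmetric])
    finally show ?thesis .
  qed
  have top: "cont_paths n \<in> sets (coord_filtration n 0)" using sets.top[of "coord_filtration n 0"] by simp
  have "(\<integral>\<^sup>+ \<omega>. ennreal (total_mass n \<omega> 0 * (\<Prod>i=2..n. \<omega> i 0)) \<partial>P)
    = (\<integral>\<^sup>+ \<omega>. ennreal (total_mass n \<omega> 0 * (\<Prod>i=2..n. \<omega> i 0)) * indicator (cont_paths n) \<omega> \<partial>P)"
    by (intro nn_integral_cong) (simp add: space_P)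
  also have "\<dots> = (\<Sum>i=1..n. \<integral>\<^sup>+ \<omega>. ennreal (\<Prod>i=1..n. \<omega> i 0) * indicator (cont_paths n) \<omega> \<partial>front_law i)"
    by (rule total_prod_transfer[OF order_refl top])
  also have "\<dots> < \<infinity>"
  proof (simp only: infinity_ennreal_def ennreal_sum_less_top finite_atLeastAtMost, intro ballI)
    fix i assume i: "i \<in> {1..n}"
    interpret L: product_law "front_law i" n z by (rule front_law[OF i])
    have "cont_paths n \<in> sets (front_law i)" using top L.A.sets_N by blast
    then show "(\<integral>\<^sup>+ \<omega>. ennreal (\<Prod>i=1..n. \<omega> i 0) * indicator (cont_paths n) \<omega> \<partial>front_law i) < top"
      using pos_martingale.nn_set_integral_Y[OF mart[OF i] order_refl] by simp
  qed
  finally show "(\<integral>\<^sup>+ \<omega>. ennreal (total_mass n \<omega> 0 * (\<Prod>i=2..n. \<omega> i 0)) \<partial>P) < \<infinity>" .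
qed

end

text \<open>The processes \<open>X\<close> on \<open>W\<close> realise \<open>Q\<close>;
  \<open>Z\<close> may live on another space and is tied to them through its law \<open>P\<close>.
  The factor \<open>1 / R\<close> is \<open>\<zeta> / Z(1)\<close>, so the three strict local
  martingales have the numerators \<open>\<zeta>\<close>, \<open>Z 2\<close> and the product over
  coordinates 2 to \<open>n\<close>.\<close>

theorem proposition4:
  fixes n :: nat and z :: real
    and W :: "'w measure" and X :: "nat \<Rightarrow> real \<Rightarrow> 'w \<Rightarrow> real"
    and Q P :: "(nat \<Rightarrow> real \<Rightarrow> real) measure"
    and M :: "'a measure" and Z :: "nat \<Rightarrow> real \<Rightarrow> 'a \<Rightarrow> real"
    and F :: "real \<Rightarrow> 'a measure" and \<zeta> R :: "real \<Rightarrow> 'a \<Rightarrow> real"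
  assumes "n \<ge> 2" and "z > 0"
    and "prob_space W"
    and "\<And>i. i \<in> {1..n} \<Longrightarrow> besq0 W z (X i)"
    and "prob_space.indep_vars W (\<lambda>_. \<Pi>\<^sub>M t\<in>{0 :: real..}. (borel :: real measure))
           (\<lambda>i x. \<lambda>t\<in>{0..}. X i t x) {1..n}"
    and "Q = distr W (path_space n) (joint_path n X)"
    and "size_biased_law n Q P"
    and "prob_space M"
    and "\<And>i. i \<in> {1..n} \<Longrightarrow> random_process M (Z i) \<and> continuous_paths M (Z i)"
    and "distr M (path_space n) (joint_path n Z) = P"
    and F_eq: "F = usual_augmentation M (natural_filtration (space M) {1..n} Z)"
    and zeta_eq: "\<zeta> = (\<lambda>t x. total_mass n (\<lambda>i s. Z i s x) t)"
    and R_eq: "R = (\<lambda>t x. ratio n (\<lambda>i s. Z i s x) 1 t)"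
  shows "strict_local_martingale (completion M) F (\<lambda>t x. \<zeta> t x * (1 / R t x)) \<and>
         strict_local_martingale (completion M) F (\<lambda>t x. Z 2 t x * (1 / R t x)) \<and>
         strict_local_martingale (completion M) F (\<lambda>t x. (1 / R t x) * (\<Prod>i=2..n. Z i t x)) \<and>
         martingale (completion M) F (\<lambda>t x. \<zeta> t x * (\<Prod>i=2..n. Z i t x))"
proof -
  interpret X: indep_besq0 W n z X
    by (intro indep_besq0.intro indep_besq0_axioms.intro assms(1-5))
  interpret realisation Q n z P M Z
    unfolding assms(6)
    by (intro realisation.intro size_biased.intro size_biased_axioms.intro realisation_axioms.intro X.product_law_joint_path)
      (use assms(6-10) in auto)
  have F: "F = MA.F" unfolding F_eq by (rule refl)
  \<comment> \<open>The index sets for \<open>U\<close> and \<open>V\<close>; both are nonempty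
    subsets of \<open>{2..n}\<close> because \<open>n\<close> is at least 2.\<close>
  have two: "{2} \<subseteq> {2..n}" "{2..n} \<noteq> {}" using assms(1) by auto
  show ?thesis
    unfolding F zeta_eq R_eq
  proof (intro conjI martingale_total_prod)
    show "strict_local_martingale (completion M) MA.F
        (\<lambda>t x. total_mass n (\<lambda>i s. Z i s x) t * (1 / ratio n (\<lambda>i s. Z i s x) 1 t))"
      by (rule strict_local_martingale_over_ratio[OF numerator_total]) (simp only: total_J)
    show "strict_local_martingale (completion M) MA.F (\<lambda>t x. Z 2 t x * (1 / ratio n (\<lambda>i s. Z i s x) 1 t))"
      by (rule strict_local_martingale_over_ratio[OF numerator_prod[OF two(1)]])
        (use assms(1) in \<open>simp_all add: J_apply\<close>)
    show "strict_local_martingale (completion M) MA.F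
        (\<lambda>t x. (1 / ratio n (\<lambda>i s. Z i s x) 1 t) * (\<Prod>i=2..n. Z i t x))"
    proof (rule strict_local_martingale_over_ratio[OF numerator_prod[OF order_refl two(2)]])
      fix t :: real and x assume t: "0 \<le> t"
      have "(\<Prod>i=2..n. J x i t) = (\<Prod>i=2..n. Z i t x)" using t by (intro prod.cong refl J_apply) auto
      then show "(1 / ratio n (\<lambda>i s. Z i s x) 1 t) * (\<Prod>i=2..n. Z i t x)
          = (\<Prod>i=2..n. J x i t) * (1 / ratio n (\<lambda>i s. Z i s x) 1 t)" by (simp only: mult.commute)
    qed
  qed
qed

end
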